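(* Let $\widehat{m}$ be a given rooted planar map and let $M_n$ denote a uniformly random rooted planar map with $n$ edges. Let $s(\widehat{m},M_n)$ be the number of occurrences of $\widehat{m}$ as a submap in $M_n$. Then \[ \mathbb{E}[s(\widehat{m},M_n)] = c'_1\cdot n + c'_2 + O(1/n), \qquad n\to\infty, \] where $c'_1$ and $c'_2$ are constants depending only on $\widehat{m}$, and $c'_1$ is a computable positive rational number.
   Context: A planar map is a connected planar graph (loops and multiple edges allowed) embedded in the plane; two maps are identified if they are isomorphic as graphs embedded on the sphere (respecting roots). All maps are rooted: one edge, the root edge, is distinguished and directed; its starting vertex is the root vertex, the face to its left is the root face (regarded as the outer face). The map with a single vertex and no edges is also counted. An inner-face of a map is any face other than its root face; $V(M)$, $E(M)$ denote vertex and edge sets. A face $f_1$ is part of a face $f_2$ if $f_2$ is divided by some edges and vertices into several parts and $f_1$ is one of them. A map $S$ occurs as a submap in a map $M$ if $V(S)\subseteq V(M)$, $E(S)\subseteq E(M)$, and the root face of $M$ is not an inner-face of $S$ and is not part of an inner-face of $S$. An occurrence of $\widehat{m}$ as a submap in $M$ is such a sub-configuration of $M$ isomorphic to $\widehat{m}$, with the direction/choice of root edge of the occurrence forgotten (i.e. $s(\widehat{m},M)$ counts the ways to choose and mark one submap of $M$ isomorphic to $\widehat{m}$ with its root edge direction erased). *)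

theory Defs
  imports
    "Graph_Theory.Graph_Theory"
    "HOL-Combinatorics.Orbits"
    "HOL-Library.Nat_Bijection"
    "HOL-Library.Landau_Symbols"
    "HOL-Probability.Probability_Mass_Function"
begin

section \<open>Rooted planar maps\<close>

text \<open>
  An embedding of a connected graph on the oriented sphere, up to orientation-preserving
  homeomorphism, is given by its rotation system. Each edge is a pair of opposite arcs exchanged
  by \<open>edge_rev\<close>; \<open>edge_succ\<close> sends an arc to the next arc in clockwise order around their common
  tail. The root edge, directed from its tail, is the arc \<open>root_arc\<close>; it is \<open>None\<close> exactly for the
  map without edges.
\<close>

record ('a, 'b) pre_map =
  map_graph :: "('a, 'b) pre_digraph"
  edge_rev :: "'b \<Rightarrow> 'b"
  edge_succ :: "'b \<Rightarrow> 'b"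
  root_arc :: "'b option"

abbreviation map_verts :: "('a, 'b) pre_map \<Rightarrow> 'a set" where
  "map_verts M \<equiv> verts (map_graph M)"

abbreviation map_arcs :: "('a, 'b) pre_map \<Rightarrow> 'b set" where
  "map_arcs M \<equiv> arcs (map_graph M)"

text \<open>
  Arriving along \<open>a\<close>, the boundary walk that keeps the face on its left continues with the arc
  that follows the reverse of \<open>a\<close> clockwise. A face is the set of the arcs that have it on their
  left; the only face of the map without edges is the empty set.
\<close>

definition face_succ :: "('a, 'b) pre_map \<Rightarrow> 'b \<Rightarrow> 'b" where
  "face_succ M = edge_succ M \<circ> edge_rev M"

definition left_face :: "('a, 'b) pre_map \<Rightarrow> 'b \<Rightarrow> 'b set" where
  "left_face M a = orbit (face_succ M) a"

definition faces :: "('a, 'b) pre_map \<Rightarrow> 'b set set" where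
  "faces M = (if map_arcs M = {} then {{}} else left_face M ` map_arcs M)"

definition root_face :: "('a, 'b) pre_map \<Rightarrow> 'b set" where
  "root_face M = (case root_arc M of None \<Rightarrow> {} | Some r \<Rightarrow> left_face M r)"

definition inner_faces :: "('a, 'b) pre_map \<Rightarrow> 'b set set" where
  "inner_faces M = faces M - {root_face M}"

definition edge_count :: "('a, 'b) pre_map \<Rightarrow> nat" where
  "edge_count M = card (map_arcs M) div 2"

text \<open>The equation between cardinalities is Euler's formula: the surface has genus 0.\<close>

definition rooted_planar_map :: "('a, 'b) pre_map \<Rightarrow> bool" where
  "rooted_planar_map M \<longleftrightarrow>
     fin_digraph (map_graph M) \<and>
     Digraph_Component.connected (map_graph M) \<and>
     bidirected_digraph (map_graph M) (edge_rev M) \<and>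
     edge_succ M permutes map_arcs M \<and>
     (\<forall>v\<in>map_verts M. out_arcs (map_graph M) v \<noteq> {} \<longrightarrow>
        cyclic_on (edge_succ M) (out_arcs (map_graph M) v)) \<and>
     card (map_verts M) + card (faces M) = edge_count M + 2 \<and>
     (case root_arc M of None \<Rightarrow> map_arcs M = {} | Some r \<Rightarrow> r \<in> map_arcs M)"

definition map_isomorphism ::
  "('a, 'b) pre_map \<Rightarrow> ('c, 'd) pre_map \<Rightarrow> ('a, 'b, 'c, 'd) digraph_isomorphism \<Rightarrow> bool" where
  "map_isomorphism M N f \<longleftrightarrow>
     pre_digraph.digraph_isomorphism (map_graph M) f \<and>
     map_graph N = app_iso f (map_graph M) \<and>
     (\<forall>a\<in>map_arcs M. edge_rev N (iso_arcs f a) = iso_arcs f (edge_rev M a)) \<and>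
     (\<forall>a\<in>map_arcs M. edge_succ N (iso_arcs f a) = iso_arcs f (edge_succ M a)) \<and>
     root_arc N = map_option (iso_arcs f) (root_arc M)"

definition map_iso :: "('a, 'b) pre_map \<Rightarrow> ('c, 'd) pre_map \<Rightarrow> bool" where
  "map_iso M N \<longleftrightarrow> (\<exists>f. map_isomorphism M N f)"


section \<open>Submaps\<close>

definition first_return :: "('b \<Rightarrow> 'b) \<Rightarrow> 'b set \<Rightarrow> 'b \<Rightarrow> 'b" where
  "first_return f A a = (f ^^ (LEAST k. 0 < k \<and> (f ^^ k) a \<in> A)) a"

text \<open>
  Let \<open>S\<close> be a connected part of \<open>M\<close> with the induced embedding. Each face of \<open>S\<close> is the union of
  the faces of \<open>M\<close> that can be reached from one another by crossing edges outside \<open>S\<close> (together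
  with the edges and vertices between them). So the face \<open>g\<close> of \<open>S\<close> on the left of an arc \<open>a\<close> of
  \<open>S\<close> consists of the faces of \<open>M\<close> that can be reached in this way from the one on the left of
  \<open>a\<close>. If \<open>g = {}\<close>, then \<open>S\<close> is a single vertex, \<open>g\<close> is the complement of this vertex, and every
  face of \<open>M\<close> is part of \<open>g\<close>. A face counts as a part of itself.
\<close>

definition crossings :: "('a, 'b) pre_map \<Rightarrow> ('a, 'b) pre_map \<Rightarrow> 'b set rel" where
  "crossings M S =
     {(left_face M a, left_face M (edge_rev M a)) | a. a \<in> map_arcs M - map_arcs S}"

definition part_of_face ::
  "('a, 'b) pre_map \<Rightarrow> ('a, 'b) pre_map \<Rightarrow> 'b set \<Rightarrow> 'b set \<Rightarrow> bool" where
  "part_of_face M S f g \<longleftrightarrow> (\<forall>a\<in>g. (left_face M a, f) \<in> (crossings M S)\<^sup>*)"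

definition occurs_as_submap :: "('a, 'b) pre_map \<Rightarrow> ('a, 'b) pre_map \<Rightarrow> bool" where
  "occurs_as_submap S M \<longleftrightarrow>
     subgraph (map_graph S) (map_graph M) \<and>
     (\<forall>a\<in>map_arcs S. edge_rev S a = edge_rev M a) \<and>
     (\<forall>a\<in>map_arcs S. edge_succ S a = first_return (edge_succ M) (map_arcs S) a) \<and>
     (\<forall>g\<in>inner_faces S. \<not> part_of_face M S (root_face M) g)"

text \<open>
  Passing to the pair of vertex and arc set forgets the root of the submap \<open>S\<close>, so that each
  unrooted submap counts once even if it can be rooted in several ways to become isomorphic to
  \<open>m\<close>. (It also forgets the irrelevant values of the functions outside the arcs of \<open>S\<close>.)
\<close>

definition occurrence_count :: "('c, 'd) pre_map \<Rightarrow> ('a, 'b) pre_map \<Rightarrow> nat" where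
  "occurrence_count m M =
     card ((\<lambda>S. (map_verts S, map_arcs S)) ` {S. map_iso m S \<and> occurs_as_submap S M})"


section \<open>Invariance under isomorphism\<close>

lemma map_isomorphism_inj:
  assumes "map_isomorphism M N f"
  shows "inj_on (iso_verts f) (map_verts M)" "inj_on (iso_arcs f) (map_arcs M)"
    "map_verts N = iso_verts f ` map_verts M" "map_arcs N = iso_arcs f ` map_arcs M"
    "wf_digraph (map_graph M)"
    "\<And>a. a \<in> map_arcs M \<Longrightarrow> tail (map_graph N) (iso_arcs f a) = iso_verts f (tail (map_graph M) a)"
    "\<And>a. a \<in> map_arcs M \<Longrightarrow> head (map_graph N) (iso_arcs f a) = iso_verts f (head (map_graph M) a)"
    "\<And>a. a \<in> map_arcs M \<Longrightarrow> edge_rev N (iso_arcs f a) = iso_arcs f (edge_rev M a)"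
    "\<And>a. a \<in> map_arcs M \<Longrightarrow> edge_succ N (iso_arcs f a) = iso_arcs f (edge_succ M a)"
    "root_arc N = map_option (iso_arcs f) (root_arc M)"
  using assms by (auto simp: map_isomorphism_def pre_digraph.digraph_isomorphism_def)

lemma map_isoI:
  assumes "inj_on h (map_verts M)" "inj_on k (map_arcs M)"
    "map_verts N = h ` map_verts M" "map_arcs N = k ` map_arcs M" "wf_digraph (map_graph M)"
    "\<And>a. a \<in> map_arcs M \<Longrightarrow> tail (map_graph N) (k a) = h (tail (map_graph M) a)"
    "\<And>a. a \<in> map_arcs M \<Longrightarrow> head (map_graph N) (k a) = h (head (map_graph M) a)"
    "\<And>a. a \<in> map_arcs M \<Longrightarrow> edge_rev N (k a) = k (edge_rev M a)"
    "\<And>a. a \<in> map_arcs M \<Longrightarrow> edge_succ N (k a) = k (edge_succ M a)"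
    "root_arc N = map_option k (root_arc M)"
  shows "map_iso M N"
  unfolding map_iso_def
proof
  show "map_isomorphism M N
     \<lparr>iso_verts = h, iso_arcs = k, iso_head = head (map_graph N), iso_tail = tail (map_graph N)\<rparr>"
    using assms
    by (auto simp: map_isomorphism_def pre_digraph.digraph_isomorphism_def app_iso_def)
qed

lemma rooted_planar_mapD:
  assumes "rooted_planar_map M"
  shows "fin_digraph (map_graph M)" "wf_digraph (map_graph M)"
    "finite (map_verts M)" "finite (map_arcs M)"
    "\<And>a. a \<in> map_arcs M \<Longrightarrow> edge_rev M a \<in> map_arcs M"
    "\<And>a. a \<in> map_arcs M \<Longrightarrow> edge_succ M a \<in> map_arcs M"
    "\<And>r. root_arc M = Some r \<Longrightarrow> r \<in> map_arcs M"
proof -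
  show *: "fin_digraph (map_graph M)" using assms by (simp add: rooted_planar_map_def)
  then interpret fin_digraph "map_graph M" .
  show "wf_digraph (map_graph M)" "finite (map_verts M)" "finite (map_arcs M)"
    by (auto intro: wf_digraph)
  show "edge_rev M a \<in> map_arcs M" if "a \<in> map_arcs M" for a
    using assms that bidirected_digraph.arev_in_arcs by (fastforce simp: rooted_planar_map_def)
  show "edge_succ M a \<in> map_arcs M" if "a \<in> map_arcs M" for a
    using assms that by (simp add: rooted_planar_map_def permutes_in_image)
  show "r \<in> map_arcs M" if "root_arc M = Some r" for r
    using assms that by (simp add: rooted_planar_map_def)
qed

lemma map_iso_trans:
  assumes "map_iso L M" "map_iso M N" "rooted_planar_map L"
  shows "map_iso L N"
proof -
  obtain f g where f: "map_isomorphism L M f" and g: "map_isomorphism M N g"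
    using assms by (auto simp: map_iso_def)
  note F = map_isomorphism_inj[OF f] and G = map_isomorphism_inj[OF g]
  note L = rooted_planar_mapD[OF assms(3)]
  show ?thesis
  proof (rule map_isoI[where h = "iso_verts g \<circ> iso_verts f" and k = "iso_arcs g \<circ> iso_arcs f"])
    show "inj_on (iso_verts g \<circ> iso_verts f) (map_verts L)"
      using F G by (auto intro: comp_inj_on)
    show "inj_on (iso_arcs g \<circ> iso_arcs f) (map_arcs L)"
      using F G by (auto intro: comp_inj_on)
  qed (use F G L in \<open>auto simp: image_comp option.map_comp\<close>)
qed

lemma map_iso_sym:
  assumes "map_iso M N" "rooted_planar_map M"
  shows "map_iso N M"
proof -
  obtain f where f: "map_isomorphism M N f"
    using assms by (auto simp: map_iso_def)
  note F = map_isomorphism_inj[OF f] and M = rooted_planar_mapD[OF assms(2)]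
  define h where "h = the_inv_into (map_verts M) (iso_verts f)"
  define k where "k = the_inv_into (map_arcs M) (iso_arcs f)"
  have h: "h (iso_verts f v) = v" if "v \<in> map_verts M" for v
    using F(1) that by (simp add: h_def the_inv_into_f_f)
  have k: "k (iso_arcs f a) = a" if "a \<in> map_arcs M" for a
    using F(2) that by (simp add: k_def the_inv_into_f_f)
  have t: "tail (map_graph M) a \<in> map_verts M" "head (map_graph M) a \<in> map_verts M"
    if "a \<in> map_arcs M" for a
    using that M(2) by (auto simp: wf_digraph_def)
  show ?thesis
  proof (rule map_isoI[where h = h and k = k])
    show "inj_on h (map_verts N)" "inj_on k (map_arcs N)"
      by (auto simp: F h k intro!: inj_onI)
    show "map_verts M = h ` map_verts N" "map_arcs M = k ` map_arcs N"
      by (auto simp: F h k image_image)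
    show "wf_digraph (map_graph N)"
      using F t by (auto simp: wf_digraph_def)
    show "root_arc M = map_option k (root_arc N)"
      using M(7) by (cases "root_arc M") (auto simp: F k)
  qed (use F M h k t in auto)
qed

lemma orbit_image:
  assumes "\<And>a. a \<in> A \<Longrightarrow> s a \<in> A" "\<And>a. a \<in> A \<Longrightarrow> t (k a) = k (s a)" "a \<in> A"
  shows "orbit t (k a) = k ` orbit s a" "orbit s a \<subseteq> A"
proof -
  have sub: "x \<in> A \<and> k x \<in> orbit t (k a)" if "x \<in> orbit s a" for x
    using that
  proof induction
    case base
    have "t (k a) \<in> orbit t (k a)" by (rule orbit.base)
    then show ?case using assms by simp
  next
    case (step x)
    then have "t (k x) \<in> orbit t (k a)" by (blast intro: orbit.step)
    then show ?case using assms step by simp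
  qed
  then show "orbit s a \<subseteq> A" by blast
  have "y \<in> k ` orbit s a" if "y \<in> orbit t (k a)" for y
    using that
  proof induction
    case base
    then show ?case using assms by (auto intro: orbit.base)
  next
    case (step y)
    then obtain x where x: "x \<in> orbit s a" "y = k x" by blast
    then have "t y = k (s x)" using sub assms by blast
    then show ?case using x by (auto intro: orbit.step)
  qed
  then show "orbit t (k a) = k ` orbit s a" using sub by blast
qed

lemma left_face_iso:
  assumes "\<And>a. a \<in> map_arcs M \<Longrightarrow> edge_rev M a \<in> map_arcs M"
    "\<And>a. a \<in> map_arcs M \<Longrightarrow> edge_succ M a \<in> map_arcs M"
    "\<And>a. a \<in> map_arcs M \<Longrightarrow> edge_rev N (k a) = k (edge_rev M a)"
    "\<And>a. a \<in> map_arcs M \<Longrightarrow> edge_succ N (k a) = k (edge_succ M a)"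
    "a \<in> map_arcs M"
  shows "left_face N (k a) = k ` left_face M a" "left_face M a \<subseteq> map_arcs M"
proof -
  have "\<And>a. a \<in> map_arcs M \<Longrightarrow> face_succ M a \<in> map_arcs M"
    "\<And>a. a \<in> map_arcs M \<Longrightarrow> face_succ N (k a) = k (face_succ M a)"
    using assms by (auto simp: face_succ_def)
  from orbit_image[of "map_arcs M" "face_succ M" "face_succ N" k, OF this assms(5)]
  show "left_face N (k a) = k ` left_face M a" "left_face M a \<subseteq> map_arcs M"
    by (simp_all add: left_face_def)
qed

lemma rtrancl_pullback:
  assumes "(x, y) \<in> R\<^sup>*" "inj_on k U" "R \<subseteq> {(k a, k b) | a b. a \<in> U \<and> b \<in> U \<and> (a, b) \<in> Q}"
    "x = k a" "a \<in> U"
  shows "\<exists>b\<in>U. y = k b \<and> (a, b) \<in> Q\<^sup>*"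
  using assms(1)
proof induction
  case base
  then show ?case using assms by blast
next
  case (step y z)
  then obtain b where b: "b \<in> U" "y = k b" "(a, b) \<in> Q\<^sup>*" by blast
  from step(2) assms(3) obtain b' c where c: "b' \<in> U" "c \<in> U" "y = k b'" "z = k c" "(b', c) \<in> Q"
    by blast
  then have "b' = b" using b assms(2) by (auto dest: inj_onD)
  then show ?case using b c by (auto intro: rtrancl_into_rtrancl)
qed

lemma occurrence_transport:
  fixes M N :: "('a, 'b) pre_map"
  assumes m: "rooted_planar_map m" and M: "rooted_planar_map M"
    and f: "map_isomorphism M N f"
    and S: "map_iso m S" "occurs_as_submap S M"
  shows "\<exists>T. map_iso m T \<and> occurs_as_submap T N \<and>
    map_verts T = iso_verts f ` map_verts S \<and> map_arcs T = iso_arcs f ` map_arcs S"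
proof -
  note F = map_isomorphism_inj[OF f] and M' = rooted_planar_mapD[OF M]
    and m' = rooted_planar_mapD[OF m]
  obtain e where e: "map_isomorphism m S e" using S(1) by (auto simp: map_iso_def)
  note E = map_isomorphism_inj[OF e]
  define k where "k = iso_arcs f"
  define h where "h = iso_verts f"
  note F = F[folded k_def h_def]
  define T :: "('a, 'b) pre_map" where
    "T = \<lparr>map_graph = \<lparr>verts = h ` map_verts S, arcs = k ` map_arcs S,
                    tail = tail (map_graph N), head = head (map_graph N)\<rparr>,
          edge_rev = edge_rev N,
          edge_succ = first_return (edge_succ N) (k ` map_arcs S),
          root_arc = map_option k (root_arc S)\<rparr>"
  have vS: "map_verts S \<subseteq> map_verts M" and aS: "map_arcs S \<subseteq> map_arcs M"
    and wS: "wf_digraph (map_graph S)"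
    and cS: "tail (map_graph S) = tail (map_graph M)" "head (map_graph S) = head (map_graph M)"
    and rS: "\<And>a. a \<in> map_arcs S \<Longrightarrow> edge_rev S a = edge_rev M a"
    and sS: "\<And>a. a \<in> map_arcs S \<Longrightarrow>
               edge_succ S a = first_return (edge_succ M) (map_arcs S) a"
    and oS: "\<And>g. g \<in> inner_faces S \<Longrightarrow> \<not> part_of_face M S (root_face M) g"
    using S(2) by (auto simp: occurs_as_submap_def subgraph_def compatible_def)
  have pow: "(edge_succ N ^^ i) (k a) = k ((edge_succ M ^^ i) a) \<and> (edge_succ M ^^ i) a \<in> map_arcs M"
    if "a \<in> map_arcs M" for a i
    using that by (induction i) (use F M' in auto)
  have mem: "k b \<in> k ` map_arcs S \<longleftrightarrow> b \<in> map_arcs S" if "b \<in> map_arcs M" for b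
    using that aS F(2) by (auto dest: inj_onD)
  have fr: "first_return (edge_succ N) (k ` map_arcs S) (k a) = k (first_return (edge_succ M) (map_arcs S) a)"
    if "a \<in> map_arcs M" for a
    using pow[OF that] by (simp add: first_return_def mem)
  have wfS: "tail (map_graph M) a \<in> map_verts S" "head (map_graph M) a \<in> map_verts S"
    if "a \<in> map_arcs S" for a
    using wS that cS by (auto simp: wf_digraph_def)
  have closed: "edge_rev S a \<in> map_arcs S" "edge_succ S a \<in> map_arcs S" if "a \<in> map_arcs S" for a
    using that E m' by auto
  have rootS: "r \<in> map_arcs S" if "root_arc S = Some r" for r
    using that E m' by auto
  have iso: "map_iso S T"
  proof (rule map_isoI[where h = h and k = k])
    show "inj_on h (map_verts S)" "inj_on k (map_arcs S)"
      using F vS aS by (auto intro: inj_on_subset)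
    show "wf_digraph (map_graph S)" by fact
    show "edge_succ T (k a) = k (edge_succ S a)" if "a \<in> map_arcs S" for a
      using that fr aS sS by (auto simp: T_def)
    show "edge_rev T (k a) = k (edge_rev S a)" if "a \<in> map_arcs S" for a
      using that F aS rS by (auto simp: T_def)
  qed (use F aS cS in \<open>auto simp: T_def\<close>)
  have lfM: "left_face N (k a) = k ` left_face M a" "left_face M a \<subseteq> map_arcs M"
    if "a \<in> map_arcs M" for a
    using left_face_iso[of M N k a] F M' that by auto
  have lfS: "left_face T (k a) = k ` left_face S a" "left_face S a \<subseteq> map_arcs S"
    if "a \<in> map_arcs S" for a
  proof -
    have "edge_rev T (k a) = k (edge_rev S a)" "edge_succ T (k a) = k (edge_succ S a)"
      if "a \<in> map_arcs S" for a
      using that F(8)[of a] fr[of a] aS rS[of a] sS[of a] by (auto simp: T_def)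
    from left_face_iso[of S T k a, OF closed this that]
    show "left_face T (k a) = k ` left_face S a" "left_face S a \<subseteq> map_arcs S" by auto
  qed
  have rfM: "root_face N = k ` root_face M" "root_face M \<subseteq> map_arcs M"
    using lfM M'(7) F(10) by (auto simp: root_face_def split: option.splits)
  have rfS: "root_face T = k ` root_face S" "root_face S \<subseteq> map_arcs S"
    using lfS rootS by (auto simp: root_face_def T_def split: option.splits)
  have aT: "map_arcs T = k ` map_arcs S" by (simp add: T_def)
  have fS: "faces T = (\<lambda>g. k ` g) ` faces S"
    using lfS by (auto simp: faces_def aT image_image)
  have fS': "g \<subseteq> map_arcs S" if "g \<in> faces S" for g
    using that lfS by (auto simp: faces_def split: if_splits)
  have cr: "crossings N T \<subseteq> {(k ` x, k ` y) | x y. x \<in> Pow (map_arcs M) \<and> y \<in> Pow (map_arcs M) \<and>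
      (x, y) \<in> crossings M S}"
  proof
    fix p assume "p \<in> crossings N T"
    then obtain b where b: "p = (left_face N b, left_face N (edge_rev N b))"
      "b \<in> map_arcs N" "b \<notin> map_arcs T" by (auto simp: crossings_def)
    then obtain a where a: "b = k a" "a \<in> map_arcs M" using F by auto
    with b have "a \<notin> map_arcs S" by (auto simp: aT)
    then have "(left_face M a, left_face M (edge_rev M a)) \<in> crossings M S"
      using a by (auto simp: crossings_def)
    moreover have "p = (k ` left_face M a, k ` left_face M (edge_rev M a))"
      using a b lfM M' F(8) by simp
    ultimately show "p \<in> {(k ` x, k ` y) | x y. x \<in> Pow (map_arcs M) \<and> y \<in> Pow (map_arcs M) \<and>
      (x, y) \<in> crossings M S}"
      using lfM(2)[OF a(2)] lfM(2)[of "edge_rev M a"] M'(5)[OF a(2)] by blast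
  qed
  have injP: "inj_on (image k) (Pow (map_arcs M))"
    using F(2) by (simp add: inj_on_image_Pow)
  have "occurs_as_submap T N"
    unfolding occurs_as_submap_def
  proof (intro conjI ballI)
    have "wf_digraph (map_graph N)"
      using F M'(2) by (auto simp: wf_digraph_def)
    moreover have "wf_digraph (map_graph T)"
      using F wfS aS by (auto simp: wf_digraph_def T_def)
    ultimately show "subgraph (map_graph T) (map_graph N)"
      using F vS aS by (auto simp: subgraph_def compatible_def T_def)
    show "edge_rev T a = edge_rev N a" for a by (simp add: T_def)
    show "edge_succ T a = first_return (edge_succ N) (map_arcs T) a" for a by (simp add: T_def)
    fix g' assume g': "g' \<in> inner_faces T"
    then obtain g where g: "g' = k ` g" "g \<in> faces S" "g \<noteq> root_face S"
      by (auto simp: inner_faces_def fS rfS)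
    then have "\<not> part_of_face M S (root_face M) g"
      using oS by (simp add: inner_faces_def)
    then obtain a where a: "a \<in> g" "(left_face M a, root_face M) \<notin> (crossings M S)\<^sup>*"
      by (auto simp: part_of_face_def)
    have aM: "a \<in> map_arcs M" using a g fS' aS by blast
    have "(left_face N (k a), root_face N) \<notin> (crossings N T)\<^sup>*"
    proof
      assume "(left_face N (k a), root_face N) \<in> (crossings N T)\<^sup>*"
      from rtrancl_pullback[OF this injP cr, of "left_face M a"] lfM[OF aM]
      obtain b where b: "b \<in> Pow (map_arcs M)" "root_face N = k ` b"
        "(left_face M a, b) \<in> (crossings M S)\<^sup>*" by auto
      then have "b = root_face M"
        using rfM injP by (metis PowI inj_onD)
      with b a show False by simp
    qed
    then show "\<not> part_of_face N T (root_face N) g'"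
      using a g by (auto simp: part_of_face_def)
  qed
  moreover have "map_iso m T" using map_iso_trans[OF S(1) iso m] .
  ultimately show ?thesis by (auto simp: T_def h_def k_def)
qed

lemma occurrence_count_mono:
  fixes M N :: "('a, 'b) pre_map"
  assumes m: "rooted_planar_map m" and M: "rooted_planar_map M" and N: "rooted_planar_map N"
    and f: "map_iso M N"
  shows "occurrence_count m M \<le> occurrence_count m N"
proof -
  obtain f where f: "map_isomorphism M N f" using f by (auto simp: map_iso_def)
  note F = map_isomorphism_inj[OF f]
  define K :: "('a, 'b) pre_map \<Rightarrow> _" where
    "K M = (\<lambda>S. (map_verts S, map_arcs S)) ` {S. map_iso m S \<and> occurs_as_submap S M}" for M
  have KM: "K M \<subseteq> Pow (map_verts M) \<times> Pow (map_arcs M)" for M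
    by (auto simp: K_def occurs_as_submap_def subgraph_def)
  have "inj_on (map_prod (image (iso_verts f)) (image (iso_arcs f))) (K M)"
    by (rule inj_on_subset[OF map_prod_inj_on KM]) (use F in \<open>auto simp: inj_on_image_Pow\<close>)
  moreover have "map_prod (image (iso_verts f)) (image (iso_arcs f)) ` K M \<subseteq> K N"
  proof clarsimp
    fix V A assume "(V, A) \<in> K M"
    then obtain S where S: "V = map_verts S" "A = map_arcs S" "map_iso m S" "occurs_as_submap S M"
      by (auto simp: K_def)
    from occurrence_transport[OF m M f S(3,4)] S(1,2)
    show "(iso_verts f ` V, iso_arcs f ` A) \<in> K N"
      unfolding K_def by force
  qed
  moreover have "finite (K N)"
    by (rule finite_subset[OF KM]) (simp add: rooted_planar_mapD(3,4)[OF N])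
  ultimately show ?thesis
    unfolding occurrence_count_def K_def[symmetric] by (rule card_inj_on_le)
qed

lemma edge_count_iso: "map_iso M N \<Longrightarrow> edge_count M = edge_count N"
  by (metis map_iso_def edge_count_def card_image map_isomorphism_inj(2,4))

definition vertex_map :: "(nat, 'b) pre_map" where
  "vertex_map = \<lparr>map_graph = \<lparr>verts = {0}, arcs = {}, tail = \<lambda>_. 0, head = \<lambda>_. 0\<rparr>,
     edge_rev = id, edge_succ = id, root_arc = None\<rparr>"

lemma rooted_planar_map_vertex_map: "rooted_planar_map vertex_map"
proof -
  have "fin_digraph (map_graph vertex_map)" by unfold_locales (auto simp: vertex_map_def)
  moreover have "Digraph_Component.connected (map_graph vertex_map)"
    by (auto simp: Digraph_Component.connected_def strongly_connected_def vertex_map_def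
        mk_symmetric_def reachable_def rtrancl_on.intros)
  moreover have "bidirected_digraph (map_graph vertex_map) (edge_rev vertex_map)"
    by unfold_locales (auto simp: vertex_map_def)
  ultimately show ?thesis
    by (auto simp: rooted_planar_map_def faces_def edge_count_def vertex_map_def out_arcs_def
        permutes_id)
qed

lemma map_iso_refl: "rooted_planar_map M \<Longrightarrow> map_iso M M"
  by (rule map_isoI[where h = id and k = id]) (auto simp: rooted_planar_mapD option.map_id)

text \<open>Every finite map is isomorphic to one whose vertices and arcs are natural numbers.\<close>

quotient_type planar_map = "(nat, nat) pre_map" /
    partial: "\<lambda>M N. rooted_planar_map M \<and> rooted_planar_map N \<and> map_iso M N"
  morphisms rep_planar_map abs_planar_map
proof (rule part_equivpI)
  show "\<exists>M :: (nat, nat) pre_map. rooted_planar_map M \<and> rooted_planar_map M \<and> map_iso M M"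
    using rooted_planar_map_vertex_map map_iso_refl by blast
qed (auto intro!: sympI transpI intro: map_iso_sym map_iso_trans)

lift_definition num_edges :: "planar_map \<Rightarrow> nat" is edge_count
  by (simp add: edge_count_iso)

lift_definition occurrences :: "planar_map \<Rightarrow> planar_map \<Rightarrow> nat" is occurrence_count
proof -
  fix m m' M M' :: "(nat, nat) pre_map"
  assume m: "rooted_planar_map m \<and> rooted_planar_map m' \<and> map_iso m m'"
    and M: "rooted_planar_map M \<and> rooted_planar_map M' \<and> map_iso M M'"
  have "map_iso m S \<longleftrightarrow> map_iso m' S" for S :: "(nat, nat) pre_map"
    using m map_iso_sym map_iso_trans by blast
  then have "occurrence_count m M = occurrence_count m' M"
    by (simp add: occurrence_count_def)
  also have "\<dots> = occurrence_count m' M'"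
    using m M map_iso_sym by (intro antisym occurrence_count_mono) auto
  finally show "occurrence_count m M = occurrence_count m' M'" .
qed

definition random_planar_map :: "nat \<Rightarrow> planar_map pmf" where
  "random_planar_map n = pmf_of_set {M. num_edges M = n}"


section \<open>Computable functions from maps to rational numbers\<close>

text \<open>
  The total recursive functions of \<open>k\<close> arguments, given as functions on lists; the values on
  lists of a length other than \<open>k\<close> are irrelevant. Minimisation is restricted to the case where
  a zero always exists, which suffices for all total recursive functions by Kleene's normal form.
\<close>

inductive recursive_fn :: "nat \<Rightarrow> (nat list \<Rightarrow> nat) \<Rightarrow> bool" where
  zero: "recursive_fn k (\<lambda>xs. 0)"
| succ: "recursive_fn 1 (\<lambda>xs. Suc (xs ! 0))"
| proj: "i < k \<Longrightarrow> recursive_fn k (\<lambda>xs. xs ! i)"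
| comp: "recursive_fn (length gs) f \<Longrightarrow> (\<And>g. g \<in> set gs \<Longrightarrow> recursive_fn k g) \<Longrightarrow>
    recursive_fn k (\<lambda>xs. f (map (\<lambda>g. g xs) gs))"
| prim: "recursive_fn k f \<Longrightarrow> recursive_fn (Suc (Suc k)) g \<Longrightarrow>
    recursive_fn (Suc k) (\<lambda>xs. rec_nat (f (tl xs)) (\<lambda>n r. g (n # r # tl xs)) (hd xs))"
| mini: "recursive_fn (Suc k) f \<Longrightarrow> (\<And>xs. length xs = k \<Longrightarrow> \<exists>n. f (n # xs) = 0) \<Longrightarrow>
    recursive_fn k (\<lambda>xs. LEAST n. f (n # xs) = 0)"

definition recursive :: "(nat \<Rightarrow> nat) \<Rightarrow> bool" where
  "recursive f \<longleftrightarrow> (\<exists>F. recursive_fn 1 F \<and> (\<forall>x. f x = F [x]))"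

text \<open>
  The code of a map whose arcs are the numbers less than some \<open>k\<close> lists the tail, the reverse and
  the successor of each arc, preceded by the root.
\<close>

definition map_code :: "(nat, nat) pre_map \<Rightarrow> nat" where
  "map_code M = list_encode
     ((case root_arc M of None \<Rightarrow> 0 | Some r \<Rightarrow> Suc r) #
      map (\<lambda>a. list_encode [tail (map_graph M) a, edge_rev M a, edge_succ M a])
        [0..<card (map_arcs M)])"

definition computable_on_maps :: "(planar_map \<Rightarrow> rat) \<Rightarrow> bool" where
  "computable_on_maps c \<longleftrightarrow>
     (\<exists>p q d. recursive p \<and> recursive q \<and> recursive d \<and>
        (\<forall>M. rooted_planar_map M \<and> map_arcs M = {..<card (map_arcs M)} \<longrightarrow>
           c (abs_planar_map M) =
             (of_nat (p (map_code M)) - of_nat (q (map_code M))) / of_nat (Suc (d (map_code M)))))"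

end

theory Submission
  imports Defs
begin

text \<open>
  A rooted map is a fixed-point free involution and a permutation of its arcs, whose product has the
  faces as cycles. The maps containing a given map \<open>m\<close> as a submap arise by drawing the remaining
  edges into the faces of \<open>m\<close> one at a time, so their generating function is a product over the
  faces of series that depend only on the degrees. The quadratic method shows that each of these
  series is \<open>A + B (1 - 12z)\<^bsup>3/2\<^esup>\<close> with Laurent polynomials \<open>A\<close>, \<open>B\<close>, and so is the series for rooted
  maps. Marking a root in the outer face of \<open>m\<close> amounts to differentiating the factor of that face,
  which lowers the exponent to \<open>1/2\<close>; hence the expected number of occurrences is a rational
  function of \<open>n\<close> for large \<open>n\<close>, of linear growth, and its slope is an explicit product over the
  faces of \<open>m\<close>, divided by the number of automorphisms that preserve the outer face.
\<close>

section \<open>Orbits of finite bijections\<close>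

text \<open>Two conditions resist a direct count. Planarity is global, but it can be tested edge by
  edge: an edge that joins two different faces lowers the Euler count for good, so in a drawing that
  ends in a planar map every edge splits a face or reaches a new vertex. The outer-face condition
  asks from which face of \<open>m\<close> the root of the large map can be reached. That distinct
  faces of \<open>m\<close> stay separated is a discrete Jordan theorem; it is proved in the same
  induction as the count, with a variable \<open>t\<close> that marks the edges drawn inside a
  chosen union of faces. Counting labelled objects removes the symmetry problem: a rooted map is
  rigid, so every isomorphism class has the same number of labellings, and the uniform law on
  labelled maps induces the one on classes. Only the unrooted submap keeps automorphisms. Two facts
  about the slope do not follow from its formula: the integers in it come from a recursion with
  signs, so positivity is obtained from a coefficientwise lower bound, and independence of the
  representative comes from the uniqueness of the linear term.\<close>

abbreviation swp :: "'b \<Rightarrow> 'b \<Rightarrow> 'b \<Rightarrow> 'b" where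
  "swp \<equiv> Transposition.transpose"

definition orbits_on :: "('b \<Rightarrow> 'b) \<Rightarrow> 'b set \<Rightarrow> 'b set set" where
  "orbits_on f A = orbit f ` A"

text \<open>\<open>orbit f x\<close> starts with \<open>f x\<close>, so \<open>x\<close> itself
  belongs to it only because a finite bijection returns. Outside \<open>A\<close> the function is
  arbitrary; the proof passes to the permutation \<open>g\<close> that is the identity
  there.\<close>

lemma orbit_self:
  assumes "finite A" "bij_betw f A A" "x \<in> A"
  shows "x \<in> orbit f x"
proof -
  define g where "g = (\<lambda>x. if x \<in> A then f x else x)"
  have "bij_betw g A A"
    using assms(2) by (rule bij_betw_cong[THEN iffD1, rotated]) (simp add: g_def)
  then have "g permutes A" by (rule bij_imp_permutes) (simp add: g_def)
  then have "x \<in> orbit g x"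
    using assms(1) by (meson permutation_permutes permutation_self_in_orbit)
  moreover have "orbit f x = orbit g x"
    by (rule orbit_cong0[OF assms(3)]) (use assms(2) in \<open>auto simp: g_def bij_betw_def\<close>)
  ultimately show ?thesis by simp
qed

lemma orbit_closed_subset:
  assumes "\<And>a. a \<in> A \<Longrightarrow> f a \<in> A" "x \<in> A"
  shows "orbit f x \<subseteq> A"
proof
  fix y assume "y \<in> orbit f x"
  then show "y \<in> A" by induction (auto simp: assms)
qed

lemma bij_on_mem: "bij_betw f A A \<Longrightarrow> x \<in> A \<Longrightarrow> f x \<in> A"
  by (auto simp: bij_betw_def)

lemma orbit_subset_on: "bij_betw f A A \<Longrightarrow> x \<in> A \<Longrightarrow> orbit f x \<subseteq> A"
  by (rule orbit_closed_subset) (auto simp: bij_on_mem)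

lemma orbit_eq:
  assumes "finite A" "bij_betw f A A" "x \<in> A" "y \<in> orbit f x"
  shows "orbit f y = orbit f x"
proof -
  have x: "x \<in> orbit f x" by (rule orbit_self[OF assms(1-3)])
  show ?thesis
    using orbit_swap[OF x assms(4)] assms(4) by (auto intro: orbit_trans)
qed

lemma orbit_step_eq:
  assumes "finite A" "bij_betw f A A" "x \<in> A"
  shows "orbit f (f x) = orbit f x"
  by (rule orbit_eq[OF assms]) (rule orbit.base)

lemma orbit_mem_iff:
  assumes "finite A" "bij_betw f A A" "x \<in> A" "y \<in> A"
  shows "y \<in> orbit f x \<longleftrightarrow> orbit f y = orbit f x"
  using orbit_eq[OF assms(1-3)] orbit_self[OF assms(1,2,4)] by auto

lemma orbit_disjoint:
  assumes "finite A" "bij_betw f A A" "x \<in> A" "y \<in> A" "orbit f x \<noteq> orbit f y"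
  shows "orbit f x \<inter> orbit f y = {}"
  using orbit_eq[OF assms(1-3)] orbit_eq[OF assms(1,2,4)] assms(5) by blast

lemma finite_orbits_on: "finite A \<Longrightarrow> finite (orbits_on f A)"
  by (simp add: orbits_on_def)

lemma orbits_on_eqD:
  assumes "finite A" "bij_betw f A A" "P \<in> orbits_on f A" "x \<in> P"
  shows "P = orbit f x" "x \<in> A"
proof -
  obtain a where a: "a \<in> A" "P = orbit f a" using assms(3) by (auto simp: orbits_on_def)
  then show "P = orbit f x" using orbit_eq[OF assms(1,2) a(1)] assms(4) by simp
  show "x \<in> A" using a orbit_subset_on[OF assms(2)] assms(4) by blast
qed

lemma Union_orbits_on:
  assumes "finite A" "bij_betw f A A"
  shows "\<Union>(orbits_on f A) = A"
  using orbit_self[OF assms] orbit_subset_on[OF assms(2)] by (auto simp: orbits_on_def)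

lemma orbits_on_disjoint:
  assumes "finite A" "bij_betw f A A" "P \<in> orbits_on f A" "Q \<in> orbits_on f A" "P \<noteq> Q"
  shows "P \<inter> Q = {}"
  using assms orbit_disjoint[OF assms(1,2)] by (auto simp: orbits_on_def)

lemma orbits_on_nonempty: "P \<in> orbits_on f A \<Longrightarrow> P \<noteq> {}"
  by (auto simp: orbits_on_def orbit_nonempty)

section \<open>Cycles after composition with a transposition\<close>

lemma orbits_on_swap_ends:
  assumes "finite A" "bij_betw f A A" "x \<in> A" "y \<in> A"
  shows "bij_betw (f \<circ> swp x y) A A"
proof -
  have "bij_betw (swp x y) A A" using assms(3,4) by (simp add: permutes_imp_bij permutes_swap_id)
  then show ?thesis using assms(2) by (rule bij_betw_trans)
qed

lemma swap_orbit_unaffected: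
  assumes "finite A" "bij_betw f A A" "x \<in> A" "y \<in> A" "z \<in> A"
    "x \<notin> orbit f z" "y \<notin> orbit f z"
  shows "orbit (f \<circ> swp x y) z = orbit f z"
  by (rule orbit_cong[OF orbit_self[OF assms(1,2,5)]])
    (use assms in \<open>auto simp: Transposition.transpose_def\<close>)

text \<open>\<open>f \<circ> swp x y\<close> exchanges the images of \<open>x\<close> and
  \<open>y\<close>, so the walk from \<open>x\<close> first runs through the cycle of
  \<open>y\<close> and, on arriving at \<open>y\<close>, continues in the cycle of
  \<open>x\<close>.\<close>

lemma swap_merge:
  assumes fin: "finite A" and f: "bij_betw f A A" and x: "x \<in> A" and y: "y \<in> A"
    and xy: "y \<notin> orbit f x"
  shows "orbit (f \<circ> swp x y) x = orbit f x \<union> orbit f y"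
proof -
  define g where "g = f \<circ> swp x y"
  have g: "bij_betw g A A" unfolding g_def by (rule orbits_on_swap_ends[OF fin f x y])
  have gx: "g x = f y" and gy: "g y = f x" by (simp_all add: g_def)
  have gz: "g z = f z" if "z \<noteq> x" "z \<noteq> y" for z
    using that by (simp add: g_def)
  have xy': "x \<notin> orbit f y" using xy orbit_mem_iff[OF fin f] x y by auto
  note self = orbit_self[OF fin f]
  \<comment> \<open>Applied to \<open>z = y\<close>: were \<open>y\<close> never reached from
    \<open>x\<close>, the walk would follow the whole \<open>f\<close>-cycle of \<open>y\<close>,
    which contains \<open>y\<close>.\<close>
  have in1: "z \<in> orbit g x" if "z \<in> orbit f y" "y \<notin> orbit g x" for z
    using that(1)
  proof induction
    case base
    then show ?case using orbit.base[of g x] gx by simp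
  next
    case (step z)
    then have "z \<noteq> y" "z \<noteq> x" using that xy' by auto
    then show ?case using orbit.step[OF step(2)] gz by simp
  qed
  have y_in: "y \<in> orbit g x"
    using in1[of y] self[OF y] by blast
  have x_in: "x \<in> orbit g x" by (rule orbit_self[OF fin g x])
  have fclosed: "f z \<in> orbit g x" if "z \<in> orbit g x" for z
    using that x_in y_in gx gy gz orbit.step[of _ g x] by (metis)
  have "orbit f x \<subseteq> orbit g x" "orbit f y \<subseteq> orbit g x"
    using orbit_closed_subset[of "orbit g x" f] fclosed x_in y_in by auto
  moreover have "orbit g x \<subseteq> orbit f x \<union> orbit f y"
  proof (rule orbit_closed_subset)
    show "x \<in> orbit f x \<union> orbit f y" using self[OF x] by simp
    show "g a \<in> orbit f x \<union> orbit f y" if "a \<in> orbit f x \<union> orbit f y" for a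
      using that gx gy gz[of a] by (cases "a = x"; cases "a = y") (auto intro: orbit.intros)
  qed
  ultimately show ?thesis unfolding g_def by blast
qed

lemma swap_merge_orbits:
  assumes fin: "finite A" and f: "bij_betw f A A" and x: "x \<in> A" and y: "y \<in> A"
    and xy: "y \<notin> orbit f x"
  shows "orbits_on (f \<circ> swp x y) A =
      insert (orbit f x \<union> orbit f y) (orbits_on f A - {orbit f x, orbit f y})"
    and "Suc (card (orbits_on (f \<circ> swp x y) A)) = card (orbits_on f A)"
proof -
  define g where "g = f \<circ> swp x y"
  have g: "bij_betw g A A" unfolding g_def by (rule orbits_on_swap_ends[OF fin f x y])
  note m = swap_merge[OF assms, folded g_def]
  have on_u: "orbit g z = orbit f x \<union> orbit f y" if "z \<in> orbit f x \<union> orbit f y" for z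
    using orbit_eq[OF fin g x, of z] that m by simp
  have off_u: "orbit g z = orbit f z" if "z \<in> A" "z \<notin> orbit f x \<union> orbit f y" for z
    unfolding g_def
  proof (rule swap_orbit_unaffected[OF fin f x y that(1)])
    show "x \<notin> orbit f z" "y \<notin> orbit f z" using that orbit_mem_iff[OF fin f] x y by auto
  qed
  have ne: "orbit f x \<noteq> orbit f y" using xy orbit_self[OF fin f y] by auto
  show eq: "orbits_on (f \<circ> swp x y) A =
      insert (orbit f x \<union> orbit f y) (orbits_on f A - {orbit f x, orbit f y})"
  proof
    show "orbits_on (f \<circ> swp x y) A \<subseteq>
      insert (orbit f x \<union> orbit f y) (orbits_on f A - {orbit f x, orbit f y})"
    proof
      fix P assume "P \<in> orbits_on (f \<circ> swp x y) A"
      then obtain z where z: "z \<in> A" "P = orbit g z" by (auto simp: orbits_on_def g_def)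
      show "P \<in> insert (orbit f x \<union> orbit f y) (orbits_on f A - {orbit f x, orbit f y})"
      proof (cases "z \<in> orbit f x \<union> orbit f y")
        case True then show ?thesis using on_u z by simp
      next
        case False
        then have "orbit f z \<noteq> orbit f x" "orbit f z \<noteq> orbit f y"
          using orbit_self[OF fin f z(1)] by auto
        then show ?thesis using off_u[OF z(1) False] z by (auto simp: orbits_on_def)
      qed
    qed
    show "insert (orbit f x \<union> orbit f y) (orbits_on f A - {orbit f x, orbit f y})
        \<subseteq> orbits_on (f \<circ> swp x y) A"
    proof
      fix P assume P: "P \<in> insert (orbit f x \<union> orbit f y) (orbits_on f A - {orbit f x, orbit f y})"
      show "P \<in> orbits_on (f \<circ> swp x y) A"
      proof (cases "P = orbit f x \<union> orbit f y")
        case True then show ?thesis using m x by (auto simp: orbits_on_def g_def[symmetric])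
      next
        case False
        then obtain z where z: "z \<in> A" "P = orbit f z" "orbit f z \<noteq> orbit f x" "orbit f z \<noteq> orbit f y"
          using P by (auto simp: orbits_on_def)
        then have "z \<notin> orbit f x \<union> orbit f y" using orbit_mem_iff[OF fin f] x y by auto
        then show ?thesis using off_u[OF z(1)] z by (auto simp: orbits_on_def g_def[symmetric])
      qed
    qed
  qed
  have "orbit f x \<union> orbit f y \<notin> orbits_on f A - {orbit f x, orbit f y}"
  proof
    assume "orbit f x \<union> orbit f y \<in> orbits_on f A - {orbit f x, orbit f y}"
    then have "orbit f x \<union> orbit f y = orbit f x"
      using orbits_on_eqD(1)[OF fin f] orbit_self[OF fin f x] by blast
    then show False using xy orbit_self[OF fin f y] by blast
  qed
  moreover have "card (orbits_on f A - {orbit f x, orbit f y}) = card (orbits_on f A) - 2"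
    using ne x y by (subst card_Diff_subset) (auto simp: orbits_on_def)
  moreover have "card (orbits_on f A) \<ge> 2"
    using ne x y card_mono[of "orbits_on f A" "{orbit f x, orbit f y}"] finite_orbits_on[OF fin]
    by (auto simp: orbits_on_def)
  ultimately show "Suc (card (orbits_on (f \<circ> swp x y) A)) = card (orbits_on f A)"
    unfolding eq using finite_orbits_on[OF fin, of f] by simp
qed

lemma orbit_funpow_image:
  assumes "(f ^^ n) x = x" "0 < n"
  shows "orbit f x = (\<lambda>i. (f ^^ i) x) ` {1..n}"
proof -
  have "orbit f x \<subseteq> (\<lambda>i. (f ^^ i) x) ` {1..n}"
  proof
    fix y assume "y \<in> orbit f x"
    then obtain m where m: "m < n" "y = (f ^^ m) x" using orbit_altdef_bounded[OF assms] by auto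
    then show "y \<in> (\<lambda>i. (f ^^ i) x) ` {1..n}"
      using assms by (cases "m = 0") (force intro: image_eqI[of _ _ n], force)
  qed
  moreover have "(\<lambda>i. (f ^^ i) x) ` {1..n} \<subseteq> orbit f x" by (auto simp: orbit_altdef)
  ultimately show ?thesis by blast
qed

lemma orbit_enum:
  assumes "finite A" "bij_betw f A A" "x \<in> A"
  obtains n where "0 < n" "(f ^^ n) x = x" "inj_on (\<lambda>i. (f ^^ i) x) {1..n}"
    "orbit f x = (\<lambda>i. (f ^^ i) x) ` {1..n}"
proof -
  have self: "x \<in> orbit f x" by (rule orbit_self[OF assms])
  define n where "n = funpow_dist1 f x x"
  have n: "0 < n" "(f ^^ n) x = x" using funpow_dist1_prop[OF self] by (simp_all add: n_def)
  have inj: "inj_on (\<lambda>i. (f ^^ i) x) {0..<n}"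
    unfolding n_def by (rule inj_on_funpow_dist1[OF self])
  have "inj_on (\<lambda>i. (f ^^ i) x) {1..n}"
  proof (rule inj_onI)
    fix i j assume ij: "i \<in> {1..n}" "j \<in> {1..n}" "(f ^^ i) x = (f ^^ j) x"
    have mod: "(f ^^ (i mod n)) x = (f ^^ i) x" for i
      using n by (simp add: funpow_mod_eq)
    have "i mod n = j mod n"
      using n(1) ij(3) mod[of i] mod[of j] by (intro inj_onD[OF inj]) auto
    then show "i = j" using ij n
      by (cases "i = n"; cases "j = n") (auto simp: mod_less)
  qed
  then show ?thesis using that n orbit_funpow_image[OF n(2,1)] by blast
qed

text \<open>The two halves are given by position along the old cycle, not only as sets:
  \<open>sum_face_prod\<close> has to know how many open corners lie on each side of a chord.
  Counting from \<open>1\<close> to \<open>n\<close> puts \<open>y\<close> last, so that both halves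
  are intervals.\<close>

lemma swap_split:
  assumes n: "0 < n" "(f ^^ n) y = y" "inj_on (\<lambda>i. (f ^^ i) y) {1..n}"
    and j: "1 \<le> j" "j < n"
  shows "orbit (f \<circ> swp ((f ^^ j) y) y) ((f ^^ j) y) = (\<lambda>i. (f ^^ i) y) ` {1..j}"
    and "orbit (f \<circ> swp ((f ^^ j) y) y) y = (\<lambda>i. (f ^^ i) y) ` {j<..n}"
proof -
  define c where "c = (f ^^ j) y"
  define g where "g = f \<circ> swp c y"
  have gc: "g c = f y" and gy: "g y = f c" by (simp_all add: g_def)
  have g: "g ((f ^^ i) y) = (f ^^ Suc i) y" if "1 \<le> i" "i < n" "i \<noteq> j" for i
  proof -
    have "(f ^^ i) y \<noteq> c"
    proof
      assume "(f ^^ i) y = c"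
      then have "i = j" unfolding c_def by (rule inj_onD[OF n(3)]) (use that j in auto)
      then show False using that by simp
    qed
    moreover have "(f ^^ i) y \<noteq> y"
    proof
      assume "(f ^^ i) y = y"
      then have "(f ^^ i) y = (f ^^ n) y" using n(2) by simp
      then have "i = n" by (rule inj_onD[OF n(3)]) (use that in auto)
      then show False using that by simp
    qed
    ultimately show ?thesis by (simp add: g_def)
  qed
  have 1: "(g ^^ i) c = (f ^^ i) y" if "1 \<le> i" "i \<le> j" for i
    using that
  proof (induction i)
    case (Suc i)
    show ?case
    proof (cases "i = 0")
      case True then show ?thesis using gc by simp
    next
      case False
      then have "(g ^^ Suc i) c = g ((f ^^ i) y)" using Suc by simp
      also have "\<dots> = (f ^^ Suc i) y" using Suc False j by (intro g) auto
      finally show ?thesis .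
    qed
  qed simp
  have 2: "(g ^^ i) y = (f ^^ (j + i)) y" if "1 \<le> i" "i \<le> n - j" for i
    using that
  proof (induction i)
    case (Suc i)
    show ?case
    proof (cases "i = 0")
      case True then show ?thesis using gy by (simp add: c_def)
    next
      case False
      then have "(g ^^ Suc i) y = g ((f ^^ (j + i)) y)" using Suc by simp
      also have "\<dots> = (f ^^ Suc (j + i)) y" using Suc False j by (intro g) auto
      finally show ?thesis by simp
    qed
  qed simp
  have "(g ^^ j) c = c" using 1[of j] j by (simp add: c_def)
  from orbit_funpow_image[OF this] j have "orbit g c = (\<lambda>i. (g ^^ i) c) ` {1..j}" by simp
  also have "\<dots> = (\<lambda>i. (f ^^ i) y) ` {1..j}" using 1 by (intro image_cong) auto
  finally show "orbit (f \<circ> swp ((f ^^ j) y) y) ((f ^^ j) y) = (\<lambda>i. (f ^^ i) y) ` {1..j}"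
    by (simp add: g_def c_def)
  have "(g ^^ (n - j)) y = y" using 2[of "n - j"] j n by simp
  from orbit_funpow_image[OF this] j have "orbit g y = (\<lambda>i. (g ^^ i) y) ` {1..n-j}" by simp
  also have "\<dots> = (\<lambda>i. (f ^^ (j + i)) y) ` {1..n-j}" using 2 by (intro image_cong) auto
  also have "\<dots> = (\<lambda>i. (f ^^ i) y) ` ((+) j ` {1..n-j})" by (simp only: image_image)
  also have "(+) j ` {1..n-j} = {j<..n}" using j by auto
  finally show "orbit (f \<circ> swp ((f ^^ j) y) y) y = (\<lambda>i. (f ^^ i) y) ` {j<..n}"
    unfolding g_def c_def .
qed

text \<open>The transposition is an involution, so \<open>f\<close> arises from \<open>g\<close> by
  merging. Once \<open>swap_split\<close> has shown that \<open>x\<close> and \<open>y\<close> lie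
  in different cycles of \<open>g\<close>, everything is read off from
  \<open>swap_merge_orbits\<close>.\<close>

lemma swap_split_orbits:
  assumes fin: "finite A" and f: "bij_betw f A A" and x: "x \<in> A" and y: "y \<in> A"
    and xy: "x \<noteq> y" "y \<in> orbit f x"
  shows "orbits_on (f \<circ> swp x y) A =
      insert (orbit (f \<circ> swp x y) x) (insert (orbit (f \<circ> swp x y) y) (orbits_on f A - {orbit f x}))"
    and "card (orbits_on (f \<circ> swp x y) A) = Suc (card (orbits_on f A))"
    and "y \<notin> orbit (f \<circ> swp x y) x"
    and "orbit (f \<circ> swp x y) x \<union> orbit (f \<circ> swp x y) y = orbit f x"
proof -
  define g where "g = f \<circ> swp x y"
  have g: "bij_betw g A A" unfolding g_def by (rule orbits_on_swap_ends[OF fin f x y])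
  have fg: "f = g \<circ> swp x y" by (simp add: g_def o_assoc[symmetric])
  obtain n where n: "0 < n" "(f ^^ n) y = y" "inj_on (\<lambda>i. (f ^^ i) y) {1..n}"
    "orbit f y = (\<lambda>i. (f ^^ i) y) ` {1..n}"
    by (rule orbit_enum[OF fin f y])
  have "x \<in> orbit f y" using xy orbit_mem_iff[OF fin f] x y by simp
  then obtain j where j: "1 \<le> j" "j \<le> n" "x = (f ^^ j) y" unfolding n(4) by auto
  have "j \<noteq> n" using j(3) n(2) xy(1) by auto
  with j(2) have "j < n" by simp
  note sp = swap_split[OF n(1-3) j(1) this, folded j(3), folded g_def]
  have dis: "y \<notin> orbit g x"
  proof
    assume "y \<in> orbit g x"
    then obtain i where i: "i \<in> {1..j}" "y = (f ^^ i) y" unfolding sp(1) by blast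
    have "(f ^^ i) y = (f ^^ n) y" using i(2) n(2) by (rule trans[OF sym sym])
    then have "i = n" by (rule inj_onD[OF n(3)]) (use i(1) \<open>j < n\<close> in auto)
    then show False using i \<open>j < n\<close> by simp
  qed
  then show "y \<notin> orbit (f \<circ> swp x y) x" by (simp add: g_def)
  from swap_merge_orbits[OF fin g x y dis]
  have m: "orbits_on f A = insert (orbit g x \<union> orbit g y) (orbits_on g A - {orbit g x, orbit g y})"
    "Suc (card (orbits_on f A)) = card (orbits_on g A)" by (simp_all add: fg[symmetric])
  from swap_merge[OF fin g x y dis] have o: "orbit f x = orbit g x \<union> orbit g y"
    by (simp add: fg[symmetric])
  show "card (orbits_on (f \<circ> swp x y) A) = Suc (card (orbits_on f A))"
    using m by (simp add: g_def)
  show "orbit (f \<circ> swp x y) x \<union> orbit (f \<circ> swp x y) y = orbit f x"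
    using o by (simp add: g_def)
  have "orbit g x \<union> orbit g y \<notin> orbits_on g A"
  proof
    assume a: "orbit g x \<union> orbit g y \<in> orbits_on g A"
    from orbits_on_eqD(1)[OF fin g a, of x] orbit_self[OF fin g x]
    have "orbit g y \<subseteq> orbit g x" by auto
    then show False using dis orbit_self[OF fin g y] by blast
  qed
  then have "orbits_on f A - {orbit f x} = orbits_on g A - {orbit g x, orbit g y}"
    unfolding m(1) o by auto
  moreover have "orbit g x \<in> orbits_on g A" "orbit g y \<in> orbits_on g A"
    using x y by (auto simp: orbits_on_def)
  ultimately show "orbits_on (f \<circ> swp x y) A =
      insert (orbit (f \<circ> swp x y) x) (insert (orbit (f \<circ> swp x y) y) (orbits_on f A - {orbit f x}))"
    unfolding g_def[symmetric] by auto
qed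

section \<open>First returns\<close>

text \<open>A relational form of \<open>first_return\<close> that carries an induction along the
  walk and also expresses that a return happens; the \<open>LEAST\<close> in
  \<open>first_return\<close> gives neither.\<close>

inductive ret :: "('b \<Rightarrow> 'b) \<Rightarrow> 'b set \<Rightarrow> 'b \<Rightarrow> 'b \<Rightarrow> bool" for f A where
  now: "f a \<in> A \<Longrightarrow> ret f A a (f a)"
| later: "f a \<notin> A \<Longrightarrow> ret f A (f a) b \<Longrightarrow> ret f A a b"

lemma ret_funpow:
  "ret f A a b \<Longrightarrow> \<exists>k>0. (f ^^ k) a = b \<and> b \<in> A \<and> (\<forall>i. 0 < i \<and> i < k \<longrightarrow> (f ^^ i) a \<notin> A)"
proof (induction rule: ret.induct)
  case (now a)
  show ?case by (rule exI[of _ 1]) (use now in simp)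
next
  case (later a b)
  from later(3) obtain k where "k > 0 \<and> (f ^^ k) (f a) = b \<and> b \<in> A \<and>
    (\<forall>i. 0 < i \<and> i < k \<longrightarrow> (f ^^ i) (f a) \<notin> A)" ..
  note k = this[THEN conjunct1] this[THEN conjunct2, THEN conjunct1]
    this[THEN conjunct2, THEN conjunct2, THEN conjunct1]
    this[THEN conjunct2, THEN conjunct2, THEN conjunct2]
  show ?case
  proof (intro exI[of _ "Suc k"] conjI allI impI)
    show "(f ^^ Suc k) a = b" using k(2) unfolding funpow_Suc_right by simp
    fix i assume i: "0 < i \<and> i < Suc k"
    then obtain i' where i': "i = Suc i'" by (cases i) auto
    show "(f ^^ i) a \<notin> A"
    proof (cases "i' = 0")
      case True then show ?thesis using i' later(1) by simp
    next
      case False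
      then have "(f ^^ i') (f a) \<notin> A" using i i' k(4) by auto
      then show ?thesis unfolding i' funpow_Suc_right by simp
    qed
  qed (use k in auto)
qed

lemma ret_first_return:
  assumes "ret f A a b"
  shows "first_return f A a = b"
proof -
  obtain k where k: "k > 0" "(f ^^ k) a = b" "b \<in> A"
    "\<And>i. 0 < i \<and> i < k \<Longrightarrow> (f ^^ i) a \<notin> A" using ret_funpow[OF assms] by blast
  have "(LEAST k. 0 < k \<and> (f ^^ k) a \<in> A) = k"
    by (rule Least_equality) (use k in \<open>auto simp: not_less[symmetric]\<close>)
  then show ?thesis using k by (simp add: first_return_def)
qed

lemma ret_ex_funpow:
  assumes "0 < k" "(f ^^ k) a \<in> A"
  shows "\<exists>b. ret f A a b"
  using assms
proof (induction k arbitrary: a)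
  case (Suc k)
  show ?case
  proof (cases "f a \<in> A")
    case True then show ?thesis by (blast intro: ret.now)
  next
    case False
    then have "k > 0" using Suc(3) by (cases k) auto
    moreover have "(f ^^ k) (f a) \<in> A" using Suc(3) by (simp add: funpow_swap1)
    moreover note False
    ultimately have "k > 0" "(f ^^ k) (f a) \<in> A" by auto
    with Suc.IH False show ?thesis by (blast intro: ret.later)
  qed
qed simp

lemma ret_ex:
  assumes "finite D" "bij_betw f D D" "A \<subseteq> D" "a \<in> A"
  shows "ret f A a (first_return f A a)"
proof -
  have "a \<in> orbit f a" using orbit_self assms by (metis subsetD)
  then obtain k where k: "0 < k" "a = (f ^^ k) a" unfolding orbit_altdef by blast
  have "(f ^^ k) a \<in> A" using k(2) assms(4) by (rule subst)
  then obtain b where "ret f A a b" using ret_ex_funpow[OF k(1), of f a A] by blast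
  then show ?thesis using ret_first_return by metis
qed

text \<open>Deleting arcs from a cycle in two stages is the same as deleting them at once. This is
  what reduces the drawing of an edge to the insertion of single arcs.\<close>

lemma ret_trans:
  assumes "ret f A a b" "A \<subseteq> B"
  shows "ret (first_return f B) A a b"
  using assms(1)
proof (induction rule: ret.induct)
  case (now a)
  then have "ret f B a (f a)" using assms(2) by (auto intro: ret.now)
  then have "first_return f B a = f a" by (rule ret_first_return)
  then show ?case using now ret.now[of "first_return f B" a A] by simp
next
  case (later a b)
  show ?case
  proof (cases "f a \<in> B")
    case True
    then have "first_return f B a = f a" by (intro ret_first_return ret.now)
    then show ?thesis using later ret.later[of "first_return f B" a A b] by simp
  next
    case False
    obtain k where "k > 0" "(f ^^ k) (f a) \<in> B"
      using ret_funpow[OF later(2)] assms(2) by blast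
    then obtain c where "ret f B (f a) c" using ret_ex_funpow by metis
    then have "first_return f B a = first_return f B (f a)"
      using ret.later[of f a B c] False ret_first_return by metis
    with later(3) show ?thesis
      by (metis ret.simps)
  qed
qed

lemma ret_cong:
  assumes "ret f A a b" "a \<in> B" "\<And>x. x \<in> B \<Longrightarrow> f x \<in> B \<and> g x = f x"
  shows "ret g A a b"
  using assms(1,2)
proof (induction rule: ret.induct)
  case (now a)
  then show ?case using assms(3)[of a] ret.now[of g a A] by simp
next
  case (later a b)
  then show ?case using assms(3)[of a] ret.later[of g a A b] by simp
qed

text \<open>If one return takes fewer steps than the other, cancelling the common steps shows that
  the longer walk meets \<open>A\<close> too early, namely at the start of the shorter one.\<close>

lemma ret_inj:
  assumes f: "inj_on f D" "\<And>x. x \<in> D \<Longrightarrow> f x \<in> D" and "A \<subseteq> D"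
    and "ret f A a b" "ret f A a' b" "a \<in> A" "a' \<in> A"
  shows "a = a'"
proof -
  have *: "a = a'" if k: "0 < k" "(f ^^ k) a = b" and k': "(f ^^ k') a' = b" "k \<le> k'"
    "\<And>i. 0 < i \<and> i < k' \<Longrightarrow> (f ^^ i) a' \<notin> A" and a: "a \<in> A" "a' \<in> A" for k k' a a'
  proof -
    have inj: "(f ^^ i) x = (f ^^ i) y \<Longrightarrow> x \<in> D \<Longrightarrow> y \<in> D \<Longrightarrow> x = y" for i x y
    proof (induction i arbitrary: x y)
      case (Suc i)
      then have "f x = f y" using f(2) by (simp add: funpow_swap1)
      then show ?case using Suc f(1) by (auto dest: inj_onD)
    qed simp
    have inD: "x \<in> D \<Longrightarrow> (f ^^ i) x \<in> D" for i x by (induction i) (auto simp: f(2))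
    have "(f ^^ k) ((f ^^ (k' - k)) a') = (f ^^ k) a"
      using k k' by (simp add: funpow_add[symmetric, THEN fun_cong, unfolded o_apply])
    then have "(f ^^ (k' - k)) a' = a" using inj inD a assms(3) by blast
    then show ?thesis using k'(3)[of "k' - k"] a k k' by (cases "k' = k") auto
  qed
  obtain k where "k > 0" "(f ^^ k) a = b" "\<And>i. 0 < i \<and> i < k \<Longrightarrow> (f ^^ i) a \<notin> A"
    using ret_funpow[OF assms(4)] by blast
  moreover obtain k' where "k' > 0" "(f ^^ k') a' = b" "\<And>i. 0 < i \<and> i < k' \<Longrightarrow> (f ^^ i) a' \<notin> A"
    using ret_funpow[OF assms(5)] by blast
  ultimately show ?thesis using *[of k a k' a'] *[of k' a' k a] assms(6,7)
    by (metis nat_le_linear)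
qed

text \<open>The rotation system induced on the arcs in \<open>B\<close> when all other arcs are
  erased. Being the identity outside \<open>B\<close> makes it a permutation in the sense of
  \<open>permutes\<close>.\<close>

definition restrict_return :: "('b \<Rightarrow> 'b) \<Rightarrow> 'b set \<Rightarrow> 'b \<Rightarrow> 'b" where
  "restrict_return f B a = (if a \<in> B then first_return f B a else a)"

lemma restrict_return_permutes:
  assumes "finite D" "bij_betw f D D" "B \<subseteq> D"
  shows "restrict_return f B permutes B"
proof (rule bij_imp_permutes)
  have fin: "finite B" using assms finite_subset by blast
  have "first_return f B a \<in> B" if "a \<in> B" for a
    using ret_funpow[OF ret_ex[OF assms that]] by blast
  then have sub: "restrict_return f B ` B \<subseteq> B" by (auto simp: restrict_return_def)
  have "inj_on (restrict_return f B) B"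
  proof (rule inj_onI)
    fix a a' assume a: "a \<in> B" "a' \<in> B" "restrict_return f B a = restrict_return f B a'"
    then have "first_return f B a = first_return f B a'" by (simp add: restrict_return_def)
    then have "ret f B a (first_return f B a)" "ret f B a' (first_return f B a)"
      using ret_ex[OF assms a(1)] ret_ex[OF assms a(2)] by simp_all
    then show "a = a'"
      using ret_inj[of f D B a _ a'] assms a by (auto simp: bij_betw_def)
  qed
  then show "bij_betw (restrict_return f B) B B"
    using sub fin by (simp add: bij_betw_def endo_inj_surj)
qed (simp add: restrict_return_def)

lemma restrict_return_trans:
  assumes "finite D" "bij_betw f D D" "A \<subseteq> B" "B \<subseteq> D" "a \<in> A"
  shows "first_return (restrict_return f B) A a = first_return f A a"
proof -
  have "ret f A a (first_return f A a)" using ret_ex assms by (metis subset_trans)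
  from ret_trans[OF this assms(3)] have r: "ret (first_return f B) A a (first_return f A a)" .
  have p: "restrict_return f B permutes B" using restrict_return_permutes assms by blast
  have "ret (restrict_return f B) A a (first_return f A a)"
  proof (rule ret_cong[OF r, of B])
    show "a \<in> B" using assms by blast
    show "first_return f B x \<in> B \<and> restrict_return f B x = first_return f B x" if "x \<in> B" for x
      using that permutes_in_image[OF p, of x] by (auto simp: restrict_return_def)
  qed
  then show ?thesis by (rule ret_first_return)
qed

text \<open>The only freedom in adding an arc \<open>y\<close> to a rotation system is its
  predecessor \<open>p\<close>; the choice \<open>p = y\<close> puts \<open>y\<close> alone at a new
  vertex.\<close>

lemma insert_after:
  assumes s: "s permutes A" and y: "y \<notin> A" and g: "g permutes insert y A"
    and ret: "\<And>a. a \<in> A \<Longrightarrow> first_return g A a = s a" and fin: "finite A" and p: "g p = y"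
  shows "g = s \<circ> swp p y" "p \<in> insert y A"
proof -
  show pin: "p \<in> insert y A" using g p by (metis insertI1 permutes_in_image)
  have inj: "g u = g v \<longleftrightarrow> u = v" for u v using permutes_inj[OF g] by (simp add: inj_eq)
  have in_A: "g x \<in> A" if "x \<in> insert y A" "x \<noteq> p" for x
    using permutes_in_image[OF g, of x] that p inj by auto
  have sy: "s y = y" using s y by (rule permutes_not_in)
  show "g = s \<circ> swp p y"
  proof
    fix x
    consider "x \<notin> insert y A" | "x = p" | "x \<noteq> p" "x = y" | "x \<noteq> p" "x \<noteq> y" "x \<in> A" by blast
    then show "g x = (s \<circ> swp p y) x"
    proof cases
      case 1
      then have "x \<noteq> p" "x \<noteq> y" using pin by auto
      then show ?thesis using 1 permutes_not_in[OF g] permutes_not_in[OF s] by simp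
    next
      case 2 then show ?thesis using p sy by simp
    next
      case 3
      then have "p \<in> A" using pin by auto
      have "g y \<in> A" using in_A 3 by simp
      then have "ret g A p (g y)" using p y by (metis ret.later ret.now)
      then show ?thesis using 3 ret[OF \<open>p \<in> A\<close>] by (simp add: ret_first_return)
    next
      case 4
      then have "ret g A x (g x)" using in_A by (intro ret.now) simp
      then show ?thesis using 4 ret[OF \<open>x \<in> A\<close>] by (simp add: ret_first_return)
    qed
  qed
qed

lemma first_return_insert_after:
  assumes s: "s permutes A" and y: "y \<notin> A" and p: "p \<in> insert y A" and a: "a \<in> A"
  shows "first_return (s \<circ> swp p y) A a = s a"
proof (cases "a = p")
  case True
  then have "p \<noteq> y" using a y by auto
  have "s y = y" using s y by (rule permutes_not_in)
  moreover have "s p \<in> A" using s a True by (simp add: permutes_in_image)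
  ultimately have "ret (s \<circ> swp p y) A p (s p)"
    using y ret.now[of "s \<circ> swp p y" y A] ret.later[of "s \<circ> swp p y" p A] by simp
  then show ?thesis using True by (simp add: ret_first_return)
next
  case False
  moreover have "a \<noteq> y" using a y by auto
  moreover have "s a \<in> A" using s a by (simp add: permutes_in_image)
  ultimately show ?thesis
    using ret.now[of "s \<circ> swp p y" a A] by (intro ret_first_return) simp
qed

lemma insert_after_permutes:
  assumes "s permutes A" "p \<in> insert y A"
  shows "s \<circ> swp p y permutes insert y A"
proof -
  have 1: "swp p y permutes insert y A" by (rule permutes_swap_id) (use assms(2) in auto)
  have 2: "s permutes insert y A" using permutes_subset[OF assms(1) subset_insertI] .
  show ?thesis using permutes_compose[OF 1 2] .
qed

section \<open>Fillings of the faces of a submap\<close>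

definition arc_inv :: "('b \<Rightarrow> 'b) \<Rightarrow> 'b set \<Rightarrow> bool" where
  "arc_inv r A \<longleftrightarrow> finite A \<and> (\<forall>a\<in>A. r a \<in> A \<and> r (r a) = a \<and> r a \<noteq> a)"

text \<open>Connectedness of the map whose edges are given by \<open>r\<close> and whose vertices
  are the cycles of \<open>s\<close>. On a finite set closure under the two permutations suffices,
  without their inverses.\<close>

definition transitive_on :: "('b \<Rightarrow> 'b) \<Rightarrow> ('b \<Rightarrow> 'b) \<Rightarrow> 'b set \<Rightarrow> bool" where
  "transitive_on r s D \<longleftrightarrow> (\<forall>B. B \<subseteq> D \<and> B \<noteq> {} \<and> (\<forall>a\<in>B. r a \<in> B \<and> s a \<in> B) \<longrightarrow> B = D)"

text \<open>
  Euler's formula: the cycles of \<open>s\<close> are the vertices, those of \<open>s \<circ> r\<close> the faces.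
\<close>

definition planar_on :: "('b \<Rightarrow> 'b) \<Rightarrow> ('b \<Rightarrow> 'b) \<Rightarrow> 'b set \<Rightarrow> bool" where
  "planar_on r s D \<longleftrightarrow> card (orbits_on s D) + card (orbits_on (s \<circ> r) D) = card D div 2 + 2"

text \<open>
  An arc \<open>b\<close> in \<open>A\<close> also stands for the corner between \<open>r b\<close> and \<open>s (r b)\<close>, which belongs to the
  face of \<open>b\<close>. The corners in \<open>K\<close> are those where edges with arcs in \<open>X\<close> may be attached.
\<close>

definition fillings ::
  "('b \<Rightarrow> 'b) \<Rightarrow> 'b set \<Rightarrow> ('b \<Rightarrow> 'b) \<Rightarrow> 'b set \<Rightarrow> 'b set \<Rightarrow> ('b \<Rightarrow> 'b) set" where
  "fillings r A s K X = {g. g permutes (A \<union> X) \<and> (\<forall>a\<in>A. first_return g A a = s a) \<and>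
     (\<forall>b\<in>A-K. g (r b) = s (r b)) \<and> transitive_on r g (A \<union> X) \<and> planar_on r g (A \<union> X)}"

text \<open>
  The edge \<open>{y, r y}\<close> is drawn from the corner \<open>b\<close> to the corner \<open>c\<close>; if \<open>c = y\<close>, it ends in a new vertex.
\<close>

definition add_edge :: "('b \<Rightarrow> 'b) \<Rightarrow> ('b \<Rightarrow> 'b) \<Rightarrow> 'b \<Rightarrow> 'b \<Rightarrow> 'b \<Rightarrow> 'b \<Rightarrow> 'b" where
  "add_edge r s b y c = s \<circ> swp (r b) y \<circ> swp (r c) (r y)"

text \<open>
  The arcs reached from the faces in \<open>U\<close> without crossing an edge of the submap with arcs \<open>A\<close>.
\<close>

inductive_set region :: "('b \<Rightarrow> 'b) \<Rightarrow> ('b \<Rightarrow> 'b) \<Rightarrow> 'b set \<Rightarrow> 'b set \<Rightarrow> 'b set" for r g A U where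
  base: "u \<in> U \<Longrightarrow> u \<in> region r g A U"
| turn: "x \<in> region r g A U \<Longrightarrow> g (r x) \<in> region r g A U"
| cross: "x \<in> region r g A U \<Longrightarrow> x \<notin> A \<Longrightarrow> r x \<in> region r g A U"

lemma arc_invD:
  assumes "arc_inv r A" "a \<in> A"
  shows "r a \<in> A" "r (r a) = a" "r a \<noteq> a"
  using assms by (auto simp: arc_inv_def)

lemma arc_inv_finite: "arc_inv r A \<Longrightarrow> finite A"
  by (simp add: arc_inv_def)

lemma arc_inv_Un: "arc_inv r A \<Longrightarrow> arc_inv r X \<Longrightarrow> arc_inv r (A \<union> X)"
  by (auto simp: arc_inv_def)

lemma arc_inv_pair: "arc_inv r X \<Longrightarrow> y \<in> X \<Longrightarrow> arc_inv r {y, r y}"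
  by (auto simp: arc_inv_def)

lemma arc_inv_Diff: "arc_inv r X \<Longrightarrow> arc_inv r Y \<Longrightarrow> arc_inv r (X - Y)"
  unfolding arc_inv_def by (metis DiffE DiffI finite_Diff)

lemma arc_inv_eq_iff: "arc_inv r A \<Longrightarrow> a \<in> A \<Longrightarrow> b \<in> A \<Longrightarrow> r a = r b \<longleftrightarrow> a = b"
  by (metis arc_invD(2))

lemma arc_inv_bij: "arc_inv r A \<Longrightarrow> bij_betw r A A"
  by (rule bij_betw_byWitness[where f' = r]) (auto simp: arc_inv_def)

lemma face_bij:
  assumes "arc_inv r A" "s permutes A"
  shows "bij_betw (s \<circ> r) A A"
  using arc_inv_bij[OF assms(1)] permutes_imp_bij[OF assms(2)] by (rule bij_betw_trans)

lemma orbits_on_cong: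
  assumes "\<And>x. x \<in> A \<Longrightarrow> f x = g x" "\<And>x. x \<in> A \<Longrightarrow> f x \<in> A"
  shows "orbits_on f A = orbits_on g A"
  unfolding orbits_on_def
  by (intro image_cong[OF refl] orbit_cong0[where A = A]) (use assms in auto)

lemma fillings_permutes: "g \<in> fillings r A s K X \<Longrightarrow> g permutes (A \<union> X)"
  by (simp add: fillings_def)

lemma finite_fillings:
  assumes "finite A" "finite X"
  shows "finite (fillings r A s K X)"
  by (rule finite_subset[of _ "{g. g permutes (A \<union> X)}"])
    (use assms in \<open>auto simp: fillings_def intro: finite_permutations\<close>)

text \<open>If the arc after \<open>r b\<close> already belongs to \<open>A\<close>, it is the first
  return of \<open>r b\<close> and so equals \<open>s (r b)\<close>: nothing is drawn in the corner
  \<open>b\<close>.\<close>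

lemma fillings_closed_corner:
  assumes A: "arc_inv r A" and s: "s permutes A" and b: "b \<in> K" "K \<subseteq> A"
  shows "{g \<in> fillings r A s K X. g (r b) \<in> A} = fillings r A s (K - {b}) X"
proof -
  have rb: "r b \<in> A" using A b by (auto simp: arc_inv_def)
  have *: "g (r b) = s (r b)" if "\<forall>a\<in>A. first_return g A a = s a" "g (r b) \<in> A" for g
    using that rb ret_first_return[OF ret.now, of g "r b" A] by auto
  have "s (r b) \<in> A" using s rb by (simp add: permutes_in_image)
  moreover have "A - (K - {b}) = insert b (A - K)" using b by blast
  ultimately show ?thesis
    unfolding fillings_def using * by (intro set_eqI iffI; clarsimp)
qed

text \<open>The flag passed to \<open>h\<close> tells whether the face lies in the marked set
  \<open>U\<close>, in which case the edges drawn into it will carry the weight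
  \<open>t\<close>.\<close>

definition face_prod ::
  "(bool \<Rightarrow> nat \<Rightarrow> 'a::comm_ring_1) \<Rightarrow> ('b \<Rightarrow> 'b) \<Rightarrow> 'b set \<Rightarrow> ('b \<Rightarrow> 'b) \<Rightarrow> 'b set \<Rightarrow> 'b set \<Rightarrow> 'a" where
  "face_prod h r A s K U = (\<Prod>P\<in>orbits_on (s \<circ> r) A. h (P \<subseteq> U) (card (K \<inter> P)))"

text \<open>Used for the chords of a face: when the possible endpoints are listed along the
  boundary, the number of open corners cut off takes each value from \<open>1\<close> to
  \<open>card I\<close> once.\<close>

lemma rank_sum:
  fixes I :: "'i::linorder set"
  assumes "finite I"
  shows "(\<Sum>i\<in>I. f (card {j \<in> I. j \<le> i})) = (\<Sum>j=1..card I. f j)"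
  using assms
proof (induction I rule: finite_linorder_max_induct)
  case (insert b A)
  have b: "b \<notin> A" using insert by auto
  have "{j \<in> insert b A. j \<le> b} = insert b A" using insert by auto
  moreover have "{j \<in> insert b A. j \<le> i} = {j \<in> A. j \<le> i}" if "i \<in> A" for i
    using that insert by auto
  ultimately show ?case using insert b by (simp add: add.commute)
qed simp

text \<open>One step of the drawing: \<open>b\<close> is the corner under treatment and
  \<open>y\<close> the arc that is to follow \<open>r b\<close>. The constants with suffix
  \<open>2\<close> describe the situation after the edge \<open>{y, r y}\<close> has been
  drawn.\<close>

locale edge_slot =
  fixes r :: "'b \<Rightarrow> 'b" and A s K X b y
  assumes A: "arc_inv r A" and X: "arc_inv r X" and AX: "A \<inter> X = {}"
    and s: "s permutes A" and K: "K \<subseteq> A" and b: "b \<in> K" and y: "y \<in> X"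
begin

definition A2 where "A2 = insert (r y) (insert y A)"
text \<open>The part of the corner \<open>b\<close> before \<open>y\<close> is closed; the part
  behind \<open>y\<close> is the corner \<open>r y\<close>. At the other end, \<open>y\<close> is
  the corner behind \<open>r y\<close>, and it doubles as the code for an edge to a new vertex. An
  old corner \<open>c\<close> where the edge arrives stays open in front of
  \<open>r y\<close>.\<close>

definition K2 where "K2 = insert y (insert (r y) (K - {b}))"
definition X2 where "X2 = X - {y, r y}"

lemma bA: "b \<in> A" using b K by blast
lemma rb: "r b \<in> A" using arc_invD(1)[OF A bA] .
lemma ryX: "r y \<in> X" using arc_invD(1)[OF X y] .
lemma yA: "y \<notin> A" "r y \<notin> A" using y ryX AX by auto
lemma ry: "r y \<noteq> y" "r (r y) = y" using arc_invD[OF X y] by auto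
lemma finA: "finite A" and finX: "finite X" using A X by (auto simp: arc_inv_def)

lemma A2: "arc_inv r A2"
proof -
  have "A2 = A \<union> {y, r y}" by (auto simp: A2_def)
  then show ?thesis using arc_inv_Un[OF A arc_inv_pair[OF X y]] by simp
qed

lemma finA2: "finite A2" using A2 by (rule arc_inv_finite)

lemma X2: "arc_inv r X2"
  unfolding X2_def by (rule arc_inv_Diff[OF X arc_inv_pair[OF X y]])

lemma A2X2: "A2 \<inter> X2 = {}" "A2 \<union> X2 = A \<union> X" "A2 \<subseteq> A \<union> X"
  using AX y ryX by (auto simp: A2_def X2_def)

lemma cardX2: "card X = card X2 + 2"
proof -
  have "X = insert y (insert (r y) X2)" using y ryX by (auto simp: X2_def)
  moreover have "card (insert y (insert (r y) X2)) = card X2 + 2"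
    using finX ry by (simp add: X2_def)
  ultimately show ?thesis by simp
qed

lemma cardA2: "card A2 = card A + 2"
  using yA ry finA by (simp add: A2_def)

lemma K2: "K2 \<subseteq> A2" "y \<in> K2" "r y \<in> K2" "b \<notin> K2" "K2 \<inter> A = K - {b}"
  using K b yA bA by (auto simp: K2_def A2_def)

lemma cardK2: "card K2 = Suc (card K)"
proof -
  have "finite K" using K finA by (rule finite_subset)
  moreover have "y \<notin> K" "r y \<notin> K" using K yA by auto
  ultimately have "card K2 = card (K - {b}) + 2" using ry by (simp add: K2_def)
  then show ?thesis using card_Suc_Diff1[OF \<open>finite K\<close> b] by simp
qed

lemma rc: "c \<in> K2 \<Longrightarrow> r c \<in> A2" "c \<in> K2 \<Longrightarrow> r (r c) = c"
  using K2(1) arc_invD[OF A2, of c] by auto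

lemma s_fix: "s y = y" "s (r y) = r y"
  using s yA by (simp_all add: permutes_not_in)

lemma s1: "s \<circ> swp (r b) y permutes insert y A"
  by (rule insert_after_permutes[OF s]) (simp add: rb)

lemma s2:
  assumes "c \<in> K2"
  shows "add_edge r s b y c permutes A2"
  unfolding add_edge_def A2_def
  by (rule insert_after_permutes[OF s1]) (use rc(1)[OF assms] in \<open>simp add: A2_def\<close>)

lemma ry_notin: "r y \<notin> insert y A" using ry yA by simp

lemma s2_values:
  assumes c: "c \<in> K2"
  shows "add_edge r s b y c (r b) = y"
    and "add_edge r s b y c (r c) = r y"
    and "\<And>a. a \<in> A \<Longrightarrow> a \<notin> K2 \<Longrightarrow> a \<noteq> b \<Longrightarrow> add_edge r s b y c (r a) = s (r a)"
proof -
  have "c \<in> A2" using c K2 by auto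
  note eq = arc_inv_eq_iff[OF A2]
  have in2: "a \<in> A2" if "a \<in> A" for a using that by (simp add: A2_def)
  have y2: "y \<in> A2" "r y \<in> A2" by (simp_all add: A2_def)
  have "r b \<noteq> r c" using eq[of b c] in2[OF bA] \<open>c \<in> A2\<close> c K2(4) by auto
  moreover have "r b \<noteq> r y" using rb yA by auto
  ultimately show "add_edge r s b y c (r b) = y" by (simp add: add_edge_def s_fix)
  show "add_edge r s b y c (r c) = r y"
    using rb yA ry by (auto simp: add_edge_def s_fix Transposition.transpose_def)
  show "add_edge r s b y c (r a) = s (r a)" if a: "a \<in> A" "a \<notin> K2" "a \<noteq> b" for a
  proof -
    have "r a \<in> A" using A a by (auto simp: arc_inv_def)
    moreover have "r a \<noteq> r c" using eq[of a c] in2[OF a(1)] \<open>c \<in> A2\<close> c a by auto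
    moreover have "r a \<noteq> r b" using arc_inv_eq_iff[OF A a(1) bA] a by auto
    ultimately show ?thesis using yA by (auto simp: add_edge_def Transposition.transpose_def)
  qed
qed

lemma first_return_s2:
  assumes c: "c \<in> K2" and a: "a \<in> A"
  shows "first_return (add_edge r s b y c) A a = s a"
proof -
  let ?s1 = "s \<circ> swp (r b) y"
  note s2 = s2[OF c]
  have fr: "first_return (add_edge r s b y c) (insert y A) x = ?s1 x" if "x \<in> insert y A" for x
    unfolding add_edge_def
    by (rule first_return_insert_after[OF s1 ry_notin _ that]) (use rc(1)[OF c] in \<open>simp add: A2_def\<close>)
  have "restrict_return (add_edge r s b y c) (insert y A) = ?s1"
  proof
    fix x show "restrict_return (add_edge r s b y c) (insert y A) x = ?s1 x"
      using fr[of x] permutes_not_in[OF s1, of x] by (auto simp: restrict_return_def)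
  qed
  moreover have "first_return (restrict_return (add_edge r s b y c) (insert y A)) A a =
      first_return (add_edge r s b y c) A a"
    by (rule restrict_return_trans[OF finA2 permutes_imp_bij[OF s2] _ _ a]) (auto simp: A2_def)
  moreover have "first_return ?s1 A a = s a"
    by (rule first_return_insert_after[OF s _ _ a]) (use yA rb in auto)
  ultimately show ?thesis by simp
qed

text \<open>Erasing the arcs outside \<open>A2\<close> from \<open>g\<close> leaves \<open>s\<close>
  with two inserted arcs. The predecessor of \<open>y\<close> is \<open>r b\<close>, that of
  \<open>r y\<close> determines \<open>c\<close>, and \<open>c\<close> must be an open corner
  because at a closed one \<open>r c\<close> is followed by an arc of \<open>A\<close>.\<close>

lemma fillings_edge:
  "{g \<in> fillings r A s K X. g (r b) = y} =
     (\<Union>c\<in>K2. fillings r A2 (add_edge r s b y c) K2 X2)" (is "?L = ?R")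
proof
  show "?L \<subseteq> ?R"
  proof
    fix g assume "g \<in> ?L"
    then have g: "g permutes (A \<union> X)" and fr: "\<And>a. a \<in> A \<Longrightarrow> first_return g A a = s a"
      and cor: "\<And>a. a \<in> A - K \<Longrightarrow> g (r a) = s (r a)" and gb: "g (r b) = y"
      and tp: "transitive_on r g (A \<union> X)" "planar_on r g (A \<union> X)"
      by (auto simp: fillings_def)
    have fin: "finite (A \<union> X)" using finA finX by simp
    note gbij = permutes_imp_bij[OF g]
    define g1 where "g1 = restrict_return g (insert y A)"
    define g2 where "g2 = restrict_return g A2"
    have sub1: "insert y A \<subseteq> A \<union> X" using y by auto
    have g1: "g1 permutes insert y A"
      unfolding g1_def by (rule restrict_return_permutes[OF fin gbij sub1])
    have g2: "g2 permutes A2"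
      unfolding g2_def by (rule restrict_return_permutes[OF fin gbij A2X2(3)])
    have fr1: "first_return g1 A a = s a" if "a \<in> A" for a
      unfolding g1_def by (subst restrict_return_trans[OF fin gbij _ sub1 that]) (auto simp: fr that)
    have fr2: "first_return g2 (insert y A) a = g1 a" if "a \<in> insert y A" for a
    proof -
      have "first_return g2 (insert y A) a = first_return g (insert y A) a"
        unfolding g2_def by (rule restrict_return_trans[OF fin gbij _ A2X2(3) that]) (auto simp: A2_def)
      then show ?thesis using that by (simp add: g1_def restrict_return_def)
    qed
    have direct: "g2 x = g x" if "x \<in> A2" "g x \<in> A2" for x
      using that ret_first_return[OF ret.now, of g x A2] by (simp add: g2_def restrict_return_def)
    have "g1 (r b) = y"
      using gb rb ret_first_return[OF ret.now, of g "r b" "insert y A"]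
      by (simp add: g1_def restrict_return_def)
    from insert_after(1)[OF s yA(1) g1 fr1 finA this] have g1_eq: "g1 = s \<circ> swp (r b) y" .
    have "r y \<in> A2" by (simp add: A2_def)
    then obtain p where p: "g2 p = r y" "p \<in> A2"
      using g2 permutes_surj[OF g2] by (metis permutes_in_image surj_def)
    from insert_after(1)[OF g1 ry_notin g2[unfolded A2_def] fr2 _ p(1)] finA
    have g2_eq: "g2 = g1 \<circ> swp p (r y)" by simp
    define c where "c = r p"
    have pc: "p = r c" "c \<in> A2" using arc_invD[OF A2 p(2)] by (simp_all add: c_def)
    have g2_add: "g2 = add_edge r s b y c"
      by (simp add: g2_eq g1_eq add_edge_def pc(1))
    have cK: "c \<in> K2"
    proof (cases "c \<in> A")
      case True
      have "c \<noteq> b" using direct[of "r b"] gb rb p(1) pc(1) ry by (auto simp: A2_def)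
      moreover have "c \<in> K"
      proof (rule ccontr)
        assume "c \<notin> K"
        then have e: "g (r c) = s (r c)" using cor True by simp
        have "s (r c) \<in> A" using arc_invD(1)[OF A True] s by (simp add: permutes_in_image)
        then have "g2 (r c) \<in> A" using direct[of "r c"] e p(2) pc by (simp add: A2_def)
        then show False using p(1) pc(1) yA by simp
      qed
      ultimately show ?thesis by (simp add: K2_def)
    next
      case False then show ?thesis using pc(2) by (auto simp: A2_def K2_def)
    qed
    have "g \<in> fillings r A2 g2 K2 X2"
      unfolding fillings_def A2X2(2)
    proof (intro CollectI conjI ballI g tp)
      show "first_return g A2 a = g2 a" if "a \<in> A2" for a
        using that by (simp add: g2_def restrict_return_def)
      fix a assume a: "a \<in> A2 - K2"
      then have aA: "a \<in> A" by (auto simp: A2_def K2_def)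
      have "g (r a) \<in> A2"
      proof (cases "a = b")
        case True then show ?thesis using gb by (simp add: A2_def)
      next
        case False
        then have "a \<notin> K" using a by (auto simp: K2_def)
        then have "g (r a) = s (r a)" using cor aA by simp
        then show ?thesis using arc_invD(1)[OF A aA] s by (simp add: permutes_in_image A2_def)
      qed
      moreover have "r a \<in> A2" using arc_invD(1)[OF A aA] by (simp add: A2_def)
      ultimately show "g (r a) = g2 (r a)" using direct by simp
    qed
    then show "g \<in> ?R" using cK g2_add by blast
  qed
next
  show "?R \<subseteq> ?L"
  proof
    fix g assume "g \<in> ?R"
    then obtain c where c: "c \<in> K2" and "g \<in> fillings r A2 (add_edge r s b y c) K2 X2" by blast
    then have g: "g permutes (A \<union> X)"
      and fr: "\<And>a. a \<in> A2 \<Longrightarrow> first_return g A2 a = add_edge r s b y c a"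
      and cor: "\<And>a. a \<in> A2 - K2 \<Longrightarrow> g (r a) = add_edge r s b y c (r a)"
      and tp: "transitive_on r g (A \<union> X)" "planar_on r g (A \<union> X)"
      by (auto simp: fillings_def A2X2(2))
    have fin: "finite (A \<union> X)" using finA finX by simp
    note gbij = permutes_imp_bij[OF g]
    have "restrict_return g A2 = add_edge r s b y c"
    proof
      fix x show "restrict_return g A2 x = add_edge r s b y c x"
        using fr[of x] permutes_not_in[OF s2[OF c], of x] by (auto simp: restrict_return_def)
    qed
    then have fr': "first_return g A a = s a" if "a \<in> A" for a
    proof -
      have "A \<subseteq> A2" by (auto simp: A2_def)
      from restrict_return_trans[OF fin gbij this A2X2(3) that] first_return_s2[OF c that]
      show ?thesis using \<open>restrict_return g A2 = _\<close> by simp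
    qed
    have "g (r b) = y"
      using cor[of b] bA K2(4) s2_values(1)[OF c] by (simp add: A2_def)
    moreover have "g (r a) = s (r a)" if "a \<in> A - K" for a
    proof -
      have "a \<notin> K2" "a \<noteq> b" using that b yA by (auto simp: K2_def)
      then show ?thesis using that cor[of a] s2_values(3)[OF c, of a] by (simp add: A2_def)
    qed
    ultimately show "g \<in> ?L" using g fr' tp by (simp add: fillings_def)
  qed
qed

lemma fillings_edge_disjoint:
  assumes "c \<in> K2" "c' \<in> K2" "c \<noteq> c'"
  shows "fillings r A2 (add_edge r s b y c) K2 X2 \<inter> fillings r A2 (add_edge r s b y c') K2 X2 = {}"
proof (rule ccontr)
  assume "\<not> ?thesis"
  then obtain g where "g \<in> fillings r A2 (add_edge r s b y c) K2 X2"
    "g \<in> fillings r A2 (add_edge r s b y c') K2 X2" by blast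
  then have eq: "add_edge r s b y c a = add_edge r s b y c' a" if "a \<in> A2" for a
    using that by (auto simp: fillings_def)
  have "add_edge r s b y c (r c) = add_edge r s b y c (r c')"
    using eq[OF rc(1)[OF assms(2)]] s2_values(2)[OF assms(1)] s2_values(2)[OF assms(2)] by simp
  then have "r c = r c'" using permutes_inj[OF s2[OF assms(1)]] by (simp add: inj_eq)
  then show False using rc(2) assms by metis
qed

text \<open>First returns stay inside a closed set, so a closed set that meets \<open>A\<close>
  contains \<open>A\<close> and then also \<open>y\<close>. One that avoids \<open>A\<close> would
  have to contain the predecessor \<open>r b\<close> of \<open>y\<close>.\<close>

lemma transitive_s2:
  assumes c: "c \<in> K2" and tr: "transitive_on r s A"
  shows "transitive_on r (add_edge r s b y c) A2"
  unfolding transitive_on_def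
proof (intro allI impI, elim conjE)
  fix B assume B: "B \<subseteq> A2" "B \<noteq> {}" "\<forall>a\<in>B. r a \<in> B \<and> add_edge r s b y c a \<in> B"
  let ?s2 = "add_edge r s b y c"
  note bij = permutes_imp_bij[OF s2[OF c]]
  show "B = A2"
  proof (cases "B \<inter> A = {}")
    case True
    then have "B \<subseteq> {y, r y}" using B(1) by (auto simp: A2_def)
    then have yB: "y \<in> B" using B(2,3) ry by (metis empty_subsetI insertE singletonD subsetD subset_antisym all_not_in_conv)
    have "finite B" using B(1) finA2 finite_subset by blast
    moreover have "inj_on ?s2 B" using permutes_inj[OF s2[OF c]] by (rule inj_on_subset) simp
    moreover have "?s2 ` B \<subseteq> B" using B(3) by auto
    ultimately have "?s2 ` B = B" by (simp add: endo_inj_surj)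
    then obtain x where "x \<in> B" "?s2 x = y" using yB by (metis imageE)
    then have "x = r b" using s2_values(1)[OF c] permutes_inj[OF s2[OF c]] by (metis injD)
    then show ?thesis using \<open>x \<in> B\<close> True rb by auto
  next
    case False
    have "s a \<in> B" if a: "a \<in> B \<inter> A" for a
    proof -
      have "ret ?s2 A a (s a)"
        using ret_ex[OF finA2 bij, of A a] a first_return_s2[OF c, of a] by (auto simp: A2_def)
      then obtain k where "(?s2 ^^ k) a = s a" using ret_funpow by metis
      moreover have "(?s2 ^^ k) a \<in> B" for k using a B(3) by (induction k) auto
      ultimately show ?thesis by metis
    qed
    moreover have "s a \<in> A" if "a \<in> A" for a using that s by (simp add: permutes_in_image)
    moreover have "r a \<in> B \<inter> A" if "a \<in> B \<inter> A" for a using that B(3) arc_invD(1)[OF A] by auto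
    ultimately have "\<forall>a\<in>B \<inter> A. r a \<in> B \<inter> A \<and> s a \<in> B \<inter> A" by blast
    then have "B \<inter> A = A" using tr False unfolding transitive_on_def by blast
    then have AB: "A \<subseteq> B" by blast
    then have "r b \<in> B" using rb by auto
    then have "y \<in> B" using B(3) s2_values(1)[OF c] by metis
    then have "r y \<in> B" using B(3) by blast
    then show ?thesis using AB \<open>y \<in> B\<close> B(1) by (auto simp: A2_def)
  qed
qed

section \<open>Euler's formula after drawing an edge\<close>

lemma sA2: "s permutes A2"
  by (rule permutes_subset[OF s]) (auto simp: A2_def)

lemma A2_mem: "y \<in> A2" "r y \<in> A2" "b \<in> A2" "r b \<in> A2" "a \<in> A \<Longrightarrow> a \<in> A2"
  using bA rb by (auto simp: A2_def)

lemma orbits_s_A2: "orbits_on s A2 = insert {r y} (insert {y} (orbits_on s A))"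
proof -
  have "orbit s y = {y}" "orbit s (r y) = {r y}" by (simp_all add: orbit_eq_singleton_iff s_fix)
  then show ?thesis by (simp add: orbits_on_def A2_def)
qed

lemma card_orbits_s_A2: "card (orbits_on s A2) = card (orbits_on s A) + 2"
proof -
  have "{y} \<notin> orbits_on s A" "{r y} \<notin> orbits_on s A"
    using orbits_on_eqD(2)[OF finA permutes_imp_bij[OF s]] yA by blast+
  then show ?thesis using ry finite_orbits_on[OF finA, of s] by (simp add: orbits_s_A2)
qed

text \<open>As a permutation of \<open>A2\<close>, \<open>s\<close> has the extra fixed points
  \<open>y\<close> and \<open>r y\<close>. Each insertion merges one of them into an existing
  vertex, except that for \<open>c = y\<close> the second transposition is trivial and
  \<open>r y\<close> remains a new vertex.\<close>

lemma card_vertices: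
  assumes c: "c \<in> K2"
  shows "card (orbits_on (add_edge r s b y c) A2) = card (orbits_on s A) + (if c = y then 1 else 0)"
proof -
  let ?s1 = "s \<circ> swp (r b) y"
  note bs = permutes_imp_bij[OF sA2]
  have "y \<notin> orbit s (r b)"
    using orbit_subset_on[OF permutes_imp_bij[OF s] rb] yA by blast
  from swap_merge_orbits(2)[OF finA2 bs A2_mem(4,1) this]
  have 1: "card (orbits_on ?s1 A2) = card (orbits_on s A) + 1"
    by (simp add: card_orbits_s_A2)
  show ?thesis
  proof (cases "c = y")
    case True then show ?thesis using 1 by (simp add: add_edge_def)
  next
    case False
    have b1: "bij_betw ?s1 A2 A2" by (rule orbits_on_swap_ends[OF finA2 bs A2_mem(4,1)])
    have "?s1 (r y) = r y" using ry rb yA by (auto simp: s_fix Transposition.transpose_def)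
    then have o: "orbit ?s1 (r y) = {r y}" by (simp add: orbit_eq_singleton_iff)
    have "r y \<notin> orbit ?s1 (r c)"
    proof
      assume "r y \<in> orbit ?s1 (r c)"
      then have "orbit ?s1 (r y) = orbit ?s1 (r c)"
        by (rule orbit_eq[OF finA2 b1 rc(1)[OF c]])
      then have "r c = r y" using orbit_self[OF finA2 b1 rc(1)[OF c]] o by blast
      then show False using False rc(2)[OF c] ry by metis
    qed
    from swap_merge_orbits(2)[OF finA2 b1 rc(1)[OF c] A2_mem(2) this] 1 False
    show ?thesis by (simp add: add_edge_def)
  qed
qed

definition "phi = s \<circ> r"
text \<open>The face permutation when the new edge ends in a new vertex: moving the transposition
  \<open>swp (r b) y\<close> past \<open>r\<close> turns it into \<open>swp b (r y)\<close>. By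
  \<open>phi2_eq\<close> any other endpoint costs one more transposition.\<close>

definition "phi1 = s \<circ> r \<circ> swp b (r y)"
definition "phi2 c = add_edge r s b y c \<circ> r"

lemma phi_bij: "bij_betw phi A A" "bij_betw phi A2 A2"
  unfolding phi_def using face_bij[OF A s] face_bij[OF A2 sA2] by auto

lemma phi1_bij: "bij_betw phi1 A2 A2"
  unfolding phi1_def phi_def[symmetric]
  by (rule orbits_on_swap_ends[OF finA2 phi_bij(2) A2_mem(3,2)])

lemma phi2_bij: "c \<in> K2 \<Longrightarrow> bij_betw (phi2 c) A2 A2"
  unfolding phi2_def by (rule face_bij[OF A2 s2])

lemma swp_r:
  assumes "u \<in> A2" "v \<in> A2" "x \<in> A2"
  shows "swp (r u) (r v) (r x) = r (swp u v x)"
  using arc_inv_eq_iff[OF A2 assms(3,1)] arc_inv_eq_iff[OF A2 assms(3,2)]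
  by (auto simp: Transposition.transpose_def)

lemma phi2_eq:
  assumes c: "c \<in> K2" and x: "x \<in> A2"
  shows "phi2 c x = (phi1 \<circ> swp c y) x"
proof -
  have cA: "c \<in> A2" using c K2(1) by auto
  have z: "swp c y x \<in> A2" using cA x A2_mem(1) by (auto simp: Transposition.transpose_def)
  have "phi2 c x = s (swp (r b) y (r (swp c y x)))"
    by (simp add: phi2_def add_edge_def swp_r[OF cA A2_mem(1) x])
  also have "swp (r b) y (r (swp c y x)) = r (swp b (r y) (swp c y x))"
    using swp_r[OF A2_mem(3,2) z] ry(2) by simp
  finally show ?thesis by (simp add: phi1_def)
qed

lemma orbits_phi2:
  assumes c: "c \<in> K2"
  shows "orbits_on (phi2 c) A2 = orbits_on (phi1 \<circ> swp c y) A2"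
  by (rule orbits_on_cong[OF phi2_eq[OF c]]) (use bij_on_mem[OF phi2_bij[OF c]] in auto)

abbreviation "face \<equiv> orbit phi b"
abbreviation "big \<equiv> orbit phi1 b"
definition "others = orbits_on phi A - {face}"

lemma face_sub: "face \<subseteq> A" "b \<in> face" "face \<in> orbits_on phi A"
  using orbit_subset_on[OF phi_bij(1) bA] orbit_self[OF finA phi_bij(1) bA] bA
  by (auto simp: orbits_on_def)

lemma orbit_phi_ry: "orbit phi (r y) = {y, r y}" "orbit phi y = {y, r y}"
proof -
  have p: "phi y = r y" "phi (r y) = y" by (simp_all add: phi_def s_fix ry)
  have two: "{1..2::nat} = {1, 2}" by auto
  have "(phi ^^ 2) (r y) = r y" "(phi ^^ 2) y = y" by (simp_all add: p numeral_2_eq_2)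
  from this[THEN orbit_funpow_image, unfolded two]
  show "orbit phi (r y) = {y, r y}" "orbit phi y = {y, r y}"
    by (auto simp: p numeral_2_eq_2)
qed

text \<open>On \<open>A2\<close> the old face permutation has the additional cycle
  \<open>{y, r y}\<close>, a detached edge; the transposition merges it into the face of
  \<open>b\<close>.\<close>

lemma big_eq: "big = face \<union> {y, r y}"
  and orbits_phi1: "orbits_on phi1 A2 = insert big others"
  and card_orbits_phi1: "card (orbits_on phi1 A2) = card (orbits_on phi A)"
proof -
  have p1: "phi1 = phi \<circ> swp b (r y)" by (simp add: phi1_def phi_def)
  have n: "r y \<notin> face" using face_sub yA by blast
  note m = swap_merge[OF finA2 phi_bij(2) A2_mem(3,2) n]
    swap_merge_orbits[OF finA2 phi_bij(2) A2_mem(3,2) n]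
  have o: "orbits_on phi A2 = insert {y, r y} (orbits_on phi A)"
    using orbit_phi_ry by (auto simp: orbits_on_def A2_def)
  have n2: "{y, r y} \<notin> orbits_on phi A"
    using orbits_on_eqD(2)[OF finA phi_bij(1)] yA by blast
  show b: "big = face \<union> {y, r y}" using m(1) orbit_phi_ry(1) by (simp add: phi1_def phi_def[symmetric])
  have "orbits_on phi1 A2 = insert big (orbits_on phi A2 - {face, {y, r y}})"
    using m(2) by (simp only: p1[symmetric] orbit_phi_ry b)
  also have "orbits_on phi A2 - {face, {y, r y}} = others"
    using n2 by (auto simp: o others_def)
  finally show "orbits_on phi1 A2 = insert big others" .
  show "card (orbits_on phi1 A2) = card (orbits_on phi A)"
    using m(3) n2 finite_orbits_on[OF finA, of phi] by (simp add: o phi1_def phi_def[symmetric])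
qed

lemma others: "finite others" "P \<in> others \<Longrightarrow> P \<subseteq> A" "P \<in> others \<Longrightarrow> P \<inter> face = {}"
  "P \<in> others \<Longrightarrow> P \<inter> big = {}" "P \<in> others \<Longrightarrow> P \<noteq> {}" "orbits_on phi A = insert face others"
  "face \<notin> others"
proof -
  show "finite others" using finite_orbits_on[OF finA] by (simp add: others_def)
  show 1: "P \<subseteq> A" if "P \<in> others"
    using that orbits_on_eqD(2)[OF finA phi_bij(1)] by (auto simp: others_def)
  show 2: "P \<inter> face = {}" if "P \<in> others"
    using that orbits_on_disjoint[OF finA phi_bij(1)] face_sub(3) by (auto simp: others_def)
  show "P \<inter> big = {}" if "P \<in> others" using 1[OF that] 2[OF that] yA big_eq by auto
  show "P \<noteq> {}" if "P \<in> others" using that orbits_on_nonempty by (auto simp: others_def)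
qed (use face_sub(3) in \<open>auto simp: others_def\<close>)

lemma c_in_big: "c \<in> K2 \<Longrightarrow> c \<in> big \<Longrightarrow> y \<in> orbit phi1 c" "y \<in> big"
  "c \<in> A2 \<Longrightarrow> y \<in> orbit phi1 c \<longleftrightarrow> c \<in> big"
proof -
  show 1: "y \<in> big" using big_eq by simp
  have "orbit phi1 y = big" by (rule orbit_eq[OF finA2 phi1_bij A2_mem(3) 1])
  then show 2: "y \<in> orbit phi1 c \<longleftrightarrow> c \<in> big" if "c \<in> A2" for c
    using orbit_mem_iff[OF finA2 phi1_bij] that A2_mem by (metis)
  show "c \<in> K2 \<Longrightarrow> c \<in> big \<Longrightarrow> y \<in> orbit phi1 c" using 2 K2(1) by blast
qed

lemma card_faces_link: "card (orbits_on (phi2 y) A2) = card (orbits_on phi A)"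
  "orbits_on (phi2 y) A2 = insert big others"
  using orbits_phi2[OF K2(2)] card_orbits_phi1 orbits_phi1 by simp_all

lemma card_faces_join:
  assumes "c \<in> K2" "c \<notin> big"
  shows "Suc (card (orbits_on (phi2 c) A2)) = card (orbits_on phi A)"
proof -
  have cA: "c \<in> A2" using assms K2(1) by auto
  then have "y \<notin> orbit phi1 c" using assms c_in_big by blast
  from swap_merge_orbits(2)[OF finA2 phi1_bij cA A2_mem(1) this] show ?thesis
    by (simp add: orbits_phi2[OF assms(1)] card_orbits_phi1)
qed

lemma faces_chord:
  assumes "c \<in> K2" "c \<in> big" "c \<noteq> y"
  shows "card (orbits_on (phi2 c) A2) = Suc (card (orbits_on phi A))"
    and "orbits_on (phi2 c) A2 =
      insert (orbit (phi1 \<circ> swp c y) c) (insert (orbit (phi1 \<circ> swp c y) y) others)"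
    and "y \<notin> orbit (phi1 \<circ> swp c y) c"
    and "orbit (phi1 \<circ> swp c y) c \<union> orbit (phi1 \<circ> swp c y) y = big"
proof -
  have cA: "c \<in> A2" using assms K2(1) by auto
  note sp = swap_split_orbits[OF finA2 phi1_bij cA A2_mem(1) assms(3) c_in_big(1)[OF assms(1,2)]]
  have "orbit phi1 c = big" by (rule orbit_eq[OF finA2 phi1_bij A2_mem(3) assms(2)])
  moreover have "big \<notin> others" using others(2) yA c_in_big(2) by blast
  ultimately show "card (orbits_on (phi2 c) A2) = Suc (card (orbits_on phi A))"
    "orbits_on (phi2 c) A2 =
      insert (orbit (phi1 \<circ> swp c y) c) (insert (orbit (phi1 \<circ> swp c y) y) others)"
    "y \<notin> orbit (phi1 \<circ> swp c y) c"
    "orbit (phi1 \<circ> swp c y) c \<union> orbit (phi1 \<circ> swp c y) y = big"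
    using sp card_orbits_phi1 by (simp_all add: orbits_phi2[OF assms(1)] orbits_phi1)
qed

text \<open>A new vertex or a chord inside the face of \<open>b\<close> keeps the number of vertices
  plus faces minus edges; a connection to another face lowers it by two. Hence the bound is
  inherited, and equality survives only for endpoints in \<open>big\<close>.\<close>

lemma planar_child:
  assumes c: "c \<in> K2"
    and euler: "card (orbits_on s A) + card (orbits_on (s \<circ> r) A) \<le> card A div 2 + 2"
  shows "card (orbits_on (add_edge r s b y c) A2) + card (orbits_on (add_edge r s b y c \<circ> r) A2)
      \<le> card A2 div 2 + 2"
    and "planar_on r (add_edge r s b y c) A2 \<longleftrightarrow> planar_on r s A \<and> c \<in> big"
proof -
  note v = card_vertices[OF c]
  have f: "c = y \<Longrightarrow> card (orbits_on (phi2 c) A2) = card (orbits_on phi A)"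
    "c \<noteq> y \<Longrightarrow> c \<in> big \<Longrightarrow> card (orbits_on (phi2 c) A2) = Suc (card (orbits_on phi A))"
    "c \<notin> big \<Longrightarrow> Suc (card (orbits_on (phi2 c) A2)) = card (orbits_on phi A)"
    using card_faces_link faces_chord(1) card_faces_join c by auto
  note d = phi2_def[symmetric] phi_def[symmetric]
  show "card (orbits_on (add_edge r s b y c) A2) + card (orbits_on (add_edge r s b y c \<circ> r) A2)
      \<le> card A2 div 2 + 2"
    using euler v f unfolding d cardA2 by (cases "c \<in> big"; cases "c = y") auto
  show "planar_on r (add_edge r s b y c) A2 \<longleftrightarrow> planar_on r s A \<and> c \<in> big"
    using euler v f c_in_big(2) unfolding planar_on_def d cardA2
    by (cases "c \<in> big"; cases "c = y") auto
qed

section \<open>Weights and regions after drawing an edge\<close>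

definition "U2 U = (if b \<in> U then insert y (insert (r y) U) else U)"
definition "rest h U = (\<Prod>P\<in>others. h (P \<subseteq> U) (card (K \<inter> P)))"

lemma K2_big: "card (K2 \<inter> big) = Suc (card (K \<inter> face))"
proof -
  have e: "K2 \<inter> big = insert y (insert (r y) ((K \<inter> face) - {b}))"
    using face_sub yA K by (auto simp: big_eq K2_def)
  have "finite (K \<inter> face)" using finA K by (meson finite_Int finite_subset)
  moreover have "b \<in> K \<inter> face" using b face_sub by simp
  moreover have "y \<notin> K" "r y \<notin> K" using K yA by auto
  ultimately show ?thesis unfolding e using ry card_Suc_Diff1[of "K \<inter> face" b] by simp
qed

context
  fixes U assumes U: "U \<subseteq> A" "\<And>a. a \<in> U \<Longrightarrow> phi a \<in> U"
begin

lemma orbit_dichotomy: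
  assumes "P \<in> orbits_on phi A" "x \<in> P"
  shows "x \<in> U \<longleftrightarrow> P \<subseteq> U"
proof
  assume "x \<in> U"
  then show "P \<subseteq> U"
    using orbit_closed_subset[of U phi x] U(2) orbits_on_eqD(1)[OF finA phi_bij(1) assms] by simp
qed (use assms in auto)

lemma face_U: "face \<subseteq> U \<longleftrightarrow> b \<in> U"
  using orbit_dichotomy[OF face_sub(3,2)] by simp

lemma big_U2: "x \<in> big \<Longrightarrow> x \<in> U2 U \<longleftrightarrow> b \<in> U"
  using face_U orbit_dichotomy[OF face_sub(3)] U(1) yA by (auto simp: big_eq U2_def)

lemma part_U2: "P \<noteq> {} \<Longrightarrow> P \<subseteq> big \<Longrightarrow> P \<subseteq> U2 U \<longleftrightarrow> b \<in> U"
  using big_U2 by blast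

lemma others_weight:
  assumes "P \<in> others"
  shows "h (P \<subseteq> U2 U) (card (K2 \<inter> P)) = h (P \<subseteq> U) (card (K \<inter> P))"
proof -
  have "b \<notin> P" using others(3)[OF assms] face_sub(2) by blast
  then have "K2 \<inter> P = K \<inter> P" using others(2)[OF assms] yA by (auto simp: K2_def)
  moreover have "P \<subseteq> U2 U \<longleftrightarrow> P \<subseteq> U" using others(2)[OF assms] yA by (auto simp: U2_def)
  ultimately show ?thesis by simp
qed

lemma prod_others: "(\<Prod>P\<in>others. h (P \<subseteq> U2 U) (card (K2 \<inter> P))) = rest h U"
  unfolding rest_def by (rule prod.cong[OF refl]) (rule others_weight)

lemma face_prod_link:
  "face_prod h r A2 (add_edge r s b y y) K2 (U2 U) = h (b \<in> U) (Suc (card (K \<inter> face))) * rest h U"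
proof -
  have "big \<notin> others" using others(2) yA c_in_big(2) by blast
  moreover have "big \<subseteq> U2 U \<longleftrightarrow> b \<in> U" using part_U2[of big] c_in_big(2) by auto
  ultimately show ?thesis
    using others(1) by (simp add: face_prod_def phi2_def[symmetric] card_faces_link prod_others K2_big)
qed

lemma face_prod_chord:
  assumes c: "c \<in> K2" "c \<in> big" "c \<noteq> y"
  shows "face_prod h r A2 (add_edge r s b y c) K2 (U2 U) =
    h (b \<in> U) (card (K2 \<inter> orbit (phi1 \<circ> swp c y) c)) *
    h (b \<in> U) (card (K2 \<inter> orbit (phi1 \<circ> swp c y) y)) * rest h U"
proof -
  define Pc where "Pc = orbit (phi1 \<circ> swp c y) c"
  define Py where "Py = orbit (phi1 \<circ> swp c y) y"
  note f = faces_chord[OF c, folded Pc_def Py_def]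
  have cA: "c \<in> A2" using c K2(1) by auto
  have bij: "bij_betw (phi1 \<circ> swp c y) A2 A2"
    by (rule orbits_on_swap_ends[OF finA2 phi1_bij cA A2_mem(1)])
  have in_P: "c \<in> Pc" "y \<in> Py"
    unfolding Pc_def Py_def using orbit_self[OF finA2 bij] cA A2_mem(1) by auto
  have "Pc \<notin> others" "Py \<notin> others" using others(4) f(4) in_P by blast+
  moreover have "Pc \<noteq> Py" using in_P f(3) by blast
  moreover have "Pc \<subseteq> U2 U \<longleftrightarrow> b \<in> U" "Py \<subseteq> U2 U \<longleftrightarrow> b \<in> U"
    using part_U2[of Pc] part_U2[of Py] f(4) in_P by auto
  ultimately show ?thesis
    using others(1)
    by (simp add: face_prod_def phi2_def[symmetric] f(2) prod_others Pc_def[symmetric] Py_def[symmetric]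
        mult.assoc)
qed

text \<open>With \<open>k = card (K \<inter> face)\<close> this is the bracket of the recursion for
  \<open>fill\<close>: an edge to a new vertex leaves one face with \<open>k + 1\<close> open
  corners, and a chord to the \<open>j\<close>-th endpoint splits these into \<open>j\<close> and
  \<open>k + 1 - j\<close>.\<close>

lemma sum_face_prod:
  "(\<Sum>c\<in>K2 \<inter> big. face_prod h r A2 (add_edge r s b y c) K2 (U2 U)) =
    (h (b \<in> U) (Suc (card (K \<inter> face))) +
      (\<Sum>j=1..card (K \<inter> face). h (b \<in> U) j * h (b \<in> U) (Suc (card (K \<inter> face)) - j))) * rest h U"
proof -
  define k where "k = card (K \<inter> face)"
  define H where "H = h (b \<in> U)"
  obtain n where n: "0 < n" "(phi1 ^^ n) y = y" "inj_on (\<lambda>i. (phi1 ^^ i) y) {1..n}"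
    "orbit phi1 y = (\<lambda>i. (phi1 ^^ i) y) ` {1..n}"
    by (rule orbit_enum[OF finA2 phi1_bij A2_mem(1)])
  define e where "e = (\<lambda>i. (phi1 ^^ i) y)"
  have inj: "inj_on e {1..n}" and en: "e n = y" using n by (simp_all add: e_def)
  have big: "big = e ` {1..n}"
    using orbit_eq[OF finA2 phi1_bij A2_mem(3) c_in_big(2)] n(4) by (simp add: e_def)
  \<comment> \<open>Positions of the possible endpoints along the boundary walk from
    \<open>y\<close>. The last position is \<open>y\<close> itself, which stands for the new vertex
    and is treated separately.\<close>
  define I where "I = {i \<in> {1..<n}. e i \<in> K2}"
  have finI: "finite I" by (simp add: I_def)
  have inj_less: "e i = e j \<longleftrightarrow> i = j" if "i \<in> {1..n}" "j \<in> {1..n}" for i j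
    using inj_on_eq_iff[OF inj that] .
  have eI: "e ` I = K2 \<inter> big - {y}"
  proof
    have "e i \<noteq> y" if "i \<in> I" for i
      using inj_less[of i n] that n(1) by (auto simp: I_def en[symmetric])
    then show "e ` I \<subseteq> K2 \<inter> big - {y}"
      by (auto simp: I_def big)
    show "K2 \<inter> big - {y} \<subseteq> e ` I"
    proof
      fix x assume x: "x \<in> K2 \<inter> big - {y}"
      then obtain i where i: "i \<in> {1..n}" "x = e i" by (auto simp: big)
      then have "i \<noteq> n" using x en by auto
      then show "x \<in> e ` I" using i x by (auto simp: I_def)
    qed
  qed
  have injI: "inj_on e I" by (rule inj_on_subset[OF inj]) (auto simp: I_def)
  have finK: "finite (K2 \<inter> big)" using finA2 K2(1) by (meson finite_Int finite_subset)
  have yK: "y \<in> K2 \<inter> big" using K2(2) c_in_big(2) by simp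
  have cI: "card I = k"
    using card_image[OF injI] yK finK K2_big by (simp add: eI k_def)
  have trm: "face_prod h r A2 (add_edge r s b y (e i)) K2 (U2 U) =
      H (card {j \<in> I. j \<le> i}) * H (Suc k - card {j \<in> I. j \<le> i}) * rest h U" if i: "i \<in> I" for i
  proof -
    have c: "e i \<in> K2" "e i \<in> big" "e i \<noteq> y" using eI i by auto
    define Pc where "Pc = orbit (phi1 \<circ> swp (e i) y) (e i)"
    define Py where "Py = orbit (phi1 \<circ> swp (e i) y) y"
    have i': "1 \<le> i" "i < n" using i by (auto simp: I_def)
    note sp = swap_split[OF n(1-3) i', folded e_def]
    have Pc: "Pc = e ` {1..i}" and Py: "Py = e ` {i<..n}"
      using sp by (simp_all add: Pc_def Py_def e_def)
    have "K2 \<inter> Pc = e ` {j \<in> I. j \<le> i}"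
      using i' by (auto simp: Pc I_def)
    moreover have "inj_on e {j \<in> I. j \<le> i}" by (rule inj_on_subset[OF injI]) auto
    ultimately have 1: "card (K2 \<inter> Pc) = card {j \<in> I. j \<le> i}" by (simp add: card_image)
    have "Pc \<inter> Py = {}"
    proof -
      have "e j \<noteq> e j'" if "j \<in> {1..i}" "j' \<in> {i<..n}" for j j'
        using inj_less[of j j'] that i' by auto
      then show ?thesis by (auto simp: Pc Py)
    qed
    moreover have "Pc \<union> Py = big" using faces_chord(4)[OF c] by (simp add: Pc_def Py_def)
    ultimately have "K2 \<inter> big = (K2 \<inter> Pc) \<union> (K2 \<inter> Py)" "(K2 \<inter> Pc) \<inter> (K2 \<inter> Py) = {}"
      by auto
    then have "card (K2 \<inter> big) = card (K2 \<inter> Pc) + card (K2 \<inter> Py)"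
      using finK card_Un_disjoint[of "K2 \<inter> Pc" "K2 \<inter> Py"] by (metis finite_Un)
    then have "card (K2 \<inter> Py) = Suc k - card {j \<in> I. j \<le> i}"
      using 1 K2_big by (simp add: k_def)
    then show ?thesis
      using face_prod_chord[OF c, of h] 1 by (simp add: H_def Pc_def Py_def)
  qed
  have "(\<Sum>c\<in>K2 \<inter> big. face_prod h r A2 (add_edge r s b y c) K2 (U2 U)) =
      H (Suc k) * rest h U + (\<Sum>c\<in>K2 \<inter> big - {y}. face_prod h r A2 (add_edge r s b y c) K2 (U2 U))"
    using sum.remove[OF finK yK, of "\<lambda>c. face_prod h r A2 (add_edge r s b y c) K2 (U2 U)"]
    by (simp add: face_prod_link H_def k_def)
  also have "(\<Sum>c\<in>K2 \<inter> big - {y}. face_prod h r A2 (add_edge r s b y c) K2 (U2 U)) =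
      (\<Sum>i\<in>I. H (card {j \<in> I. j \<le> i}) * H (Suc k - card {j \<in> I. j \<le> i}) * rest h U)"
    unfolding eI[symmetric] by (subst sum.reindex[OF injI]) (simp add: trm)
  also have "\<dots> = (\<Sum>j=1..k. H j * H (Suc k - j) * rest h U)"
    using rank_sum[OF finI, of "\<lambda>j. H j * H (Suc k - j) * rest h U"] by (simp add: cI)
  finally show ?thesis by (simp add: H_def k_def distrib_right sum_distrib_right)
qed

lemma U2_sub: "U2 U \<subseteq> A2"
  using U(1) A2_mem by (auto simp: U2_def)

lemma U2_closed:
  assumes c: "c \<in> K2" "c \<in> big" and a: "a \<in> U2 U"
  shows "phi2 c a \<in> U2 U"
proof -
  define P where "P = orbit (phi2 c) a"
  have aA: "a \<in> A2" using a U2_sub by blast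
  have aP: "a \<in> P" unfolding P_def by (rule orbit_self[OF finA2 phi2_bij[OF c(1)] aA])
  have "P \<in> orbits_on (phi2 c) A2" using aA by (auto simp: P_def orbits_on_def)
  then have "P \<in> others \<or> P \<subseteq> big"
    using card_faces_link(2) faces_chord(2,4)[OF c] by (cases "c = y") auto
  then have "P \<subseteq> U2 U"
  proof
    assume P: "P \<in> others"
    then have "a \<in> A" "a \<in> U" using others(2) aP a yA by (auto simp: U2_def split: if_splits)
    then show ?thesis
      using P orbit_dichotomy[of P a] aP by (auto simp: U2_def others_def)
  next
    assume P: "P \<subseteq> big"
    then show ?thesis using part_U2[of P] big_U2 aP a by auto
  qed
  then show ?thesis using orbit.base[of "phi2 c" a] by (auto simp: P_def)
qed

text \<open>The two regions differ only in whether the new edge may be crossed. By \<open>J\<close>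
  one of its arcs lies in the region only if both belong to \<open>U2 U\<close>, so crossing it
  leads nowhere new.\<close>

lemma region_child:
  assumes c: "c \<in> K2" and g: "g \<in> fillings r A2 (add_edge r s b y c) K2 X2"
    and J: "region r g A2 (U2 U) \<inter> A2 = U2 U"
  shows "region r g A2 (U2 U) = region r g A U"
proof
  have gb: "g (r b) = y"
    using fillings_edge c g by blast
  show "region r g A2 (U2 U) \<subseteq> region r g A U"
  proof
    fix x assume "x \<in> region r g A2 (U2 U)"
    then show "x \<in> region r g A U"
    proof induction
      case (base u)
      show ?case
      proof (cases "u \<in> U")
        case True then show ?thesis by (rule region.base)
      next
        case False
        then have bU: "b \<in> U" and u: "u = y \<or> u = r y" using base by (auto simp: U2_def split: if_splits)
        from bU have "g (r b) \<in> region r g A U" by (intro region.turn region.base)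
        then have y: "y \<in> region r g A U" by (simp add: gb)
        moreover from y have "r y \<in> region r g A U" using yA(1) by (rule region.cross)
        ultimately show ?thesis using u by auto
      qed
    next
      case (turn x) then show ?case by (intro region.turn)
    next
      case (cross x) then show ?case by (intro region.cross) (auto simp: A2_def)
    qed
  qed
  show "region r g A U \<subseteq> region r g A2 (U2 U)"
  proof
    fix x assume "x \<in> region r g A U"
    then show "x \<in> region r g A2 (U2 U)"
    proof induction
      case (base u) then show ?case by (intro region.base) (auto simp: U2_def)
    next
      case (turn x) then show ?case by (intro region.turn)
    next
      case (cross x)
      show ?case
      proof (cases "x \<in> A2")
        case False then show ?thesis using cross by (intro region.cross)
      next
        case True
        then have "x = y \<or> x = r y" using cross(2) by (auto simp: A2_def)
        moreover have "x \<in> U2 U" using J True cross by blast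
        moreover have "y \<notin> U" "r y \<notin> U" using U(1) yA by auto
        ultimately have "r x \<in> U2 U" using ry by (auto simp: U2_def split: if_splits)
        then show ?thesis by (rule region.base)
      qed
    qed
  qed
qed

lemma region_card_child:
  assumes c: "c \<in> K2" and g: "g \<in> fillings r A2 (add_edge r s b y c) K2 X2"
    and J: "region r g A2 (U2 U) \<inter> A2 = U2 U"
  shows "card (region r g A U \<inter> X) = card (region r g A2 (U2 U) \<inter> X2) + (if b \<in> U then 2 else 0)"
    and "region r g A U \<inter> A = U"
proof -
  note e = region_child[OF c g J]
  have "A \<subseteq> A2" by (auto simp: A2_def)
  then have "region r g A U \<inter> A = U2 U \<inter> A" using J e by blast
  also have "\<dots> = U" using U(1) yA by (auto simp: U2_def)
  finally show "region r g A U \<inter> A = U" .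
  have X: "X2 \<union> {y, r y} = X" using y ryX by (auto simp: X2_def)
  have RX: "R \<inter> X = (R \<inter> X2) \<union> (R \<inter> {y, r y})" for R
    using Int_Un_distrib[of R X2 "{y, r y}"] by (simp only: X)
  have "region r g A U \<inter> {y, r y} = U2 U \<inter> {y, r y}"
    using J e A2_mem by blast
  also have "\<dots> = (if b \<in> U then {y, r y} else {})"
    using U(1) yA by (auto simp: U2_def)
  finally have "region r g A U \<inter> X = (region r g A2 (U2 U) \<inter> X2) \<union> (if b \<in> U then {y, r y} else {})"
    unfolding RX e by simp
  moreover have "card ((region r g A2 (U2 U) \<inter> X2) \<union> (if b \<in> U then {y, r y} else {})) =
      card (region r g A2 (U2 U) \<inter> X2) + card (if b \<in> U then {y, r y} else {})"
    using finX by (intro card_Un_disjoint) (auto simp: X2_def)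
  ultimately show "card (region r g A U \<inter> X) =
      card (region r g A2 (U2 U) \<inter> X2) + (if b \<in> U then 2 else 0)"
    using ry(1) by auto
qed

text \<open>The recursion step for a fixed arc \<open>y\<close>: endpoints outside
  \<open>big\<close> give no filling, and an edge drawn in a face within \<open>U\<close>
  contributes the factor \<open>t\<close>.\<close>

lemma sum_edge:
  fixes t N :: real and H :: "bool \<Rightarrow> nat \<Rightarrow> real fps"
  assumes none: "\<And>c. c \<in> K2 \<Longrightarrow> c \<notin> big \<Longrightarrow> fillings r A2 (add_edge r s b y c) K2 X2 = {}"
    and J: "\<And>c g. c \<in> K2 \<Longrightarrow> c \<in> big \<Longrightarrow> g \<in> fillings r A2 (add_edge r s b y c) K2 X2 \<Longrightarrow>
      region r g A2 (U2 U) \<inter> A2 = U2 U"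
    and sums: "\<And>c. c \<in> K2 \<Longrightarrow> c \<in> big \<Longrightarrow>
      (\<Sum>g\<in>fillings r A2 (add_edge r s b y c) K2 X2. t ^ (card (region r g A2 (U2 U) \<inter> X2) div 2)) =
      N * fps_nth (face_prod H r A2 (add_edge r s b y c) K2 (U2 U)) m"
  shows "(\<Sum>g\<in>{g \<in> fillings r A s K X. g (r b) = y}. t ^ (card (region r g A U \<inter> X) div 2)) =
    (if b \<in> U then t else 1) * N * fps_nth ((H (b \<in> U) (Suc (card (K \<inter> face))) +
      (\<Sum>j=1..card (K \<inter> face). H (b \<in> U) j * H (b \<in> U) (Suc (card (K \<inter> face)) - j))) * rest H U) m"
    (is "_ = ?tau * N * fps_nth ?F m")
proof -
  let ?ch = "\<lambda>c. fillings r A2 (add_edge r s b y c) K2 X2"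
  have fin: "finite K2" using K2(1) finA2 finite_subset by blast
  have finch: "finite (?ch c)" for c
    by (rule finite_fillings[OF finA2]) (simp add: X2_def finX)
  have "(\<Sum>g\<in>{g \<in> fillings r A s K X. g (r b) = y}. t ^ (card (region r g A U \<inter> X) div 2)) =
      (\<Sum>c\<in>K2. \<Sum>g\<in>?ch c. t ^ (card (region r g A U \<inter> X) div 2))"
    unfolding fillings_edge
    by (rule sum.UNION_disjoint[OF fin]) (use finch fillings_edge_disjoint in auto)
  also have "\<dots> = (\<Sum>c\<in>K2 \<inter> big. \<Sum>g\<in>?ch c. t ^ (card (region r g A U \<inter> X) div 2))"
    by (rule sum.mono_neutral_right[OF fin]) (use none in auto)
  also have "\<dots> = (\<Sum>c\<in>K2 \<inter> big. ?tau * (\<Sum>g\<in>?ch c. t ^ (card (region r g A2 (U2 U) \<inter> X2) div 2)))"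
  proof (rule sum.cong[OF refl])
    fix c assume c: "c \<in> K2 \<inter> big"
    show "(\<Sum>g\<in>?ch c. t ^ (card (region r g A U \<inter> X) div 2)) =
        ?tau * (\<Sum>g\<in>?ch c. t ^ (card (region r g A2 (U2 U) \<inter> X2) div 2))"
      unfolding sum_distrib_left
    proof (rule sum.cong[OF refl])
      fix g assume g: "g \<in> ?ch c"
      show "t ^ (card (region r g A U \<inter> X) div 2) =
          ?tau * t ^ (card (region r g A2 (U2 U) \<inter> X2) div 2)"
        using region_card_child(1)[OF _ g J[OF _ _ g]] c by simp
    qed
  qed
  also have "\<dots> = (\<Sum>c\<in>K2 \<inter> big. ?tau * N * fps_nth (face_prod H r A2 (add_edge r s b y c) K2 (U2 U)) m)"
    by (rule sum.cong[OF refl]) (simp add: sums)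
  also have "\<dots> = ?tau * N * fps_nth (\<Sum>c\<in>K2 \<inter> big. face_prod H r A2 (add_edge r s b y c) K2 (U2 U)) m"
    by (simp add: sum_distrib_left fps_sum_nth)
  finally show ?thesis by (simp only: sum_face_prod)
qed

end

end

section \<open>Counting fillings\<close>

text \<open>
  The number of ways of drawing \<open>n\<close> edges into a face with \<open>k\<close> open corners: the first corner is
  closed, or it receives an edge to a new vertex, or an edge within the face, which splits it.
\<close>

function fill :: "nat \<Rightarrow> nat \<Rightarrow> nat" where
  "fill 0 n = (if n = 0 then 1 else 0)"
| "fill (Suc k) 0 = 1"
| "fill (Suc k) (Suc n) = fill k (Suc n) + fill (Suc (Suc k)) n +
     (\<Sum>i\<le>k. \<Sum>j\<le>n. fill (Suc i) j * fill (Suc k - i) (n - j))"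
  by pat_completeness auto
termination
  by (relation "measures [\<lambda>(k, n). n, \<lambda>(k, n). k]") auto

text \<open>The weight \<open>t\<close> of an edge is a real number and not a second formal
  variable, so that an identity valid for all \<open>t\<close> can later be differentiated
  analytically.\<close>

definition fill_fps :: "real \<Rightarrow> nat \<Rightarrow> real fps" where
  "fill_fps t k = Abs_fps (\<lambda>n. real (fill k n) * t ^ n)"

lemma fill_fps_nth: "fps_nth (fill_fps t k) n = real (fill k n) * t ^ n"
  by (simp add: fill_fps_def)

lemma fill_fps_0: "fill_fps t 0 = 1"
  by (rule fps_ext) (simp add: fill_fps_nth)

lemma fill_fps_step:
  assumes "k > 0"
  shows "fill_fps t k = fill_fps t (k - 1) + fps_const t * fps_X *
    (fill_fps t (Suc k) + (\<Sum>j=1..k. fill_fps t j * fill_fps t (Suc k - j)))"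
proof (rule fps_ext)
  fix n
  obtain k' where k: "k = Suc k'" using assms by (cases k) auto
  have "(\<Sum>j=1..k. fill_fps t j * fill_fps t (Suc k - j)) =
      (\<Sum>i\<le>k'. fill_fps t (Suc i) * fill_fps t (Suc k' - i))"
    unfolding k by (rule sum.reindex_bij_witness[of _ Suc "\<lambda>j. j - 1"]) auto
  then have *: "fill_fps t (Suc k) + (\<Sum>j=1..k. fill_fps t j * fill_fps t (Suc k - j)) =
    fill_fps t (Suc (Suc k')) + (\<Sum>i\<le>k'. fill_fps t (Suc i) * fill_fps t (Suc k' - i))"
    by (simp add: k)
  show "fps_nth (fill_fps t k) n = fps_nth (fill_fps t (k - 1) + fps_const t * fps_X *
    (fill_fps t (Suc k) + (\<Sum>j=1..k. fill_fps t j * fill_fps t (Suc k - j)))) n"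
  proof (cases n)
    case 0
    then show ?thesis by (cases k') (simp_all add: k fill_fps_nth)
  next
    case (Suc m)
    have conv: "fps_nth (fill_fps t (Suc i) * fill_fps t (Suc k' - i)) m =
        t ^ m * (\<Sum>j\<le>m. real (fill (Suc i) j) * real (fill (Suc k' - i) (m - j)))" for i
    proof -
      have "fps_nth (fill_fps t (Suc i) * fill_fps t (Suc k' - i)) m =
          (\<Sum>j\<le>m. (real (fill (Suc i) j) * t ^ j) * (real (fill (Suc k' - i) (m - j)) * t ^ (m - j)))"
        by (simp add: fps_mult_nth fill_fps_nth atLeast0AtMost)
      also have "\<dots> = (\<Sum>j\<le>m. t ^ m * (real (fill (Suc i) j) * real (fill (Suc k' - i) (m - j))))"
      proof (rule sum.cong[OF refl])
        fix j assume "j \<in> {..m}"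
        then have "t ^ m = t ^ j * t ^ (m - j)" by (simp add: power_add[symmetric])
        then show "real (fill (Suc i) j) * t ^ j * (real (fill (Suc k' - i) (m - j)) * t ^ (m - j)) =
            t ^ m * (real (fill (Suc i) j) * real (fill (Suc k' - i) (m - j)))" by simp
      qed
      finally show ?thesis by (simp add: sum_distrib_left)
    qed
    have "fps_nth (fps_const t * fps_X * G) (Suc m) = t * fps_nth G m" for G :: "real fps"
      by (simp add: mult.assoc)
    then show ?thesis
      unfolding * Suc
      by (simp add: k fps_sum_nth conv fill_fps_nth sum_distrib_left[symmetric] algebra_simps)
  qed
qed

text \<open>Without open corners a filling agrees with \<open>s\<close> on \<open>A\<close>, so
  \<open>A\<close> is closed under both permutations and connectedness leaves no room for further
  arcs.\<close>

lemma fillings_no_corners: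
  assumes A: "arc_inv r A" "A \<noteq> {}" and s: "s permutes A" "transitive_on r s A"
    and X: "arc_inv r X" "A \<inter> X = {}"
  shows "fillings r A s {} X = (if X = {} \<and> planar_on r s A then {s} else {})"
proof -
  have fr: "first_return s A a = s a" if "a \<in> A" for a
    by (rule ret_first_return[OF ret.now]) (use s that in \<open>simp add: permutes_in_image\<close>)
  have "X = {} \<and> planar_on r s A \<and> g = s" if g: "g \<in> fillings r A s {} X" for g
  proof -
    have gs: "g a = s a" if "a \<in> A" for a
    proof -
      have "r a \<in> A" "r (r a) = a" using arc_invD[OF A(1) that] by auto
      moreover have "g (r (r a)) = s (r (r a))" using g \<open>r a \<in> A\<close> by (simp add: fillings_def)
      ultimately show ?thesis by simp
    qed
    have "\<forall>a\<in>A. r a \<in> A \<and> g a \<in> A"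
      using gs arc_invD(1)[OF A(1)] s(1) by (simp add: permutes_in_image)
    moreover have "transitive_on r g (A \<union> X)" using g by (simp add: fillings_def)
    ultimately have "A = A \<union> X" using A(2) unfolding transitive_on_def by blast
    then have X0: "X = {}" using X by blast
    have "g x = s x" for x
      using gs[of x] g s(1) X0 by (cases "x \<in> A") (auto simp: fillings_def permutes_not_in)
    then have "g = s" by blast
    then show ?thesis using g X0 by (auto simp: fillings_def)
  qed
  moreover have "s \<in> fillings r A s {} {}" if "planar_on r s A"
    using that s fr by (simp add: fillings_def)
  ultimately show ?thesis by auto
qed

text \<open>Induction on the number of arcs to be drawn plus the number of open corners: closing a
  corner lowers the second, drawing an edge lowers the first by two and raises the second by one.
  The region claim belongs to the induction because adding up the weights needs it for the smaller
  fillings, and the non-planar case because it discards edges between different faces. The factor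
  \<open>2 ^ n * fact n\<close> counts the labellings of \<open>n\<close> oriented edges.\<close>

theorem fillings_count:
  fixes t :: real
  assumes "arc_inv r A" "A \<noteq> {}" "s permutes A" "transitive_on r s A" "K \<subseteq> A"
    "arc_inv r X" "A \<inter> X = {}" "card X = 2 * n"
    "card (orbits_on s A) + card (orbits_on (s \<circ> r) A) \<le> card A div 2 + 2"
  shows "(\<not> planar_on r s A \<longrightarrow> fillings r A s K X = {}) \<and>
    (planar_on r s A \<longrightarrow> (\<forall>U. U \<subseteq> A \<and> (\<forall>a\<in>U. s (r a) \<in> U) \<longrightarrow>
      (\<forall>g\<in>fillings r A s K X. region r g A U \<inter> A = U) \<and>
      (\<Sum>g\<in>fillings r A s K X. t ^ (card (region r g A U \<inter> X) div 2)) =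
        2 ^ n * fact n * fps_nth (face_prod (\<lambda>u. fill_fps (if u then t else 1)) r A s K U) n))"
  using assms
proof (induction "card X + card K" arbitrary: A s K X n rule: less_induct)
  case less
  note A = less.prems(1,2) and s = less.prems(3,4) and K = less.prems(5) and X = less.prems(6,7,8)
  note euler = less.prems(9)
  let ?H = "\<lambda>u. fill_fps (if u then t else 1)"
  have finA: "finite A" and finX: "finite X" using A X by (auto simp: arc_inv_def)
  have finK: "finite K" using K finA finite_subset by blast
  show ?case
  proof (cases "K = {}")
    case True
    note f = fillings_no_corners[OF A s X(1,2)]
    have reg: "region r s A U = U" if U: "U \<subseteq> A" "\<forall>a\<in>U. s (r a) \<in> U" for U
    proof
      show "region r s A U \<subseteq> U"
      proof
        fix x assume "x \<in> region r s A U"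
        then show "x \<in> U" by induction (use U in auto)
      qed
    qed (auto intro: region.base)
    have fp: "face_prod ?H r A s {} U = 1" for U
      by (simp add: face_prod_def fill_fps_0)
    have Xn: "X = {} \<longleftrightarrow> n = 0" using X(3) finX by auto
    show ?thesis
    proof (intro conjI impI allI; (elim conjE)?)
      assume "\<not> planar_on r s A"
      then show "fillings r A s K X = {}" by (simp add: True f)
    next
      fix U assume p: "planar_on r s A" and U: "U \<subseteq> A" "\<forall>a\<in>U. s (r a) \<in> U"
      show "\<forall>g\<in>fillings r A s K X. region r g A U \<inter> A = U"
      proof
        fix g assume "g \<in> fillings r A s K X"
        then have "g = s" by (simp add: True f split: if_splits)
        then show "region r g A U \<inter> A = U" using reg[OF U] U(1) by blast
      qed
      show "(\<Sum>g\<in>fillings r A s K X. t ^ (card (region r g A U \<inter> X) div 2)) =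
        2 ^ n * fact n * fps_nth (face_prod ?H r A s K U) n"
        unfolding True f fp using Xn p by (cases "n = 0") simp_all
    qed
  next
    case False
    then obtain b where b: "b \<in> K" by blast
    then have bA: "b \<in> A" using K by blast
    have rbA: "r b \<in> A" using arc_invD(1)[OF A(1) bA] .
    have slot: "edge_slot r A s K X b y" if "y \<in> X" for y
      using A(1) X(1,2) s(1) K b that by unfold_locales
    define Fy where "Fy y = {g \<in> fillings r A s K X. g (r b) = y}" for y
    define F0 where "F0 = fillings r A s (K - {b}) X"
    have F0: "F0 = {g \<in> fillings r A s K X. g (r b) \<in> A}"
      using fillings_closed_corner[OF A(1) s(1) b K, of X] by (simp add: F0_def)
    have split: "fillings r A s K X = F0 \<union> (\<Union>y\<in>X. Fy y)"
    proof -
      have "g (r b) \<in> A \<union> X" if "g \<in> fillings r A s K X" for g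
        using permutes_in_image[OF fillings_permutes[OF that], of "r b"] rbA by blast
      then show ?thesis by (auto simp: F0 Fy_def)
    qed
    have "card (K - {b}) < card K" using finK b by (metis card_Diff1_less)
    then have IH0: "(\<not> planar_on r s A \<longrightarrow> F0 = {}) \<and>
      (planar_on r s A \<longrightarrow> (\<forall>U. U \<subseteq> A \<and> (\<forall>a\<in>U. s (r a) \<in> U) \<longrightarrow>
      (\<forall>g\<in>F0. region r g A U \<inter> A = U) \<and>
      (\<Sum>g\<in>F0. t ^ (card (region r g A U \<inter> X) div 2)) =
        2 ^ n * fact n * fps_nth (face_prod ?H r A s (K - {b}) U) n))"
      unfolding F0_def using K by (intro less.hyps[OF _ A s _ X euler]) auto
    \<comment> \<open>The constants of the locale depend on \<open>y\<close>; named as functions of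
      \<open>y\<close> they permit one induction hypothesis for all arcs.\<close>
    define AA where "AA y = edge_slot.A2 r A y" for y
    define KK where "KK y = edge_slot.K2 r K b y" for y
    define XX where "XX y = edge_slot.X2 r X y" for y
    define UU where "UU U y = edge_slot.U2 r b y U" for U y
    define BB where "BB y = orbit (edge_slot.phi1 r s b y) b" for y
    define ch where "ch y c = fillings r (AA y) (add_edge r s b y c) (KK y) (XX y)" for y c
    have n_pos: "n > 0" if "y \<in> X" for y
      using that X(3) finX by (cases n) auto
    have IH: "(\<not> planar_on r (add_edge r s b y c) (AA y) \<longrightarrow> ch y c = {}) \<and>
      (planar_on r (add_edge r s b y c) (AA y) \<longrightarrow>
      (\<forall>U. U \<subseteq> AA y \<and> (\<forall>a\<in>U. add_edge r s b y c (r a) \<in> U) \<longrightarrow>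
      (\<forall>g\<in>ch y c. region r g (AA y) U \<inter> AA y = U) \<and>
      (\<Sum>g\<in>ch y c. t ^ (card (region r g (AA y) U \<inter> XX y) div 2)) =
        2 ^ (n - 1) * fact (n - 1) * fps_nth (face_prod ?H r (AA y) (add_edge r s b y c) (KK y) U) (n - 1)))"
      if y: "y \<in> X" and c: "c \<in> KK y" for y c
    proof -
      interpret edge_slot r A s K X b y by (rule slot[OF y])
      have c': "c \<in> K2" using c by (simp add: KK_def)
      have "card X2 + card K2 < card X + card K" using cardX2 cardK2 by simp
      moreover have "card X2 = 2 * (n - 1)" using cardX2 less.prems(8) by simp
      moreover have "A2 \<noteq> {}" using A2_mem by blast
      ultimately show ?thesis
        unfolding ch_def AA_def KK_def XX_def
        using A2 s2[OF c'] transitive_s2[OF c' less.prems(4)] K2(1) X2 A2X2(1)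
          planar_child(1)[OF c' euler]
        by (intro less.hyps) auto
    qed
    have planar_ch: "planar_on r (add_edge r s b y c) (AA y) \<longleftrightarrow> planar_on r s A \<and> c \<in> BB y"
      if y: "y \<in> X" and c: "c \<in> KK y" for y c
      using edge_slot.planar_child(2)[OF slot[OF y], of c] c euler by (simp add: KK_def AA_def BB_def)
    have Fy_ch: "Fy y = (\<Union>c\<in>KK y. ch y c)" if y: "y \<in> X" for y
      using edge_slot.fillings_edge[OF slot[OF y]] by (simp add: Fy_def ch_def KK_def AA_def XX_def)
    show ?thesis
    proof (intro conjI impI allI; (elim conjE)?)
      assume np: "\<not> planar_on r s A"
      then have "Fy y = {}" if "y \<in> X" for y
        using Fy_ch[OF that] IH[OF that] planar_ch[OF that] by auto
      then show "fillings r A s K X = {}" using split IH0 np by simp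
    next
      fix U assume p: "planar_on r s A" and U: "U \<subseteq> A" "\<forall>a\<in>U. s (r a) \<in> U"
      have UU: "UU U y \<subseteq> AA y" "c \<in> BB y \<Longrightarrow> \<forall>a\<in>UU U y. add_edge r s b y c (r a) \<in> UU U y"
        if y: "y \<in> X" and c: "c \<in> KK y" for y c
      proof -
        interpret edge_slot r A s K X b y by (rule slot[OF y])
        have U': "U \<subseteq> A" "\<And>a. a \<in> U \<Longrightarrow> phi a \<in> U" using U by (auto simp: phi_def)
        show "UU U y \<subseteq> AA y" using U2_sub[OF U'] by (simp add: UU_def AA_def)
        show "c \<in> BB y \<Longrightarrow> \<forall>a\<in>UU U y. add_edge r s b y c (r a) \<in> UU U y"
          using U2_closed[OF U', of c] c by (simp add: UU_def KK_def BB_def phi2_def)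
      qed
      have J: "region r g (AA y) (UU U y) \<inter> AA y = UU U y"
        if "y \<in> X" "c \<in> KK y" "c \<in> BB y" "g \<in> ch y c" for y c g
        using IH[OF that(1,2)] planar_ch[OF that(1,2)] UU[OF that(1,2)] p that by blast
      show "\<forall>g\<in>fillings r A s K X. region r g A U \<inter> A = U"
      proof
        fix g assume "g \<in> fillings r A s K X"
        then consider "g \<in> F0" | y c where "y \<in> X" "c \<in> KK y" "g \<in> ch y c"
          using split Fy_ch by blast
        then show "region r g A U \<inter> A = U"
        proof cases
          case 1 then show ?thesis using IH0 p U by blast
        next
          case 2
          then have cb: "c \<in> BB y" using IH[OF 2(1,2)] planar_ch[OF 2(1,2)] by blast
          interpret edge_slot r A s K X b y by (rule slot[OF 2(1)])
          have U': "U \<subseteq> A" "\<And>a. a \<in> U \<Longrightarrow> phi a \<in> U" using U by (auto simp: phi_def)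
          show ?thesis
            using region_card_child(2)[OF U', of c g] J[OF 2(1,2) cb 2(3)] 2
            by (simp add: UU_def AA_def KK_def ch_def XX_def)
        qed
      qed
      define k where "k = card (K \<inter> orbit (s \<circ> r) b)"
      define h where "h = ?H (b \<in> U)"
      define R where "R = (\<Prod>P\<in>orbits_on (s \<circ> r) A - {orbit (s \<circ> r) b}. ?H (P \<subseteq> U) (card (K \<inter> P)))"
      define G where "G = h (Suc k) + (\<Sum>j=1..k. h j * h (Suc k - j))"
      define tau where "tau = (if b \<in> U then t else 1)"
      have sy: "(\<Sum>g\<in>Fy y. t ^ (card (region r g A U \<inter> X) div 2)) =
          tau * (2 ^ (n - 1) * fact (n - 1)) * fps_nth (G * R) (n - 1)"
        if y: "y \<in> X" for y
      proof -
        interpret edge_slot r A s K X b y by (rule slot[OF y])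
        have U': "U \<subseteq> A" "\<And>a. a \<in> U \<Longrightarrow> phi a \<in> U" using U by (auto simp: phi_def)
        have R: "rest ?H U = R" by (simp add: rest_def R_def others_def phi_def)
        have k: "k = card (K \<inter> orbit phi b)" by (simp add: k_def phi_def)
        show "(\<Sum>g\<in>Fy y. t ^ (card (region r g A U \<inter> X) div 2)) =
          tau * (2 ^ (n - 1) * fact (n - 1)) * fps_nth (G * R) (n - 1)"
          unfolding Fy_def tau_def G_def h_def k R[symmetric]
        proof (rule sum_edge[OF U'])
          fix c assume c: "c \<in> edge_slot.K2 r K b y"
          have cy: "c \<in> edge_slot.K2 r K b y" using c .
          show "fillings r A2 (add_edge r s b y c) K2 X2 = {}" if "c \<notin> orbit phi1 b"
            using IH[OF y, of c] planar_ch[OF y, of c] that cy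
            unfolding KK_def ch_def AA_def XX_def BB_def by blast
          show "region r g A2 (U2 U) \<inter> A2 = U2 U"
            if "c \<in> orbit phi1 b" "g \<in> fillings r A2 (add_edge r s b y c) K2 X2" for g
            using J[OF y, of c g] that cy
            unfolding KK_def ch_def AA_def XX_def BB_def UU_def by blast
          show "(\<Sum>g\<in>fillings r A2 (add_edge r s b y c) K2 X2.
              t ^ (card (region r g A2 (U2 U) \<inter> X2) div 2)) =
            2 ^ (n - 1) * fact (n - 1) *
              fps_nth (face_prod ?H r A2 (add_edge r s b y c) K2 (U2 U)) (n - 1)"
            if "c \<in> orbit phi1 b"
            using IH[OF y, of c] planar_ch[OF y, of c] p UU[OF y, of c] that cy
            unfolding KK_def ch_def AA_def XX_def BB_def UU_def by blast
        qed
      qed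
      show "(\<Sum>g\<in>fillings r A s K X. t ^ (card (region r g A U \<inter> X) div 2)) =
        2 ^ n * fact n * fps_nth (face_prod ?H r A s K U) n"
      proof -
        have fin: "finite (fillings r A s K X)" by (rule finite_fillings[OF finA finX])
        have "(\<Sum>g\<in>fillings r A s K X. t ^ (card (region r g A U \<inter> X) div 2)) =
          (\<Sum>g\<in>F0. t ^ (card (region r g A U \<inter> X) div 2)) +
          (\<Sum>g\<in>(\<Union>y\<in>X. Fy y). t ^ (card (region r g A U \<inter> X) div 2))"
          unfolding split
        proof (rule sum.union_disjoint)
          show "finite F0" "finite (\<Union>y\<in>X. Fy y)"
            using fin unfolding split by auto
          show "F0 \<inter> (\<Union>y\<in>X. Fy y) = {}" using X(2) by (auto simp: F0 Fy_def)
        qed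
        also have "(\<Sum>g\<in>(\<Union>y\<in>X. Fy y). t ^ (card (region r g A U \<inter> X) div 2)) =
          (\<Sum>y\<in>X. \<Sum>g\<in>Fy y. t ^ (card (region r g A U \<inter> X) div 2))"
          by (rule sum.UNION_disjoint[OF finX]) (use fin in \<open>auto simp: Fy_def\<close>)
        also have "\<dots> = (\<Sum>y\<in>X. tau * (2 ^ (n - 1) * fact (n - 1)) * fps_nth (G * R) (n - 1))"
          by (rule sum.cong[OF refl]) (rule sy)
        \<comment> \<open>Each of the \<open>2 * n\<close> arcs can be the first one in the corner
          \<open>b\<close>; this number times \<open>2 ^ (n - 1) * fact (n - 1)\<close> is the
          factor for \<open>n\<close>.\<close>
        also have "\<dots> = real (2 * n) * tau * (2 ^ (n - 1) * fact (n - 1)) * fps_nth (G * R) (n - 1)"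
          by (simp add: X(3))
        also have "(\<Sum>g\<in>F0. t ^ (card (region r g A U \<inter> X) div 2)) =
          2 ^ n * fact n * fps_nth (face_prod ?H r A s (K - {b}) U) n"
          using IH0 p U by blast
        finally have tot: "(\<Sum>g\<in>fillings r A s K X. t ^ (card (region r g A U \<inter> X) div 2)) =
          2 ^ n * fact n * fps_nth (face_prod ?H r A s (K - {b}) U) n +
          real (2 * n) * tau * (2 ^ (n - 1) * fact (n - 1)) * fps_nth (G * R) (n - 1)" .
        have fin_k: "finite (K \<inter> orbit (s \<circ> r) b)" using finK by simp
        have fp': "face_prod ?H r A s K U = h k * R" "face_prod ?H r A s (K - {b}) U = h (k - 1) * R"
          "k > 0"
        proof -
          note fb = face_bij[OF A(1) s(1)]
          have bf: "b \<in> orbit (s \<circ> r) b" by (rule orbit_self[OF finA fb bA])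
          have ob: "orbit (s \<circ> r) b \<in> orbits_on (s \<circ> r) A" using bA by (auto simp: orbits_on_def)
          show "k > 0" using fin_k b bf by (auto simp: k_def card_gt_0_iff)
          have bU: "orbit (s \<circ> r) b \<subseteq> U \<longleftrightarrow> b \<in> U"
            using orbit_closed_subset[of U "s \<circ> r" b] U(2) bf by auto
          show "face_prod ?H r A s K U = h k * R"
            unfolding face_prod_def R_def
            by (subst prod.remove[OF finite_orbits_on[OF finA] ob]) (simp add: h_def k_def bU)
          have "(K - {b}) \<inter> orbit (s \<circ> r) b = K \<inter> orbit (s \<circ> r) b - {b}" by auto
          then have c1: "card ((K - {b}) \<inter> orbit (s \<circ> r) b) = k - 1"
            using b bf by (simp add: k_def)
          have c2: "(K - {b}) \<inter> P = K \<inter> P" if "P \<in> orbits_on (s \<circ> r) A - {orbit (s \<circ> r) b}" for P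
            using orbits_on_disjoint[OF finA fb _ ob, of P] that bf by auto
          show "face_prod ?H r A s (K - {b}) U = h (k - 1) * R"
            unfolding face_prod_def R_def
            by (subst prod.remove[OF finite_orbits_on[OF finA] ob]) (simp add: h_def c1 c2 bU)
        qed
        have hk: "h k = h (k - 1) + fps_const tau * fps_X * G"
          using fill_fps_step[OF fp'(3), of tau] by (simp add: h_def G_def tau_def)
        show ?thesis
        proof (cases n)
          case 0
          then show ?thesis using tot fp' hk by (simp add: distrib_right mult.assoc)
        next
          case (Suc m)
          have "fps_nth (h k * R) (Suc m) = fps_nth (h (k - 1) * R) (Suc m) + tau * fps_nth (G * R) m"
            by (simp add: hk distrib_right mult.assoc)
          then show ?thesis using tot fp' Suc by (simp add: algebra_simps)
        qed
      qed
    qed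
  qed
qed

section \<open>The generating functions of fillings\<close>

text \<open>The binomial series of the square root of \<open>1 - 12 X\<close>; its singularity
  \<open>1/12\<close> governs all counting series below.\<close>

definition root_fps :: "real fps" where
  "root_fps = Abs_fps (\<lambda>n. ((1/2) gchoose n) * (-12) ^ n)"

lemma root_fps_square: "root_fps ^ 2 = 1 - 12 * fps_X"
proof -
  have e: "root_fps = fps_binomial (1/2) oo (fps_const (-12) * fps_X)"
    by (rule fps_ext) (simp add: root_fps_def fps_compose_linear fps_binomial_def)
  have "root_fps ^ 2 = (fps_binomial (1/2) * fps_binomial (1/2)) oo (fps_const (-12) * fps_X)"
    by (simp add: e power2_eq_square fps_compose_mult_distrib)
  also have "fps_binomial (1/2) * fps_binomial (1/2) = fps_binomial (1::real)"
    by (simp add: fps_binomial_add_mult[symmetric])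
  also have "\<dots> = 1 + fps_X" by (simp add: fps_binomial_1)
  also have "(1 + fps_X) oo (fps_const (-12) * fps_X) = 1 - 12 * (fps_X :: real fps)"
    by (simp add: fps_compose_add_distrib numeral_fps_const)
  finally show ?thesis .
qed

definition root_coeff :: "nat \<Rightarrow> real" where "root_coeff n = fps_nth root_fps n"

lemma root_coeff_Suc: "root_coeff (Suc n) * (real n + 1) = root_coeff n * (12 * real n - 6)"
proof -
  have "(1/2 gchoose Suc n) * (real n + 1) = (1/2 gchoose n) * (1/2 - real n)"
    using gbinomial_mult_1[of "1/2::real" n] by (simp add: algebra_simps)
  then have "(1/2 gchoose Suc n) * (real n + 1) * (-12) ^ Suc n =
      (1/2 gchoose n) * (1/2 - real n) * ((-12) * (-12) ^ n)" by simp
  then show ?thesis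
    unfolding root_coeff_def root_fps_def fps_nth_Abs_fps by (simp add: algebra_simps)
qed

lemma root_fps_0: "fps_nth root_fps 0 = 1"
  by (simp add: root_fps_def)

text \<open>The square root of a power series in a second variable whose coefficients
  \<open>q n\<close> are themselves power series, found coefficient by coefficient from a root
  \<open>c\<close> of the lowest one.\<close>

function sqrt_coeff :: "real fps \<Rightarrow> (nat \<Rightarrow> real fps) \<Rightarrow> nat \<Rightarrow> real fps" where
  "sqrt_coeff c q n = (if n = 0 then c else
     inverse (2 * c) * (q n - (\<Sum>i\<in>{1..<n}. sqrt_coeff c q i * sqrt_coeff c q (n - i))))"
  by pat_completeness auto
termination by (relation "measures [\<lambda>(c, q, n). n]") auto

declare sqrt_coeff.simps [simp del]

lemma sqrt_coeff_square:
  assumes "q 0 = c ^ 2" "fps_nth c 0 \<noteq> 0"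
  shows "Abs_fps (sqrt_coeff c q) ^ 2 = Abs_fps q"
proof (rule fps_ext)
  fix n
  let ?g = "sqrt_coeff c q"
  have g0: "?g 0 = c" by (simp add: sqrt_coeff.simps)
  show "fps_nth (Abs_fps ?g ^ 2) n = fps_nth (Abs_fps q) n"
  proof (cases "n = 0")
    case True
    then show ?thesis using assms(1) by (simp add: power2_eq_square g0)
  next
    case False
    have "{0..n} = insert 0 (insert n {1..<n})" using False by auto
    then have "fps_nth (Abs_fps ?g ^ 2) n =
        2 * c * ?g n + (\<Sum>i\<in>{1..<n}. ?g i * ?g (n - i))"
      using False by (simp add: power2_eq_square fps_mult_nth g0)
    also have "2 * c * ?g n = (2 * c * inverse (2 * c)) * (q n - (\<Sum>i\<in>{1..<n}. ?g i * ?g (n - i)))"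
      by (subst sqrt_coeff.simps) (use False in simp)
    also have "2 * c * inverse (2 * c) = 1"
      by (rule inverse_mult_eq_1') (use assms(2) in \<open>simp add: fps_numeral_nth_0 fps_mult_nth_0\<close>)
    finally show ?thesis by simp
  qed
qed

text \<open>Apart from \<open>H (k - 1)\<close> the right-hand side carries a factor
  \<open>X\<close>, so coefficient \<open>n\<close> of \<open>H k\<close> depends only on lower
  coefficients and on coefficient \<open>n\<close> of \<open>H (k - 1)\<close>. The two nested
  inductions follow this order. Hence it is enough to guess a solution.\<close>

lemma fill_recursion_unique:
  fixes H G :: "nat \<Rightarrow> real fps"
  assumes H: "\<And>k. k > 0 \<Longrightarrow> H k = H (k - 1) + fps_X * (H (Suc k) + (\<Sum>j=1..k. H j * H (Suc k - j)))"
    and G: "\<And>k. k > 0 \<Longrightarrow> G k = G (k - 1) + fps_X * (G (Suc k) + (\<Sum>j=1..k. G j * G (Suc k - j)))"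
    and "H 0 = G 0"
  shows "H k = G k"
proof -
  have "\<forall>k. fps_nth (H k) n = fps_nth (G k) n" for n
  proof (induction n rule: less_induct)
    case (less n)
    show ?case
    proof
      fix k show "fps_nth (H k) n = fps_nth (G k) n"
      proof (induction k)
        case (Suc k)
        have "fps_nth (fps_X * (H (Suc (Suc k)) + (\<Sum>j=1..Suc k. H j * H (Suc (Suc k) - j)))) n =
            fps_nth (fps_X * (G (Suc (Suc k)) + (\<Sum>j=1..Suc k. G j * G (Suc (Suc k) - j)))) n"
        proof (cases n)
          case (Suc m)
          have "fps_nth (H i * H j) m = fps_nth (G i * G j) m" for i j
            unfolding fps_mult_nth by (rule sum.cong) (use less Suc in auto)
          then show ?thesis using less Suc by (simp add: fps_sum_nth)
        qed simp
        note eq = this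
        have "fps_nth (H (Suc k)) n = fps_nth (H k) n +
            fps_nth (fps_X * (H (Suc (Suc k)) + (\<Sum>j=1..Suc k. H j * H (Suc (Suc k) - j)))) n"
          by (subst H) simp_all
        moreover have "fps_nth (G (Suc k)) n = fps_nth (G k) n +
            fps_nth (fps_X * (G (Suc (Suc k)) + (\<Sum>j=1..Suc k. G j * G (Suc (Suc k) - j)))) n"
          by (subst G) simp_all
        ultimately show ?case unfolding eq using Suc.IH by linarith
      qed (use assms(3) in simp)
    qed
  qed
  then show ?thesis by (intro fps_ext) blast
qed

text \<open>The power series \<open>p\<close> with \<open>p = X + 3p\<^sup>2\<close> rationally parametrises the generating functions.\<close>

definition par_fps :: "real fps" where "par_fps = fps_const (1/6) * (1 - root_fps)"

lemma root_par: "root_fps = 1 - 6 * par_fps"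
proof -
  have "6 * par_fps = (fps_const 6 * fps_const (1/6)) * (1 - root_fps)"
    by (simp add: par_fps_def numeral_fps_const mult.assoc)
  also have "\<dots> = 1 - root_fps" by simp
  finally show ?thesis by simp
qed

lemma par_fps_eq: "fps_X = par_fps - 3 * par_fps ^ 2"
proof -
  have "12 * fps_X = 12 * (par_fps - 3 * par_fps ^ 2)"
    using root_fps_square unfolding root_par by (simp add: algebra_simps power2_eq_square)
  then show ?thesis by (metis mult_cancel_left zero_neq_numeral)
qed

lemma par_fps_0: "fps_nth par_fps 0 = 0"
  by (simp add: par_fps_def root_fps_0)

text \<open>
  The quadratic method: the equation for the generating function of \<open>fill_fps 1 k\<close> in a variable
  \<open>y\<close> marking \<open>k\<close> has discriminant \<open>(p - y)\<^sup>2 ((1 - 3p)\<^sup>2 - 2 (1 - p) y + y\<^sup>2)\<close>.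
\<close>

lemma fill_fps_1:
  "fps_X ^ 2 * fill_fps 1 1 = par_fps ^ 2 * (1 - 4 * par_fps)"
proof -
  define p where "p = par_fps"
  define c where "c = 1 - 3 * p"
  \<comment> \<open>The coefficients in \<open>y\<close> of the simple factor of the discriminant;
    \<open>g\<close> is its square root with constant term \<open>c\<close>.\<close>
  define q where "q k = (if k = 0 then c ^ 2 else if k = 1 then - (2 * (1 - p)) else if k = 2 then 1 else 0)" for k :: nat
  define g where "g = sqrt_coeff c q"
  \<comment> \<open>The quadratic formula: \<open>num k\<close> is the coefficient of
    \<open>y ^ k\<close> in \<open>y - y ^ 2 - X + (p - y) g\<close>, with the sign of the root for
    which \<open>num 0\<close> vanishes.\<close>
  define num where "num k = (if k = 0 then - fps_X else if k = 1 then 1 else if k = 2 then -1 else 0)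
     + p * g k - (if k = 0 then 0 else g (k - 1))" for k :: nat
  define G where "G k = fps_const (1/2) * fps_shift 1 (num k)" for k
  \<comment> \<open>The value of the unknown series \<open>fill_fps 1 1\<close> for which the
    discriminant has the double root \<open>y = p\<close>.\<close>
  define F1 where "F1 = (1 - 4 * p) * inverse (c ^ 2)"
  have c0: "fps_nth c 0 = 1" by (simp add: c_def p_def par_fps_0 fps_numeral_nth_0)
  have X: "fps_X = p * c" using par_fps_eq by (simp add: p_def c_def algebra_simps power2_eq_square)
  have g0: "g 0 = c" by (simp add: g_def sqrt_coeff.simps)
  have cc: "c * inverse c = 1" by (rule inverse_mult_eq_1') (simp add: c0)
  have F1: "fps_X ^ 2 * F1 = p ^ 2 * (1 - 4 * p)"
  proof -
    have "c ^ 2 * inverse (c ^ 2) = 1" by (rule inverse_mult_eq_1') (simp add: c0 fps_nth_power_0)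
    then have "p ^ 2 * (1 - 4 * p) = p ^ 2 * (1 - 4 * p) * (c ^ 2 * inverse (c ^ 2))" by simp
    also have "\<dots> = fps_X ^ 2 * F1" unfolding X F1_def by (simp add: algebra_simps power2_eq_square)
    finally show ?thesis by simp
  qed
  have sq: "Abs_fps g ^ 2 = Abs_fps q"
    unfolding g_def by (rule sqrt_coeff_square) (simp_all add: q_def c0)
  \<comment> \<open>At \<open>X = 0\<close> the series \<open>p\<close> vanishes and
    \<open>g\<close> becomes \<open>1 - y\<close>; then the numerator vanishes too, which permits
    the division by \<open>2 X\<close>.\<close>
  have g_const: "fps_nth (g k) 0 = (if k = 0 then 1 else if k = 1 then -1 else 0)" for k
  proof (induction k rule: less_induct)
    case (less k)
    show ?case
    proof (cases "k = 0")
      case True then show ?thesis by (simp add: g0 c0)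
    next
      case False
      have i0: "fps_nth (inverse (2 * c)) 0 = 1/2" by (simp add: c0 fps_numeral_nth_0)
      have q0: "fps_nth (q k) 0 = (if k = 1 then -2 else if k = 2 then 1 else 0)"
        using False by (simp add: q_def p_def par_fps_0 fps_numeral_nth_0)
      have "fps_nth (g k) 0 = 1/2 * (fps_nth (q k) 0 - (\<Sum>i\<in>{1..<k}. fps_nth (g i) 0 * fps_nth (g (k - i)) 0))"
        unfolding g_def by (subst sqrt_coeff.simps) (use False in \<open>simp add: i0[simplified] fps_sum_nth\<close>)
      also have "(\<Sum>i\<in>{1..<k}. fps_nth (g i) 0 * fps_nth (g (k - i)) 0) =
          (\<Sum>i\<in>{1..<k}. if i = 1 \<and> k = 2 then 1 else 0)"
        by (rule sum.cong[OF refl]) (use less in auto)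
      also have "\<dots> = (if k = 2 then 1 else 0)"
        by (cases "k = 2") auto
      finally show ?thesis using False unfolding q0 by (cases "k = 1"; cases "k = 2") simp_all
    qed
  qed
  have num0: "fps_nth (num k) 0 = 0" for k
    by (auto simp: num_def g_const p_def par_fps_0 split: if_splits)
  have XG: "2 * fps_X * G k = num k" for k
  proof -
    have "fps_X * fps_shift 1 (num k) = num k"
      by (rule fps_ext) (simp add: num0 split: nat.splits)
    moreover have "2 * fps_X * G k = (2 * fps_const (1/2)) * (fps_X * fps_shift 1 (num k))"
      by (simp only: G_def mult_ac)
    moreover have "2 * fps_const (1/2) = (1 :: real fps)" by (simp add: numeral_fps_const)
    ultimately show ?thesis by simp
  qed
  have "num 0 = 0" by (simp add: num_def g0 X)
  then have G0: "G 0 = 0" by (simp add: G_def)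
  \<comment> \<open>From here on the setting is power series in \<open>y\<close> over power series
    in \<open>X\<close>: \<open>Y\<close> is the outer variable, while \<open>Z\<close>,
    \<open>P\<close> and \<open>W\<close> are constant in it.\<close>
  define Y where "Y = (fps_X :: real fps fps)"
  define Z where "Z = fps_const (fps_X :: real fps)"
  define P where "P = fps_const p"
  define f where "f = Abs_fps G"
  define gg where "gg = Abs_fps g"
  define W where "W = fps_const (fps_X * F1)"
  have Zf: "2 * Z * f = Y - Y ^ 2 - Z + (P - Y) * gg"
  proof (rule fps_ext)
    fix k
    have two: "fps_nth (2 * Z * f) k = 2 * fps_X * G k"
      by (simp add: Z_def f_def numeral_fps_const mult.assoc)
    have "fps_nth (Y - Y ^ 2 - Z + (P - Y) * gg) k = num k"
      by (auto simp: Y_def Z_def P_def gg_def num_def fps_X_power_nth left_diff_distrib)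
    then show "fps_nth (2 * Z * f) k = fps_nth (Y - Y ^ 2 - Z + (P - Y) * gg) k"
      by (simp add: two XG)
  qed
  have gg2: "gg ^ 2 = (1 - 3 * P) ^ 2 - 2 * (1 - P) * Y + Y ^ 2"
  proof -
    have cP: "1 - 3 * P = fps_const c" "1 - P = fps_const (1 - p)"
      by (simp_all add: P_def c_def numeral_fps_const fps_const_sub[symmetric])
    have "Abs_fps q = (1 - 3 * P) ^ 2 - 2 * (1 - P) * Y + Y ^ 2"
      unfolding cP
      by (rule fps_ext) (auto simp: q_def Y_def fps_X_power_nth fps_const_power numeral_fps_const mult.assoc)
    then show ?thesis using sq by (simp add: gg_def)
  qed
  have ZP: "Z = P - 3 * P ^ 2"
  proof -
    have "Z = fps_const (p - 3 * p ^ 2)" unfolding Z_def p_def by (simp only: par_fps_eq[symmetric])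
    also have "\<dots> = P - 3 * P ^ 2" by (simp add: P_def numeral_fps_const)
    finally show ?thesis .
  qed
  have ZW: "Z * W = P ^ 2 * (1 - 4 * P)"
  proof -
    have "Z * W = fps_const (fps_X ^ 2 * F1)" by (simp add: Z_def W_def power2_eq_square mult.assoc)
    also have "\<dots> = P ^ 2 * (1 - 4 * P)"
      unfolding F1 by (simp add: P_def numeral_fps_const fps_const_power)
    finally show ?thesis .
  qed
  \<comment> \<open>Completing the square, so that the root occurs only as
    \<open>gg ^ 2\<close>.\<close>
  have "4 * Z * (Z * f ^ 2 + (Z + Y ^ 2 - Y) * f + Y ^ 2 - Y * W) =
      (2 * Z * f) ^ 2 + 2 * (Z + Y ^ 2 - Y) * (2 * Z * f) + 4 * Z * Y ^ 2 - 4 * Y * (Z * W)"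
    by (simp add: algebra_simps power2_eq_square)
  also have "\<dots> = (P - Y) ^ 2 * gg ^ 2 - (Z + Y ^ 2 - Y) ^ 2 + 4 * Z * Y ^ 2 - 4 * Y * (Z * W)"
    unfolding Zf by (simp add: algebra_simps power2_eq_square)
  also have "\<dots> = 0"
    unfolding gg2 ZW unfolding ZP by (simp add: algebra_simps power2_eq_square)
  finally have "4 * Z * (Z * f ^ 2 + (Z + Y ^ 2 - Y) * f + Y ^ 2 - Y * W) = 0" .
  moreover have "4 * Z \<noteq> 0" by (simp add: Z_def)
  ultimately have eq0: "Z * f ^ 2 + (Z + Y ^ 2 - Y) * f + Y ^ 2 - Y * W = 0"
    by (metis mult_eq_0_iff)
  have coeff: "fps_X * (\<Sum>i=0..k. G i * G (k - i)) + fps_X * G k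
      + (if k < 2 then 0 else G (k - 2)) - (if k = 0 then 0 else G (k - 1)) + (if k = 2 then 1 else 0)
      - (if k = 1 then fps_X * F1 else 0) = 0" for k
  proof -
    have "fps_nth (Z * f ^ 2 + (Z + Y ^ 2 - Y) * f + Y ^ 2 - Y * W) k = 0" by (simp add: eq0)
    moreover have "fps_nth (Z * f ^ 2) k = fps_X * (\<Sum>i=0..k. G i * G (k - i))"
      by (simp add: Z_def f_def power2_eq_square[of "Abs_fps G"] fps_mult_nth[of "Abs_fps G"])
    moreover have "fps_nth ((Z + Y ^ 2 - Y) * f) k = fps_X * G k
      + (if k < 2 then 0 else G (k - 2)) - (if k = 0 then 0 else G (k - 1))"
      by (simp add: Z_def Y_def f_def fps_X_power_mult_nth distrib_right left_diff_distrib)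
    moreover have "fps_nth (Y ^ 2) k = (if k = 2 then 1 else 0)"
      by (simp add: Y_def fps_X_power_nth)
    moreover have "fps_nth (Y * W) k = (if k = 1 then fps_X * F1 else 0)"
      by (simp add: Y_def W_def)
    ultimately show ?thesis
      by (simp only: fps_add_nth fps_sub_nth add.assoc add_diff_eq diff_add_eq)
  qed
  have G1: "G 1 = F1"
  proof -
    have "fps_X * G 1 = fps_X * F1" using coeff[of 1] by (simp add: G0)
    then show ?thesis by simp
  qed
  \<comment> \<open>In the quadratic equation the term for \<open>k = 0\<close> is zero, whereas in
    the recursion the face without corners counts as one; the other values agree.\<close>
  define H where "H k = (if k = 0 then 1 else G k)" for k
  have H: "H k = H (k - 1) + fps_X * (H (Suc k) + (\<Sum>j=1..k. H j * H (Suc k - j)))" if k: "k > 0" for k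
  proof -
    have "(\<Sum>i=0..Suc k. G i * G (Suc k - i)) = (\<Sum>j=1..k. H j * H (Suc k - j))"
      by (rule sum.mono_neutral_cong_right) (auto simp: H_def G0 Suc_le_eq)
    then have "G k = (if k = 1 then 1 else G (k - 1)) + fps_X * (G (Suc k) + (\<Sum>j=1..k. H j * H (Suc k - j)))"
      using coeff[of "Suc k"] k by (cases "k = 1") (auto simp: G0 algebra_simps)
    then show ?thesis using k by (auto simp: H_def)
  qed
  have "H k = fill_fps 1 k" for k
  proof (rule fill_recursion_unique)
    show "H k = H (k - 1) + fps_X * (H (Suc k) + (\<Sum>j=1..k. H j * H (Suc k - j)))" if "k > 0" for k
      by (rule H[OF that])
    show "fill_fps 1 k = fill_fps 1 (k - 1) +
        fps_X * (fill_fps 1 (Suc k) + (\<Sum>j=1..k. fill_fps 1 j * fill_fps 1 (Suc k - j)))" if "k > 0" for k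
      using fill_fps_step[OF that, of 1] by (simp only: fps_const_1_eq_1 mult_1_left)
  qed (simp add: H_def fill_fps_0)
  then have "fill_fps 1 1 = F1" using G1 by (metis H_def zero_neq_one)
  with F1 show ?thesis by (simp only: p_def)
qed

text \<open>Tutte's generating function of rooted planar maps by edges; the parameter
  \<open>par_fps\<close> is eliminated from \<open>fill_fps_1\<close> in favour of the root.\<close>

lemma fill_fps_1_root: "54 * fps_X ^ 2 * fill_fps 1 1 = 18 * fps_X - 1 + root_fps ^ 3"
proof -
  have "54 * fps_X ^ 2 * fill_fps 1 1 = 54 * (par_fps ^ 2 * (1 - 4 * par_fps))"
    by (simp only: fill_fps_1 mult.assoc)
  also have "\<dots> = 18 * fps_X - 1 + root_fps ^ 3"
    unfolding root_par par_fps_eq by (simp add: algebra_simps power2_eq_square power3_eq_cube)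
  finally show ?thesis .
qed

section \<open>Singular expansions\<close>

text \<open>
  \<open>sing_value G u v\<close>: up to a power of \<open>X\<close> the series is \<open>A + B (1 - 12X)\<^bsup>3/2\<^esup>\<close> with
  polynomials \<open>A\<close>, \<open>B\<close>, and \<open>u\<close>, \<open>v\<close> are the values of the two parts at the singularity \<open>1/12\<close>.
  Similarly \<open>half_value G w\<close> for \<open>A + B (1 - 12X)\<^bsup>1/2\<^esup>\<close>, where only \<open>B\<close> matters.
\<close>

definition sing_value :: "real fps \<Rightarrow> real \<Rightarrow> real \<Rightarrow> bool" where
  "sing_value G u v \<longleftrightarrow> (\<exists>m A B. fps_X ^ m * G = fps_of_poly A + fps_of_poly B * root_fps ^ 3 \<and>
     u = 12 ^ m * poly A (1/12) \<and> v = 12 ^ m * poly B (1/12))"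

definition half_value :: "real fps \<Rightarrow> real \<Rightarrow> bool" where
  "half_value G w \<longleftrightarrow> (\<exists>m A B. fps_X ^ m * G = fps_of_poly A + fps_of_poly B * root_fps \<and>
     w = 12 ^ m * poly B (1/12))"

text \<open>Both facts drive the calculus below: positive even powers of the root are polynomials,
  and these vanish at the singularity, so products of singular parts leave no trace in the
  values.\<close>

lemma poly_crit: "fps_of_poly [:1, -12:] = root_fps ^ 2" "poly [:1, -12:] (1/12 :: real) = 0"
  by (simp_all add: root_fps_square fps_of_poly_pCons numeral_fps_const fps_const_neg[symmetric]
      del: fps_const_neg)

lemma sing_value_1: "sing_value 1 1 0"
  unfolding sing_value_def by (rule exI[of _ 0], rule exI[of _ 1], rule exI[of _ 0]) simp

text \<open>The product of the two parts with exponent \<open>3/2\<close> is a multiple of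
  \<open>(1 - 12 X) ^ 3\<close>, a polynomial vanishing at \<open>1/12\<close>; so the regular
  values multiply and the singular ones obey the Leibniz rule.\<close>

lemma sing_value_mult:
  assumes "sing_value G u v" "sing_value G' u' v'"
  shows "sing_value (G * G') (u * u') (u * v' + v * u')"
proof -
  obtain m A B where 1: "fps_X ^ m * G = fps_of_poly A + fps_of_poly B * root_fps ^ 3"
    "u = 12 ^ m * poly A (1/12)" "v = 12 ^ m * poly B (1/12)"
    using assms(1) unfolding sing_value_def by blast
  obtain m' A' B' where 2: "fps_X ^ m' * G' = fps_of_poly A' + fps_of_poly B' * root_fps ^ 3"
    "u' = 12 ^ m' * poly A' (1/12)" "v' = 12 ^ m' * poly B' (1/12)"
    using assms(2) unfolding sing_value_def by blast
  have "fps_X ^ (m + m') * (G * G') = (fps_X ^ m * G) * (fps_X ^ m' * G')"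
    by (simp add: power_add mult_ac)
  also have "\<dots> = (fps_of_poly A * fps_of_poly A' + fps_of_poly B * fps_of_poly B' * (root_fps ^ 2) ^ 3)
      + (fps_of_poly A * fps_of_poly B' + fps_of_poly B * fps_of_poly A') * root_fps ^ 3"
    unfolding 1 2 by (simp add: algebra_simps power_mult[symmetric] power_add[symmetric])
  also have "\<dots> = fps_of_poly (A * A' + B * B' * [:1, -12:] ^ 3) + fps_of_poly (A * B' + B * A') * root_fps ^ 3"
    by (simp only: poly_crit(1)[symmetric] fps_of_poly_mult fps_of_poly_add fps_of_poly_power)
  finally have e: "fps_X ^ (m + m') * (G * G') = \<dots>" .
  show ?thesis unfolding sing_value_def
    by (intro exI conjI, rule e)
      (simp_all add: 1 2 power_add algebra_simps poly_crit(2) del: poly_pCons)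
qed

text \<open>Passing to the common denominator \<open>X ^ (m + m')\<close> does not change the
  values: the factor \<open>12 ^ m\<close> in the definition compensates for \<open>X ^ m\<close> at
  \<open>1/12\<close>.\<close>

lemma sing_value_add:
  assumes "sing_value G u v" "sing_value G' u' v'"
  shows "sing_value (G + G') (u + u') (v + v')"
proof -
  obtain m A B where 1: "fps_X ^ m * G = fps_of_poly A + fps_of_poly B * root_fps ^ 3"
    "u = 12 ^ m * poly A (1/12)" "v = 12 ^ m * poly B (1/12)"
    using assms(1) unfolding sing_value_def by blast
  obtain m' A' B' where 2: "fps_X ^ m' * G' = fps_of_poly A' + fps_of_poly B' * root_fps ^ 3"
    "u' = 12 ^ m' * poly A' (1/12)" "v' = 12 ^ m' * poly B' (1/12)"
    using assms(2) unfolding sing_value_def by blast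
  have "fps_X ^ (m + m') * (G + G') = fps_X ^ m' * (fps_X ^ m * G) + fps_X ^ m * (fps_X ^ m' * G')"
    by (simp add: power_add algebra_simps)
  also have "\<dots> = fps_of_poly (monom 1 m' * A + monom 1 m * A') +
      fps_of_poly (monom 1 m' * B + monom 1 m * B') * root_fps ^ 3"
    unfolding 1 2 by (simp add: fps_of_poly_mult fps_of_poly_add fps_of_poly_monom' algebra_simps)
  finally have e: "fps_X ^ (m + m') * (G + G') = \<dots>" .
  show ?thesis unfolding sing_value_def
    by (intro exI conjI, rule e)
      (simp_all add: 1 2 power_add poly_monom power_one_over field_simps)
qed

lemma sing_value_cmult:
  assumes "sing_value G u v"
  shows "sing_value (fps_const c * G) (c * u) (c * v)"
proof -
  obtain m A B where 1: "fps_X ^ m * G = fps_of_poly A + fps_of_poly B * root_fps ^ 3"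
    "u = 12 ^ m * poly A (1/12)" "v = 12 ^ m * poly B (1/12)"
    using assms unfolding sing_value_def by blast
  have "fps_X ^ m * (fps_const c * G) = fps_const c * (fps_X ^ m * G)" by (simp only: mult_ac)
  also have "\<dots> = fps_of_poly (smult c A) + fps_of_poly (smult c B) * root_fps ^ 3"
    unfolding 1 by (simp add: fps_of_poly_smult algebra_simps)
  finally have e: "fps_X ^ m * (fps_const c * G) = \<dots>" .
  show ?thesis unfolding sing_value_def
    by (intro exI conjI, rule e) (simp_all add: 1)
qed

lemma sing_value_diff:
  assumes "sing_value G u v" "sing_value G' u' v'"
  shows "sing_value (G - G') (u - u') (v - v')"
proof -
  have "fps_const (-1) * G' = - G'" by (simp add: fps_eq_iff)
  with sing_value_add[OF assms(1) sing_value_cmult[OF assms(2), of "-1"]] show ?thesis by simp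
qed

lemma sing_value_sum:
  assumes "finite I" "\<And>i. i \<in> I \<Longrightarrow> sing_value (G i) (u i) (v i)"
  shows "sing_value (\<Sum>i\<in>I. G i) (\<Sum>i\<in>I. u i) (\<Sum>i\<in>I. v i)"
  using assms
proof (induction I rule: finite_induct)
  case empty
  then show ?case using sing_value_cmult[OF sing_value_1, of 0] by simp
qed (simp add: sing_value_add)

lemma sing_value_X:
  assumes "sing_value (fps_X * G) u v"
  shows "sing_value G (12 * u) (12 * v)"
proof -
  obtain m A B where 1: "fps_X ^ m * (fps_X * G) = fps_of_poly A + fps_of_poly B * root_fps ^ 3"
    "u = 12 ^ m * poly A (1/12)" "v = 12 ^ m * poly B (1/12)"
    using assms unfolding sing_value_def by blast
  have "fps_X ^ Suc m * G = fps_of_poly A + fps_of_poly B * root_fps ^ 3"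
    unfolding 1(1)[symmetric] by (simp add: mult_ac)
  then show ?thesis unfolding sing_value_def using 1(2,3)
    by (intro exI[of _ "Suc m"] exI[of _ A] exI[of _ B]) simp
qed

text \<open>
  \<open>3\<^sup>k\<close> times the values at the singularity of the two parts of \<open>fill_fps 1 k\<close>; the factor makes
  them integers.
\<close>

function crit_u :: "nat \<Rightarrow> int" and crit_v :: "nat \<Rightarrow> int" where
  "crit_u 0 = 1"
| "crit_u (Suc 0) = 4"
| "crit_u (Suc (Suc k)) = 36 * crit_u (Suc k) - 108 * crit_u k
     - (\<Sum>j\<in>{1..Suc k}. crit_u j * crit_u (Suc (Suc k) - j))"
| "crit_v 0 = 0"
| "crit_v (Suc 0) = 8"
| "crit_v (Suc (Suc k)) = 36 * crit_v (Suc k) - 108 * crit_v k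
     - 2 * (\<Sum>j\<in>{1..Suc k}. crit_u j * crit_v (Suc (Suc k) - j))"
  by pat_completeness auto
termination
  by (relation "measures [case_sum id id]") auto

text \<open>\<open>fill_fps_step\<close> is solved for its largest index and evaluated at the
  singularity. Division by \<open>X\<close> becomes multiplication by \<open>12\<close>, and the
  scaling by powers of \<open>3\<close> turns the coefficients into \<open>12 * 3 = 36\<close> and
  \<open>12 * 9 = 108\<close>. The start values come from \<open>fill_fps_1_root\<close>.\<close>

lemma sing_value_fill:
  "sing_value (fill_fps 1 k) (of_int (crit_u k) / 3 ^ k) (of_int (crit_v k) / 3 ^ k)"
proof (induction k rule: less_induct)
  case (less k)
  consider "k = 0" | "k = 1" | l where "k = Suc (Suc l)"
    by (metis One_nat_def old.nat.exhaust)
  then show ?case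
  proof cases
    case 1 then show ?thesis using sing_value_1 by (simp add: fill_fps_0)
  next
    case 2
    have "fps_X ^ 2 * fill_fps 1 1 = (fps_const (1/54) * 54) * (fps_X ^ 2 * fill_fps 1 1)"
      by (simp add: numeral_fps_const)
    also have "\<dots> = fps_const (1/54) * (54 * fps_X ^ 2 * fill_fps 1 1)" by (simp only: mult_ac)
    also have "\<dots> = fps_const (1/54) * (18 * fps_X - 1) + fps_const (1/54) * root_fps ^ 3"
      unfolding fill_fps_1_root by (simp only: distrib_left)
    also have "fps_const (1/54) * (18 * fps_X - 1) = (fps_of_poly [: -1/54, 1/3 :] :: real fps)"
      by (rule fps_ext) (auto simp: coeff_pCons numeral_fps_const split: nat.split)
    also have "fps_const (1/54) = (fps_of_poly [: 1/54 :] :: real fps)" by simp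
    finally have e: "fps_X ^ 2 * fill_fps 1 1 = fps_of_poly [: -1/54, 1/3 :] + fps_of_poly [: 1/54 :] * root_fps ^ 3" .
    show ?thesis unfolding sing_value_def 2
      by (intro exI conjI, rule e) (simp_all add: power2_eq_square)
  next
    case 3
    let ?F = "fill_fps 1"
    have "?F (Suc l) = ?F l + fps_X * (?F (Suc (Suc l)) + (\<Sum>j=1..Suc l. ?F j * ?F (Suc (Suc l) - j)))"
      using fill_fps_step[of "Suc l" 1] by simp
    then have e: "fps_X * ?F (Suc (Suc l)) =
        ?F (Suc l) - ?F l - fps_X * (\<Sum>j=1..Suc l. ?F j * ?F (Suc (Suc l) - j))"
      by (simp add: algebra_simps)
    define u v where "u j = real_of_int (crit_u j) / 3 ^ j" and "v j = real_of_int (crit_v j) / 3 ^ j" for j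
    have IH: "sing_value (?F j) (u j) (v j)" if "j < Suc (Suc l)" for j
      using less that 3 by (simp add: u_def v_def)
    have X: "sing_value fps_X (1/12) 0"
      unfolding sing_value_def
      by (rule exI[of _ 0], rule exI[of _ "monom 1 1"], rule exI[of _ 0])
        (simp add: fps_of_poly_monom' poly_monom)
    have "sing_value (fps_X * ?F (Suc (Suc l)))
        (u (Suc l) - u l - 1/12 * (\<Sum>j=1..Suc l. u j * u (Suc (Suc l) - j)))
        (v (Suc l) - v l - (1/12 * (\<Sum>j=1..Suc l. u j * v (Suc (Suc l) - j) + v j * u (Suc (Suc l) - j))
           + 0 * (\<Sum>j=1..Suc l. u j * u (Suc (Suc l) - j))))"
      unfolding e by (intro sing_value_diff sing_value_mult sing_value_sum X IH) auto
    from sing_value_X[OF this]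
    have sv: "sing_value (?F (Suc (Suc l)))
        (12 * (u (Suc l) - u l) - (\<Sum>j=1..Suc l. u j * u (Suc (Suc l) - j)))
        (12 * (v (Suc l) - v l) - (\<Sum>j=1..Suc l. u j * v (Suc (Suc l) - j) + v j * u (Suc (Suc l) - j)))"
      by (simp add: algebra_simps)
    have pw: "3 ^ Suc (Suc l) = 3 ^ j * (3::real) ^ (Suc (Suc l) - j)" if "j \<in> {1..Suc l}" for j
      using that by (simp add: power_add[symmetric])
    have s1: "(\<Sum>j=1..Suc l. u j * u (Suc (Suc l) - j)) =
        of_int (\<Sum>j=1..Suc l. crit_u j * crit_u (Suc (Suc l) - j)) / 3 ^ Suc (Suc l)"
      unfolding of_int_sum sum_divide_distrib
      by (rule sum.cong[OF refl]) (simp add: pw u_def del: power_Suc)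
    have s2: "(\<Sum>j=1..Suc l. u j * v (Suc (Suc l) - j)) =
        of_int (\<Sum>j=1..Suc l. crit_u j * crit_v (Suc (Suc l) - j)) / 3 ^ Suc (Suc l)"
      unfolding of_int_sum sum_divide_distrib
      by (rule sum.cong[OF refl]) (simp add: pw u_def v_def del: power_Suc)
    have s3: "(\<Sum>j=1..Suc l. v j * u (Suc (Suc l) - j)) = (\<Sum>j=1..Suc l. u j * v (Suc (Suc l) - j))"
      by (rule sum.reindex_bij_witness[of _ "\<lambda>j. Suc (Suc l) - j" "\<lambda>j. Suc (Suc l) - j"])
        (auto simp: mult.commute)
    have "12 * (u (Suc l) - u l) - (\<Sum>j=1..Suc l. u j * u (Suc (Suc l) - j)) = u (Suc (Suc l))"
      unfolding s1 by (simp add: u_def field_simps)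
    moreover have "12 * (v (Suc l) - v l) - (\<Sum>j=1..Suc l. u j * v (Suc (Suc l) - j) + v j * u (Suc (Suc l) - j))
        = v (Suc (Suc l))"
      unfolding sum.distrib s3 s2 by (simp add: v_def field_simps)
    ultimately show ?thesis using sv by (simp add: 3 u_def v_def)
  qed
qed

text \<open>The cube of the root is \<open>1 - 12 X\<close> times the root, and this polynomial
  factor vanishes at \<open>1/12\<close>.\<close>

lemma half_value_sing:
  assumes "sing_value G u v"
  shows "half_value G 0"
proof -
  obtain m A B where 1: "fps_X ^ m * G = fps_of_poly A + fps_of_poly B * root_fps ^ 3"
    using assms unfolding sing_value_def by blast
  have "fps_X ^ m * G = fps_of_poly A + fps_of_poly (B * [:1, -12:]) * root_fps"
    unfolding 1 fps_of_poly_mult poly_crit(1) by (simp add: power2_eq_square power3_eq_cube mult.assoc)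
  then show ?thesis unfolding half_value_def
    by (intro exI conjI) (assumption, simp)
qed

text \<open>The singular part of \<open>G\<close> has the higher exponent \<open>3/2\<close>, so
  only its regular value \<open>u\<close> survives in the coefficient of the square root.\<close>

lemma half_value_mult:
  assumes "sing_value G u v" "half_value G' w"
  shows "half_value (G * G') (u * w)"
proof -
  obtain m A B where 1: "fps_X ^ m * G = fps_of_poly A + fps_of_poly B * root_fps ^ 3"
    "u = 12 ^ m * poly A (1/12)"
    using assms(1) unfolding sing_value_def by blast
  obtain m' A' B' where 2: "fps_X ^ m' * G' = fps_of_poly A' + fps_of_poly B' * root_fps"
    "w = 12 ^ m' * poly B' (1/12)"
    using assms(2) unfolding half_value_def by blast
  have "fps_X ^ (m + m') * (G * G') = (fps_X ^ m * G) * (fps_X ^ m' * G')"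
    by (simp add: power_add mult_ac)
  also have "\<dots> = (fps_of_poly A * fps_of_poly A' + fps_of_poly B * fps_of_poly B' * (root_fps ^ 2) ^ 2)
      + (fps_of_poly A * fps_of_poly B' + fps_of_poly B * fps_of_poly A' * root_fps ^ 2) * root_fps"
    unfolding 1 2 by (simp add: algebra_simps power2_eq_square power3_eq_cube)
  also have "\<dots> = fps_of_poly (A * A' + B * B' * [:1, -12:] ^ 2) +
      fps_of_poly (A * B' + B * A' * [:1, -12:]) * root_fps"
    by (simp only: poly_crit(1)[symmetric] fps_of_poly_mult fps_of_poly_add fps_of_poly_power)
  finally have e: "fps_X ^ (m + m') * (G * G') = \<dots>" .
  show ?thesis unfolding half_value_def
    by (intro exI conjI, rule e) (simp add: 1 2 power_add algebra_simps)
qed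

lemma half_value_add:
  assumes "half_value G w" "half_value G' w'"
  shows "half_value (G + G') (w + w')"
proof -
  obtain m A B where 1: "fps_X ^ m * G = fps_of_poly A + fps_of_poly B * root_fps"
    "w = 12 ^ m * poly B (1/12)"
    using assms(1) unfolding half_value_def by blast
  obtain m' A' B' where 2: "fps_X ^ m' * G' = fps_of_poly A' + fps_of_poly B' * root_fps"
    "w' = 12 ^ m' * poly B' (1/12)"
    using assms(2) unfolding half_value_def by blast
  have "fps_X ^ (m + m') * (G + G') = fps_X ^ m' * (fps_X ^ m * G) + fps_X ^ m * (fps_X ^ m' * G')"
    by (simp add: power_add algebra_simps)
  also have "\<dots> = fps_of_poly (monom 1 m' * A + monom 1 m * A') +
      fps_of_poly (monom 1 m' * B + monom 1 m * B') * root_fps"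
    unfolding 1 2 by (simp add: fps_of_poly_mult fps_of_poly_add fps_of_poly_monom' algebra_simps)
  finally have e: "fps_X ^ (m + m') * (G + G') = \<dots>" .
  show ?thesis unfolding half_value_def
    by (intro exI conjI, rule e) (simp_all add: 1 2 power_add poly_monom power_one_over field_simps)
qed

lemma half_value_X_power:
  assumes "half_value G w"
  shows "half_value (fps_X ^ e * G) (w / 12 ^ e)"
proof -
  obtain m A B where 1: "fps_X ^ m * G = fps_of_poly A + fps_of_poly B * root_fps"
    "w = 12 ^ m * poly B (1/12)"
    using assms(1) unfolding half_value_def by blast
  have "fps_X ^ m * (fps_X ^ e * G) = fps_X ^ e * (fps_X ^ m * G)" by (simp only: mult_ac)
  also have "\<dots> = fps_of_poly (monom 1 e * A) + fps_of_poly (monom 1 e * B) * root_fps"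
    unfolding 1 by (simp add: fps_of_poly_mult fps_of_poly_monom' algebra_simps)
  finally have e: "fps_X ^ m * (fps_X ^ e * G) = \<dots>" .
  show ?thesis unfolding half_value_def
    by (intro exI conjI, rule e) (simp add: 1 poly_monom power_one_over field_simps)
qed

text \<open>Applied to the cube of the root, \<open>X d/dX\<close> gives \<open>- 18 X\<close> times
  the root, and \<open>- 18 X\<close> is \<open>- 3/2\<close> at \<open>1/12\<close>; all other
  terms keep a factor \<open>1 - 12 X\<close>. The operator \<open>X d/dX\<close> is chosen because
  it preserves the denominator \<open>X ^ m\<close>.\<close>

lemma half_value_deriv:
  assumes "sing_value G u v"
  shows "half_value (fps_X * fps_deriv G) (- 3/2 * v)"
proof -
  obtain m A B where 1: "fps_X ^ m * G = fps_of_poly A + fps_of_poly B * root_fps ^ 3"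
    "v = 12 ^ m * poly B (1/12)"
    using assms unfolding sing_value_def by blast
  \<comment> \<open>Differentiating \<open>root_fps ^ 2 = 1 - 12 X\<close> yields the derivative of
    the root in the product form that is needed, without a division.\<close>
  have "fps_deriv (root_fps ^ 2) = - 12"
    unfolding root_fps_square by (simp add: numeral_fps_const)
  then have "2 * (root_fps * fps_deriv root_fps) = 2 * (- 6)"
    by (simp add: power2_eq_square algebra_simps)
  then have rr: "root_fps * fps_deriv root_fps = - 6" by (metis mult_cancel_left zero_neq_numeral)
  have "fps_deriv (root_fps ^ 3) = 3 * root_fps * (root_fps * fps_deriv root_fps)"
    by (simp add: power3_eq_cube algebra_simps)
  then have r3: "fps_deriv (root_fps ^ 3) = - 18 * root_fps" by (simp add: rr)
  have Xm: "fps_X * fps_deriv (fps_X ^ m) = of_nat m * (fps_X ^ m :: real fps)"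
    by (induction m) (simp_all add: algebra_simps)
  have "fps_X * fps_deriv (fps_X ^ m * G) = of_nat m * (fps_X ^ m * G) + fps_X ^ m * (fps_X * fps_deriv G)"
    unfolding fps_deriv_mult distrib_left mult.assoc[symmetric] Xm by (simp add: mult_ac)
  then have "fps_X ^ m * (fps_X * fps_deriv G) =
      fps_X * fps_deriv (fps_X ^ m * G) - of_nat m * (fps_X ^ m * G)" by simp
  also have "fps_deriv (fps_X ^ m * G) = fps_of_poly (pderiv A) + fps_of_poly (pderiv B) * root_fps ^ 3
      + fps_of_poly B * (- 18 * root_fps)"
    unfolding 1(1) fps_deriv_add fps_deriv_mult r3 by (simp add: fps_of_poly_pderiv)
  also have "fps_X * (fps_of_poly (pderiv A) + fps_of_poly (pderiv B) * root_fps ^ 3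
      + fps_of_poly B * (- 18 * root_fps)) - of_nat m * (fps_X ^ m * G) =
     (fps_X * fps_of_poly (pderiv A) - of_nat m * fps_of_poly A) +
     ((fps_X * fps_of_poly (pderiv B) - of_nat m * fps_of_poly B) * root_fps ^ 2
      - 18 * fps_X * fps_of_poly B) * root_fps"
    unfolding 1(1) by (simp add: algebra_simps power2_eq_square power3_eq_cube)
  also have "\<dots> = fps_of_poly (monom 1 1 * pderiv A - smult (of_nat m) A) +
     fps_of_poly ((monom 1 1 * pderiv B - smult (of_nat m) B) * [:1, -12:] - smult 18 (monom 1 1 * B)) * root_fps"
    unfolding poly_crit(1)[symmetric]
    by (simp only: fps_of_poly_mult fps_of_poly_diff fps_of_poly_smult fps_of_poly_monom'
        power_one_right fps_of_nat numeral_fps_const mult.assoc)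
  finally have e: "fps_X ^ m * (fps_X * fps_deriv G) = \<dots>" .
  show ?thesis unfolding half_value_def
    by (intro exI conjI, rule e)
      (simp add: 1 poly_monom algebra_simps)
qed

section \<open>Linear asymptotics\<close>

text \<open>The constant term stays under an existential quantifier, since only the slope is
  computed.\<close>

definition lin_asymp :: "(nat \<Rightarrow> real) \<Rightarrow> real \<Rightarrow> bool" where
  "lin_asymp h a \<longleftrightarrow> (\<exists>c. (\<lambda>n. h n - (a * real n + c)) \<in> O(\<lambda>n. 1 / real n))"

lemma lin_asymp_cong:
  assumes "lin_asymp h a" "eventually (\<lambda>n. h n = h' n) at_top"
  shows "lin_asymp h' a"
proof -
  obtain c where c: "(\<lambda>n. h n - (a * real n + c)) \<in> O(\<lambda>n. 1 / real n)"
    using assms(1) unfolding lin_asymp_def by blast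
  have "eventually (\<lambda>n. h n - (a * real n + c) = h' n - (a * real n + c)) at_top"
    using assms(2) by eventually_elim simp
  from landau_o.big.in_cong[OF this] c show ?thesis unfolding lin_asymp_def by blast
qed

lemma lin_asymp_add:
  assumes "lin_asymp h a" "lin_asymp h' a'"
  shows "lin_asymp (\<lambda>n. h n + h' n) (a + a')"
proof -
  obtain c c' where c: "(\<lambda>n. h n - (a * real n + c)) \<in> O(\<lambda>n. 1 / real n)"
    "(\<lambda>n. h' n - (a' * real n + c')) \<in> O(\<lambda>n. 1 / real n)"
    using assms unfolding lin_asymp_def by blast
  have "(\<lambda>n. h n + h' n - ((a + a') * real n + (c + c'))) \<in> O(\<lambda>n. 1 / real n)"
    using sum_in_bigo(1)[OF c] by (simp add: algebra_simps)
  then show ?thesis unfolding lin_asymp_def by blast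
qed

lemma lin_asymp_cmult:
  assumes "lin_asymp h a"
  shows "lin_asymp (\<lambda>n. k * h n) (k * a)"
proof -
  obtain c where c: "(\<lambda>n. h n - (a * real n + c)) \<in> O(\<lambda>n. 1 / real n)"
    using assms unfolding lin_asymp_def by blast
  have "(\<lambda>n. k * (h n - (a * real n + c))) \<in> O(\<lambda>n. 1 / real n)"
    using c by simp
  then have "(\<lambda>n. k * h n - (k * a * real n + k * c)) \<in> O(\<lambda>n. 1 / real n)"
    by (simp add: algebra_simps)
  then show ?thesis unfolding lin_asymp_def by blast
qed

lemma lin_asymp_0: "lin_asymp (\<lambda>n. 0) 0"
  unfolding lin_asymp_def by (rule exI[of _ 0]) simp

lemma lin_asymp_sum:
  assumes "finite I" "\<And>i. i \<in> I \<Longrightarrow> lin_asymp (h i) (a i)"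
  shows "lin_asymp (\<lambda>n. \<Sum>i\<in>I. h i n) (\<Sum>i\<in>I. a i)"
  using assms by (induction I rule: finite_induct) (simp_all add: lin_asymp_0 lin_asymp_add)

lemma ratio_asymp:
  fixes c1 c2 d1 d2 :: real
  assumes "d1 \<noteq> 0"
  shows "(\<lambda>n. (c1 * real n + c2) / (d1 * real n + d2) - (c1/d1 + (c2 - c1/d1 * d2) / d1 / real n))
    \<in> O(\<lambda>n. 1 / real n ^ 2)"
proof -
  define e where "e = d2 / d1"
  define v where "v = (c2 - c1/d1 * d2) / d1"
  have 1: "(\<lambda>n. v / (real n + e) - v / real n) \<in> O(\<lambda>n. 1 / real n ^ 2)"
    by real_asymp
  have "eventually (\<lambda>n. real n + e > 0) at_top" by real_asymp
  then have "eventually (\<lambda>n. v / (real n + e) - v / real n =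
      (c1 * real n + c2) / (d1 * real n + d2) - (c1/d1 + v / real n)) at_top"
  proof eventually_elim
    case (elim n)
    have "d1 * real n + d2 = d1 * (real n + e)" using assms by (simp add: e_def field_simps)
    moreover have "c1 * real n + c2 = c1 / d1 * (d1 * (real n + e)) + v * d1"
      using assms by (simp add: e_def v_def field_simps)
    ultimately have "(c1 * real n + c2) / (d1 * real n + d2) =
        (c1 / d1 * (d1 * (real n + e)) + v * d1) / (d1 * (real n + e))" by simp
    also have "\<dots> = c1 / d1 + v / (real n + e)"
      using elim assms by (simp add: add_divide_distrib)
    finally show ?case by simp
  qed
  from landau_o.big.in_cong[OF this] 1 show ?thesis by (simp add: v_def)
qed

text \<open>The ratio is expanded up to an error of order \<open>1 / n ^ 2\<close>, because it is
  multiplied by a quantity that grows linearly.\<close>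

lemma lin_asymp_mult_ratio:
  fixes c1 c2 d1 d2 :: real
  assumes h: "lin_asymp h a" and d: "d1 \<noteq> 0"
  shows "lin_asymp (\<lambda>n. h n * ((c1 * real n + c2) / (d1 * real n + d2))) (a * (c1 / d1))"
proof -
  obtain c where c: "(\<lambda>n. h n - (a * real n + c)) \<in> O(\<lambda>n. 1 / real n)"
    using h unfolding lin_asymp_def by blast
  define q where "q n = (c1 * real n + c2) / (d1 * real n + d2)" for n
  define u v where "u = c1 / d1" and "v = (c2 - c1/d1 * d2) / d1"
  have q: "(\<lambda>n. q n - (u + v / real n)) \<in> O(\<lambda>n. 1 / real n ^ 2)"
    using ratio_asymp[OF d, of c1 c2 d2] by (simp add: q_def u_def v_def)
  have "(\<lambda>n. (q n - (u + v / real n)) + (u + v / real n)) \<in> O(\<lambda>n. 1)"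
  proof (rule sum_in_bigo(1))
    have "(\<lambda>n. 1 / real n ^ 2) \<in> O(\<lambda>n. 1)" by real_asymp
    with q show "(\<lambda>n. q n - (u + v / real n)) \<in> O(\<lambda>n. 1)" by (rule landau_o.big_trans)
    show "(\<lambda>n. u + v / real n) \<in> O(\<lambda>n. 1)" by real_asymp
  qed
  then have q1: "q \<in> O(\<lambda>n. 1)" by simp
  have t1: "(\<lambda>n. (h n - (a * real n + c)) * q n) \<in> O(\<lambda>n. 1 / real n)"
    using landau_o.big.mult[OF c q1] by simp
  have "(\<lambda>n. (a * real n + c) * (q n - (u + v / real n))) \<in> O(\<lambda>n. real n * (1 / real n ^ 2))"
    by (rule landau_o.big.mult[OF _ q]) real_asymp
  moreover have "(\<lambda>n. real n * (1 / real n ^ 2)) \<in> O(\<lambda>n. 1 / real n)" by real_asymp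
  ultimately have t2: "(\<lambda>n. (a * real n + c) * (q n - (u + v / real n))) \<in> O(\<lambda>n. 1 / real n)"
    by (rule landau_o.big_trans)
  have t3: "(\<lambda>n. c * v / real n) \<in> O(\<lambda>n. 1 / real n)" by real_asymp
  have "eventually (\<lambda>n. (h n - (a * real n + c)) * q n + (a * real n + c) * (q n - (u + v / real n)) + c * v / real n
      = h n * q n - (a * u * real n + (a * v + c * u))) at_top"
    using eventually_gt_at_top[of 0]
    by eventually_elim (simp add: field_simps)
  from landau_o.big.in_cong[OF this] sum_in_bigo(1)[OF sum_in_bigo(1)[OF t1 t2] t3]
  have "(\<lambda>n. h n * q n - (a * u * real n + (a * v + c * u))) \<in> O(\<lambda>n. 1 / real n)" by simp
  then show ?thesis unfolding lin_asymp_def q_def u_def by blast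
qed

section \<open>Coefficients relative to the number of rooted maps\<close>

lemma root_coeff_nonzero: "root_coeff n \<noteq> 0"
proof (induction n)
  case 0 then show ?case by (simp add: root_coeff_def root_fps_0)
next
  case (Suc n)
  have "12 * real n - 6 \<noteq> 0"
  proof
    assume "12 * real n - 6 = 0"
    then have "real (2 * n) = real 1" by simp
    then have "2 * n = 1" by (simp only: of_nat_eq_iff)
    then show False by presburger
  qed
  then show ?case using root_coeff_Suc[of n] Suc by auto
qed

text \<open>Coefficient \<open>n + 2\<close> of \<open>fill_fps_1_root\<close>, simplified by
  \<open>root_coeff_Suc\<close>. It makes \<open>root_coeff (n + 1) / fill 1 n\<close> exactly
  linear in \<open>n\<close>, the anchor of all asymptotics below.\<close>

lemma fill_1_root: "3 * (real n + 2) * real (fill 1 n) = - root_coeff (n + 1)"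
proof -
  have r3: "root_fps ^ 3 = (1 - 12 * fps_X) * root_fps"
    unfolding root_fps_square[symmetric] by (simp add: power2_eq_square power3_eq_cube)
  have "54 * fps_X ^ 2 * fill_fps 1 1 = fps_X ^ 2 * (54 * fill_fps 1 1)" by (simp only: mult_ac)
  moreover have "fps_nth (fps_X ^ 2 * (54 * fill_fps 1 1)) (n + 2) = 54 * real (fill 1 n)"
    by (simp add: fps_X_power_mult_nth numeral_fps_const fill_fps_nth)
  ultimately have "fps_nth (54 * fps_X ^ 2 * fill_fps 1 1) (n + 2) = 54 * real (fill 1 n)" by metis
  moreover have "fps_nth (18 * fps_X - 1 + root_fps ^ 3) (n + 2) = root_coeff (n + 2) - 12 * root_coeff (n + 1)"
    by (simp add: r3 left_diff_distrib numeral_fps_const mult.assoc root_coeff_def)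
  ultimately have "54 * real (fill 1 n) = root_coeff (n + 2) - 12 * root_coeff (n + 1)"
    using fill_fps_1_root by simp
  then have "54 * real (fill 1 n) * (real n + 2) = (root_coeff (n + 2) - 12 * root_coeff (n + 1)) * (real n + 2)"
    by (simp only:)
  also have "\<dots> = root_coeff (n + 2) * (real n + 2) - 12 * root_coeff (n + 1) * (real n + 2)"
    by (simp only: left_diff_distrib)
  also have "root_coeff (n + 2) * (real n + 2) = root_coeff (n + 1) * (12 * real n + 6)"
    using root_coeff_Suc[of "n + 1"] by (simp add: algebra_simps)
  finally show ?thesis by (simp add: algebra_simps)
qed

lemma fill_1_pos: "fill 1 n > 0"
  using fill_1_root[of n] root_coeff_nonzero[of "n + 1"] by (cases "fill 1 n = 0") auto

text \<open>The exact ratio of consecutive values is \<open>(12 n + 6) / (n + 3)\<close>.\<close>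

lemma fill_1_Suc_le: "fill 1 (Suc n) \<le> 12 * fill 1 n"
proof -
  have "3 * (real n + 3) * real (fill 1 (Suc n)) * (real n + 2) = - root_coeff (n + 2) * (real n + 2)"
    using fill_1_root[of "Suc n"] by (simp add: algebra_simps)
  also have "\<dots> = - root_coeff (n + 1) * (12 * real n + 6)"
    using root_coeff_Suc[of "n + 1"] by (simp add: algebra_simps)
  also have "\<dots> = 3 * (real n + 2) * real (fill 1 n) * (12 * real n + 6)"
    by (simp only: fill_1_root)
  finally have "3 * (real n + 2) * ((real n + 3) * real (fill 1 (Suc n))) =
      3 * (real n + 2) * ((12 * real n + 6) * real (fill 1 n))" by (simp only: mult_ac)
  then have "(real n + 3) * real (fill 1 (Suc n)) = (12 * real n + 6) * real (fill 1 n)"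
    by (subst (asm) mult_cancel_left) (simp add: add_eq_0_iff)
  also have "\<dots> \<le> (12 * (real n + 3)) * real (fill 1 n)" by (intro mult_right_mono) auto
  finally have "(real n + 3) * real (fill 1 (Suc n)) \<le> (real n + 3) * (12 * real (fill 1 n))"
    by (simp add: algebra_simps)
  then have "real (fill 1 (Suc n)) \<le> 12 * real (fill 1 n)" by simp
  then show ?thesis by linarith
qed

lemma fill_1_le: "fill 1 (n + e) \<le> 12 ^ e * fill 1 n"
proof (induction e)
  case (Suc e)
  have "fill 1 (n + Suc e) \<le> 12 * fill 1 (n + e)" using fill_1_Suc_le[of "n + e"] by simp
  also have "\<dots> \<le> 12 * (12 ^ e * fill 1 n)" using Suc by simp
  finally show ?case by simp
qed simp

lemma fill_mono: "fill (Suc k) n \<le> fill (Suc (Suc k)) n"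
  by (cases n) simp_all

lemma fill_1_mono: "k > 0 \<Longrightarrow> fill 1 n \<le> fill k n"
proof (induction k)
  case (Suc k)
  then show ?case using fill_mono[of "k - 1" n] by (cases "k = 0") (auto intro: order_trans)
qed simp

text \<open>Each unit of shift multiplies the quotient by a ratio of linear functions that tends to
  \<open>12\<close>, by \<open>root_coeff_Suc\<close>. Upward and downward shifts are separate
  because \<open>n - k\<close> is truncated.\<close>

lemma lin_asymp_root_up: "lin_asymp (\<lambda>n. root_coeff (n + Suc k) / real (fill 1 n)) (- 3 * 12 ^ k)"
proof (induction k)
  case 0
  have "root_coeff (n + Suc 0) / real (fill 1 n) = - 3 * real n + (- 6)" for n
    using fill_1_root[of n] fill_1_pos[of n] by (simp add: field_simps)
  then have "root_coeff (n + Suc 0) / real (fill 1 n) - (- 3 * 12 ^ 0 * real n + (- 6)) = 0" for n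
    by simp
  then show ?case unfolding lin_asymp_def by (intro exI[of _ "-6"]) (simp only:, simp)
next
  case (Suc k)
  have "lin_asymp (\<lambda>n. root_coeff (n + Suc k) / real (fill 1 n) *
      ((12 * real n + (12 * (real k + 1) - 6)) / (1 * real n + (real k + 2)))) (- 3 * 12 ^ k * (12 / 1))"
    by (rule lin_asymp_mult_ratio[OF Suc]) simp
  moreover have "root_coeff (n + Suc k) / real (fill 1 n) *
      ((12 * real n + (12 * (real k + 1) - 6)) / (1 * real n + (real k + 2))) =
      root_coeff (n + Suc (Suc k)) / real (fill 1 n)" for n
  proof -
    have "root_coeff (n + Suc (Suc k)) = root_coeff (n + Suc k) *
        ((12 * real n + (12 * (real k + 1) - 6)) / (1 * real n + (real k + 2)))"
      using root_coeff_Suc[of "n + Suc k"] by (simp add: field_simps)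
    then show ?thesis by simp
  qed
  ultimately show ?case by (simp add: mult_ac)
qed

lemma lin_asymp_root_down: "lin_asymp (\<lambda>n. root_coeff (n - k) / real (fill 1 n)) (- (1/4) / 12 ^ k)"
proof (induction k)
  case 0
  have "lin_asymp (\<lambda>n. root_coeff (n + Suc 0) / real (fill 1 n) *
      ((1 * real n + 1) / (12 * real n + (- 6)))) (- 3 * 12 ^ 0 * (1 / 12))"
    by (rule lin_asymp_mult_ratio[OF lin_asymp_root_up]) simp
  then have "lin_asymp (\<lambda>n. root_coeff (n - 0) / real (fill 1 n)) (- 3 * 12 ^ 0 * (1 / 12))"
  proof (rule lin_asymp_cong, intro eventually_mono[OF eventually_gt_at_top[of 0]])
    fix n :: nat assume n: "0 < n"
    then have nz: "12 * real n + (- 6) \<noteq> 0" by linarith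
    have "root_coeff (n + Suc 0) * ((1 * real n + 1) / (12 * real n + (- 6))) = root_coeff n"
      using root_coeff_Suc[of n] nz by (simp add: field_simps)
    then show "root_coeff (n + Suc 0) / real (fill 1 n) * ((1 * real n + 1) / (12 * real n + (- 6))) =
        root_coeff (n - 0) / real (fill 1 n)"
      unfolding times_divide_eq_left[of "root_coeff (n + Suc 0)"] diff_zero by (rule arg_cong)
  qed
  then show ?case by simp
next
  case (Suc k)
  have "lin_asymp (\<lambda>n. root_coeff (n - k) / real (fill 1 n) *
      ((1 * real n + (- real k)) / (12 * real n + (- 12 * (real k + 1) - 6)))) (- (1/4) / 12 ^ k * (1 / 12))"
    by (rule lin_asymp_mult_ratio[OF Suc]) simp
  then have "lin_asymp (\<lambda>n. root_coeff (n - Suc k) / real (fill 1 n)) (- (1/4) / 12 ^ k * (1 / 12))"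
  proof (rule lin_asymp_cong, intro eventually_mono[OF eventually_gt_at_top[of "Suc k"]])
    fix n :: nat assume n: "Suc k < n"
    define j where "j = n - Suc k"
    have nj: "n = j + Suc k" "n - k = Suc j" "j > 0" using n by (auto simp: j_def)
    have nz: "12 * real j - 6 \<noteq> 0" using nj(3) by linarith
    have e: "1 * real n + (- real k) = real j + 1" "12 * real n + (- 12 * (real k + 1) - 6) = 12 * real j - 6"
      using nj(1) by simp_all
    have "root_coeff (n - k) * ((real j + 1) / (12 * real j - 6)) = root_coeff j"
      using root_coeff_Suc[of j] nz unfolding nj(2) by (simp add: field_simps)
    then show "root_coeff (n - k) / real (fill 1 n) *
        ((1 * real n + (- real k)) / (12 * real n + (- 12 * (real k + 1) - 6))) =
        root_coeff (n - Suc k) / real (fill 1 n)"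
      unfolding e j_def[symmetric] by (metis times_divide_eq_left)
  qed
  then show ?case by simp
qed

lemma lin_asymp_root:
  "lin_asymp (\<lambda>n. root_coeff (n + m - j) / real (fill 1 n)) (- (12 ^ m / (4 * 12 ^ j)))"
proof (cases "j < m")
  case True
  define k where "k = m - Suc j"
  have m: "m = j + Suc k" using True by (simp add: k_def)
  have "n + m - j = n + Suc k" for n by (simp add: m)
  then show ?thesis using lin_asymp_root_up[of k] by (simp add: m power_add)
next
  case False
  define k where "k = j - m"
  have j: "j = m + k" using False by (simp add: k_def)
  have "n + m - j = n - k" for n by (simp add: j)
  then show ?thesis using lin_asymp_root_down[of k] by (simp add: j power_add)
qed

text \<open>For large \<open>n\<close> the polynomial \<open>A\<close> has no coefficient left, and
  \<open>B\<close> gives a fixed linear combination of shifted coefficients of the root. Their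
  slopes \<open>- (12 ^ m / (4 * 12 ^ j))\<close> assemble to the value of \<open>B\<close> at
  \<open>1/12\<close>.\<close>

lemma half_value_asymp:
  assumes "half_value G w"
  shows "lin_asymp (\<lambda>n. fps_nth G n / real (fill 1 n)) (- w / 4)"
proof -
  obtain m A B where 1: "fps_X ^ m * G = fps_of_poly A + fps_of_poly B * root_fps"
    "w = 12 ^ m * poly B (1/12)"
    using assms unfolding half_value_def by blast
  have "lin_asymp (\<lambda>n. \<Sum>j\<le>degree B. coeff B j * (root_coeff (n + m - j) / real (fill 1 n)))
      (\<Sum>j\<le>degree B. coeff B j * (- (12 ^ m / (4 * 12 ^ j))))"
    by (intro lin_asymp_sum lin_asymp_cmult lin_asymp_root) simp
  moreover have "(\<Sum>j\<le>degree B. coeff B j * (- (12 ^ m / (4 * 12 ^ j)))) = - w / 4"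
    unfolding 1(2) poly_altdef
    by (simp add: sum_distrib_left sum_negf sum_divide_distrib power_one_over field_simps)
  moreover have "eventually (\<lambda>n. (\<Sum>j\<le>degree B. coeff B j * (root_coeff (n + m - j) / real (fill 1 n))) =
      fps_nth G n / real (fill 1 n)) at_top"
    using eventually_gt_at_top[of "degree A + degree B"]
  proof eventually_elim
    case (elim n)
    have "fps_nth G n = fps_nth (fps_X ^ m * G) (n + m)" by (simp add: fps_X_power_mult_nth)
    also have "\<dots> = (\<Sum>j=0..n+m. coeff B j * root_coeff (n + m - j))"
      using elim unfolding 1(1) by (simp add: fps_mult_nth coeff_eq_0 root_coeff_def)
    also have "\<dots> = (\<Sum>j\<le>degree B. coeff B j * root_coeff (n + m - j))"
      by (rule sum.mono_neutral_right) (use elim in \<open>auto simp: coeff_eq_0\<close>)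
    finally show ?case by (simp add: sum_divide_distrib)
  qed
  ultimately show ?thesis using lin_asymp_cong by simp
qed

text \<open>The tool for positivity: a crude linear lower bound passes to the slope, whatever the
  constant terms are.\<close>

lemma lin_asymp_lower:
  assumes h: "lin_asymp h a" and "eventually (\<lambda>n. h n \<ge> b * real n - d) at_top"
  shows "a \<ge> b"
proof -
  obtain c where c: "(\<lambda>n. h n - (a * real n + c)) \<in> O(\<lambda>n. 1 / real n)"
    using h unfolding lin_asymp_def by blast
  have "(\<lambda>n. 1 / real n) \<in> O(\<lambda>n. 1)" by real_asymp
  with c have "(\<lambda>n. h n - (a * real n + c)) \<in> O(\<lambda>n. 1)" by (rule landau_o.big_trans)
  then obtain C where C: "eventually (\<lambda>n. norm (h n - (a * real n + c)) \<le> C) at_top"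
    by (auto elim!: landau_o.bigE)
  show ?thesis
  proof (rule ccontr)
    assume "\<not> a \<ge> b"
    then have "filterlim (\<lambda>n. (b - a) * real n) at_top at_top"
      by (intro filterlim_tendsto_pos_mult_at_top[OF tendsto_const] filterlim_real_sequentially) simp
    then have "eventually (\<lambda>n. (b - a) * real n > C + c + d) at_top"
      by (simp add: filterlim_at_top_dense)
    with C assms(2) have "eventually (\<lambda>n::nat. False) at_top"
    proof eventually_elim
      case (elim n)
      have "h n \<le> a * real n + c + C" using elim(1) by (simp add: abs_le_iff)
      then show ?case using elim by (simp add: algebra_simps)
    qed
    then show False by simp
  qed
qed

lemma lin_asymp_unique:
  assumes "lin_asymp h a" "lin_asymp h b"
  shows "a = b"
proof -
  have *: "b \<le> a" if ab: "lin_asymp h a" "lin_asymp h b" for a b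
  proof -
    obtain c where c: "(\<lambda>n. h n - (b * real n + c)) \<in> O(\<lambda>n. 1 / real n)"
      using ab(2) unfolding lin_asymp_def by blast
    have "(\<lambda>n. 1 / real n) \<in> O(\<lambda>n. 1)" by real_asymp
    with c have "(\<lambda>n. h n - (b * real n + c)) \<in> O(\<lambda>n. 1)" by (rule landau_o.big_trans)
    then obtain C where C: "eventually (\<lambda>n. norm (h n - (b * real n + c)) \<le> C) at_top"
      by (auto elim!: landau_o.bigE)
    have "eventually (\<lambda>n. h n \<ge> b * real n - (C - c)) at_top"
      using C by eventually_elim (simp add: abs_le_iff)
    with ab(1) show ?thesis by (rule lin_asymp_lower)
  qed
  from *[OF assms] *[OF assms(2,1)] show ?thesis by simp
qed

section \<open>Labelled maps\<close>

text \<open>The functions are extensional, so that an embedding is determined by its values on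
  \<open>A\<close> and can be counted.\<close>

definition embeddings :: "('c \<Rightarrow> 'c) \<Rightarrow> 'c set \<Rightarrow> ('b \<Rightarrow> 'b) \<Rightarrow> 'b set \<Rightarrow> ('c \<Rightarrow> 'b) set" where
  "embeddings r A r' D = {f \<in> A \<rightarrow>\<^sub>E D. inj_on f A \<and> (\<forall>a\<in>A. f (r a) = r' (f a))}"

lemma arc_inv_remove:
  assumes "arc_inv r A" "a \<in> A"
  shows "arc_inv r (A - {a, r a})" "card A = card (A - {a, r a}) + 2"
proof -
  show "arc_inv r (A - {a, r a})" by (rule arc_inv_Diff[OF assms(1) arc_inv_pair[OF assms]])
  have "A = insert a (insert (r a) (A - {a, r a}))" using arc_invD(1)[OF assms] assms(2) by auto
  moreover have "card (insert a (insert (r a) (A - {a, r a}))) = card (A - {a, r a}) + 2"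
    using arc_inv_finite[OF assms(1)] arc_invD(3)[OF assms] by simp
  ultimately show "card A = card (A - {a, r a}) + 2" by simp
qed

lemma arc_inv_even: "arc_inv r A \<Longrightarrow> even (card A)"
proof (induction "card A" arbitrary: A rule: less_induct)
  case less
  show ?case
  proof (cases "A = {}")
    case False
    then obtain a where a: "a \<in> A" by blast
    show ?thesis using less.hyps[OF _ arc_inv_remove(1)[OF less.prems a]] arc_inv_remove(2)[OF less.prems a]
      by simp
  qed simp
qed

lemma finite_embeddings: "finite A \<Longrightarrow> finite D \<Longrightarrow> finite (embeddings r A r' D)"
  by (rule finite_subset[of _ "A \<rightarrow>\<^sub>E D"]) (auto simp: embeddings_def intro: finite_PiE)

text \<open>The image \<open>y\<close> of \<open>a\<close> determines the image of
  \<open>r a\<close>, and the remaining edges go anywhere except to the edge of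
  \<open>y\<close>.\<close>

lemma embeddings_insert:
  assumes A: "arc_inv r A" and D: "arc_inv r' D" and a: "a \<in> A"
  shows "bij_betw (\<lambda>f. (f a, restrict f (A - {a, r a}))) (embeddings r A r' D)
    (SIGMA y:D. embeddings r (A - {a, r a}) r' (D - {y, r' y}))"
proof (rule bij_betw_byWitness[where f' = "\<lambda>(y, f) x. if x = a then y else if x = r a then r' y else f x"])
  let ?A = "A - {a, r a}"
  note aa = arc_invD[OF A a]
  show "\<forall>f\<in>embeddings r A r' D.
      (case (f a, restrict f ?A) of (y, f) \<Rightarrow> \<lambda>x. if x = a then y else if x = r a then r' y else f x) = f"
  proof
    fix f assume "f \<in> embeddings r A r' D"
    then have f: "f \<in> A \<rightarrow>\<^sub>E D" "f (r a) = r' (f a)" using a by (auto simp: embeddings_def)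
    show "(case (f a, restrict f ?A) of (y, f) \<Rightarrow> \<lambda>x. if x = a then y else if x = r a then r' y else f x) = f"
      using f PiE_arb[OF f(1)] by (auto simp: fun_eq_iff restrict_def)
  qed
  show "\<forall>p\<in>SIGMA y:D. embeddings r ?A r' (D - {y, r' y}).
      (\<lambda>f. (f a, restrict f ?A)) (case p of (y, f) \<Rightarrow> \<lambda>x. if x = a then y else if x = r a then r' y else f x) = p"
    by (auto simp: embeddings_def fun_eq_iff restrict_def PiE_def extensional_def)
  show "(\<lambda>f. (f a, restrict f ?A)) ` embeddings r A r' D \<subseteq>
      (SIGMA y:D. embeddings r ?A r' (D - {y, r' y}))"
  proof clarify
    fix f assume "f \<in> embeddings r A r' D"
    then have f: "\<And>x. x \<in> A \<Longrightarrow> f x \<in> D" "inj_on f A" "\<And>x. x \<in> A \<Longrightarrow> f (r x) = r' (f x)"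
      by (auto simp: embeddings_def)
    have "f x \<noteq> f a" "f x \<noteq> r' (f a)" if "x \<in> ?A" for x
      using that inj_on_eq_iff[OF f(2), of x a] inj_on_eq_iff[OF f(2), of x "r a"] a aa f(3)[OF a] by auto
    moreover have "r x \<in> ?A" if "x \<in> ?A" for x
      using arc_invD(1)[OF arc_inv_remove(1)[OF A a] that] .
    moreover have "inj_on f ?A" using f(2) by (rule inj_on_subset) auto
    ultimately show "f a \<in> D \<and> restrict f ?A \<in> embeddings r ?A r' (D - {f a, r' (f a)})"
      using f a by (auto simp: embeddings_def inj_on_restrict_eq)
  qed
  show "(\<lambda>(y, f) x. if x = a then y else if x = r a then r' y else f x) `
      (SIGMA y:D. embeddings r ?A r' (D - {y, r' y})) \<subseteq> embeddings r A r' D"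
  proof clarify
    fix y f assume y: "y \<in> D" and "f \<in> embeddings r ?A r' (D - {y, r' y})"
    then have f: "\<And>x. x \<in> ?A \<Longrightarrow> f x \<in> D - {y, r' y}" "inj_on f ?A" "\<And>x. x \<in> ?A \<Longrightarrow> f (r x) = r' (f x)"
      "\<And>x. x \<notin> ?A \<Longrightarrow> f x = undefined"
      by (auto simp: embeddings_def PiE_def extensional_def)
    note yy = arc_invD[OF D y]
    let ?g = "\<lambda>x. if x = a then y else if x = r a then r' y else f x"
    have rx: "r x \<in> ?A" if "x \<in> ?A" for x
      using arc_invD(1)[OF arc_inv_remove(1)[OF A a] that] .
    have cases_A: "x = a \<or> x = r a \<or> x \<in> ?A" if "x \<in> A" for x using that by auto
    have "inj_on ?g A"
    proof (rule inj_onI)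
      fix u v assume "u \<in> A" "v \<in> A" "?g u = ?g v"
      then show "u = v"
        using cases_A[of u] cases_A[of v] f(1)[of u] f(1)[of v] yy aa inj_onD[OF f(2), of u v]
        by (auto split: if_splits)
    qed
    moreover have "?g (r x) = r' (?g x)" if "x \<in> A" for x
      using cases_A[OF that] yy aa f(3)[of x] rx[of x] by auto
    moreover have "?g \<in> A \<rightarrow>\<^sub>E D"
      using f(1,4) y yy(1) a aa(1) by (auto simp: PiE_def extensional_def)
    ultimately show "?g \<in> embeddings r A r' D" by (simp add: embeddings_def)
  qed
qed

text \<open>Each edge has as many choices as there are arcs left. For \<open>e > n\<close> the
  factor with \<open>i = n\<close> makes the product zero.\<close>

lemma card_embeddings:
  assumes "arc_inv r A" "card A = 2 * e" "arc_inv r' D" "card D = 2 * n"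
  shows "card (embeddings r A r' D) = (\<Prod>i<e. 2 * (n - i))"
  using assms
proof (induction e arbitrary: A D n)
  case 0
  then have "A = {}" using arc_inv_finite by fastforce
  then show ?case by (simp add: embeddings_def)
next
  case (Suc e)
  then have "A \<noteq> {}" by auto
  then obtain a where a: "a \<in> A" by blast
  note A' = arc_inv_remove[OF Suc.prems(1) a]
  have "card (embeddings r A r' D) = card (SIGMA y:D. embeddings r (A - {a, r a}) r' (D - {y, r' y}))"
    by (rule bij_betw_same_card[OF embeddings_insert[OF Suc.prems(1,3) a]])
  also have "\<dots> = (\<Sum>y\<in>D. card (embeddings r (A - {a, r a}) r' (D - {y, r' y})))"
    by (intro card_SigmaI ballI finite_embeddings finite_Diff arc_inv_finite[OF Suc.prems(1)]
        arc_inv_finite[OF Suc.prems(3)])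
  also have "\<dots> = (\<Sum>y\<in>D. \<Prod>i<e. 2 * (n - 1 - i))"
  proof (rule sum.cong[OF refl])
    fix y assume y: "y \<in> D"
    note D' = arc_inv_remove[OF Suc.prems(3) y]
    show "card (embeddings r (A - {a, r a}) r' (D - {y, r' y})) = (\<Prod>i<e. 2 * (n - 1 - i))"
      by (rule Suc.IH[OF A'(1) _ D'(1)]) (use A'(2) D'(2) Suc.prems in auto)
  qed
  also have "\<dots> = (\<Prod>i<Suc e. 2 * (n - i))"
    unfolding prod.lessThan_Suc_shift using Suc.prems(4) by simp
  finally show ?case .
qed

lemma embeddings_factorial:
  "e \<le> n \<Longrightarrow> (\<Prod>i<e. 2 * (n - i)) * (2 ^ (n - e) * fact (n - e)) = (2 ^ n * fact n :: nat)"
proof (induction e)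
  case (Suc e)
  then obtain k where k: "n - e = Suc k" by (cases "n - e") auto
  then have k': "n - Suc e = k" by simp
  have "(\<Prod>i<Suc e. 2 * (n - i)) * (2 ^ (n - Suc e) * fact (n - Suc e)) =
      (\<Prod>i<e. 2 * (n - i)) * (2 * Suc k * (2 ^ k * fact k))"
    by (simp only: prod.lessThan_Suc k k' mult.assoc)
  also have "2 * Suc k * (2 ^ k * fact k) = 2 ^ (n - e) * fact (n - e)" by (simp add: k algebra_simps)
  also have "(\<Prod>i<e. 2 * (n - i)) * (2 ^ (n - e) * fact (n - e)) = 2 ^ n * fact n"
    by (rule Suc.IH) (use Suc.prems in simp)
  finally show ?case .
qed simp

section \<open>Counting planar permutations, and duality\<close>

definition planar_perms :: "('b \<Rightarrow> 'b) \<Rightarrow> 'b set \<Rightarrow> ('b \<Rightarrow> 'b) set" where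
  "planar_perms r D = {s. s permutes D \<and> transitive_on r s D \<and> planar_on r s D}"

lemma finite_planar_perms: "finite D \<Longrightarrow> finite (planar_perms r D)"
  by (rule finite_subset[of _ "{s. s permutes D}"]) (auto simp: planar_perms_def intro: finite_permutations)

lemma card_fillings:
  assumes A: "arc_inv r A" "A \<noteq> {}" "s permutes A" "transitive_on r s A" "planar_on r s A"
    and X: "arc_inv r X" "A \<inter> X = {}" "card X = 2 * n"
  shows "real (card (fillings r A s A X)) =
    2 ^ n * fact n * fps_nth (\<Prod>P\<in>orbits_on (s \<circ> r) A. fill_fps 1 (card P)) n"
proof -
  have e: "card (orbits_on s A) + card (orbits_on (s \<circ> r) A) \<le> card A div 2 + 2"
    using A(5) by (simp add: planar_on_def)
  have P: "A \<inter> P = P" if "P \<in> orbits_on (s \<circ> r) A" for P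
    using orbits_on_eqD(2)[OF arc_inv_finite[OF A(1)] face_bij[OF A(1,3)] that] by auto
  from fillings_count[OF A(1-4) order_refl X e, of 1] A(5)
  have "(\<Sum>g\<in>fillings r A s A X. 1 ^ (card (region r g A {} \<inter> X) div 2)) =
      2 ^ n * fact n * fps_nth (face_prod (\<lambda>u. fill_fps (if u then 1 else 1)) r A s A {}) n" by blast
  then show ?thesis by (simp add: face_prod_def P cong: prod.cong)
qed

lemma fillings_all_corners:
  assumes A: "arc_inv r A" and s: "s permutes A" and D: "finite (A \<union> X)"
  shows "fillings r A s A X = {g \<in> planar_perms r (A \<union> X). restrict_return g A = s}"
proof -
  have "(\<forall>a\<in>A. first_return g A a = s a) \<longleftrightarrow> restrict_return g A = s" for g
  proof
    assume "\<forall>a\<in>A. first_return g A a = s a"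
    then show "restrict_return g A = s"
      using permutes_not_in[OF s] by (auto simp: restrict_return_def fun_eq_iff)
  qed (auto simp: restrict_return_def fun_eq_iff split: if_splits)
  then show ?thesis by (auto simp: fillings_def planar_perms_def)
qed

lemma permutes_pair:
  assumes "s permutes {a, b}" "a \<noteq> b"
  shows "s = id \<or> s = swp a b"
proof -
  have "s a \<in> {a, b}" "s b \<in> {a, b}" using permutes_in_image[OF assms(1)] by blast+
  moreover have "s a \<noteq> s b" using permutes_inj[OF assms(1)] assms(2) by (auto dest: injD)
  ultimately have "(s a = a \<and> s b = b) \<or> (s a = b \<and> s b = a)" by auto
  then show ?thesis
  proof
    assume "s a = a \<and> s b = b"
    then have "s x = x" for x using permutes_not_in[OF assms(1), of x] by (cases "x \<in> {a, b}") auto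
    then show ?thesis by (auto simp: fun_eq_iff)
  next
    assume "s a = b \<and> s b = a"
    then have "s x = swp a b x" for x
      using permutes_not_in[OF assms(1), of x] by (cases "x = a"; cases "x = b") auto
    then show ?thesis by (auto simp: fun_eq_iff)
  qed
qed

text \<open>Restricted to the edge of \<open>x\<close>, a map is either a segment, with one face of
  degree two, or a loop, with two faces of degree one. The two numbers of fillings add up to the
  recursion for \<open>fill 1 n\<close>, whose term for a closed corner is zero.\<close>

lemma card_planar_perms:
  assumes D: "arc_inv r D" "card D = 2 * n" "n > 0" and x: "x \<in> D"
  shows "real (card (planar_perms r D)) = 2 ^ (n - 1) * fact (n - 1) * real (fill 1 n)"
proof -
  define A where "A = {x, r x}"
  define X where "X = D - A"
  note xx = arc_invD[OF D(1) x]
  have A: "arc_inv r A" unfolding A_def by (rule arc_inv_pair[OF D(1) x])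
  have X: "arc_inv r X" unfolding X_def by (rule arc_inv_Diff[OF D(1) A])
  have AX: "A \<union> X = D" "A \<inter> X = {}" using x xx by (auto simp: A_def X_def)
  have cX: "card X = 2 * (n - 1)" using arc_inv_remove(2)[OF D(1) x] D(2) by (simp add: X_def A_def)
  have fin: "finite D" using D(1) by (rule arc_inv_finite)
  have pid: "id permutes A" by (rule permutes_id)
  have psw: "swp x (r x) permutes A" by (rule permutes_swap_id) (auto simp: A_def)
  have o_id: "orbit id a = {a}" for a :: 'a by (simp add: orbit_eq_singleton_iff)
  have o_r: "orbits_on r A = {A}"
  proof -
    have two: "{1..2::nat} = {1, 2}" by auto
    have "(r ^^ 2) x = x" "(r ^^ 2) (r x) = r x" using xx by (simp_all add: numeral_2_eq_2)
    from this[THEN orbit_funpow_image, unfolded two] xx show ?thesis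
      by (auto simp: orbits_on_def A_def numeral_2_eq_2)
  qed
  have r_swp: "swp x (r x) a = r a" if "a \<in> A" for a using that xx by (auto simp: A_def)
  have o_swp: "orbits_on (swp x (r x)) A = {A}"
  proof -
    have "orbits_on (swp x (r x)) A = orbits_on r A"
      by (rule orbits_on_cong[OF r_swp]) (use permutes_in_image[OF psw] in auto)
    then show ?thesis by (simp add: o_r)
  qed
  have o_swp_r: "orbits_on (swp x (r x) \<circ> r) A = {{x}, {r x}}"
  proof -
    have "orbits_on (swp x (r x) \<circ> r) A = orbits_on id A"
      by (rule orbits_on_cong) (use xx in \<open>auto simp: A_def\<close>)
    then show ?thesis by (simp add: orbits_on_def A_def o_id)
  qed
  have tr: "transitive_on r s A" for s
    unfolding transitive_on_def
  proof (intro allI impI, elim conjE)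
    fix B assume B: "B \<subseteq> A" "B \<noteq> {}" "\<forall>a\<in>B. r a \<in> B \<and> s a \<in> B"
    then obtain b where "b \<in> B" by blast
    then have "b \<in> {x, r x}" "r b \<in> B" using B by (auto simp: A_def)
    then have "x \<in> B" "r x \<in> B" using \<open>b \<in> B\<close> xx(2) by auto
    then show "B = A" using B(1) by (auto simp: A_def)
  qed
  have pl_id: "planar_on r id A"
    using xx by (simp add: planar_on_def o_r) (simp add: orbits_on_def A_def o_id)
  have pl_swp: "planar_on r (swp x (r x)) A"
    using xx by (simp add: planar_on_def o_swp o_swp_r) (simp add: A_def)
  have split: "planar_perms r D = fillings r A id A X \<union> fillings r A (swp x (r x)) A X"
  proof -
    have "restrict_return g A = id \<or> restrict_return g A = swp x (r x)" if "g \<in> planar_perms r D" for g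
    proof -
      have g: "g permutes D" using that by (simp add: planar_perms_def)
      have "restrict_return g A permutes A"
        by (rule restrict_return_permutes[OF fin permutes_imp_bij[OF g]]) (use AX in auto)
      then show ?thesis using permutes_pair[of _ x "r x"] xx(3) by (auto simp: A_def)
    qed
    then show ?thesis
      using fin fillings_all_corners[OF A pid, of X] fillings_all_corners[OF A psw, of X] by (auto simp: AX(1))
  qed
  have dis: "fillings r A id A X \<inter> fillings r A (swp x (r x)) A X = {}"
  proof -
    have "swp x (r x) x \<noteq> id x" using xx by simp
    then have "swp x (r x) \<noteq> id" by metis
    then show ?thesis
      using fin fillings_all_corners[OF A pid, of X] fillings_all_corners[OF A psw, of X] by (auto simp: AX(1))
  qed
  have finf: "finite (fillings r A s A X)" for s
    by (rule finite_fillings) (use A X in \<open>auto simp: arc_inv_def\<close>)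
  have ne: "A \<noteq> {}" by (simp add: A_def)
  have "real (card (planar_perms r D)) =
      real (card (fillings r A id A X)) + real (card (fillings r A (swp x (r x)) A X))"
    unfolding split by (subst card_Un_disjoint) (auto simp: finf dis)
  also have "real (card (fillings r A id A X)) = 2 ^ (n - 1) * fact (n - 1) * fps_nth (fill_fps 1 2) (n - 1)"
    using card_fillings[OF A ne pid tr pl_id X AX(2) cX] xx by (simp add: o_r) (simp add: A_def numeral_2_eq_2)
  also have "real (card (fillings r A (swp x (r x)) A X)) =
      2 ^ (n - 1) * fact (n - 1) * fps_nth (fill_fps 1 1 * fill_fps 1 1) (n - 1)"
    using card_fillings[OF A ne psw tr pl_swp X AX(2) cX] xx by (simp add: o_swp_r)
  finally have "real (card (planar_perms r D)) = 2 ^ (n - 1) * fact (n - 1) *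
      (fps_nth (fill_fps 1 2) (n - 1) + fps_nth (fill_fps 1 1 * fill_fps 1 1) (n - 1))"
    by (simp only: distrib_left)
  also have "fps_nth (fill_fps 1 2) (n - 1) + fps_nth (fill_fps 1 1 * fill_fps 1 1) (n - 1) = real (fill 1 n)"
  proof -
    obtain m where "n = Suc m" using D(3) by (cases n) auto
    then show ?thesis
      by (simp add: fill_fps_nth fps_mult_nth numeral_2_eq_2 atLeast0AtMost)
  qed
  finally show ?thesis .
qed

text \<open>Sending \<open>s\<close> to \<open>s \<circ> r\<close> is map duality: it exchanges
  vertices and faces and is an involution since \<open>r \<circ> r = id\<close>. So vertices account
  for half of \<open>n + 2\<close> on average.\<close>

lemma sum_orbits_dual:
  assumes D: "arc_inv r D" "card D = 2 * n" and r: "\<And>a. a \<notin> D \<Longrightarrow> r a = a"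
  shows "(\<Sum>s\<in>planar_perms r D. 2 * card (orbits_on s D)) = (n + 2) * card (planar_perms r D)"
proof -
  have rp: "r permutes D" by (rule bij_imp_permutes[OF arc_inv_bij[OF D(1)] r])
  have rr: "r \<circ> r = id"
  proof
    fix x show "(r \<circ> r) x = id x" using r[of x] arc_invD(2)[OF D(1), of x] by (cases "x \<in> D") auto
  qed
  have mem: "s \<circ> r \<in> planar_perms r D" if s: "s \<in> planar_perms r D" for s
  proof -
    have "s \<circ> r permutes D" using s rp by (auto simp: planar_perms_def intro: permutes_compose)
    moreover have "transitive_on r (s \<circ> r) D"
      unfolding transitive_on_def
    proof (intro allI impI, elim conjE)
      fix B assume B: "B \<subseteq> D" "B \<noteq> {}" "\<forall>a\<in>B. r a \<in> B \<and> (s \<circ> r) a \<in> B"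
      then have "\<forall>a\<in>B. r a \<in> B \<and> s a \<in> B" using arc_invD(2)[OF D(1)]
        by (metis comp_apply subsetD)
      then show "B = D" using s B unfolding planar_perms_def transitive_on_def by blast
    qed
    moreover have "planar_on r (s \<circ> r) D"
      using s by (simp add: planar_perms_def planar_on_def comp_assoc rr add.commute)
    ultimately show ?thesis by (simp add: planar_perms_def)
  qed
  have "(\<Sum>s\<in>planar_perms r D. card (orbits_on (s \<circ> r) D)) = (\<Sum>s\<in>planar_perms r D. card (orbits_on s D))"
    by (rule sum.reindex_bij_witness[of _ "\<lambda>s. s \<circ> r" "\<lambda>s. s \<circ> r"]) (auto simp: mem comp_assoc rr)
  then have "(\<Sum>s\<in>planar_perms r D. 2 * card (orbits_on s D)) =
      (\<Sum>s\<in>planar_perms r D. card (orbits_on s D) + card (orbits_on (s \<circ> r) D))"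
    by (simp add: sum.distrib mult_2)
  also have "\<dots> = (\<Sum>s\<in>planar_perms r D. n + 2)"
    by (rule sum.cong) (use D(2) in \<open>auto simp: planar_perms_def planar_on_def\<close>)
  finally show ?thesis by simp
qed

lemma region_subset:
  assumes "arc_inv r D" "g permutes D" "U \<subseteq> D"
  shows "region r g A U \<subseteq> D"
proof
  fix x assume "x \<in> region r g A U"
  then show "x \<in> D"
  proof induction
    case (turn x) then show ?case using assms arc_invD(1)[OF assms(1)] permutes_in_image[OF assms(2)] by blast
  next
    case (cross x) then show ?case using arc_invD(1)[OF assms(1)] by blast
  qed (use assms in auto)
qed

text \<open>The identity in \<open>t\<close> of \<open>fillings_count\<close> is differentiated at \<open>t = 1\<close>.\<close>

lemma sum_region_card:
  assumes A: "arc_inv r A" "A \<noteq> {}" "s permutes A" "transitive_on r s A" "planar_on r s A"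
    and X: "arc_inv r X" "A \<inter> X = {}" "card X = 2 * n" and U: "U \<in> orbits_on (s \<circ> r) A"
  shows "g \<in> fillings r A s A X \<Longrightarrow> V \<subseteq> A \<Longrightarrow> (\<And>a. a \<in> V \<Longrightarrow> s (r a) \<in> V) \<Longrightarrow> region r g A V \<inter> A = V"
    and "(\<Sum>g\<in>fillings r A s A X. real (card (region r g A U))) = 2 ^ n * fact n *
      fps_nth ((\<Prod>P\<in>orbits_on (s \<circ> r) A - {U}. fill_fps 1 (card P)) *
        (2 * (fps_X * fps_deriv (fill_fps 1 (card U))) + of_nat (card U) * fill_fps 1 (card U))) n"
proof -
  have e: "card (orbits_on s A) + card (orbits_on (s \<circ> r) A) \<le> card A div 2 + 2"
    using A(5) by (simp add: planar_on_def)
  note finA = arc_inv_finite[OF A(1)] and fb = face_bij[OF A(1,3)]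
  note fc = fillings_count[OF A(1-4) order_refl X e]
  show J: "region r g A V \<inter> A = V"
    if "g \<in> fillings r A s A X" "V \<subseteq> A" "\<And>a. a \<in> V \<Longrightarrow> s (r a) \<in> V" for g V
    using fc A(5) that by blast
  have UA: "U \<subseteq> A" using orbits_on_eqD(2)[OF finA fb U] by auto
  have Uc: "s (r a) \<in> U" if "a \<in> U" for a
    using orbits_on_eqD(1)[OF finA fb U that] orbit.base[of "s \<circ> r" a] by simp
  have P: "A \<inter> P = P" if "P \<in> orbits_on (s \<circ> r) A" for P
    using orbits_on_eqD(2)[OF finA fb that] by auto
  define I where "I = (\<Prod>P\<in>orbits_on (s \<circ> r) A - {U}. fill_fps 1 (card P))"
  define d where "d = card U"
  define c where "c g = card (region r g A U \<inter> X) div 2" for g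
  have PU: "\<not> P \<subseteq> U" if "P \<in> orbits_on (s \<circ> r) A - {U}" for P
    using orbits_on_disjoint[OF finA fb _ U, of P] orbits_on_nonempty[of P] that by blast
  have fp: "face_prod (\<lambda>u. fill_fps (if u then t else 1)) r A s A U = fill_fps t d * I" for t
  proof -
    have "(\<Prod>P\<in>orbits_on (s \<circ> r) A - {U}. fill_fps (if P \<subseteq> U then t else 1) (card (A \<inter> P))) = I"
      unfolding I_def by (rule prod.cong[OF refl]) (use P PU in auto)
    then show ?thesis
      unfolding face_prod_def
      by (subst prod.remove[OF finite_orbits_on[OF finA] U]) (simp add: P[OF U] d_def)
  qed
  have UAc: "U \<subseteq> A \<and> (\<forall>a\<in>U. s (r a) \<in> U)" using UA Uc by blast
  have sum_t: "(\<Sum>g\<in>fillings r A s A X. t ^ c g) =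
      2 ^ n * fact n * (\<Sum>j=0..n. real (fill d j) * t ^ j * fps_nth I (n - j))" for t :: real
  proof -
    have "(\<Sum>g\<in>fillings r A s A X. t ^ c g) = 2 ^ n * fact n * fps_nth (fill_fps t d * I) n"
      using mp[OF spec[OF mp[OF conjunct2[OF fc[of t]] A(5)], of U] UAc, THEN conjunct2]
      by (simp only: c_def fp)
    then show ?thesis by (simp add: fps_mult_nth fill_fps_nth)
  qed
  have d1: "((\<lambda>t. \<Sum>g\<in>fillings r A s A X. t ^ c g) has_real_derivative
      (\<Sum>g\<in>fillings r A s A X. real (c g))) (at 1)"
    by (auto intro!: derivative_eq_intros)
  have d2: "((\<lambda>t. 2 ^ n * fact n * (\<Sum>j=0..n. real (fill d j) * t ^ j * fps_nth I (n - j)))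
      has_real_derivative (2 ^ n * fact n * (\<Sum>j=0..n. real (fill d j) * real j * fps_nth I (n - j)))) (at 1)"
    by (auto intro!: derivative_eq_intros sum.cong simp: algebra_simps)
  have "(\<Sum>g\<in>fillings r A s A X. real (c g)) =
      2 ^ n * fact n * (\<Sum>j=0..n. real (fill d j) * real j * fps_nth I (n - j))"
    using DERIV_unique[OF d1] d2 unfolding sum_t by blast
  also have "(\<Sum>j=0..n. real (fill d j) * real j * fps_nth I (n - j)) =
      fps_nth (fps_X * fps_deriv (fill_fps 1 d) * I) n"
  proof -
    have "fps_nth (fps_X * fps_deriv (fill_fps 1 d)) j = real (fill d j) * real j" for j
      by (cases j) (simp_all add: fill_fps_nth)
    then show ?thesis by (simp add: fps_mult_nth[of _ I])
  qed
  finally have sc: "(\<Sum>g\<in>fillings r A s A X. real (c g)) =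
      2 ^ n * fact n * fps_nth (fps_X * fps_deriv (fill_fps 1 d) * I) n" .
  have cardf: "real (card (fillings r A s A X)) = 2 ^ n * fact n * fps_nth (fill_fps 1 d * I) n"
    using sum_t[of 1] by (simp add: fps_mult_nth fill_fps_nth)
  \<comment> \<open>The region consists of the arcs of \<open>U\<close> itself and of both arcs of
    each edge drawn in it.\<close>
  have reg: "real (card (region r g A U)) = real d + 2 * real (c g)" if g: "g \<in> fillings r A s A X" for g
  proof -
    note gp = fillings_permutes[OF g]
    note AX = arc_inv_Un[OF A(1) X(1)]
    have sub: "region r g A U \<subseteq> A \<union> X" by (rule region_subset[OF AX gp]) (use UA in auto)
    have "arc_inv r (region r g A U \<inter> X)"
      unfolding arc_inv_def
    proof (intro conjI ballI)
      show "finite (region r g A U \<inter> X)" using arc_inv_finite[OF X(1)] by simp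
      fix a assume a: "a \<in> region r g A U \<inter> X"
      then have "a \<notin> A" using X(2) by auto
      then show "r a \<in> region r g A U \<inter> X" using a arc_invD(1)[OF X(1)] by (auto intro: region.cross)
      show "r (r a) = a" "r a \<noteq> a" using a arc_invD[OF X(1)] by auto
    qed
    from arc_inv_even[OF this] have "card (region r g A U \<inter> X) = 2 * c g" by (simp add: c_def)
    moreover have "card (region r g A U) = card (region r g A U \<inter> A) + card (region r g A U \<inter> X)"
      using sub X(2) arc_inv_finite[OF AX]
      by (subst card_Un_disjoint[symmetric]) (auto intro!: arg_cong[where f = card] intro: finite_subset)
    ultimately show ?thesis using J[OF g UA Uc] by (simp add: d_def)
  qed
  have "(\<Sum>g\<in>fillings r A s A X. real (card (region r g A U))) =
      real d * real (card (fillings r A s A X)) + 2 * (\<Sum>g\<in>fillings r A s A X. real (c g))"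
    by (simp add: reg sum.distrib sum_distrib_left)
  also have "\<dots> = 2 ^ n * fact n * (real d * fps_nth (fill_fps 1 d * I) n +
      2 * fps_nth (fps_X * fps_deriv (fill_fps 1 d) * I) n)"
    unfolding sc cardf by (simp add: algebra_simps)
  also have "real d * fps_nth (fill_fps 1 d * I) n + 2 * fps_nth (fps_X * fps_deriv (fill_fps 1 d) * I) n =
      fps_nth (I * (2 * (fps_X * fps_deriv (fill_fps 1 d)) + of_nat d * fill_fps 1 d)) n"
  proof -
    have "I * (2 * (fps_X * fps_deriv (fill_fps 1 d)) + of_nat d * fill_fps 1 d) =
        fps_const (real d) * (fill_fps 1 d * I) + fps_const 2 * (fps_X * fps_deriv (fill_fps 1 d) * I)"
      by (simp add: fps_of_nat[symmetric] numeral_fps_const algebra_simps)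
    then show ?thesis by simp
  qed
  finally show "(\<Sum>g\<in>fillings r A s A X. real (card (region r g A U))) = 2 ^ n * fact n *
      fps_nth ((\<Prod>P\<in>orbits_on (s \<circ> r) A - {U}. fill_fps 1 (card P)) *
        (2 * (fps_X * fps_deriv (fill_fps 1 (card U))) + of_nat (card U) * fill_fps 1 (card U))) n"
    by (simp add: I_def d_def)
qed

section \<open>Maps as pairs of permutations\<close>

lemma connected_closed:
  assumes "Digraph_Component.connected G" "u \<in> W" "u \<in> verts G" "v \<in> verts G"
    and W: "\<And>a. a \<in> arcs G \<Longrightarrow> tail G a \<in> W \<longleftrightarrow> head G a \<in> W"
  shows "v \<in> W"
proof -
  have "(u, v) \<in> rtrancl_on (verts G) (parcs (mk_symmetric G))"
    using assms(1,3,4) by (auto simp: Digraph_Component.connected_def strongly_connected_def reachable_def)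
  then show ?thesis
    by (induction rule: rtrancl_on_induct) (use assms(2) W in \<open>auto simp: parcs_mk_symmetric\<close>)
qed

text \<open>Cyclicity of the rotation identifies vertices with cycles of \<open>edge_succ\<close>.
  For transitivity, the tails of a closed set of arcs form a set of vertices that no edge leaves,
  hence comprise all vertices.\<close>

lemma planar_map_perm:
  assumes M: "rooted_planar_map M" and ne: "map_arcs M \<noteq> {}"
  shows planar_map_arc_inv: "arc_inv (edge_rev M) (map_arcs M)"
    and planar_map_succ: "edge_succ M permutes map_arcs M"
    and planar_map_rev: "\<And>a. a \<notin> map_arcs M \<Longrightarrow> edge_rev M a = a"
    and planar_map_tail: "\<And>a a'. a \<in> map_arcs M \<Longrightarrow> a' \<in> map_arcs M \<Longrightarrow>
      tail (map_graph M) a = tail (map_graph M) a' \<longleftrightarrow> orbit (edge_succ M) a = orbit (edge_succ M) a'"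
    and planar_map_verts: "map_verts M = tail (map_graph M) ` map_arcs M"
    and planar_map_head: "\<And>a. a \<in> map_arcs M \<Longrightarrow> head (map_graph M) a = tail (map_graph M) (edge_rev M a)"
    and planar_map_transitive: "transitive_on (edge_rev M) (edge_succ M) (map_arcs M)"
    and planar_map_planar: "planar_on (edge_rev M) (edge_succ M) (map_arcs M)"
    and planar_map_card_verts: "card (map_verts M) = card (orbits_on (edge_succ M) (map_arcs M))"
proof -
  interpret bidirected_digraph "map_graph M" "edge_rev M"
    using M by (simp add: rooted_planar_map_def)
  let ?t = "tail (map_graph M)" and ?s = "edge_succ M" and ?r = "edge_rev M" and ?A = "map_arcs M"
  have fin: "finite ?A" by (rule rooted_planar_mapD(4)[OF M])
  have con: "Digraph_Component.connected (map_graph M)"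
    and cyc: "\<And>v. v \<in> map_verts M \<Longrightarrow> out_arcs (map_graph M) v \<noteq> {} \<Longrightarrow> cyclic_on ?s (out_arcs (map_graph M) v)"
    and euler: "card (map_verts M) + card (faces M) = edge_count M + 2"
    using M by (auto simp: rooted_planar_map_def)
  show ai: "arc_inv ?r ?A"
    using fin by (simp add: arc_inv_def arev_neq)
  show s: "?s permutes ?A" using M by (simp add: rooted_planar_map_def)
  show "?r a = a" if "a \<notin> ?A" for a using arev_eq[OF that] .
  have orb: "orbit ?s a = out_arcs (map_graph M) (?t a)" if "a \<in> ?A" for a
  proof -
    have "cyclic_on ?s (out_arcs (map_graph M) (?t a))"
      by (rule cyc) (use that in auto)
    from orbit_cyclic_eq3[OF this, of a] that show ?thesis by simp
  qed
  show tl: "?t a = ?t a' \<longleftrightarrow> orbit ?s a = orbit ?s a'" if "a \<in> ?A" "a' \<in> ?A" for a a'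
    using that orb[of a] orb[of a'] by (metis in_out_arcs_conv)
  show hd: "head (map_graph M) a = ?t (?r a)" if "a \<in> ?A" for a
    using that by simp
  have closed_all: "v \<in> ?t ` B" if B: "B \<subseteq> ?A" "B \<noteq> {}" "\<forall>a\<in>B. ?r a \<in> B \<and> ?s a \<in> B"
    and v: "v \<in> map_verts M" for B v
  proof -
    obtain b where b: "b \<in> B" using B(2) by blast
    then have bA: "b \<in> ?A" using B(1) by blast
    have same: "a \<in> B" if a: "a \<in> ?A" "?t a \<in> ?t ` B" for a
    proof -
      obtain a' where a': "a' \<in> B" "?t a' = ?t a" using a by force
      then have "a \<in> orbit ?s a'" using orb[of a'] B(1) a(1) by auto
      moreover have "orbit ?s a' \<subseteq> B" by (rule orbit_closed_subset[OF _ a'(1)]) (use B(3) in blast)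
      ultimately show ?thesis by blast
    qed
    show ?thesis
    proof (rule connected_closed[OF con _ _ v])
      show "?t b \<in> ?t ` B" using b by blast
      show "?t b \<in> map_verts M" using bA by simp
      fix a assume a: "a \<in> ?A"
      show "?t a \<in> ?t ` B \<longleftrightarrow> head (map_graph M) a \<in> ?t ` B"
        unfolding hd[OF a]
        using same[OF a] same[of "?r a"] a B(3) arev_in_arcs[OF a] arev_arev[of a] by (metis imageI)
    qed
  qed
  show vs: "map_verts M = ?t ` ?A"
  proof
    show "map_verts M \<subseteq> ?t ` ?A"
      using closed_all[of ?A] ne s by (auto simp: permutes_in_image)
    show "?t ` ?A \<subseteq> map_verts M" by auto
  qed
  show "transitive_on ?r ?s ?A"
    unfolding transitive_on_def
  proof (intro allI impI, elim conjE)
    fix B assume B: "B \<subseteq> ?A" "B \<noteq> {}" "\<forall>a\<in>B. ?r a \<in> B \<and> ?s a \<in> B"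
    have "a \<in> B" if a: "a \<in> ?A" for a
    proof -
      have "?t a \<in> ?t ` B" by (rule closed_all[OF B]) (use a in simp)
      then obtain a' where a': "a' \<in> B" "?t a' = ?t a" by force
      then have "a \<in> orbit ?s a'" using orb[of a'] B(1) a by auto
      moreover have "orbit ?s a' \<subseteq> B" by (rule orbit_closed_subset[OF _ a'(1)]) (use B(3) in blast)
      ultimately show ?thesis by blast
    qed
    then show "B = ?A" using B(1) by blast
  qed
  have "bij_betw (out_arcs (map_graph M)) (map_verts M) (orbits_on ?s ?A)"
  proof (rule bij_betwI')
    show "out_arcs (map_graph M) x \<in> orbits_on ?s ?A" if "x \<in> map_verts M" for x
      using that orb by (auto simp: vs orbits_on_def)
    show "out_arcs (map_graph M) x = out_arcs (map_graph M) y \<longleftrightarrow> x = y"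
      if "x \<in> map_verts M" "y \<in> map_verts M" for x y
      using that unfolding vs by (metis (no_types, lifting) imageE in_out_arcs_conv)
    show "\<exists>x\<in>map_verts M. y = out_arcs (map_graph M) x" if "y \<in> orbits_on ?s ?A" for y
      using that orb by (auto simp: vs orbits_on_def)
  qed
  then show cv: "card (map_verts M) = card (orbits_on ?s ?A)" by (rule bij_betw_same_card)
  have "faces M = orbits_on (?s \<circ> ?r) ?A"
    using ne by (simp add: faces_def orbits_on_def left_face_def face_succ_def)
  then show "planar_on ?r ?s ?A" using euler cv by (simp add: planar_on_def edge_count_def)
qed

lemma left_face_orbit: "left_face M = orbit (edge_succ M \<circ> edge_rev M)"
  by (simp add: fun_eq_iff left_face_def face_succ_def)

text \<open>Vertices have to be natural numbers, so a cycle of \<open>s\<close> is named by its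
  least element.\<close>

definition perm_map :: "(nat \<Rightarrow> nat) \<Rightarrow> nat set \<Rightarrow> (nat \<Rightarrow> nat) \<Rightarrow> nat \<Rightarrow> (nat, nat) pre_map" where
  "perm_map r D s x = \<lparr>map_graph = \<lparr>verts = (\<lambda>a. Min (orbit s a)) ` D, arcs = D,
     tail = \<lambda>a. Min (orbit s a), head = \<lambda>a. Min (orbit s (r a))\<rparr>,
     edge_rev = r, edge_succ = s, root_arc = Some x\<rparr>"

lemma rooted_perm_map:
  assumes D: "arc_inv r D" and r: "\<And>a. a \<notin> D \<Longrightarrow> r a = a" and s: "s \<in> planar_perms r D" and x: "x \<in> D"
  shows "rooted_planar_map (perm_map r D s x)"
proof -
  let ?M = "perm_map r D s x"
  have fin: "finite D" using D by (rule arc_inv_finite)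
  have sp: "s permutes D" and tr: "transitive_on r s D" and pl: "planar_on r s D"
    using s by (auto simp: planar_perms_def)
  note bij = permutes_imp_bij[OF sp]
  have finO: "finite (orbit s a)" if "a \<in> D" for a
    using orbit_subset_on[OF bij that] fin by (rule finite_subset)
  have MinO: "Min (orbit s a) \<in> orbit s a" if "a \<in> D" for a
    using finO[OF that] orbit_nonempty by (rule Min_in)
  have tl: "Min (orbit s a) = Min (orbit s a') \<longleftrightarrow> orbit s a = orbit s a'" if "a \<in> D" "a' \<in> D" for a a'
  proof
    assume "Min (orbit s a) = Min (orbit s a')"
    then have "Min (orbit s a) \<in> orbit s a'" using MinO[OF that(2)] by simp
    from orbit_eq[OF fin bij that(1) MinO[OF that(1)]] orbit_eq[OF fin bij that(2) this]
    show "orbit s a = orbit s a'" by (rule trans[OF sym])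
  qed simp
  have "wf_digraph (map_graph ?M)"
    by unfold_locales (use arc_invD(1)[OF D] in \<open>auto simp: perm_map_def\<close>)
  then have bd: "bidirected_digraph (map_graph ?M) (edge_rev ?M)"
    by (rule wf_digraph.bidirected_digraphI) (use arc_invD[OF D] r in \<open>auto simp: perm_map_def\<close>)
  have fd: "fin_digraph (map_graph ?M)"
    by unfold_locales (use arc_invD(1)[OF D] fin in \<open>auto simp: perm_map_def\<close>)
  have con: "Digraph_Component.connected (map_graph ?M)"
    unfolding Digraph_Component.connected_def strongly_connected_def reachable_def
  proof (intro conjI ballI)
    show "verts (with_proj (mk_symmetric (map_graph ?M))) \<noteq> {}" using x by (auto simp: perm_map_def)
    fix u v assume u: "u \<in> verts (with_proj (mk_symmetric (map_graph ?M)))"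
      and v: "v \<in> verts (with_proj (mk_symmetric (map_graph ?M)))"
    let ?R = "rtrancl_on (map_verts ?M) (parcs (mk_symmetric (map_graph ?M)))"
    define B where "B = {a \<in> D. (u, Min (orbit s a)) \<in> ?R}"
    obtain a where a: "a \<in> D" "u = Min (orbit s a)" using u by (auto simp: perm_map_def)
    have "a \<in> B" using a by (auto simp: B_def perm_map_def)
    moreover have "r b \<in> B \<and> s b \<in> B" if b: "b \<in> B" for b
    proof
      have bD: "b \<in> D" and ub: "(u, Min (orbit s b)) \<in> ?R" using b by (auto simp: B_def)
      have "(Min (orbit s b), Min (orbit s (r b))) \<in> parcs (mk_symmetric (map_graph ?M))"
        using bD by (auto simp: parcs_mk_symmetric perm_map_def)
      moreover have "Min (orbit s (r b)) \<in> map_verts ?M" using arc_invD(1)[OF D bD] by (simp add: perm_map_def)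
      ultimately show "r b \<in> B" using ub arc_invD(1)[OF D bD]
        by (auto simp: B_def intro: rtrancl_on_into_rtrancl_on)
      show "s b \<in> B" using ub bD orbit_step_eq[OF fin bij bD] bij_on_mem[OF bij bD] by (simp add: B_def)
    qed
    ultimately have "B = D" using tr unfolding transitive_on_def
      by (metis (no_types, lifting) B_def Collect_subset Int_Collect empty_iff subsetI mem_Collect_eq)
    moreover obtain a' where "a' \<in> D" "v = Min (orbit s a')" using v by (auto simp: perm_map_def)
    ultimately show "(u, v) \<in> rtrancl_on (verts (with_proj (mk_symmetric (map_graph ?M))))
        (arcs_ends (with_proj (mk_symmetric (map_graph ?M))))"
      by (auto simp: B_def)
  qed
  have out: "out_arcs (map_graph ?M) (Min (orbit s a)) = orbit s a" if a: "a \<in> D" for a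
  proof -
    have "out_arcs (map_graph ?M) (Min (orbit s a)) = {e \<in> D. orbit s e = orbit s a}"
      using tl[OF _ a] by (auto simp: out_arcs_def perm_map_def)
    also have "\<dots> = orbit s a"
      using orbit_mem_iff[OF fin bij a] orbit_subset_on[OF bij a] by blast
    finally show ?thesis .
  qed
  have cyc: "cyclic_on (edge_succ ?M) (out_arcs (map_graph ?M) v)" if v: "v \<in> map_verts ?M" for v
  proof -
    obtain a where a: "a \<in> D" "v = Min (orbit s a)" using v by (auto simp: perm_map_def)
    show ?thesis unfolding a(2) out[OF a(1)]
      using orbit_self[OF fin bij a(1)] by (auto simp: cyclic_on_def perm_map_def)
  qed
  have "card (map_verts ?M) = card (orbits_on s D)"
  proof -
    have "map_verts ?M = Min ` orbits_on s D" by (simp add: perm_map_def orbits_on_def image_image)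
    moreover have "inj_on Min (orbits_on s D)"
      by (rule inj_onI) (use tl in \<open>auto simp: orbits_on_def\<close>)
    ultimately show ?thesis by (simp add: card_image)
  qed
  moreover have "faces ?M = orbits_on (s \<circ> r) D"
    using x by (auto simp: faces_def perm_map_def orbits_on_def left_face_def face_succ_def)
  ultimately have "card (map_verts ?M) + card (faces ?M) = edge_count ?M + 2"
    using pl by (simp add: planar_on_def edge_count_def perm_map_def)
  then show ?thesis
    unfolding rooted_planar_map_def using fd con bd sp cyc x by (auto simp: perm_map_def)
qed

text \<open>In a connected map with an edge every vertex is the tail of an arc, so a bijection of
  arcs that respects equality of tails induces the bijection of vertices.\<close>

lemma map_iso_arcsI:
  assumes M: "rooted_planar_map M" "map_arcs M \<noteq> {}"
    and k: "inj_on k (map_arcs M)" "map_arcs N = k ` map_arcs M"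
    and verts: "map_verts N = tail (map_graph N) ` map_arcs N"
    and head: "\<And>a. a \<in> map_arcs N \<Longrightarrow> head (map_graph N) a = tail (map_graph N) (edge_rev N a)"
    and rev: "\<And>a. a \<in> map_arcs M \<Longrightarrow> edge_rev N (k a) = k (edge_rev M a)"
    and succ: "\<And>a. a \<in> map_arcs M \<Longrightarrow> edge_succ N (k a) = k (edge_succ M a)"
    and root: "root_arc N = map_option k (root_arc M)"
    and tail: "\<And>a a'. a \<in> map_arcs M \<Longrightarrow> a' \<in> map_arcs M \<Longrightarrow>
      tail (map_graph N) (k a) = tail (map_graph N) (k a') \<longleftrightarrow> tail (map_graph M) a = tail (map_graph M) a'"
  shows "map_iso M N"
proof -
  let ?t = "tail (map_graph M)" and ?t' = "tail (map_graph N)"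
  define h where "h v = ?t' (k (SOME a. a \<in> map_arcs M \<and> ?t a = v))" for v
  have h: "h (?t a) = ?t' (k a)" if a: "a \<in> map_arcs M" for a
  proof -
    have "\<exists>b. b \<in> map_arcs M \<and> ?t b = ?t a" using a by blast
    from someI_ex[OF this] show ?thesis unfolding h_def using tail a by blast
  qed
  note vM = planar_map_verts[OF M]
  show ?thesis
  proof (rule map_isoI[where h = h and k = k])
    show "inj_on h (map_verts M)"
      by (rule inj_onI) (use h tail in \<open>auto simp: vM\<close>)
    show "map_verts N = h ` map_verts M" using h by (simp add: verts vM k(2) image_image)
    show "wf_digraph (map_graph M)" by (rule rooted_planar_mapD(2)[OF M(1)])
    show "?t' (k a) = h (?t a)" if "a \<in> map_arcs M" for a using h[OF that] by simp
    show "head (map_graph N) (k a) = h (head (map_graph M) a)" if a: "a \<in> map_arcs M" for a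
    proof -
      have "edge_rev M a \<in> map_arcs M" using arc_invD(1)[OF planar_map_arc_inv[OF M] a] .
      then show ?thesis
        using head[of "k a"] a k(2) rev[OF a] h planar_map_head[OF M a] by simp
    qed
  qed (use k rev succ root in auto)
qed

section \<open>Transport along equivariant maps\<close>

lemma transport_orbits:
  assumes "\<And>a. a \<in> A \<Longrightarrow> s a \<in> A" "\<And>a. a \<in> A \<Longrightarrow> s' (k a) = k (s a)"
  shows "orbits_on s' (k ` A) = image k ` orbits_on s A"
  using orbit_image(1)[of A s s' k] assms by (auto simp: orbits_on_def image_image)

lemma transport_card_orbits:
  assumes "finite A" "bij_betw s A A" "inj_on k A" "\<And>a. a \<in> A \<Longrightarrow> s' (k a) = k (s a)"
  shows "card (orbits_on s' (k ` A)) = card (orbits_on s A)"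
proof -
  have "orbits_on s A \<subseteq> Pow A" using orbits_on_eqD(2)[OF assms(1,2)] by auto
  then have "inj_on (image k) (orbits_on s A)"
    using inj_on_image_Pow[OF assms(3)] by (rule inj_on_subset[rotated])
  then show ?thesis
    using transport_orbits[of A s s' k] bij_on_mem[OF assms(2)] assms(4) by (simp add: card_image)
qed

lemma transport_transitive:
  assumes r: "\<And>a. a \<in> A \<Longrightarrow> r a \<in> A" "\<And>a. a \<in> A \<Longrightarrow> r' (k a) = k (r a)"
    and s: "\<And>a. a \<in> A \<Longrightarrow> s a \<in> A" "\<And>a. a \<in> A \<Longrightarrow> s' (k a) = k (s a)"
    and inj: "inj_on k A" and tr: "transitive_on r s A"
  shows "transitive_on r' s' (k ` A)"
  unfolding transitive_on_def
proof (intro allI impI, elim conjE)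
  fix B assume B: "B \<subseteq> k ` A" "B \<noteq> {}" "\<forall>a\<in>B. r' a \<in> B \<and> s' a \<in> B"
  define C where "C = {a \<in> A. k a \<in> B}"
  have BC: "B = k ` C" using B(1) by (auto simp: C_def)
  have "C \<subseteq> A" by (auto simp: C_def)
  moreover have "C \<noteq> {}" using B(2) unfolding BC by blast
  moreover have "\<forall>a\<in>C. r a \<in> C \<and> s a \<in> C"
  proof
    fix a assume "a \<in> C"
    then have a: "a \<in> A" "k a \<in> B" by (auto simp: C_def)
    then have "r' (k a) \<in> B" "s' (k a) \<in> B" using B(3) by auto
    then show "r a \<in> C \<and> s a \<in> C" using a(1) r s by (simp add: C_def)
  qed
  ultimately have "C = A" using tr unfolding transitive_on_def by blast
  then show "B = k ` A" using BC by simp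
qed

lemma transport_planar:
  assumes A: "arc_inv r A" "s permutes A" and k: "inj_on k A"
    and r': "\<And>a. a \<in> A \<Longrightarrow> r' (k a) = k (r a)" and s': "\<And>a. a \<in> A \<Longrightarrow> s' (k a) = k (s a)"
    and pl: "planar_on r s A"
  shows "planar_on r' s' (k ` A)"
proof -
  note fin = arc_inv_finite[OF A(1)]
  have "card (orbits_on s' (k ` A)) = card (orbits_on s A)"
    by (rule transport_card_orbits[OF fin permutes_imp_bij[OF A(2)] k s'])
  moreover have "card (orbits_on (s' \<circ> r') (k ` A)) = card (orbits_on (s \<circ> r) A)"
    by (rule transport_card_orbits[OF fin face_bij[OF A] k]) (use r' s' arc_invD(1)[OF A(1)] in simp)
  ultimately show ?thesis using pl k by (simp add: planar_on_def card_image)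
qed

text \<open>The arcs where the two maps agree form a closed set, so connectedness spreads agreement
  from one arc to all. In particular a rooted map has no nontrivial automorphism.\<close>

lemma equivariant_rigid:
  assumes tr: "transitive_on r s A" and x: "x \<in> A" "k x = k' x"
    and "\<And>a. a \<in> A \<Longrightarrow> r a \<in> A \<and> s a \<in> A"
    and "\<And>a. a \<in> A \<Longrightarrow> k (r a) = r' (k a) \<and> k (s a) = s' (k a)"
    and "\<And>a. a \<in> A \<Longrightarrow> k' (r a) = r' (k' a) \<and> k' (s a) = s' (k' a)"
    and a: "a \<in> A"
  shows "k a = k' a"
proof -
  define B where "B = {a \<in> A. k a = k' a}"
  have "B \<subseteq> A" "B \<noteq> {}" using x by (auto simp: B_def)
  moreover have "\<forall>a\<in>B. r a \<in> B \<and> s a \<in> B" using assms(4-6) by (auto simp: B_def)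
  ultimately have "B = A" using tr unfolding transitive_on_def by blast
  then show ?thesis using a by (auto simp: B_def)
qed

section \<open>Labelled rooted maps and the uniform distribution\<close>

definition std_rev :: "nat \<Rightarrow> nat \<Rightarrow> nat" where
  "std_rev n a = (if a < 2 * n then (if even a then a + 1 else a - 1) else a)"

lemma arc_inv_std: "arc_inv (std_rev n) {..<2 * n}"
proof -
  have "a + 1 < 2 * n" if "a < 2 * n" "even a" for a using that by presburger
  then show ?thesis by (auto simp: arc_inv_def std_rev_def elim: oddE)
qed

lemma std_rev_outside: "a \<notin> {..<2 * n} \<Longrightarrow> std_rev n a = a"
  by (simp add: std_rev_def)

text \<open>With the edge involution fixed once and for all, a labelled map is just a rotation
  together with a root.\<close>

definition labelled :: "nat \<Rightarrow> ((nat \<Rightarrow> nat) \<times> nat) set" where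
  "labelled n = planar_perms (std_rev n) {..<2 * n} \<times> {..<2 * n}"

definition labelled_map :: "nat \<Rightarrow> (nat \<Rightarrow> nat) \<times> nat \<Rightarrow> (nat, nat) pre_map" where
  "labelled_map n p = perm_map (std_rev n) {..<2 * n} (fst p) (snd p)"

lemma rooted_labelled_map: "p \<in> labelled n \<Longrightarrow> rooted_planar_map (labelled_map n p)"
  using rooted_perm_map[OF arc_inv_std std_rev_outside] by (auto simp: labelled_def labelled_map_def)

lemma labelled_map_sel:
  "map_arcs (labelled_map n p) = {..<2 * n}" "edge_rev (labelled_map n p) = std_rev n"
  "edge_succ (labelled_map n p) = fst p" "root_arc (labelled_map n p) = Some (snd p)"
  "map_verts (labelled_map n p) = tail (map_graph (labelled_map n p)) ` {..<2 * n}"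
  by (simp_all add: labelled_map_def perm_map_def)

lemma planar_perms_transport:
  assumes A: "arc_inv r A" "s permutes A" "transitive_on r s A" "planar_on r s A"
    and k: "bij_betw k A D" "\<And>a. a \<in> A \<Longrightarrow> r' (k a) = k (r a)"
  shows "\<exists>s'\<in>planar_perms r' D. \<forall>a\<in>A. s' (k a) = k (s a)"
proof -
  define s' where "s' d = (if d \<in> D then k (s (inv_into A k d)) else d)" for d
  have D: "D = k ` A" and inj: "inj_on k A" using k(1) by (auto simp: bij_betw_def)
  have s': "s' (k a) = k (s a)" if "a \<in> A" for a using that inj by (simp add: s'_def D)
  have sA: "s a \<in> A" if "a \<in> A" for a using that A(2) by (simp add: permutes_in_image)
  have "bij_betw (k \<circ> s \<circ> inv_into A k) D D"
    using bij_betw_trans[OF bij_betw_trans[OF bij_betw_inv_into[OF k(1)] permutes_imp_bij[OF A(2)]] k(1)]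
    by (simp add: comp_assoc)
  then have "bij_betw s' D D"
    by (rule bij_betw_cong[THEN iffD1, rotated]) (simp add: s'_def)
  then have "s' permutes D" by (rule bij_imp_permutes) (simp add: s'_def)
  moreover have "transitive_on r' s' D"
    unfolding D by (rule transport_transitive[OF arc_invD(1)[OF A(1)] k(2) sA s' inj A(3)])
  moreover have "planar_on r' s' D"
    unfolding D by (rule transport_planar[OF A(1,2) inj k(2) s' A(4)])
  ultimately show ?thesis using s' by (auto simp: planar_perms_def)
qed

lemma labelled_isoI:
  assumes M: "rooted_planar_map M" "map_arcs M \<noteq> {}" and p: "p \<in> labelled n"
    and k: "bij_betw k (map_arcs M) {..<2 * n}"
      "\<And>a. a \<in> map_arcs M \<Longrightarrow> std_rev n (k a) = k (edge_rev M a)"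
      "\<And>a. a \<in> map_arcs M \<Longrightarrow> fst p (k a) = k (edge_succ M a)"
      "map_option k (root_arc M) = Some (snd p)"
  shows "map_iso M (labelled_map n p)"
proof -
  let ?N = "labelled_map n p"
  have N: "rooted_planar_map ?N" "map_arcs ?N \<noteq> {}"
    using rooted_labelled_map[OF p] p by (auto simp: labelled_map_sel labelled_def)
  have inj: "inj_on k (map_arcs M)" and im: "{..<2 * n} = k ` map_arcs M"
    using k(1) by (auto simp: bij_betw_def)
  note sM = planar_map_succ[OF M]
  show ?thesis
  proof (rule map_iso_arcsI[OF M inj])
    show "map_arcs ?N = k ` map_arcs M" by (simp add: labelled_map_sel im)
    show "map_verts ?N = tail (map_graph ?N) ` map_arcs ?N" by (simp add: labelled_map_sel)
    show "head (map_graph ?N) a = tail (map_graph ?N) (edge_rev ?N a)" if "a \<in> map_arcs ?N" for a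
      using planar_map_head[OF N that] .
    show "tail (map_graph ?N) (k a) = tail (map_graph ?N) (k a') \<longleftrightarrow> tail (map_graph M) a = tail (map_graph M) a'"
      if a: "a \<in> map_arcs M" "a' \<in> map_arcs M" for a a'
    proof -
      have o: "orbit (fst p) (k b) = k ` orbit (edge_succ M) b" "orbit (edge_succ M) b \<subseteq> map_arcs M"
        if "b \<in> map_arcs M" for b
        using orbit_image[of "map_arcs M" "edge_succ M" "fst p" k b] k(3) that sM
        by (simp_all add: permutes_in_image)
      have "k a \<in> map_arcs ?N" "k a' \<in> map_arcs ?N" using a by (auto simp: labelled_map_sel im)
      from planar_map_tail[OF N this] have
        "tail (map_graph ?N) (k a) = tail (map_graph ?N) (k a') \<longleftrightarrow>
          k ` orbit (edge_succ M) a = k ` orbit (edge_succ M) a'"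
        by (simp add: labelled_map_sel(3) o a)
      also have "\<dots> \<longleftrightarrow> orbit (edge_succ M) a = orbit (edge_succ M) a'"
        by (rule inj_on_image_eq_iff[OF inj o(2)[OF a(1)] o(2)[OF a(2)]])
      finally show ?thesis using planar_map_tail[OF M a] by simp
    qed
  qed (use k labelled_map_sel in auto)
qed

lemma bij_embedding:
  assumes "f \<in> embeddings r A r' D" "finite D" "card A = card D"
  shows "bij_betw f A D"
proof -
  have f: "f ` A \<subseteq> D" "inj_on f A" using assms(1) by (auto simp: embeddings_def)
  moreover have "f ` A = D" by (rule card_subset_eq[OF assms(2) f(1)]) (simp add: card_image f(2) assms(3))
  ultimately show ?thesis by (simp add: bij_betw_def)
qed

definition map_class :: "nat \<Rightarrow> (nat \<Rightarrow> nat) \<times> nat \<Rightarrow> planar_map" where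
  "map_class n p = abs_planar_map (labelled_map n p)"

lemma abs_planar_map_eq:
  assumes "rooted_planar_map M" "rooted_planar_map N"
  shows "abs_planar_map M = abs_planar_map N \<longleftrightarrow> map_iso M N"
  using Quotient_rel[OF Quotient_planar_map, of M N] assms map_iso_refl by blast

lemma planar_map_cases:
  obtains M :: "(nat, nat) pre_map" where "rooted_planar_map M" "m = abs_planar_map M"
proof -
  have "\<exists>M. rooted_planar_map M \<and> m = abs_planar_map M"
    by (induction m rule: planar_map.abs_induct) blast
  then show ?thesis using that by blast
qed

lemma num_edges_abs: "rooted_planar_map M \<Longrightarrow> num_edges (abs_planar_map M) = edge_count M"
  by (rule num_edges.abs_eq) (simp add: map_iso_refl)

lemma occurrences_abs:
  "rooted_planar_map m \<Longrightarrow> rooted_planar_map M \<Longrightarrow>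
    occurrences (abs_planar_map m) (abs_planar_map M) = occurrence_count m M"
  by (rule occurrences.abs_eq) (simp_all add: map_iso_refl)

lemma card_arcs:
  assumes "rooted_planar_map M"
  shows "card (map_arcs M) = 2 * edge_count M"
proof (cases "map_arcs M = {}")
  case False
  have "even (card (map_arcs M))" using arc_inv_even[OF planar_map_arc_inv[OF assms False]] .
  then show ?thesis by (simp add: edge_count_def)
qed (simp add: edge_count_def)

lemma image_map_class:
  assumes n: "n > 0"
  shows "map_class n ` labelled n = {M. num_edges M = n}"
proof
  show "map_class n ` labelled n \<subseteq> {M. num_edges M = n}"
    using rooted_labelled_map by (auto simp: map_class_def num_edges_abs edge_count_def labelled_map_sel)
  show "{M. num_edges M = n} \<subseteq> map_class n ` labelled n"
  proof clarify
    fix M :: planar_map assume n': "n = num_edges M"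
    obtain M' where M': "rooted_planar_map M'" "M = abs_planar_map M'" by (rule planar_map_cases)
    have c: "card (map_arcs M') = 2 * n" using card_arcs[OF M'(1)] n' M' by (simp add: num_edges_abs)
    then have ne: "map_arcs M' \<noteq> {}" using n by auto
    note ai = planar_map_arc_inv[OF M'(1) ne]
    \<comment> \<open>The number of embeddings is positive, so the arcs can be numbered compatibly
      with \<open>std_rev n\<close>.\<close>
    have "card (embeddings (edge_rev M') (map_arcs M') (std_rev n) {..<2 * n}) > 0"
      by (subst card_embeddings[OF ai c arc_inv_std]) auto
    then obtain k where k: "k \<in> embeddings (edge_rev M') (map_arcs M') (std_rev n) {..<2 * n}"
      by (metis card_gt_0_iff ex_in_conv)
    have kb: "bij_betw k (map_arcs M') {..<2 * n}" by (rule bij_embedding[OF k]) (simp_all add: c)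
    have kr: "std_rev n (k a) = k (edge_rev M' a)" if "a \<in> map_arcs M'" for a
      using k that by (simp add: embeddings_def)
    obtain s where s: "s \<in> planar_perms (std_rev n) {..<2 * n}" "\<forall>a\<in>map_arcs M'. s (k a) = k (edge_succ M' a)"
      using planar_perms_transport[OF ai planar_map_succ[OF M'(1) ne] planar_map_transitive[OF M'(1) ne]
          planar_map_planar[OF M'(1) ne] kb kr] by blast
    obtain x where x: "root_arc M' = Some x"
      using M'(1) ne by (auto simp: rooted_planar_map_def split: option.splits)
    then have xA: "x \<in> map_arcs M'" using rooted_planar_mapD(7)[OF M'(1)] by simp
    have p: "(s, k x) \<in> labelled n" using s xA kb by (auto simp: labelled_def bij_betw_def)
    have "map_iso M' (labelled_map n (s, k x))"
      by (rule labelled_isoI[OF M'(1) ne p kb kr]) (use s x in auto)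
    then have "M = map_class n (s, k x)"
      using abs_planar_map_eq[OF M'(1) rooted_labelled_map[OF p]] M'(2) by (simp add: map_class_def)
    then have "M \<in> map_class n ` labelled n" using p by (rule image_eqI)
    then show "M \<in> map_class (num_edges M) ` labelled (num_edges M)" by (simp only: n'[symmetric])
  qed
qed

text \<open>The bijections commuting with \<open>std_rev n\<close> act on labelled maps with the
  isomorphism classes as orbits, and the action is free by \<open>equivariant_rigid\<close>, because
  a stabilising bijection fixes the root. So all classes have the same size.\<close>

lemma card_fibre:
  assumes n: "n > 0" and p: "p \<in> labelled n"
  shows "card {q \<in> labelled n. map_class n q = map_class n p} =
    card (embeddings (std_rev n) {..<2 * n} (std_rev n) {..<2 * n})"
proof -
  let ?D = "{..<2 * n}" and ?r = "std_rev n"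
  let ?E = "embeddings ?r ?D ?r ?D"
  obtain s x where sx: "p = (s, x)" by (cases p)
  have s: "s permutes ?D" "transitive_on ?r s ?D" "planar_on ?r s ?D" and x: "x \<in> ?D"
    using p by (auto simp: sx labelled_def planar_perms_def)
  have M: "rooted_planar_map (labelled_map n p)" "map_arcs (labelled_map n p) \<noteq> {}"
    using rooted_labelled_map[OF p] x by (auto simp: labelled_map_sel)
  have E: "bij_betw k ?D ?D" "\<And>a. a \<in> ?D \<Longrightarrow> ?r (k a) = k (?r a)" if "k \<in> ?E" for k
    using bij_embedding[OF that] that by (auto simp: embeddings_def)
  have ex: "\<exists>s'. s' \<in> planar_perms ?r ?D \<and> (\<forall>a\<in>?D. s' (k a) = k (s a))" if "k \<in> ?E" for k
    using planar_perms_transport[OF arc_inv_std s E[OF that]] by blast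
  \<comment> \<open>The rotation carried along \<open>k\<close>, that is, \<open>s\<close>
    conjugated by \<open>k\<close>.\<close>
  define cj where "cj k = (SOME s'. s' \<in> planar_perms ?r ?D \<and> (\<forall>a\<in>?D. s' (k a) = k (s a)))" for k
  have cj: "cj k \<in> planar_perms ?r ?D" "\<And>a. a \<in> ?D \<Longrightarrow> cj k (k a) = k (s a)" if "k \<in> ?E" for k
    using someI_ex[OF ex[OF that]] by (auto simp: cj_def)
  have "bij_betw (\<lambda>k. (cj k, k x)) ?E {q \<in> labelled n. map_class n q = map_class n p}"
    unfolding bij_betw_def
  proof
    show "inj_on (\<lambda>k. (cj k, k x)) ?E"
    proof (rule inj_onI)
      fix k k' assume k: "k \<in> ?E" "k' \<in> ?E" "(cj k, k x) = (cj k', k' x)"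
      have "k a = k' a" if a: "a \<in> ?D" for a
      proof (rule equivariant_rigid[OF s(2) x _ _ _ _ a, where r' = ?r and s' = "cj k"])
        show "k x = k' x" using k by simp
        show "?r a \<in> ?D \<and> s a \<in> ?D" if "a \<in> ?D" for a
          using arc_invD(1)[OF arc_inv_std that] permutes_in_image[OF s(1)] that by blast
        show "k (?r a) = ?r (k a) \<and> k (s a) = cj k (k a)" if "a \<in> ?D" for a
          using E(2)[OF k(1) that] cj(2)[OF k(1) that] by simp
        show "k' (?r a) = ?r (k' a) \<and> k' (s a) = cj k (k' a)" if "a \<in> ?D" for a
          using E(2)[OF k(2) that] cj(2)[OF k(2) that] k(3) by simp
      qed
      then show "k = k'" using k(1,2) by (auto simp: embeddings_def intro: PiE_ext)
    qed
    show "(\<lambda>k. (cj k, k x)) ` ?E = {q \<in> labelled n. map_class n q = map_class n p}"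
    proof
      show "(\<lambda>k. (cj k, k x)) ` ?E \<subseteq> {q \<in> labelled n. map_class n q = map_class n p}"
      proof clarify
        fix k assume k: "k \<in> ?E"
        have q: "(cj k, k x) \<in> labelled n"
          using cj(1)[OF k] E(1)[OF k] x by (auto simp: labelled_def bij_betw_def)
        have "map_iso (labelled_map n p) (labelled_map n (cj k, k x))"
          by (rule labelled_isoI[OF M q])
            (use E[OF k] cj[OF k] in \<open>auto simp: labelled_map_sel sx\<close>)
        then show "(cj k, k x) \<in> labelled n \<and> map_class n (cj k, k x) = map_class n p"
          using q abs_planar_map_eq[OF M(1) rooted_labelled_map[OF q]] by (simp add: map_class_def)
      qed
      show "{q \<in> labelled n. map_class n q = map_class n p} \<subseteq> (\<lambda>k. (cj k, k x)) ` ?E"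
      proof
        fix q assume "q \<in> {q \<in> labelled n. map_class n q = map_class n p}"
        then have q: "q \<in> labelled n" "map_class n q = map_class n p" by auto
        then have "map_iso (labelled_map n p) (labelled_map n q)"
          using abs_planar_map_eq[OF M(1) rooted_labelled_map[OF q(1)]] by (simp add: map_class_def)
        then obtain f where "map_isomorphism (labelled_map n p) (labelled_map n q) f"
          by (auto simp: map_iso_def)
        note F = map_isomorphism_inj[OF this, unfolded labelled_map_sel sx fst_conv snd_conv]
        define k where "k = restrict (iso_arcs f) ?D"
        have rD: "?r a \<in> ?D" if "a \<in> ?D" for a using arc_invD(1)[OF arc_inv_std that] .
        have sD: "s a \<in> ?D" if "a \<in> ?D" for a using permutes_in_image[OF s(1)] that by blast
        have "\<And>a. a \<in> ?D \<Longrightarrow> iso_arcs f a \<in> ?D" using F(4) by blast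
        then have k: "k \<in> ?E"
          using F(2,8) rD unfolding embeddings_def k_def by (auto simp: inj_on_restrict_eq)
        have kx: "snd q = k x" using F(10) x by (simp add: k_def)
        have "cj k d = fst q d" for d
        proof (cases "d \<in> ?D")
          case True
          then obtain a where a: "a \<in> ?D" "d = k a" using E(1)[OF k] by (auto simp: bij_betw_def)
          show ?thesis using cj(2)[OF k a(1)] F(9)[OF a(1)] a sD[OF a(1)] by (simp add: k_def)
        next
          case False
          have "cj k permutes ?D" "fst q permutes ?D"
            using cj(1)[OF k] q(1) by (auto simp: planar_perms_def labelled_def)
          then show ?thesis using False by (metis permutes_not_in)
        qed
        then have "q = (cj k, k x)" using kx by (simp add: prod_eq_iff fun_eq_iff)
        then show "q \<in> (\<lambda>k. (cj k, k x)) ` ?E" using k by blast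
      qed
    qed
  qed
  from bij_betw_same_card[OF this] show ?thesis by (rule sym)
qed

lemma finite_labelled: "finite (labelled n)"
  by (simp add: labelled_def finite_planar_perms)

lemma card_labelled:
  assumes "n > 0"
  shows "real (card (labelled n)) = 2 ^ n * fact n * real (fill 1 n)"
proof -
  obtain m where m: "n = Suc m" using assms by (cases n) auto
  have "real (card (planar_perms (std_rev n) {..<2 * n})) = 2 ^ (n - 1) * fact (n - 1) * real (fill 1 n)"
    by (rule card_planar_perms[OF arc_inv_std _ assms, where x = 0]) (use assms in auto)
  then show ?thesis by (simp add: labelled_def card_cartesian_product m algebra_simps)
qed

text \<open>All fibres of \<open>map_class n\<close> have equal size, so the uniform law on labelled
  maps projects to the uniform law on isomorphism classes.\<close>

lemma expectation_labelled:
  assumes n: "n > 0"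
  shows "measure_pmf.expectation (random_planar_map n) F =
    (\<Sum>p\<in>labelled n. F (map_class n p)) / (real (card (labelled n)))"
proof -
  let ?Ms = "{M. num_edges M = n}"
  define N where "N = card (embeddings (std_rev n) {..<2 * n} (std_rev n) {..<2 * n})"
  have sum: "(\<Sum>p\<in>labelled n. G (map_class n p)) = real N * (\<Sum>M\<in>?Ms. G M)" for G :: "planar_map \<Rightarrow> real"
  proof -
    have "(\<Sum>p\<in>labelled n. G (map_class n p)) =
        (\<Sum>M\<in>map_class n ` labelled n. \<Sum>p\<in>{p \<in> labelled n. map_class n p = M}. G (map_class n p))"
      by (rule sum.image_gen[OF finite_labelled])
    also have "\<dots> = (\<Sum>M\<in>map_class n ` labelled n. real N * G M)"
    proof (rule sum.cong[OF refl])
      fix M assume "M \<in> map_class n ` labelled n"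
      then obtain q where q: "q \<in> labelled n" "M = map_class n q" by blast
      show "(\<Sum>p\<in>{p \<in> labelled n. map_class n p = M}. G (map_class n p)) = real N * G M"
        using card_fibre[OF n q(1)] by (simp add: q(2) N_def)
    qed
    finally show ?thesis by (simp add: image_map_class[OF n] sum_distrib_left)
  qed
  have fin: "finite ?Ms" using finite_imageI[OF finite_labelled, of "map_class n" n] by (simp add: image_map_class[OF n])
  have pos: "card (labelled n) > 0" using card_labelled[OF n] fill_1_pos[of n] by (metis (mono_tags) of_nat_0_less_iff fact_gt_zero mult_pos_pos zero_less_numeral zero_less_power)
  then have "labelled n \<noteq> {}" by auto
  then have ne: "?Ms \<noteq> {}" unfolding image_map_class[OF n, symmetric] by simp
  have c: "real (card (labelled n)) = real N * real (card ?Ms)" using sum[of "\<lambda>_. 1"] by simp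
  have "real N \<noteq> 0"
  proof
    assume "real N = 0"
    then show False using c pos by simp
  qed
  then show ?thesis
    unfolding random_planar_map_def c sum using ne fin by (simp add: integral_pmf_of_set)
qed

section \<open>Occurrences as equivariant embeddings\<close>

text \<open>Erasing arcs from a cycle does not split it. Consequently the vertices of a submap,
  defined by its induced rotation, are identified exactly as in the large map.\<close>

lemma orbit_restrict_return:
  assumes fin: "finite D" and bij: "bij_betw g D D" and B: "B \<subseteq> D" and a: "a \<in> B" "a' \<in> B"
  shows "orbit g a = orbit g a' \<longleftrightarrow> orbit (restrict_return g B) a = orbit (restrict_return g B) a'"
proof -
  let ?s = "restrict_return g B"
  note sb = permutes_imp_bij[OF restrict_return_permutes[OF fin bij B]]
  have finB: "finite B" using fin B finite_subset by blast
  have sub: "orbit ?s x \<subseteq> orbit g x" if x: "x \<in> B" for x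
  proof -
    have "orbit ?s x \<subseteq> orbit g x \<inter> B"
    proof (rule orbit_closed_subset)
      show "x \<in> orbit g x \<inter> B" using orbit_self[OF fin bij] x B by blast
      fix z assume z: "z \<in> orbit g x \<inter> B"
      then obtain k where "(g ^^ k) z = ?s z"
        using ret_funpow[OF ret_ex[OF fin bij B, of z]] by (auto simp: restrict_return_def)
      then show "?s z \<in> orbit g x \<inter> B" using z funpow_in_orbit[of z g x k] bij_on_mem[OF sb, of z] by auto
    qed
    then show ?thesis by blast
  qed
  have sup: "y \<in> orbit ?s x" if "x \<in> B" "y \<in> B" "k > 0" "(g ^^ k) x = y" for x y k
    using that
  proof (induction k arbitrary: x rule: less_induct)
    case (less k)
    obtain j where j: "j > 0" "(g ^^ j) x = ?s x" "\<forall>i. 0 < i \<and> i < j \<longrightarrow> (g ^^ i) x \<notin> B"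
      using ret_funpow[OF ret_ex[OF fin bij B less.prems(1)]] less.prems(1) by (auto simp: restrict_return_def)
    have jk: "j \<le> k" using j(3) less.prems by (meson not_le)
    show ?case
    proof (cases "j = k")
      case True then show ?thesis using j less.prems orbit.base[of ?s x] by simp
    next
      case False
      have "(g ^^ (k - j)) (?s x) = y"
        using less.prems(4) j(2) jk by (metis comp_apply funpow_add le_add_diff_inverse2)
      then have "y \<in> orbit ?s (?s x)"
        using less.IH[of "k - j" "?s x"] False jk j(1) bij_on_mem[OF sb less.prems(1)] less.prems(2,3) by auto
      then show ?thesis using orbit_step_eq[OF finB sb less.prems(1)] by simp
    qed
  qed
  have aD: "a \<in> D" "a' \<in> D" using a B by auto
  show ?thesis
  proof
    assume "orbit g a = orbit g a'"
    then have "a' \<in> orbit g a" using orbit_self[OF fin bij aD(2)] by simp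
    then obtain k where "k > 0" "(g ^^ k) a = a'" unfolding orbit_altdef by blast
    then have "a' \<in> orbit ?s a" using sup[OF a] by blast
    then show "orbit ?s a = orbit ?s a'" using orbit_eq[OF finB sb a(1)] by simp
  next
    assume "orbit ?s a = orbit ?s a'"
    then have "a' \<in> orbit g a" using orbit_self[OF finB sb a(2)] sub[OF a(1)] by blast
    then show "orbit g a = orbit g a'" using orbit_eq[OF fin bij aD(1)] by simp
  qed
qed

lemma region_mono:
  assumes "U \<subseteq> region r g B V"
  shows "region r g B U \<subseteq> region r g B V"
proof
  fix x assume "x \<in> region r g B U"
  then show "x \<in> region r g B V"
    by induction (use assms in \<open>auto intro: region.turn region.cross\<close>)
qed

text \<open>Turning around a face keeps \<open>orbit (g \<circ> r)\<close>, so only the crossings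
  matter. This ties the inductive \<open>region\<close> to the relation \<open>crossings\<close> in
  the definition of submaps.\<close>

lemma region_crossing:
  assumes D: "arc_inv r D" and g: "g permutes D" and U: "U \<subseteq> D" and x: "x \<in> D"
  shows "x \<in> region r g B U \<longleftrightarrow> (\<exists>u\<in>U. (orbit (g \<circ> r) u, orbit (g \<circ> r) x) \<in>
    {(orbit (g \<circ> r) a, orbit (g \<circ> r) (r a)) | a. a \<in> D - B}\<^sup>*)" (is "_ \<longleftrightarrow> (\<exists>u\<in>U. _ \<in> ?cr\<^sup>*)")
proof
  note fin = arc_inv_finite[OF D] and bij = face_bij[OF D g]
  assume "x \<in> region r g B U"
  then show "\<exists>u\<in>U. (orbit (g \<circ> r) u, orbit (g \<circ> r) x) \<in> ?cr\<^sup>*"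
  proof induction
    case (base u) then show ?case by blast
  next
    case (turn y)
    have "y \<in> D" using turn(1) region_subset[OF D g U] by blast
    then have "orbit (g \<circ> r) (g (r y)) = orbit (g \<circ> r) y" using orbit_step_eq[OF fin bij] by simp
    then show ?case using turn(2) by (simp only:)
  next
    case (cross y)
    have "y \<in> D" using cross(1) region_subset[OF D g U] by blast
    then have "(orbit (g \<circ> r) y, orbit (g \<circ> r) (r y)) \<in> ?cr" using cross(2) by blast
    then show ?case using cross(3) by (meson rtrancl.rtrancl_into_rtrancl)
  qed
next
  note fin = arc_inv_finite[OF D] and bij = face_bij[OF D g]
  have same: "z \<in> region r g B U" if "y \<in> region r g B U" "z \<in> D" "orbit (g \<circ> r) z = orbit (g \<circ> r) y" for y z
  proof -
    have "z \<in> orbit (g \<circ> r) y" using orbit_self[OF fin bij that(2)] that(3) by simp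
    moreover have "orbit (g \<circ> r) y \<subseteq> region r g B U"
      by (rule orbit_closed_subset[OF _ that(1)]) (auto intro: region.turn)
    ultimately show ?thesis by blast
  qed
  assume "\<exists>u\<in>U. (orbit (g \<circ> r) u, orbit (g \<circ> r) x) \<in> ?cr\<^sup>*"
  then obtain u where u: "u \<in> U" "(orbit (g \<circ> r) u, orbit (g \<circ> r) x) \<in> ?cr\<^sup>*" by blast
  from u(2) have "\<forall>y\<in>D. orbit (g \<circ> r) y = orbit (g \<circ> r) x \<longrightarrow> y \<in> region r g B U"
  proof induction
    case base
    show ?case using same[OF region.base[OF u(1)]] by blast
  next
    case (step G G')
    then obtain a where a: "a \<in> D - B" "G = orbit (g \<circ> r) a" "G' = orbit (g \<circ> r) (r a)" by blast
    then have "a \<in> region r g B U" using step(3) by blast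
    then have "r a \<in> region r g B U" using a(1) by (auto intro: region.cross)
    then show ?case using same a(3) by blast
  qed
  then show "x \<in> region r g B U" using x by blast
qed

text \<open>Between \<open>r x\<close> and the next arc of \<open>B\<close> in the rotation, the
  walk meets arcs outside \<open>B\<close> one at a time and crosses each of them; so a whole face
  of the submap is reached from any one of its arcs.\<close>

lemma region_face:
  assumes D: "arc_inv r D" and g: "g permutes D" and B: "arc_inv r B" "B \<subseteq> D" and u: "u \<in> B"
  shows "orbit (restrict_return g B \<circ> r) u \<subseteq> region r g B {u}"
proof -
  let ?R = "region r g B {u}"
  have gD: "g z \<in> D" if "z \<in> D" for z using that g by (simp add: permutes_in_image)
  have ret_R: "b \<in> ?R" if "ret g B z b" "z \<in> D" "g z \<in> ?R" for z b
    using that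
  proof induction
    case (later a b)
    have "r (g a) \<in> ?R" using later.prems(2) later.hyps(1) by (rule region.cross)
    then have "g (r (r (g a))) \<in> ?R" by (rule region.turn)
    then have "g (g a) \<in> ?R" using arc_invD(2)[OF D gD[OF later.prems(1)]] by simp
    then show ?case using later.IH gD[OF later.prems(1)] by blast
  qed
  have sR: "restrict_return g B (r x) \<in> ?R \<inter> B" if x: "x \<in> ?R \<inter> B" for x
  proof -
    have rx: "r x \<in> B" using x arc_invD(1)[OF B(1)] by blast
    have "ret g B (r x) (first_return g B (r x))"
      by (rule ret_ex[OF arc_inv_finite[OF D] permutes_imp_bij[OF g] B(2) rx])
    moreover from this have "first_return g B (r x) \<in> B" using ret_funpow by metis
    moreover have "g (r x) \<in> ?R" using x by (auto intro: region.turn)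
    ultimately show ?thesis using ret_R[of "r x"] rx B(2) by (auto simp: restrict_return_def)
  qed
  have "orbit (restrict_return g B \<circ> r) u \<subseteq> ?R \<inter> B"
  proof (rule orbit_closed_subset)
    show "u \<in> ?R \<inter> B" using u by (auto intro: region.base)
  qed (use sR in simp)
  then show ?thesis by blast
qed

section \<open>Faces of a submap inside the large map\<close>

locale submap_perm =
  fixes r :: "'b \<Rightarrow> 'b" and D g B s
  assumes D: "arc_inv r D" and g: "g \<in> planar_perms r D" and B: "arc_inv r B" "B \<subseteq> D" "B \<noteq> {}"
    and s: "s = restrict_return g B" "transitive_on r s B" "planar_on r s B"
begin

lemma gp: "g permutes D" using g by (simp add: planar_perms_def)
lemma sp: "s permutes B"
  unfolding s(1) by (rule restrict_return_permutes[OF arc_inv_finite[OF D] permutes_imp_bij[OF gp] B(2)])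

lemma g_filling: "g \<in> fillings r B s B (D - B)"
proof -
  have "B \<union> (D - B) = D" using B(2) by auto
  then show ?thesis
    using fillings_all_corners[OF B(1) sp, of "D - B"] g s(1) arc_inv_finite[OF D] by simp
qed

text \<open>A discrete Jordan theorem: crossing edges outside the submap never leads from one of its
  faces to another. It is the region claim of \<open>fillings_count\<close>, since \<open>g\<close>
  is a filling of its own restriction to \<open>B\<close>.\<close>

lemma jordan:
  assumes "G \<in> orbits_on (s \<circ> r) B"
  shows "region r g B G \<inter> B = G"
proof -
  have "even (card (D - B))" by (rule arc_inv_even[OF arc_inv_Diff[OF D B(1)]])
  then obtain k where k: "card (D - B) = 2 * k" by blast
  note fb = face_bij[OF B(1) sp] and finB = arc_inv_finite[OF B(1)]
  have "G \<subseteq> B" using orbits_on_eqD(2)[OF finB fb assms] by blast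
  moreover have "s (r a) \<in> G" if "a \<in> G" for a
    using orbits_on_eqD(1)[OF finB fb assms that] orbit.base[of "s \<circ> r" a] by simp
  ultimately show ?thesis
    using sum_region_card(1)[OF B(1,3) sp s(2,3) arc_inv_Diff[OF D B(1)] _ k assms g_filling] by blast
qed

abbreviation "cr \<equiv> {(orbit (g \<circ> r) a, orbit (g \<circ> r) (r a)) | a. a \<in> D - B}"

lemma face_sub: "G \<in> orbits_on (s \<circ> r) B \<Longrightarrow> G \<subseteq> B" "G \<in> orbits_on (s \<circ> r) B \<Longrightarrow> G \<noteq> {}"
  using orbits_on_eqD(2)[OF arc_inv_finite[OF B(1)] face_bij[OF B(1) sp]] orbits_on_nonempty by blast+

lemma region_single:
  assumes G: "G \<in> orbits_on (s \<circ> r) B" and u: "u \<in> G"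
  shows "region r g B {u} = region r g B G"
proof
  show "region r g B {u} \<subseteq> region r g B G" by (rule region_mono) (use u in \<open>auto intro: region.base\<close>)
  have "G = orbit (s \<circ> r) u"
    by (rule orbits_on_eqD(1)[OF arc_inv_finite[OF B(1)] face_bij[OF B(1) sp] G u])
  then have "G \<subseteq> region r g B {u}"
    using region_face[OF D gp B(1,2)] face_sub(1)[OF G] u s(1) by blast
  then show "region r g B G \<subseteq> region r g B {u}" by (rule region_mono)
qed

text \<open>All arcs of one face of the submap reach the same arcs, so quantifying over the arcs of
  \<open>G\<close> amounts to choosing one of them.\<close>

lemma part_of_iff:
  assumes G: "G \<in> orbits_on (s \<circ> r) B" and x: "x \<in> D"
  shows "(\<forall>a\<in>G. (orbit (g \<circ> r) a, orbit (g \<circ> r) x) \<in> cr\<^sup>*) \<longleftrightarrow> x \<in> region r g B G"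
proof -
  have 1: "x \<in> region r g B G \<longleftrightarrow> (orbit (g \<circ> r) a, orbit (g \<circ> r) x) \<in> cr\<^sup>*" if a: "a \<in> G" for a
  proof -
    have "{a} \<subseteq> D" using a face_sub(1)[OF G] B(2) by blast
    show ?thesis
      unfolding region_single[OF G a, symmetric] region_crossing[OF D gp \<open>{a} \<subseteq> D\<close> x] by blast
  qed
  then show ?thesis using face_sub(2)[OF G] by blast
qed

text \<open>Crossing an edge can be undone, so two faces whose regions share an arc would be
  connected with each other, against \<open>jordan\<close>.\<close>

lemma face_unique:
  assumes G: "G \<in> orbits_on (s \<circ> r) B" "G' \<in> orbits_on (s \<circ> r) B"
    and x: "x \<in> region r g B G" "x \<in> region r g B G'"
  shows "G = G'"
proof -
  obtain u u' where u: "u \<in> G" "u' \<in> G'" using face_sub(2) G by blast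
  have uD: "u \<in> D" "u' \<in> D" using u face_sub(1) G B(2) by blast+
  have xD: "x \<in> D" using x(1) region_subset[OF D gp] face_sub(1)[OF G(1)] B(2) by blast
  have "sym cr"
  proof (rule symI)
    fix p q assume "(p, q) \<in> cr"
    then obtain a where a: "a \<in> D - B" "p = orbit (g \<circ> r) a" "q = orbit (g \<circ> r) (r a)" by blast
    have "r a \<in> D - B" "r (r a) = a" using arc_invD[OF arc_inv_Diff[OF D B(1)] a(1)] by auto
    then show "(q, p) \<in> cr" using a by (metis (mono_tags, lifting) mem_Collect_eq)
  qed
  then have "sym (cr\<^sup>*)" by (rule sym_rtrancl)
  moreover have "(orbit (g \<circ> r) u, orbit (g \<circ> r) x) \<in> cr\<^sup>*" "(orbit (g \<circ> r) u', orbit (g \<circ> r) x) \<in> cr\<^sup>*"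
    using part_of_iff[OF G(1) xD] part_of_iff[OF G(2) xD] u x by blast+
  ultimately have "(orbit (g \<circ> r) u, orbit (g \<circ> r) u') \<in> cr\<^sup>*"
    by (meson rtrancl_trans symD)
  then have "u' \<in> region r g B {u}" using region_crossing[OF D gp _ uD(2), of "{u}" B] uD(1) by blast
  then have "u' \<in> region r g B G \<inter> B" using region_single[OF G(1) u(1)] u(2) face_sub(1)[OF G(2)] by blast
  then have "u' \<in> G" using jordan[OF G(1)] by simp
  then show ?thesis
    using orbits_on_eqD(1)[OF arc_inv_finite[OF B(1)] face_bij[OF B(1) sp] G(1)]
      orbits_on_eqD(1)[OF arc_inv_finite[OF B(1)] face_bij[OF B(1) sp] G(2) u(2)] by blast
qed

text \<open>Started from all arcs of the submap, the region is closed under \<open>r\<close> and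
  \<open>g\<close>; connectedness of the large map does the rest.\<close>

lemma region_all: "region r g B B = D"
proof -
  have sub: "region r g B B \<subseteq> D" by (rule region_subset[OF D gp B(2)])
  have cl: "r x \<in> region r g B B" if "x \<in> region r g B B" for x
  proof (cases "x \<in> B")
    case True then show ?thesis using arc_invD(1)[OF B(1)] by (auto intro: region.base)
  qed (use that in \<open>auto intro: region.cross\<close>)
  have "g x \<in> region r g B B" if "x \<in> region r g B B" for x
    using region.turn[OF cl[OF that]] arc_invD(2)[OF D, of x] sub that by auto
  moreover have "region r g B B \<noteq> {}" using B(3) by (auto intro: region.base)
  moreover have "transitive_on r g D" using g by (simp add: planar_perms_def)
  ultimately show ?thesis using sub cl unfolding transitive_on_def by blast
qed

text \<open>By \<open>region_all\<close> and \<open>face_unique\<close> the regions of the faces of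
  the submap partition the arcs of the large map. So lying in no inner face, as the definition of
  submaps demands, means lying in the outer one.\<close>

lemma outer_face_iff:
  assumes F: "F \<in> orbits_on (s \<circ> r) B" and x: "x \<in> D"
  shows "(\<forall>G\<in>orbits_on (s \<circ> r) B - {F}. \<not> (\<forall>a\<in>G. (orbit (g \<circ> r) a, orbit (g \<circ> r) x) \<in> cr\<^sup>*)) \<longleftrightarrow>
    x \<in> region r g B F"
proof
  assume "x \<in> region r g B F"
  then show "\<forall>G\<in>orbits_on (s \<circ> r) B - {F}. \<not> (\<forall>a\<in>G. (orbit (g \<circ> r) a, orbit (g \<circ> r) x) \<in> cr\<^sup>*)"
    using part_of_iff[OF _ x] face_unique[OF F] by blast
next
  assume *: "\<forall>G\<in>orbits_on (s \<circ> r) B - {F}. \<not> (\<forall>a\<in>G. (orbit (g \<circ> r) a, orbit (g \<circ> r) x) \<in> cr\<^sup>*)"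
  have "x \<in> region r g B B" using x region_all by simp
  then obtain u where u: "u \<in> B" "(orbit (g \<circ> r) u, orbit (g \<circ> r) x) \<in> cr\<^sup>*"
    using region_crossing[OF D gp B(2) x] by blast
  have "{u} \<subseteq> D" using u(1) B(2) by blast
  then have xu: "x \<in> region r g B {u}" using region_crossing[OF D gp _ x] u(2) by blast
  define G where "G = orbit (s \<circ> r) u"
  have G: "G \<in> orbits_on (s \<circ> r) B" using u(1) by (auto simp: G_def orbits_on_def)
  have "u \<in> G" unfolding G_def by (rule orbit_self[OF arc_inv_finite[OF B(1)] face_bij[OF B(1) sp] u(1)])
  then have xG: "x \<in> region r g B G" using xu region_single[OF G] by blast
  then have "G = F" using * part_of_iff[OF G x] G by blast
  then show "x \<in> region r g B F" using xG by simp
qed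

end

section \<open>Occurrences as embeddings up to automorphism\<close>

definition returns_like :: "('c, 'd) pre_map \<Rightarrow> ('b \<Rightarrow> 'b) \<Rightarrow> ('d \<Rightarrow> 'b) \<Rightarrow> bool" where
  "returns_like m g f \<longleftrightarrow>
     (\<forall>a\<in>map_arcs m. first_return g (f ` map_arcs m) (f a) = f (edge_succ m a))"

definition root_left_face :: "('c, 'd) pre_map \<Rightarrow> 'd set" where
  "root_left_face m = left_face m (the (root_arc m))"

text \<open>The last condition says positively that the root lies in the outer face;
  \<open>occ_condition\<close> matches it with the negative condition on inner faces in
  \<open>occurs_as_submap\<close>.\<close>

definition occ_embeddings :: "('c, 'd) pre_map \<Rightarrow> ('a, 'b) pre_map \<Rightarrow> ('d \<Rightarrow> 'b) set" where
  "occ_embeddings m M = {f \<in> embeddings (edge_rev m) (map_arcs m) (edge_rev M) (map_arcs M).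
     returns_like m (edge_succ M) f \<and>
     the (root_arc M) \<in> region (edge_rev M) (edge_succ M) (f ` map_arcs m) (f ` root_left_face m)}"

text \<open>The automorphisms of the unrooted map that preserve the outer face. Bijectivity is
  automatic by \<open>outer_auto_bij\<close>, and one arc decides about the face because faces are
  mapped to faces.\<close>

definition outer_autos :: "('c, 'd) pre_map \<Rightarrow> ('d \<Rightarrow> 'd) set" where
  "outer_autos m = {h \<in> map_arcs m \<rightarrow>\<^sub>E map_arcs m.
     (\<forall>a\<in>map_arcs m. h (edge_rev m a) = edge_rev m (h a) \<and> h (edge_succ m a) = edge_succ m (h a)) \<and>
     h (the (root_arc m)) \<in> root_left_face m}"

lemma root_arc_the:
  assumes "rooted_planar_map M" "map_arcs M \<noteq> {}"
  shows "root_arc M = Some (the (root_arc M))" "the (root_arc M) \<in> map_arcs M"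
  using assms rooted_planar_mapD(7)[OF assms(1)]
  by (auto simp: rooted_planar_map_def split: option.splits)

lemma embedding_submap:
  assumes m: "rooted_planar_map m" "map_arcs m \<noteq> {}"
    and D: "arc_inv r D" and g: "g \<in> planar_perms r D"
    and f: "f \<in> embeddings (edge_rev m) (map_arcs m) r D" "returns_like m g f"
  defines "B \<equiv> f ` map_arcs m"
  shows "submap_perm r D g B (restrict_return g B)"
    and "\<And>a. a \<in> map_arcs m \<Longrightarrow> restrict_return g B (f a) = f (edge_succ m a)"
    and "\<And>a. a \<in> map_arcs m \<Longrightarrow> orbit (restrict_return g B \<circ> r) (f a) = f ` left_face m a"
    and "orbits_on (restrict_return g B \<circ> r) B = image f ` orbits_on (edge_succ m \<circ> edge_rev m) (map_arcs m)"
proof -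
  let ?A = "map_arcs m" and ?r = "edge_rev m" and ?s = "edge_succ m"
  note A = planar_map_arc_inv[OF m] and sA = planar_map_succ[OF m]
  have inj: "inj_on f ?A" and fD: "\<And>a. a \<in> ?A \<Longrightarrow> f a \<in> D" and fr: "\<And>a. a \<in> ?A \<Longrightarrow> r (f a) = f (?r a)"
    using f(1) by (auto simp: embeddings_def)
  have sA': "?s a \<in> ?A" if "a \<in> ?A" for a using that sA by (simp add: permutes_in_image)
  show sf: "restrict_return g B (f a) = f (?s a)" if "a \<in> ?A" for a
    using that f(2) by (simp add: restrict_return_def B_def returns_like_def)
  have B: "arc_inv r B"
    unfolding arc_inv_def B_def
  proof (intro conjI ballI)
    show "finite (f ` ?A)" using arc_inv_finite[OF A] by simp
    fix b assume "b \<in> f ` ?A"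
    then obtain a where a: "a \<in> ?A" "b = f a" by blast
    note aa = arc_invD[OF A a(1)]
    show "r b \<in> f ` ?A" "r (r b) = b" using a aa fr[OF a(1)] fr[OF aa(1)] by auto
    show "r b \<noteq> b" using a aa fr[OF a(1)] inj_onD[OF inj _ aa(1) a(1)] by auto
  qed
  have BD: "B \<subseteq> D" using fD by (auto simp: B_def)
  show "submap_perm r D g B (restrict_return g B)"
  proof
    show "B \<noteq> {}" using m(2) by (simp add: B_def)
    show "transitive_on r (restrict_return g B) B"
      unfolding B_def
      by (rule transport_transitive[OF arc_invD(1)[OF A] fr sA' sf[unfolded B_def] inj planar_map_transitive[OF m]])
    show "planar_on r (restrict_return g B) B"
      unfolding B_def
      by (rule transport_planar[OF A sA inj fr sf[unfolded B_def] planar_map_planar[OF m]])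
  qed (use D g B BD in auto)
  have sr: "(?s \<circ> ?r) a \<in> ?A" "(restrict_return g B \<circ> r) (f a) = f ((?s \<circ> ?r) a)" if "a \<in> ?A" for a
    using that fr sf arc_invD(1)[OF A] sA' by auto
  show "orbit (restrict_return g B \<circ> r) (f a) = f ` left_face m a" if "a \<in> ?A" for a
    using orbit_image(1)[of ?A "?s \<circ> ?r" "restrict_return g B \<circ> r" f a] sr that
    by (simp add: left_face_orbit)
  show "orbits_on (restrict_return g B \<circ> r) B = image f ` orbits_on (?s \<circ> ?r) ?A"
    unfolding B_def by (rule transport_orbits) (use sr in \<open>auto simp: B_def\<close>)
qed

lemma root_face_orbit:
  assumes m: "rooted_planar_map m" "map_arcs m \<noteq> {}"
  shows "root_left_face m \<in> orbits_on (edge_succ m \<circ> edge_rev m) (map_arcs m)"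
  using root_arc_the[OF m] by (auto simp: root_left_face_def left_face_orbit orbits_on_def)

lemma planar_map_in_planar_perms:
  assumes "rooted_planar_map M" "map_arcs M \<noteq> {}"
  shows "edge_succ M \<in> planar_perms (edge_rev M) (map_arcs M)"
  using planar_map_perm[OF assms] by (simp add: planar_perms_def)

lemma occ_condition:
  assumes m: "rooted_planar_map m" "map_arcs m \<noteq> {}" and M: "rooted_planar_map M" "map_arcs M \<noteq> {}"
    and f: "f \<in> embeddings (edge_rev m) (map_arcs m) (edge_rev M) (map_arcs M)"
      "returns_like m (edge_succ M) f"
    and S: "map_arcs S = f ` map_arcs m" "\<And>a. a \<in> map_arcs S \<Longrightarrow> edge_rev S a = edge_rev M a"
      "\<And>a. a \<in> map_arcs S \<Longrightarrow> edge_succ S a = first_return (edge_succ M) (map_arcs S) a"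
      "root_arc S = map_option f (root_arc m)"
  shows "(\<forall>G\<in>inner_faces S. \<not> part_of_face M S (root_face M) G) \<longleftrightarrow>
    the (root_arc M) \<in> region (edge_rev M) (edge_succ M) (f ` map_arcs m) (f ` root_left_face m)"
proof -
  let ?r = "edge_rev M" and ?g = "edge_succ M" and ?D = "map_arcs M" and ?B = "f ` map_arcs m"
  let ?s = "restrict_return ?g ?B"
  note D = planar_map_arc_inv[OF M] and g = planar_map_in_planar_perms[OF M]
  note e = embedding_submap[OF m D g f]
  interpret submap_perm ?r ?D ?g ?B ?s by (rule e(1))
  note root = root_arc_the[OF m] and rootM = root_arc_the[OF M]
  have lf: "left_face S a = orbit (?s \<circ> ?r) a" if a: "a \<in> ?B" for a
    unfolding left_face_orbit
  proof (rule orbit_cong0[OF a, symmetric])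
    have rB: "?r b \<in> ?B" if "b \<in> ?B" for b using arc_invD(1)[OF B(1) that] .
    show "?s \<circ> ?r \<in> ?B \<rightarrow> ?B" using bij_on_mem[OF face_bij[OF B(1) sp]] by blast
    show "(?s \<circ> ?r) y = (edge_succ S \<circ> edge_rev S) y" if y: "y \<in> ?B" for y
      using S y rB[OF y] by (simp add: restrict_return_def)
  qed
  have faces: "faces S = orbits_on (?s \<circ> ?r) ?B"
    using lf B(3) S(1) by (simp add: faces_def orbits_on_def)
  have rf: "root_face S = f ` root_left_face m"
  proof -
    have "root_arc S = Some (f (the (root_arc m)))" using S(4) root(1) by (cases "root_arc m") auto
    moreover have "f (the (root_arc m)) \<in> ?B" using root(2) by blast
    ultimately show ?thesis
      using lf[of "f (the (root_arc m))"] e(3)[OF root(2)] by (simp add: root_face_def root_left_face_def)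
  qed
  have F: "f ` root_left_face m \<in> orbits_on (?s \<circ> ?r) ?B"
    unfolding e(4) using root_face_orbit[OF m] by blast
  have rfM: "root_face M = orbit (?g \<circ> ?r) (the (root_arc M))"
    using rootM(1) by (cases "root_arc M") (auto simp: root_face_def left_face_orbit)
  have "crossings M S = cr"
    by (simp add: crossings_def left_face_orbit S(1))
  then have "part_of_face M S (root_face M) G \<longleftrightarrow>
      (\<forall>a\<in>G. (orbit (?g \<circ> ?r) a, orbit (?g \<circ> ?r) (the (root_arc M))) \<in> cr\<^sup>*)" for G
    by (simp add: part_of_face_def rfM left_face_orbit)
  then show ?thesis
    using outer_face_iff[OF F rootM(2)] by (simp add: inner_faces_def faces rf)
qed

lemma submap_embedding:
  assumes m: "rooted_planar_map m" "map_arcs m \<noteq> {}" and M: "rooted_planar_map M"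
    and S: "map_iso m S" "occurs_as_submap S M"
  shows "\<exists>f\<in>occ_embeddings m M. map_arcs S = f ` map_arcs m \<and> map_verts S = tail (map_graph M) ` map_arcs S"
proof -
  obtain e where e: "map_isomorphism m S e" using S(1) by (auto simp: map_iso_def)
  note E = map_isomorphism_inj[OF e]
  have sub: "map_verts S \<subseteq> map_verts M" "map_arcs S \<subseteq> map_arcs M"
    and tl: "tail (map_graph S) = tail (map_graph M)"
    and rS: "\<And>a. a \<in> map_arcs S \<Longrightarrow> edge_rev S a = edge_rev M a"
    and sS: "\<And>a. a \<in> map_arcs S \<Longrightarrow> edge_succ S a = first_return (edge_succ M) (map_arcs S) a"
    and oS: "\<forall>G\<in>inner_faces S. \<not> part_of_face M S (root_face M) G"
    using S(2) by (auto simp: occurs_as_submap_def subgraph_def compatible_def)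
  define f where "f = restrict (iso_arcs e) (map_arcs m)"
  have fe: "f a = iso_arcs e a" if "a \<in> map_arcs m" for a using that by (simp add: f_def)
  have im: "map_arcs S = f ` map_arcs m" using E(4) by (simp add: f_def)
  have ne: "map_arcs M \<noteq> {}" using sub(2) m(2) im by auto
  have ra: "edge_rev m a \<in> map_arcs m" "edge_succ m a \<in> map_arcs m" if "a \<in> map_arcs m" for a
    using rooted_planar_mapD(5,6)[OF m(1) that] by auto
  have f1: "f \<in> embeddings (edge_rev m) (map_arcs m) (edge_rev M) (map_arcs M)"
    unfolding embeddings_def
  proof (intro CollectI conjI ballI)
    show "f \<in> map_arcs m \<rightarrow>\<^sub>E map_arcs M" using sub(2) im by (auto simp: f_def)
    show "inj_on f (map_arcs m)" using E(2) by (simp add: f_def inj_on_restrict_eq)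
    fix a assume a: "a \<in> map_arcs m"
    have "f a \<in> map_arcs S" using a im by blast
    then show "f (edge_rev m a) = edge_rev M (f a)"
      using E(8)[OF a] rS[of "f a"] fe ra(1)[OF a] a by simp
  qed
  have f2: "returns_like m (edge_succ M) f"
    unfolding returns_like_def
  proof
    fix a assume a: "a \<in> map_arcs m"
    have "f a \<in> map_arcs S" using a im by blast
    from sS[OF this] E(9)[OF a] show "first_return (edge_succ M) (f ` map_arcs m) (f a) = f (edge_succ m a)"
      using fe[OF a] fe[OF ra(2)[OF a]] im by simp
  qed
  have "root_arc S = map_option f (root_arc m)"
    using E(10) root_arc_the[OF m] fe by (cases "root_arc m") auto
  from occ_condition[OF m M ne f1 f2 im rS sS this] oS have "f \<in> occ_embeddings m M"
    using f1 f2 by (simp add: occ_embeddings_def)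
  moreover have "map_verts S = tail (map_graph M) ` map_arcs S"
  proof -
    have "map_verts S = iso_verts e ` tail (map_graph m) ` map_arcs m"
      using E(3) planar_map_verts[OF m] by simp
    also have "\<dots> = tail (map_graph S) ` iso_arcs e ` map_arcs m"
      unfolding image_image by (rule image_cong[OF refl]) (simp add: E(6))
    finally show ?thesis by (simp add: tl E(4))
  qed
  ultimately show ?thesis using im by blast
qed

text \<open>The vertices of the occurrence are taken as the tails of its arcs;
  \<open>orbit_restrict_return\<close> shows that these coincide in the large map exactly when they
  do in \<open>m\<close>.\<close>

lemma embedding_occurs:
  assumes m: "rooted_planar_map m" "map_arcs m \<noteq> {}" and M: "rooted_planar_map M"
    and f: "f \<in> occ_embeddings m M"
  shows "\<exists>S. map_iso m S \<and> occurs_as_submap S M \<and> map_arcs S = f ` map_arcs m \<and>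
    map_verts S = tail (map_graph M) ` map_arcs S"
proof -
  let ?B = "f ` map_arcs m" and ?t = "tail (map_graph M)"
  have f1: "f \<in> embeddings (edge_rev m) (map_arcs m) (edge_rev M) (map_arcs M)"
    and f2: "returns_like m (edge_succ M) f"
    and f3: "the (root_arc M) \<in> region (edge_rev M) (edge_succ M) ?B (f ` root_left_face m)"
    using f by (auto simp: occ_embeddings_def)
  have inj: "inj_on f (map_arcs m)" and BD: "?B \<subseteq> map_arcs M"
    and fr: "\<And>a. a \<in> map_arcs m \<Longrightarrow> edge_rev M (f a) = f (edge_rev m a)"
    using f1 by (auto simp: embeddings_def)
  have ne: "map_arcs M \<noteq> {}" using BD m(2) by auto
  note D = planar_map_arc_inv[OF M ne] and g = planar_map_in_planar_perms[OF M ne]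
  note e = embedding_submap[OF m D g f1 f2]
  interpret submap_perm "edge_rev M" "map_arcs M" "edge_succ M" ?B "restrict_return (edge_succ M) ?B"
    by (rule e(1))
  define S where "S = \<lparr>map_graph = \<lparr>verts = ?t ` ?B, arcs = ?B, tail = ?t, head = head (map_graph M)\<rparr>,
     edge_rev = edge_rev M, edge_succ = restrict_return (edge_succ M) ?B, root_arc = map_option f (root_arc m)\<rparr>"
  have hd: "head (map_graph M) a = ?t (edge_rev M a)" if "a \<in> ?B" for a
    using planar_map_head[OF M ne] that BD by blast
  have "map_iso m S"
  proof (rule map_iso_arcsI[OF m inj])
    show "tail (map_graph S) (f a) = tail (map_graph S) (f a') \<longleftrightarrow> tail (map_graph m) a = tail (map_graph m) a'"
      if a: "a \<in> map_arcs m" "a' \<in> map_arcs m" for a a'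
    proof -
      let ?s = "restrict_return (edge_succ M) ?B"
      have faB: "f a \<in> ?B" "f a' \<in> ?B" using a by auto
      have faD: "f a \<in> map_arcs M" "f a' \<in> map_arcs M" using faB BD by auto
      have "tail (map_graph S) (f a) = tail (map_graph S) (f a') \<longleftrightarrow>
          orbit (edge_succ M) (f a) = orbit (edge_succ M) (f a')"
        using planar_map_tail[OF M ne faD] by (simp add: S_def)
      also have "\<dots> \<longleftrightarrow> orbit ?s (f a) = orbit ?s (f a')"
        by (rule orbit_restrict_return[OF arc_inv_finite[OF D] permutes_imp_bij[OF gp] BD faB])
      also have "\<dots> \<longleftrightarrow> f ` orbit (edge_succ m) a = f ` orbit (edge_succ m) a'"
      proof -
        have "orbit ?s (f b) = f ` orbit (edge_succ m) b" if "b \<in> map_arcs m" for b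
          by (rule orbit_image(1)[where A = "map_arcs m"])
            (use rooted_planar_mapD(6)[OF m(1)] e(2) that in auto)
        then show ?thesis using a by simp
      qed
      also have "\<dots> \<longleftrightarrow> orbit (edge_succ m) a = orbit (edge_succ m) a'"
      proof (rule inj_on_image_eq_iff[OF inj])
        note bm = permutes_imp_bij[OF planar_map_succ[OF m]]
        show "orbit (edge_succ m) a \<subseteq> map_arcs m" "orbit (edge_succ m) a' \<subseteq> map_arcs m"
          using orbit_subset_on[OF bm] a by auto
      qed
      finally show ?thesis using planar_map_tail[OF m a] by simp
    qed
    show "head (map_graph S) a = tail (map_graph S) (edge_rev S a)" if "a \<in> map_arcs S" for a
      using hd that by (simp add: S_def)
  qed (use fr e(2) in \<open>auto simp: S_def\<close>)
  moreover have "occurs_as_submap S M"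
    unfolding occurs_as_submap_def
  proof (intro conjI)
    have wM: "wf_digraph (map_graph M)" by (rule rooted_planar_mapD(2)[OF M])
    have "wf_digraph (map_graph S)"
      by unfold_locales (use hd arc_invD(1)[OF B(1)] in \<open>auto simp: S_def\<close>)
    then show "subgraph (map_graph S) (map_graph M)"
      using wM BD planar_map_verts[OF M ne] by (auto simp: subgraph_def compatible_def S_def)
    show "\<forall>a\<in>map_arcs S. edge_rev S a = edge_rev M a" by (simp add: S_def)
    show "\<forall>a\<in>map_arcs S. edge_succ S a = first_return (edge_succ M) (map_arcs S) a"
      by (simp add: S_def restrict_return_def)
    show "\<forall>G\<in>inner_faces S. \<not> part_of_face M S (root_face M) G"
      using occ_condition[OF m M ne f1 f2, of S] f3 by (simp add: S_def restrict_return_def)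
  qed
  ultimately show ?thesis by (intro exI[of _ S]) (simp add: S_def)
qed

text \<open>The image is closed under both permutations, so connectedness makes it everything, and
  finiteness gives injectivity.\<close>

lemma outer_auto_bij:
  assumes m: "rooted_planar_map m" "map_arcs m \<noteq> {}" and h: "h \<in> outer_autos m"
  shows "bij_betw h (map_arcs m) (map_arcs m)"
proof -
  let ?A = "map_arcs m"
  have hA: "h ` ?A \<subseteq> ?A" and hr: "\<And>a. a \<in> ?A \<Longrightarrow> h (edge_rev m a) = edge_rev m (h a)"
    and hs: "\<And>a. a \<in> ?A \<Longrightarrow> h (edge_succ m a) = edge_succ m (h a)"
    using h by (auto simp: outer_autos_def)
  have "\<forall>b\<in>h ` ?A. edge_rev m b \<in> h ` ?A \<and> edge_succ m b \<in> h ` ?A"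
    using hr[symmetric] hs[symmetric] rooted_planar_mapD(5,6)[OF m(1)] by auto
  moreover have "h ` ?A \<noteq> {}" using m(2) by simp
  ultimately have "h ` ?A = ?A"
    using planar_map_transitive[OF m] hA unfolding transitive_on_def by blast
  moreover have "finite ?A" by (rule rooted_planar_mapD(4)[OF m(1)])
  ultimately show ?thesis by (simp add: bij_betw_def eq_card_imp_inj_on)
qed

lemma outer_auto_faces:
  assumes m: "rooted_planar_map m" "map_arcs m \<noteq> {}"
    and h: "\<And>a. a \<in> map_arcs m \<Longrightarrow> h a \<in> map_arcs m"
      "\<And>a. a \<in> map_arcs m \<Longrightarrow> h (edge_rev m a) = edge_rev m (h a)"
      "\<And>a. a \<in> map_arcs m \<Longrightarrow> h (edge_succ m a) = edge_succ m (h a)"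
  shows "h ` root_left_face m = left_face m (h (the (root_arc m)))"
  unfolding root_left_face_def left_face_orbit
  by (rule orbit_image(1)[where A = "map_arcs m", symmetric])
    (use h rooted_planar_mapD(5,6)[OF m(1)] root_arc_the[OF m] in auto)

text \<open>Two embeddings with the same image differ by an automorphism of \<open>m\<close>. It
  preserves the outer face because the root of the large map lies in the region of one face
  only.\<close>

lemma card_occ_fibre:
  assumes m: "rooted_planar_map m" "map_arcs m \<noteq> {}" and M: "rooted_planar_map M"
    and f0: "f0 \<in> occ_embeddings m M"
  shows "card {f \<in> occ_embeddings m M. f ` map_arcs m = f0 ` map_arcs m} = card (outer_autos m)"
proof -
  let ?A = "map_arcs m" and ?B = "f0 ` map_arcs m" and ?x = "the (root_arc m)"
  let ?r = "edge_rev m" and ?s = "edge_succ m"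
  have emb: "f \<in> embeddings ?r ?A (edge_rev M) (map_arcs M)" "returns_like m (edge_succ M) f"
    "the (root_arc M) \<in> region (edge_rev M) (edge_succ M) (f ` ?A) (f ` root_left_face m)"
    if "f \<in> occ_embeddings m M" for f
    using that by (auto simp: occ_embeddings_def)
  note e0 = emb[OF f0]
  have inj0: "inj_on f0 ?A" and fM: "f0 ` ?A \<subseteq> map_arcs M"
    and fr0: "\<And>a. a \<in> ?A \<Longrightarrow> f0 (?r a) = edge_rev M (f0 a)"
    using e0(1) by (auto simp: embeddings_def)
  have ne: "map_arcs M \<noteq> {}" using fM m(2) by auto
  note D = planar_map_arc_inv[OF M ne] and g = planar_map_in_planar_perms[OF M ne]
  note sub0 = embedding_submap[OF m D g e0(1,2)]
  note root = root_arc_the[OF m]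
  have rs: "?r a \<in> ?A" "?s a \<in> ?A" if "a \<in> ?A" for a using rooted_planar_mapD(5,6)[OF m(1) that] by auto
  have lf_sub: "left_face m a \<subseteq> ?A" if "a \<in> ?A" for a
    unfolding left_face_orbit by (rule orbit_closed_subset[OF _ that]) (use rs in auto)
  have A: "h a \<in> ?A" "h (?r a) = ?r (h a)" "h (?s a) = ?s (h a)" if "h \<in> outer_autos m" "a \<in> ?A" for h a
    using that by (auto simp: outer_autos_def)
  have "bij_betw (\<lambda>h. restrict (f0 \<circ> h) ?A) (outer_autos m) {f \<in> occ_embeddings m M. f ` ?A = ?B}"
    unfolding bij_betw_def
  proof
    show "inj_on (\<lambda>h. restrict (f0 \<circ> h) ?A) (outer_autos m)"
    proof (rule inj_onI)
      fix h h' assume h: "h \<in> outer_autos m" "h' \<in> outer_autos m"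
        and eq: "restrict (f0 \<circ> h) ?A = restrict (f0 \<circ> h') ?A"
      have "h a = h' a" if a: "a \<in> ?A" for a
      proof (rule inj_onD[OF inj0 _ A(1)[OF h(1) a] A(1)[OF h(2) a]])
        show "f0 (h a) = f0 (h' a)" using fun_cong[OF eq, of a] a by simp
      qed
      moreover have "h \<in> ?A \<rightarrow>\<^sub>E ?A" "h' \<in> ?A \<rightarrow>\<^sub>E ?A" using h by (auto simp: outer_autos_def)
      ultimately show "h = h'" by (intro PiE_ext) auto
    qed
    show "(\<lambda>h. restrict (f0 \<circ> h) ?A) ` outer_autos m = {f \<in> occ_embeddings m M. f ` ?A = ?B}"
    proof
      show "(\<lambda>h. restrict (f0 \<circ> h) ?A) ` outer_autos m \<subseteq> {f \<in> occ_embeddings m M. f ` ?A = ?B}"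
      proof clarify
        fix h assume h: "h \<in> outer_autos m"
        let ?f = "restrict (f0 \<circ> h) ?A"
        note hb = outer_auto_bij[OF m h]
        have "?f ` ?A = f0 ` h ` ?A" unfolding image_image by (rule image_cong) auto
        also have "h ` ?A = ?A" using hb by (simp add: bij_betw_def)
        finally have img: "?f ` ?A = ?B" .
        have hF: "h ` root_left_face m = root_left_face m"
        proof -
          have "h ` root_left_face m = left_face m (h ?x)"
            by (rule outer_auto_faces[OF m]) (use A[OF h] in auto)
          also have "\<dots> = root_left_face m"
          proof -
            have "h ?x \<in> orbit (?s \<circ> ?r) ?x" using h by (simp add: outer_autos_def root_left_face_def left_face_orbit)
            from orbit_eq[OF rooted_planar_mapD(4)[OF m(1)]
                face_bij[OF planar_map_arc_inv[OF m] planar_map_succ[OF m]] root(2) this]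
            show ?thesis by (simp add: root_left_face_def left_face_orbit)
          qed
          finally show ?thesis .
        qed
        have fF: "?f ` root_left_face m = f0 ` root_left_face m"
        proof -
          have "?f ` root_left_face m = f0 ` h ` root_left_face m"
            unfolding image_image by (rule image_cong[OF refl]) (use lf_sub[OF root(2)] in \<open>auto simp: root_left_face_def\<close>)
          then show ?thesis by (simp only: hF)
        qed
        have "?f \<in> embeddings ?r ?A (edge_rev M) (map_arcs M)"
          unfolding embeddings_def
        proof (intro CollectI conjI ballI)
          show "?f \<in> ?A \<rightarrow>\<^sub>E map_arcs M" using A(1)[OF h] fM by auto
          show "inj_on ?f ?A"
            using comp_inj_on[of h ?A f0] hb inj0 by (simp add: bij_betw_def inj_on_restrict_eq)
          show "?f (?r a) = edge_rev M (?f a)" if "a \<in> ?A" for a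
            using that rs A[OF h that] fr0 by simp
        qed
        moreover have "returns_like m (edge_succ M) ?f"
          unfolding returns_like_def img
        proof
          fix a assume a: "a \<in> ?A"
          have "first_return (edge_succ M) ?B (f0 (h a)) = f0 (?s (h a))"
            using e0(2) A(1)[OF h a] by (simp add: returns_like_def)
          then show "first_return (edge_succ M) ?B (?f a) = ?f (?s a)"
            using a rs A[OF h a] by simp
        qed
        ultimately show "?f \<in> occ_embeddings m M \<and> ?f ` ?A = ?B"
          using e0(3) img fF unfolding occ_embeddings_def by simp
      qed
      show "{f \<in> occ_embeddings m M. f ` ?A = ?B} \<subseteq> (\<lambda>h. restrict (f0 \<circ> h) ?A) ` outer_autos m"
      proof
        fix f assume "f \<in> {f \<in> occ_embeddings m M. f ` ?A = ?B}"
        then have f: "f \<in> occ_embeddings m M" and img: "f ` ?A = ?B" by auto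
        note e = emb[OF f]
        have fr: "\<And>a. a \<in> ?A \<Longrightarrow> f (?r a) = edge_rev M (f a)" and fE: "f \<in> ?A \<rightarrow>\<^sub>E map_arcs M"
          using e(1) by (auto simp: embeddings_def)
        define h where "h = restrict (\<lambda>a. inv_into ?A f0 (f a)) ?A"
        have h: "h a \<in> ?A" "f0 (h a) = f a" if "a \<in> ?A" for a
        proof -
          have "f a \<in> f0 ` ?A" using that img by blast
          then show "h a \<in> ?A" "f0 (h a) = f a"
            using that by (auto simp: h_def inv_into_into f_inv_into_f)
        qed
        have hr: "h (?r a) = ?r (h a)" if a: "a \<in> ?A" for a
          by (rule inj_onD[OF inj0]) (use a rs h fr fr0 in auto)
        have hs: "h (?s a) = ?s (h a)" if a: "a \<in> ?A" for a
        proof (rule inj_onD[OF inj0])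
          have "f0 (h (?s a)) = f (?s a)" using h(2) rs a by blast
          also have "\<dots> = first_return (edge_succ M) ?B (f a)"
            using e(2) a img by (simp add: returns_like_def)
          also have "\<dots> = first_return (edge_succ M) ?B (f0 (h a))" using h(2)[OF a] by simp
          also have "\<dots> = f0 (?s (h a))" using e0(2) h(1)[OF a] by (simp add: returns_like_def)
          finally show "f0 (h (?s a)) = f0 (?s (h a))" .
        qed (use a rs h in auto)
        interpret submap_perm "edge_rev M" "map_arcs M" "edge_succ M" ?B "restrict_return (edge_succ M) ?B"
          by (rule sub0(1))
        have hx: "h ?x \<in> ?A" using h(1) root(2) by blast
        have "f ` root_left_face m = f0 ` h ` root_left_face m"
          unfolding image_image
          by (rule image_cong[OF refl]) (use h(2) lf_sub[OF root(2)] in \<open>auto simp: root_left_face_def\<close>)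
        also have "h ` root_left_face m = left_face m (h ?x)"
          by (rule outer_auto_faces[OF m]) (use h hr hs in auto)
        finally have fF: "f ` root_left_face m = f0 ` left_face m (h ?x)" .
        have "left_face m (h ?x) \<in> orbits_on (?s \<circ> ?r) ?A"
          using hx by (auto simp: left_face_orbit orbits_on_def)
        then have F1: "f0 ` left_face m (h ?x) \<in> orbits_on (restrict_return (edge_succ M) ?B \<circ> edge_rev M) ?B"
          unfolding sub0(4) by blast
        have F2: "f0 ` root_left_face m \<in> orbits_on (restrict_return (edge_succ M) ?B \<circ> edge_rev M) ?B"
          unfolding sub0(4) using root_face_orbit[OF m] by blast
        have "f0 ` left_face m (h ?x) = f0 ` root_left_face m"
          by (rule face_unique[OF F1 F2, of "the (root_arc M)"]) (use e(3) e0(3) img fF in auto)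
        then have "left_face m (h ?x) = root_left_face m"
          using inj_on_image_eq_iff[OF inj0 lf_sub[OF hx] lf_sub[OF root(2)]] by (simp add: root_left_face_def)
        moreover have "h ?x \<in> left_face m (h ?x)"
          unfolding left_face_orbit
          by (rule orbit_self[OF rooted_planar_mapD(4)[OF m(1)]
              face_bij[OF planar_map_arc_inv[OF m] planar_map_succ[OF m]] hx])
        ultimately have "h \<in> outer_autos m"
          using h(1) hr hs by (auto simp: outer_autos_def h_def)
        moreover have "f = restrict (f0 \<circ> h) ?A"
          using h(2) PiE_arb[OF fE] by (auto simp: fun_eq_iff restrict_def)
        ultimately show "f \<in> (\<lambda>h. restrict (f0 \<circ> h) ?A) ` outer_autos m" by blast
      qed
    qed
  qed
  from bij_betw_same_card[OF this] show ?thesis by (rule sym)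
qed

text \<open>An occurrence is determined by its arc set, and each such set is the image of
  \<open>card (outer_autos m)\<close> embeddings.\<close>

lemma occurrence_count_autos:
  assumes m: "rooted_planar_map m" "map_arcs m \<noteq> {}" and M: "rooted_planar_map M"
  shows "occurrence_count m M * card (outer_autos m) = card (occ_embeddings m M)"
proof -
  let ?A = "map_arcs m"
  let ?I = "(\<lambda>f. f ` ?A) ` occ_embeddings m M"
  have fin: "finite (occ_embeddings m M)"
    by (rule finite_subset[OF _ finite_embeddings[OF rooted_planar_mapD(4)[OF m(1)] rooted_planar_mapD(4)[OF M]]])
      (auto simp: occ_embeddings_def)
  have "(\<lambda>S. (map_verts S, map_arcs S)) ` {S. map_iso m S \<and> occurs_as_submap S M} =
      (\<lambda>B. (tail (map_graph M) ` B, B)) ` ?I"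
  proof
    show "(\<lambda>S. (map_verts S, map_arcs S)) ` {S. map_iso m S \<and> occurs_as_submap S M} \<subseteq>
      (\<lambda>B. (tail (map_graph M) ` B, B)) ` ?I"
    proof clarify
      fix S assume "map_iso m S" "occurs_as_submap S M"
      from submap_embedding[OF m M this]
      show "(map_verts S, map_arcs S) \<in> (\<lambda>B. (tail (map_graph M) ` B, B)) ` ?I" by force
    qed
    show "(\<lambda>B. (tail (map_graph M) ` B, B)) ` ?I \<subseteq>
      (\<lambda>S. (map_verts S, map_arcs S)) ` {S. map_iso m S \<and> occurs_as_submap S M}"
    proof clarify
      fix f assume "f \<in> occ_embeddings m M"
      from embedding_occurs[OF m M this]
      show "(tail (map_graph M) ` f ` ?A, f ` ?A) \<in>
        (\<lambda>S. (map_verts S, map_arcs S)) ` {S. map_iso m S \<and> occurs_as_submap S M}" by force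
    qed
  qed
  then have "occurrence_count m M = card ?I"
    by (simp add: occurrence_count_def card_image inj_on_def)
  moreover have "card (occ_embeddings m M) = card ?I * card (outer_autos m)"
  proof -
    have "card (occ_embeddings m M) = (\<Sum>B\<in>?I. \<Sum>f\<in>{f \<in> occ_embeddings m M. f ` ?A = B}. 1)"
      using sum.image_gen[OF fin, of "\<lambda>_. 1 :: nat" "\<lambda>f. f ` ?A"] by simp
    also have "\<dots> = (\<Sum>B\<in>?I. card (outer_autos m))"
      by (rule sum.cong[OF refl]) (use card_occ_fibre[OF m M] in auto)
    finally show ?thesis by simp
  qed
  ultimately show ?thesis by simp
qed

lemma card_outer_autos_pos:
  assumes m: "rooted_planar_map m" "map_arcs m \<noteq> {}"
  shows "card (outer_autos m) > 0"
proof -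
  note root = root_arc_the[OF m]
  have "the (root_arc m) \<in> root_left_face m"
    unfolding root_left_face_def left_face_orbit
    by (rule orbit_self[OF rooted_planar_mapD(4)[OF m(1)]
        face_bij[OF planar_map_arc_inv[OF m] planar_map_succ[OF m]] root(2)])
  then have "restrict id (map_arcs m) \<in> outer_autos m"
    using root(2) rooted_planar_mapD(5,6)[OF m(1)] by (auto simp: outer_autos_def)
  moreover have "finite (outer_autos m)"
    by (rule finite_subset[of _ "map_arcs m \<rightarrow>\<^sub>E map_arcs m"])
      (use rooted_planar_mapD(4)[OF m(1)] in \<open>auto simp: outer_autos_def intro: finite_PiE\<close>)
  ultimately show ?thesis by (auto simp: card_gt_0_iff)
qed

section \<open>The expected number of occurrences\<close>

definition inner_cycles :: "('c, 'd) pre_map \<Rightarrow> 'd set set" where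
  "inner_cycles m = orbits_on (edge_succ m \<circ> edge_rev m) (map_arcs m) - {root_left_face m}"

text \<open>The last factor counts the possible roots of the large map: the arcs of the outer face
  of \<open>m\<close>, and two for each edge drawn into that face.\<close>

definition occ_fps :: "('c, 'd) pre_map \<Rightarrow> real fps" where
  "occ_fps m = (\<Prod>P\<in>inner_cycles m. fill_fps 1 (card P)) *
     (2 * (fps_X * fps_deriv (fill_fps 1 (card (root_left_face m)))) +
      of_nat (card (root_left_face m)) * fill_fps 1 (card (root_left_face m)))"

text \<open>For a fixed embedding, the maps that induce \<open>m\<close> on its image are the
  fillings of that image; what remains is \<open>sum_region_card\<close>, transported back to
  \<open>m\<close>.\<close>

lemma sum_filling_region:
  assumes m: "rooted_planar_map m" "map_arcs m \<noteq> {}" and D: "arc_inv r D" "card D = 2 * n"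
    and e: "card (map_arcs m) = 2 * e" "e \<le> n"
    and f: "f \<in> embeddings (edge_rev m) (map_arcs m) r D"
  shows "(\<Sum>g\<in>{g \<in> planar_perms r D. returns_like m g f}.
      real (card (region r g (f ` map_arcs m) (f ` root_left_face m)))) =
    2 ^ (n - e) * fact (n - e) * fps_nth (occ_fps m) (n - e)"
proof -
  let ?A = "map_arcs m" and ?B = "f ` map_arcs m"
  note A = planar_map_arc_inv[OF m] planar_map_succ[OF m] planar_map_transitive[OF m] planar_map_planar[OF m]
  have inj: "inj_on f ?A" and BD: "?B \<subseteq> D" and fr: "\<And>a. a \<in> ?A \<Longrightarrow> r (f a) = f (edge_rev m a)"
    using f by (auto simp: embeddings_def)
  obtain s where s: "s \<in> planar_perms r ?B" "\<forall>a\<in>?A. s (f a) = f (edge_succ m a)"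
    using planar_perms_transport[OF A inj_on_imp_bij_betw[OF inj] fr] by blast
  then have sp: "s permutes ?B" "transitive_on r s ?B" "planar_on r s ?B" by (auto simp: planar_perms_def)
  have rs: "edge_rev m a \<in> ?A" "edge_succ m a \<in> ?A" if "a \<in> ?A" for a
    using rooted_planar_mapD(5,6)[OF m(1) that] by auto
  have B: "arc_inv r ?B"
    unfolding arc_inv_def
  proof (intro conjI ballI)
    show "finite (f ` ?A)" using arc_inv_finite[OF A(1)] by simp
    fix b assume "b \<in> f ` ?A"
    then obtain a where a: "a \<in> ?A" "b = f a" by blast
    note aa = arc_invD[OF A(1) a(1)]
    show "r b \<in> f ` ?A" "r (r b) = b" using a aa fr[OF a(1)] fr[OF aa(1)] by auto
    show "r b \<noteq> b" using a aa fr[OF a(1)] inj_onD[OF inj _ aa(1) a(1)] by auto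
  qed
  have un: "?B \<union> (D - ?B) = D" "?B \<union> D = D" using BD by auto
  have "{g \<in> planar_perms r D. returns_like m g f} = fillings r ?B s ?B (D - ?B)"
  proof -
    have "returns_like m g f \<longleftrightarrow> (\<forall>b\<in>?B. first_return g ?B b = s b)" for g
      using s(2) by (simp add: returns_like_def)
    then show ?thesis
      by (auto simp: fillings_def planar_perms_def un)
  qed
  moreover have "card (D - ?B) = 2 * (n - e)"
    using BD D arc_inv_finite[OF B] inj e by (simp add: card_Diff_subset card_image)
  moreover have orb: "orbits_on (s \<circ> r) ?B = image f ` orbits_on (edge_succ m \<circ> edge_rev m) ?A"
    by (rule transport_orbits) (use rs s(2) fr in auto)
  moreover have "f ` root_left_face m \<in> orbits_on (s \<circ> r) ?B"
    unfolding orb using root_face_orbit[OF m] by blast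
  moreover have "?B \<noteq> {}" using m(2) by simp
  ultimately have sum: "(\<Sum>g\<in>{g \<in> planar_perms r D. returns_like m g f}.
      real (card (region r g ?B (f ` root_left_face m)))) =
    2 ^ (n - e) * fact (n - e) * fps_nth ((\<Prod>P\<in>orbits_on (s \<circ> r) ?B - {f ` root_left_face m}. fill_fps 1 (card P)) *
        (2 * (fps_X * fps_deriv (fill_fps 1 (card (f ` root_left_face m)))) +
          of_nat (card (f ` root_left_face m)) * fill_fps 1 (card (f ` root_left_face m)))) (n - e)"
    using sum_region_card(2)[OF B _ sp arc_inv_Diff[OF D(1) B], of "n - e" "f ` root_left_face m"] by auto
  have subA: "P \<subseteq> ?A" if "P \<in> orbits_on (edge_succ m \<circ> edge_rev m) ?A" for P
    using orbits_on_eqD(2)[OF arc_inv_finite[OF A(1)] face_bij[OF A(1,2)] that] by auto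
  have cP: "card (f ` P) = card P" if "P \<in> orbits_on (edge_succ m \<circ> edge_rev m) ?A" for P
    using inj_on_subset[OF inj subA[OF that]] by (rule card_image)
  have injP: "inj_on (image f) (orbits_on (edge_succ m \<circ> edge_rev m) ?A)"
    by (rule inj_on_subset[OF inj_on_image_Pow[OF inj]]) (use subA in auto)
  have "orbits_on (s \<circ> r) ?B - {f ` root_left_face m} = image f ` inner_cycles m"
    unfolding orb inner_cycles_def
    using inj_on_image_set_diff[OF injP _ , of "orbits_on (edge_succ m \<circ> edge_rev m) ?A" "{root_left_face m}"]
      root_face_orbit[OF m] by simp
  moreover have "(\<Prod>P\<in>image f ` inner_cycles m. fill_fps 1 (card P)) = (\<Prod>P\<in>inner_cycles m. fill_fps 1 (card P))"
  proof -
    have "inj_on (image f) (inner_cycles m)" by (rule inj_on_subset[OF injP]) (auto simp: inner_cycles_def)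
    then have "(\<Prod>P\<in>image f ` inner_cycles m. fill_fps 1 (card P)) = (\<Prod>P\<in>inner_cycles m. fill_fps 1 (card (f ` P)))"
      by (simp add: prod.reindex)
    also have "\<dots> = (\<Prod>P\<in>inner_cycles m. fill_fps 1 (card P))"
      by (rule prod.cong) (auto simp: cP inner_cycles_def)
    finally show ?thesis .
  qed
  ultimately show ?thesis
    unfolding sum occ_fps_def using cP[OF root_face_orbit[OF m]] by simp
qed

text \<open>Double counting of triples of a rotation, a root and an embedding. Summing over the
  roots turns the outer-face condition into the size of a region, which is then summed over the
  rotations for a fixed embedding.\<close>

lemma sum_occ_embeddings:
  assumes m: "rooted_planar_map m" "map_arcs m \<noteq> {}"
    and e: "card (map_arcs m) = 2 * e" "e \<le> n"
  shows "(\<Sum>p\<in>labelled n. real (card (occ_embeddings m (labelled_map n p)))) =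
    2 ^ n * fact n * fps_nth (occ_fps m) (n - e)"
proof -
  let ?r = "std_rev n" and ?D = "{..<2 * n}" and ?A = "map_arcs m"
  let ?E = "embeddings (edge_rev m) ?A ?r ?D"
  let ?Q = "\<lambda>g f. returns_like m g f" and ?R = "\<lambda>g f. region ?r g (f ` ?A) (f ` root_left_face m)"
  note A = planar_map_arc_inv[OF m]
  have finE: "finite ?E" by (rule finite_embeddings[OF arc_inv_finite[OF A]]) simp
  have finP: "finite (planar_perms ?r ?D)" by (rule finite_planar_perms) simp
  have R_sub: "?R g f \<subseteq> ?D" if "g \<in> planar_perms ?r ?D" "f \<in> ?E" for g f
  proof (rule region_subset[OF arc_inv_std])
    show "g permutes ?D" using that by (simp add: planar_perms_def)
    have "root_left_face m \<subseteq> ?A"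
      using orbits_on_eqD(2)[OF arc_inv_finite[OF A] face_bij[OF A planar_map_succ[OF m]] root_face_orbit[OF m]] by auto
    then show "f ` root_left_face m \<subseteq> ?D" using that(2) by (auto simp: embeddings_def)
  qed
  have occ: "occ_embeddings m (labelled_map n (g, x)) = {f \<in> ?E. ?Q g f \<and> x \<in> ?R g f}" for g x
    by (auto simp: occ_embeddings_def labelled_map_sel)
  have card_occ: "real (card (occ_embeddings m (labelled_map n (g, x)))) =
      (\<Sum>f\<in>?E. if ?Q g f \<and> x \<in> ?R g f then 1 else 0)" for g x
    using finE by (simp add: occ sum.If_cases Int_def)
  have "(\<Sum>p\<in>labelled n. real (card (occ_embeddings m (labelled_map n p)))) =
      (\<Sum>g\<in>planar_perms ?r ?D. \<Sum>x\<in>?D. real (card (occ_embeddings m (labelled_map n (g, x)))))"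
    by (simp add: labelled_def sum.cartesian_product case_prod_beta')
  also have "\<dots> = (\<Sum>g\<in>planar_perms ?r ?D. \<Sum>f\<in>?E. \<Sum>x\<in>?D. if ?Q g f \<and> x \<in> ?R g f then 1 else 0)"
    unfolding card_occ by (rule sum.cong[OF refl]) (rule sum.swap)
  also have "\<dots> = (\<Sum>f\<in>?E. \<Sum>g\<in>planar_perms ?r ?D. \<Sum>x\<in>?D. if ?Q g f \<and> x \<in> ?R g f then 1 else 0)"
    by (rule sum.swap)
  also have "\<dots> = (\<Sum>f\<in>?E. \<Sum>g\<in>{g \<in> planar_perms ?r ?D. ?Q g f}. real (card (?R g f)))"
  proof (rule sum.cong[OF refl])
    fix f assume f: "f \<in> ?E"
    have "(\<Sum>g\<in>planar_perms ?r ?D. \<Sum>x\<in>?D. if ?Q g f \<and> x \<in> ?R g f then 1 else 0) =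
        (\<Sum>g\<in>planar_perms ?r ?D. if ?Q g f then real (card (?R g f)) else 0)"
    proof (rule sum.cong[OF refl])
      fix g assume g: "g \<in> planar_perms ?r ?D"
      have "?D \<inter> {x. x \<in> ?R g f} = ?R g f" using R_sub[OF g f] by auto
      then show "(\<Sum>x\<in>?D. if ?Q g f \<and> x \<in> ?R g f then 1 else 0) = (if ?Q g f then real (card (?R g f)) else 0)"
        by (simp add: sum.If_cases)
    qed
    also have "\<dots> = (\<Sum>g\<in>{g \<in> planar_perms ?r ?D. ?Q g f}. real (card (?R g f)))"
      using finP by (simp add: sum.inter_filter)
    finally show "(\<Sum>g\<in>planar_perms ?r ?D. \<Sum>x\<in>?D. if ?Q g f \<and> x \<in> ?R g f then 1 else 0) = \<dots>" .
  qed
  also have "\<dots> = (\<Sum>f\<in>?E. 2 ^ (n - e) * fact (n - e) * fps_nth (occ_fps m) (n - e))"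
    by (rule sum.cong[OF refl]) (rule sum_filling_region[OF m arc_inv_std _ e], simp_all)
  also have "\<dots> = real (card ?E * (2 ^ (n - e) * fact (n - e))) * fps_nth (occ_fps m) (n - e)"
    by simp
  also have "card ?E = (\<Prod>i<e. 2 * (n - i))"
    by (rule card_embeddings[OF A e(1) arc_inv_std]) simp
  also have "(\<Prod>i<e. 2 * (n - i)) * (2 ^ (n - e) * fact (n - e)) = 2 ^ n * fact n"
    by (rule embeddings_factorial[OF e(2)])
  finally show ?thesis by simp
qed

text \<open>The factor \<open>2 ^ n * fact n\<close> is common to the labelled maps and to the
  labelled occurrences and cancels.\<close>

lemma expectation_occurrences:
  assumes m: "rooted_planar_map m" "map_arcs m \<noteq> {}"
    and e: "card (map_arcs m) = 2 * e" "e \<le> n"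
  shows "measure_pmf.expectation (random_planar_map n) (\<lambda>M. real (occurrences (abs_planar_map m) M)) =
    1 / real (card (outer_autos m)) * (fps_nth (fps_X ^ e * occ_fps m) n / real (fill 1 n))"
proof -
  have "e > 0" using e(1) m(2) rooted_planar_mapD(4)[OF m(1)] by (cases e) auto
  then have n: "n > 0" using e(2) by simp
  define R where "R = real (card (outer_autos m))"
  have R: "R > 0" using card_outer_autos_pos[OF m] by (simp add: R_def)
  have "(\<Sum>p\<in>labelled n. real (occurrences (abs_planar_map m) (map_class n p))) * R =
      (\<Sum>p\<in>labelled n. real (card (occ_embeddings m (labelled_map n p))))"
    unfolding sum_distrib_right
  proof (rule sum.cong[OF refl])
    fix p assume p: "p \<in> labelled n"
    show "real (occurrences (abs_planar_map m) (map_class n p)) * R = real (card (occ_embeddings m (labelled_map n p)))"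
      using occurrence_count_autos[OF m rooted_labelled_map[OF p]]
      by (simp add: map_class_def occurrences_abs[OF m(1) rooted_labelled_map[OF p]] R_def
          of_nat_mult[symmetric] del: of_nat_mult)
  qed
  then have "(\<Sum>p\<in>labelled n. real (occurrences (abs_planar_map m) (map_class n p))) =
      2 ^ n * fact n * fps_nth (occ_fps m) (n - e) / R"
    using R sum_occ_embeddings[OF m e] by (simp add: field_simps)
  moreover have "fps_nth (fps_X ^ e * occ_fps m) n = fps_nth (occ_fps m) (n - e)"
    using e(2) by (simp add: fps_X_power_mult_nth)
  ultimately show ?thesis
    by (simp add: expectation_labelled[OF n] card_labelled[OF n] R_def)
qed

text \<open>
  The occurrences of the map without edges are the vertices; by duality their number is
  \<open>(n + 2) / 2\<close> on average.
\<close>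

definition slope :: "('c, 'd) pre_map \<Rightarrow> rat" where
  "slope m = (if map_arcs m = {} then 1 / 2 else
     of_int (3 * (\<Prod>P\<in>inner_cycles m. crit_u (card P)) * crit_v (card (root_left_face m))) /
     of_nat (4 * 12 ^ edge_count m * 3 ^ card (map_arcs m) * card (outer_autos m)))"

text \<open>Only the differentiated factor has a part of order \<open>1/2\<close>; the inner faces
  enter through their regular values. The factor \<open>- 3\<close> is twice the
  \<open>- 3/2\<close> of \<open>half_value_deriv\<close>, and the powers of \<open>3\<close>
  combine because the degrees of all faces add up to the number of arcs.\<close>

lemma half_value_occ_fps:
  assumes m: "rooted_planar_map m" "map_arcs m \<noteq> {}"
  shows "half_value (occ_fps m) (- 3 * of_int ((\<Prod>P\<in>inner_cycles m. crit_u (card P)) *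
    crit_v (card (root_left_face m))) / 3 ^ card (map_arcs m))"
proof -
  let ?d = "card (root_left_face m)"
  note A = planar_map_arc_inv[OF m]
  note finA = arc_inv_finite[OF A] and fb = face_bij[OF A planar_map_succ[OF m]]
  have fin: "finite (inner_cycles m)" using finite_orbits_on[OF finA] by (simp add: inner_cycles_def)
  have prod_sing: "\<exists>v. sing_value (\<Prod>P\<in>I. fill_fps 1 (card P)) (\<Prod>P\<in>I. of_int (crit_u (card P)) / 3 ^ card P) v"
    if "finite I" for I :: "'b set set"
    using that
  proof (induction I rule: finite_induct)
    case empty show ?case using sing_value_1 by auto
  next
    case (insert P I)
    then obtain v where "sing_value (\<Prod>P\<in>I. fill_fps 1 (card P)) (\<Prod>P\<in>I. of_int (crit_u (card P)) / 3 ^ card P) v"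
      by blast
    from sing_value_mult[OF sing_value_fill this] insert show ?case by auto
  qed
  obtain v where v: "sing_value (\<Prod>P\<in>inner_cycles m. fill_fps 1 (card P))
      (\<Prod>P\<in>inner_cycles m. of_int (crit_u (card P)) / 3 ^ card P) v"
    using prod_sing[OF fin] by blast
  let ?F = "fill_fps 1 ?d" and ?v = "real_of_int (crit_v ?d) / 3 ^ ?d"
  have h1: "half_value (fps_X * fps_deriv ?F) (- 3/2 * ?v)" by (rule half_value_deriv[OF sing_value_fill])
  have "half_value (fps_X * fps_deriv ?F + fps_X * fps_deriv ?F) (- 3/2 * ?v + - 3/2 * ?v)"
    by (rule half_value_add[OF h1 h1])
  moreover have "half_value (fps_const (of_nat ?d) * ?F) 0"
    by (rule half_value_sing[OF sing_value_cmult[OF sing_value_fill]])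
  ultimately have "half_value (fps_X * fps_deriv ?F + fps_X * fps_deriv ?F + fps_const (of_nat ?d) * ?F)
      (- 3/2 * ?v + - 3/2 * ?v + 0)" by (rule half_value_add)
  moreover have "fps_X * fps_deriv ?F + fps_X * fps_deriv ?F + fps_const (of_nat ?d) * ?F =
      2 * (fps_X * fps_deriv ?F) + of_nat ?d * ?F"
    by (simp only: mult_2 fps_of_nat)
  moreover have "- 3/2 * ?v + - 3/2 * ?v + 0 = - 3 * ?v" by simp
  ultimately have "half_value (2 * (fps_X * fps_deriv ?F) + of_nat ?d * ?F) (- 3 * ?v)" by metis
  from half_value_mult[OF v this]
  have hv: "half_value (occ_fps m) ((\<Prod>P\<in>inner_cycles m. of_int (crit_u (card P)) / 3 ^ card P) * (- 3 * ?v))"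
    unfolding occ_fps_def .
  have "(\<Sum>P\<in>orbits_on (edge_succ m \<circ> edge_rev m) (map_arcs m). card P) = card (map_arcs m)"
  proof -
    have "card (\<Union>(orbits_on (edge_succ m \<circ> edge_rev m) (map_arcs m))) =
        (\<Sum>P\<in>orbits_on (edge_succ m \<circ> edge_rev m) (map_arcs m). card P)"
    proof (rule card_Union_disjoint)
      show "disjoint (orbits_on (edge_succ m \<circ> edge_rev m) (map_arcs m))"
        using orbits_on_disjoint[OF finA fb] by (auto simp: disjoint_def)
      show "finite P" if "P \<in> orbits_on (edge_succ m \<circ> edge_rev m) (map_arcs m)" for P
        using orbits_on_eqD(2)[OF finA fb that] finA by (meson finite_subset subsetI)
    qed
    then show ?thesis by (simp add: Union_orbits_on[OF finA fb])
  qed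
  moreover have "orbits_on (edge_succ m \<circ> edge_rev m) (map_arcs m) = insert (root_left_face m) (inner_cycles m)"
    "root_left_face m \<notin> inner_cycles m"
    using root_face_orbit[OF m] by (auto simp: inner_cycles_def)
  ultimately have "card (map_arcs m) = ?d + (\<Sum>P\<in>inner_cycles m. card P)" using fin by simp
  then have "3 ^ card (map_arcs m) = 3 ^ ?d * (\<Prod>P\<in>inner_cycles m. (3::real) ^ card P)"
    by (simp add: power_add power_sum)
  then have "(\<Prod>P\<in>inner_cycles m. of_int (crit_u (card P)) / 3 ^ card P) * (- 3 * ?v) =
    - 3 * of_int ((\<Prod>P\<in>inner_cycles m. crit_u (card P)) * crit_v ?d) / 3 ^ card (map_arcs m)"
    by (simp add: prod_dividef mult_ac)
  then show ?thesis using hv by simp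
qed

text \<open>The recursions for \<open>crit_u\<close> and \<open>crit_v\<close> have signs, so
  positivity of the slope is taken from the coefficients themselves: the product over the inner
  faces has nonnegative coefficients and constant term \<open>1\<close>, and the outer face counts
  at least as much as one of degree one.\<close>

lemma occ_fps_lower:
  assumes m: "rooted_planar_map m" "map_arcs m \<noteq> {}"
  shows "fps_nth (occ_fps m) k \<ge> 2 * real k * real (fill 1 k)"
proof -
  let ?d = "card (root_left_face m)"
  note A = planar_map_arc_inv[OF m]
  note finA = arc_inv_finite[OF A] and fb = face_bij[OF A planar_map_succ[OF m]]
  have "finite (root_left_face m)" "root_left_face m \<noteq> {}"
    using orbits_on_eqD(2)[OF finA fb root_face_orbit[OF m]] finA orbits_on_nonempty[OF root_face_orbit[OF m]]
    by (auto intro: finite_subset)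
  then have d: "?d > 0" by (simp add: card_gt_0_iff)
  have fin: "finite (inner_cycles m)" using finite_orbits_on[OF finA] by (simp add: inner_cycles_def)
  define J where "J = 2 * (fps_X * fps_deriv (fill_fps 1 ?d)) + of_nat ?d * fill_fps 1 ?d"
  have J: "fps_nth J k = (2 * real k + real ?d) * real (fill ?d k)" for k
  proof -
    have "J = fps_const 2 * (fps_X * fps_deriv (fill_fps 1 ?d)) + fps_const (real ?d) * fill_fps 1 ?d"
      by (simp add: J_def numeral_fps_const fps_of_nat)
    moreover have "fps_nth (fps_X * fps_deriv (fill_fps 1 ?d)) k = real k * real (fill ?d k)"
      by (cases k) (simp_all add: fill_fps_nth)
    ultimately show ?thesis by (simp add: fill_fps_nth distrib_right)
  qed
  have I: "(\<forall>k. fps_nth (\<Prod>P\<in>I. fill_fps 1 (card P)) k \<ge> 0) \<and> fps_nth (\<Prod>P\<in>I. fill_fps 1 (card P)) 0 = 1"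
    if "finite I" for I :: "'b set set"
    using that
  proof (induction I rule: finite_induct)
    case (insert P I)
    have "fill j 0 = 1" for j by (cases j) auto
    then show ?case using insert
      by (auto simp: fps_mult_nth fill_fps_nth intro!: sum_nonneg)
  qed simp
  define K where "K = (\<Prod>P\<in>inner_cycles m. fill_fps 1 (card P))"
  have K: "fps_nth K k \<ge> 0" "fps_nth K 0 = 1" for k using I[OF fin] by (auto simp: K_def)
  have "2 * real k * real (fill 1 k) \<le> (2 * real k + real ?d) * real (fill ?d k)"
    by (rule mult_mono) (use fill_1_mono[OF d, of k] in auto)
  also have "\<dots> = fps_nth K 0 * fps_nth J (k - 0)" by (simp add: J K)
  also have "\<dots> \<le> (\<Sum>i=0..k. fps_nth K i * fps_nth J (k - i))"
    by (rule member_le_sum) (use K J in auto)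
  also have "\<dots> = fps_nth (K * J) k" by (simp add: fps_mult_nth)
  finally show ?thesis by (simp add: occ_fps_def K_def J_def)
qed

text \<open>The only face of a single vertex is its root face, so the condition on inner faces is
  void and every vertex counts once.\<close>

lemma vertex_occurrence_count:
  assumes m: "rooted_planar_map m" "map_arcs m = {}" and M: "rooted_planar_map M"
  shows "occurrence_count m M = card (map_verts M)"
proof -
  have "card (map_verts m) + card (faces m) = edge_count m + 2" using m by (simp add: rooted_planar_map_def)
  then have "card (map_verts m) = 1" using m(2) by (simp add: faces_def edge_count_def)
  then obtain v0 where v0: "map_verts m = {v0}" by (rule card_1_singletonE)
  have r0: "root_arc m = None" using m by (auto simp: rooted_planar_map_def split: option.splits)
  have "(\<lambda>S. (map_verts S, map_arcs S)) ` {S. map_iso m S \<and> occurs_as_submap S M} =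
      (\<lambda>v. ({v}, {})) ` map_verts M"
  proof
    show "(\<lambda>S. (map_verts S, map_arcs S)) ` {S. map_iso m S \<and> occurs_as_submap S M} \<subseteq>
      (\<lambda>v. ({v}, {})) ` map_verts M"
    proof clarify
      fix S assume S: "map_iso m S" "occurs_as_submap S M"
      then obtain f where "map_isomorphism m S f" by (auto simp: map_iso_def)
      note F = map_isomorphism_inj(3,4)[OF this]
      have "map_verts S \<subseteq> map_verts M" using S(2) by (auto simp: occurs_as_submap_def subgraph_def)
      then show "(map_verts S, map_arcs S) \<in> (\<lambda>v. ({v}, {})) ` map_verts M"
        using F v0 m(2) by auto
    qed
    show "(\<lambda>v. ({v}, {})) ` map_verts M \<subseteq>
      (\<lambda>S. (map_verts S, map_arcs S)) ` {S. map_iso m S \<and> occurs_as_submap S M}"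
    proof clarify
      fix v assume v: "v \<in> map_verts M"
      define S where "S = \<lparr>map_graph = \<lparr>verts = {v}, arcs = {}, tail = tail (map_graph M), head = head (map_graph M)\<rparr>,
        edge_rev = edge_rev M, edge_succ = edge_succ M, root_arc = None\<rparr>"
      have "map_iso m S"
        by (rule map_isoI[where h = "\<lambda>_. v" and k = undefined])
          (use m v0 r0 rooted_planar_mapD(2)[OF m(1)] in \<open>auto simp: S_def\<close>)
      moreover have "occurs_as_submap S M"
      proof -
        have "wf_digraph (map_graph S)" by unfold_locales (auto simp: S_def)
        then show ?thesis
          using v rooted_planar_mapD(2)[OF M]
          by (auto simp: occurs_as_submap_def subgraph_def compatible_def S_def inner_faces_def faces_def root_face_def)
      qed
      ultimately show "({v}, {}) \<in> (\<lambda>S. (map_verts S, map_arcs S)) ` {S. map_iso m S \<and> occurs_as_submap S M}"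
        by (intro image_eqI[of _ _ S]) (auto simp: S_def)
    qed
  qed
  then show ?thesis by (simp add: occurrence_count_def card_image inj_on_def)
qed

lemma expectation_vertices:
  assumes m: "rooted_planar_map m" "map_arcs m = {}" and n: "n > 0"
  shows "measure_pmf.expectation (random_planar_map n) (\<lambda>M. real (occurrences (abs_planar_map m) M)) =
    1 / 2 * real n + 1"
proof -
  let ?P = "planar_perms (std_rev n) {..<2 * n}"
  have "real (occurrences (abs_planar_map m) (map_class n p)) = real (card (orbits_on (fst p) {..<2 * n}))"
    if p: "p \<in> labelled n" for p
  proof -
    note M = rooted_labelled_map[OF p]
    have "map_arcs (labelled_map n p) \<noteq> {}" using p by (auto simp: labelled_map_sel labelled_def)
    from planar_map_card_verts[OF M this] show ?thesis
      by (simp add: map_class_def occurrences_abs[OF m(1) M] vertex_occurrence_count[OF m M] labelled_map_sel(1,3))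
  qed
  then have "(\<Sum>p\<in>labelled n. real (occurrences (abs_planar_map m) (map_class n p))) =
      (\<Sum>p\<in>labelled n. real (card (orbits_on (fst p) {..<2 * n})))" by (rule sum.cong[OF refl])
  also have "\<dots> = (\<Sum>s\<in>?P. \<Sum>x<2 * n. real (card (orbits_on s {..<2 * n})))"
    unfolding labelled_def sum.cartesian_product by (rule sum.cong) auto
  also have "\<dots> = real n * real (\<Sum>s\<in>?P. 2 * card (orbits_on s {..<2 * n}))"
    by (simp add: sum_distrib_left algebra_simps)
  also have "(\<Sum>s\<in>?P. 2 * card (orbits_on s {..<2 * n})) = (n + 2) * card ?P"
    by (rule sum_orbits_dual[OF arc_inv_std _ std_rev_outside]) simp_all
  finally have sum: "(\<Sum>p\<in>labelled n. real (occurrences (abs_planar_map m) (map_class n p))) =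
    real n * real ((n + 2) * card ?P)" .
  have c: "card (labelled n) = card ?P * (2 * n)" by (simp add: labelled_def card_cartesian_product)
  have "real (card (labelled n)) > 0" unfolding card_labelled[OF n] using fill_1_pos[of n] by simp
  then have "card ?P > 0" unfolding c by (cases "card ?P") auto
  then show ?thesis
    unfolding expectation_labelled[OF n] sum c using n by (simp add: field_simps)
qed

theorem expectation_asymp:
  assumes m: "rooted_planar_map m"
  shows "lin_asymp (\<lambda>n. measure_pmf.expectation (random_planar_map n) (\<lambda>M. real (occurrences (abs_planar_map m) M)))
      (of_rat (slope m))" (is "lin_asymp ?E _")
    and "slope m > 0"
proof -
  have "lin_asymp ?E (of_rat (slope m)) \<and> slope m > 0"
  proof (cases "map_arcs m = {}")
    case True
    have "lin_asymp (\<lambda>n. 1 / 2 * real n + 1) (1 / 2)"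
      unfolding lin_asymp_def by (rule exI[of _ 1]) simp
    moreover have "eventually (\<lambda>n. 1 / 2 * real n + 1 = ?E n) at_top"
      using eventually_gt_at_top[of 0] by eventually_elim (simp add: expectation_vertices[OF m True])
    ultimately have "lin_asymp ?E (1 / 2)" by (rule lin_asymp_cong)
    then show ?thesis using True by (simp add: slope_def of_rat_divide)
  next
    case False
    note m' = m False
    define e where "e = edge_count m"
    have e: "card (map_arcs m) = 2 * e" using card_arcs[OF m] by (simp add: e_def)
    define R where "R = card (outer_autos m)"
    have R: "R > 0" using card_outer_autos_pos[OF m'] by (simp add: R_def)
    define C where "C = (\<Prod>P\<in>inner_cycles m. crit_u (card P)) * crit_v (card (root_left_face m))"
    have ev: "eventually (\<lambda>n. 1 / real R * (fps_nth (fps_X ^ e * occ_fps m) n / real (fill 1 n)) = ?E n) at_top"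
      using eventually_ge_at_top[of e]
      by eventually_elim (simp only: expectation_occurrences[OF m' e] R_def)
    have "lin_asymp (\<lambda>n. 1 / real R * (fps_nth (fps_X ^ e * occ_fps m) n / real (fill 1 n)))
        (1 / real R * (- ((- 3 * of_int C / 3 ^ card (map_arcs m)) / 12 ^ e) / 4))"
      by (intro lin_asymp_cmult half_value_asymp half_value_X_power half_value_occ_fps[OF m', folded C_def])
    from lin_asymp_cong[OF this ev]
    have "lin_asymp ?E (1 / real R * (- ((- 3 * of_int C / 3 ^ card (map_arcs m)) / 12 ^ e) / 4))" .
    moreover have "1 / real R * (- ((- 3 * of_int C / 3 ^ card (map_arcs m)) / 12 ^ e) / 4) = of_rat (slope m)"
    proof -
      have "slope m = of_int (3 * C) / of_nat (4 * 12 ^ e * 3 ^ card (map_arcs m) * R)"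
        by (simp only: slope_def False if_False C_def e_def R_def mult.assoc)
      then show ?thesis by (simp add: of_rat_divide of_rat_mult of_rat_power mult_ac)
    qed
    ultimately have lin: "lin_asymp ?E (of_rat (slope m))" by simp
    \<comment> \<open>The bound from \<open>occ_fps_lower\<close> and \<open>fill_1_le\<close>:
      taking away \<open>e\<close> edges costs at most the factor \<open>12 ^ e\<close>, and each
      occurrence is counted \<open>R\<close> times.\<close>
    define b where "b = 2 / (real R * 12 ^ e)"
    have "eventually (\<lambda>n. ?E n \<ge> b * real n - b * real e) at_top"
      using eventually_ge_at_top[of e]
    proof eventually_elim
      case (elim n)
      have f: "real (fill 1 n) \<le> 12 ^ e * real (fill 1 (n - e))"
      proof -
        have "fill 1 n \<le> 12 ^ e * fill 1 (n - e)" using fill_1_le[of "n - e" e] elim by simp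
        then have "real (fill 1 n) \<le> real (12 ^ e * fill 1 (n - e))" by (rule of_nat_mono)
        then show ?thesis by simp
      qed
      have "b * real n - b * real e = 1 / real R * (2 * real (n - e) / 12 ^ e)"
        using elim R by (simp add: b_def of_nat_diff field_simps)
      also have "\<dots> \<le> 1 / real R * (fps_nth (fps_X ^ e * occ_fps m) n / real (fill 1 n))"
      proof (rule mult_left_mono)
        have "2 * real (n - e) * real (fill 1 n) \<le> 2 * real (n - e) * (12 ^ e * real (fill 1 (n - e)))"
          using f by (intro mult_left_mono) auto
        also have "\<dots> = 12 ^ e * (2 * real (n - e) * real (fill 1 (n - e)))" by simp
        also have "\<dots> \<le> 12 ^ e * fps_nth (fps_X ^ e * occ_fps m) n"
          using occ_fps_lower[OF m', of "n - e"] elim by (simp add: fps_X_power_mult_nth)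
        finally show "2 * real (n - e) / 12 ^ e \<le> fps_nth (fps_X ^ e * occ_fps m) n / real (fill 1 n)"
          using fill_1_pos[of n] by (simp add: field_simps)
      qed simp
      finally show ?case by (simp only: expectation_occurrences[OF m' e elim] R_def)
    qed
    from lin_asymp_lower[OF lin this] have "b \<le> of_rat (slope m)" .
    moreover have "b > 0" using R by (simp add: b_def)
    ultimately have "(0::real) < of_rat (slope m)" by linarith
    then show ?thesis using lin by simp
  qed
  then show "lin_asymp ?E (of_rat (slope m))" "slope m > 0" by auto
qed

section \<open>Recursive functions\<close>

text \<open>Agreement is required only on lists of length \<open>k\<close>;
  \<open>recursive_fn\<close> singles out particular functions on all lists, which would obstruct
  rewriting.\<close>

definition rcn :: "nat \<Rightarrow> (nat list \<Rightarrow> nat) \<Rightarrow> bool" where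
  "rcn k f \<longleftrightarrow> (\<exists>F. recursive_fn k F \<and> (\<forall>xs. length xs = k \<longrightarrow> f xs = F xs))"

definition rcp :: "nat \<Rightarrow> (nat list \<Rightarrow> bool) \<Rightarrow> bool" where
  "rcp k P \<longleftrightarrow> rcn k (\<lambda>xs. if P xs then 1 else 0)"

lemma rcn_cong: "rcn k f \<Longrightarrow> (\<And>xs. length xs = k \<Longrightarrow> g xs = f xs) \<Longrightarrow> rcn k g"
  unfolding rcn_def by auto

lemma rcn_comp:
  assumes f: "rcn (length gs) f" and gs: "\<And>g. g \<in> set gs \<Longrightarrow> rcn k g"
  shows "rcn k (\<lambda>xs. f (map (\<lambda>g. g xs) gs))"
proof -
  obtain F where F: "recursive_fn (length gs) F" "\<And>xs. length xs = length gs \<Longrightarrow> f xs = F xs"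
    using f unfolding rcn_def by auto
  define ch where "ch g = (SOME G. recursive_fn k G \<and> (\<forall>xs. length xs = k \<longrightarrow> g xs = G xs))" for g
  have ch: "recursive_fn k (ch g)" "\<And>xs. length xs = k \<Longrightarrow> g xs = ch g xs" if "g \<in> set gs" for g
    using someI_ex[OF gs[OF that, unfolded rcn_def], folded ch_def] by auto
  have "recursive_fn k (\<lambda>xs. F (map (\<lambda>g. g xs) (map ch gs)))"
    by (rule recursive_fn.comp) (use F(1) ch(1) in auto)
  moreover have "f (map (\<lambda>g. g xs) gs) = F (map (\<lambda>g. g xs) (map ch gs))" if "length xs = k" for xs
  proof -
    have "f (map (\<lambda>g. g xs) gs) = F (map (\<lambda>g. g xs) gs)" by (rule F(2)) simp
    also have "F (map (\<lambda>g. g xs) gs) = F (map (\<lambda>g. g xs) (map ch gs))"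
      using ch(2)[OF _ that] by (intro arg_cong[where f = F]) simp
    finally show ?thesis .
  qed
  ultimately show ?thesis unfolding rcn_def by blast
qed

lemma rcn_nth: "i < k \<Longrightarrow> rcn k (\<lambda>xs. xs ! i)"
  unfolding rcn_def using recursive_fn.proj by blast

lemma rcn_hd: "rcn (Suc k) (\<lambda>xs. hd xs)"
  by (rule rcn_cong[OF rcn_nth[of 0]]) (auto simp: length_Suc_conv)

lemma rcn_tl:
  assumes "rcn k g"
  shows "rcn (Suc k) (\<lambda>xs. g (tl xs))"
proof -
  let ?gs = "map (\<lambda>i xs. xs ! Suc i) [0..<k]"
  have "rcn (Suc k) (\<lambda>xs. g (map (\<lambda>g. g xs) ?gs))"
    by (rule rcn_comp) (use assms in \<open>auto intro: rcn_nth\<close>)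
  then show ?thesis
  proof (rule rcn_cong)
    fix xs :: "nat list" assume "length xs = Suc k"
    then have "tl xs = map (\<lambda>g. g xs) ?gs"
      by (intro nth_equalityI) (auto simp: nth_tl)
    then show "g (tl xs) = g (map (\<lambda>g. g xs) ?gs)" by simp
  qed
qed

lemma rcn_cons:
  assumes "rcn (Suc k) f" "rcn k b"
  shows "rcn k (\<lambda>xs. f (b xs # xs))"
proof -
  let ?gs = "b # map (\<lambda>i xs. xs ! i) [0..<k]"
  have "rcn k (\<lambda>xs. f (map (\<lambda>g. g xs) ?gs))"
    by (rule rcn_comp) (use assms in \<open>auto intro: rcn_nth\<close>)
  then show ?thesis
  proof (rule rcn_cong)
    fix xs :: "nat list" assume "length xs = k"
    then have "b xs # xs = map (\<lambda>g. g xs) ?gs"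
      by (auto intro: nth_equalityI)
    then show "f (b xs # xs) = f (map (\<lambda>g. g xs) ?gs)" by simp
  qed
qed

lemma rcn_Suc:
  assumes "rcn k a"
  shows "rcn k (\<lambda>xs. Suc (a xs))"
proof -
  have "rcn (length [a]) (\<lambda>xs. Suc (xs ! 0))"
    unfolding rcn_def using recursive_fn.succ by auto
  from rcn_comp[OF this, of k] assms show ?thesis by simp
qed

lemma rcn_const: "rcn k (\<lambda>xs. c)"
proof (induction c)
  case 0 show ?case unfolding rcn_def using recursive_fn.zero by blast
qed (rule rcn_Suc)

text \<open>In \<open>prim\<close> the counter and the value reached so far precede the parameters,
  hence \<open>hd ys\<close>, \<open>hd (tl ys)\<close> and \<open>tl (tl ys)\<close>. The final
  step substitutes \<open>b\<close> for the number of iterations.\<close>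

lemma rcn_rec:
  assumes a: "rcn k a" and b: "rcn k b"
    and g: "rcn (Suc (Suc k)) (\<lambda>ys. g (hd ys) (hd (tl ys)) (tl (tl ys)))"
  shows "rcn k (\<lambda>xs. rec_nat (a xs) (\<lambda>n r. g n r xs) (b xs))"
proof -
  obtain F where F: "recursive_fn k F" "\<And>xs. length xs = k \<Longrightarrow> a xs = F xs"
    using a unfolding rcn_def by auto
  obtain G where G: "recursive_fn (Suc (Suc k)) G"
    "\<And>ys. length ys = Suc (Suc k) \<Longrightarrow> g (hd ys) (hd (tl ys)) (tl (tl ys)) = G ys"
    using g unfolding rcn_def by auto
  have "rcn (Suc k) (\<lambda>xs. rec_nat (a (tl xs)) (\<lambda>n r. g n r (tl xs)) (hd xs))"
    unfolding rcn_def
  proof (intro exI conjI allI impI)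
    show "recursive_fn (Suc k) (\<lambda>xs. rec_nat (F (tl xs)) (\<lambda>n r. G (n # r # tl xs)) (hd xs))"
      by (rule recursive_fn.prim[OF F(1) G(1)])
    fix xs :: "nat list" assume "length xs = Suc k"
    then have len: "length (tl xs) = k" by simp
    then have "(\<lambda>n r. g n r (tl xs)) = (\<lambda>n r. G (n # r # tl xs))"
      using G(2)[of "_ # _ # tl xs"] by (auto simp: fun_eq_iff)
    then show "rec_nat (a (tl xs)) (\<lambda>n r. g n r (tl xs)) (hd xs) =
        rec_nat (F (tl xs)) (\<lambda>n r. G (n # r # tl xs)) (hd xs)"
      using F(2)[OF len] by simp
  qed
  from rcn_cons[OF this b] show ?thesis by simp
qed

lemma rcn_var1: "rcn (Suc (Suc k)) (\<lambda>ys. hd (tl ys))"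
  by (rule rcn_tl[OF rcn_hd])

lemma rcn_add: "rcn k a \<Longrightarrow> rcn k b \<Longrightarrow> rcn k (\<lambda>xs. a xs + b xs)"
proof -
  assume "rcn k a" "rcn k b"
  then have "rcn k (\<lambda>xs. rec_nat (a xs) (\<lambda>n r. Suc r) (b xs))"
    by (intro rcn_rec rcn_Suc rcn_var1)
  moreover have "rec_nat x (\<lambda>n r. Suc r) y = x + y" for x y by (induction y) auto
  ultimately show ?thesis by simp
qed

lemma rcn_mult: "rcn k a \<Longrightarrow> rcn k b \<Longrightarrow> rcn k (\<lambda>xs. a xs * b xs)"
proof -
  assume "rcn k a" "rcn k b"
  then have "rcn k (\<lambda>xs. rec_nat 0 (\<lambda>n r. r + a xs) (b xs))"
    by (intro rcn_rec rcn_add rcn_var1 rcn_const rcn_tl)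
  moreover have "rec_nat 0 (\<lambda>n r. r + x) y = x * y" for x y by (induction y) auto
  ultimately show ?thesis by simp
qed

lemma rcn_power: "rcn k a \<Longrightarrow> rcn k b \<Longrightarrow> rcn k (\<lambda>xs. a xs ^ b xs)"
proof -
  assume "rcn k a" "rcn k b"
  then have "rcn k (\<lambda>xs. rec_nat 1 (\<lambda>n r. r * a xs) (b xs))"
    by (intro rcn_rec rcn_mult rcn_var1 rcn_const rcn_tl)
  moreover have "rec_nat 1 (\<lambda>n r. r * x) y = x ^ y" for x y :: nat by (induction y) auto
  ultimately show ?thesis by simp
qed

lemma rcn_pred: "rcn k a \<Longrightarrow> rcn k (\<lambda>xs. a xs - 1)"
proof -
  assume "rcn k a"
  then have "rcn k (\<lambda>xs. rec_nat 0 (\<lambda>n r. n) (a xs))"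
    by (intro rcn_rec rcn_hd rcn_const)
  moreover have "rec_nat 0 (\<lambda>n r. n) y = y - 1" for y by (cases y) auto
  ultimately show ?thesis by simp
qed

lemma rcn_diff: "rcn k a \<Longrightarrow> rcn k b \<Longrightarrow> rcn k (\<lambda>xs. a xs - b xs)"
proof -
  assume "rcn k a" "rcn k b"
  then have "rcn k (\<lambda>xs. rec_nat (a xs) (\<lambda>n r. r - 1) (b xs))"
    by (intro rcn_rec rcn_pred rcn_var1)
  moreover have "rec_nat x (\<lambda>n r. r - 1) y = x - y" for x y :: nat by (induction y) auto
  ultimately show ?thesis by simp
qed

lemma rcn_tl_tl_nth: "i < k \<Longrightarrow> rcn (Suc (Suc k)) (\<lambda>ys. tl (tl ys) ! i)"
  by (rule rcn_tl[where g = "\<lambda>xs. tl xs ! i", OF rcn_tl[where g = "\<lambda>xs. xs ! i", OF rcn_nth]])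

text \<open>In the loops for sums and products the second argument is the value accumulated so far,
  which the summand must ignore.\<close>

lemma rcn_skip:
  assumes f: "rcn (Suc k) (\<lambda>ys. f (hd ys) (tl ys))"
  shows "rcn (Suc (Suc k)) (\<lambda>ys. f (hd ys) (tl (tl ys)))"
proof -
  have "rcn (Suc (Suc k)) (\<lambda>ys. (\<lambda>zs. f (hd zs) (tl zs)) (map (\<lambda>g. g ys) (hd # map (\<lambda>i ys. tl (tl ys) ! i) [0..<k])))"
    by (rule rcn_comp) (use f in \<open>auto intro: rcn_hd rcn_tl_tl_nth\<close>)
  then show ?thesis
  proof (rule rcn_cong)
    fix ys :: "nat list" assume "length ys = Suc (Suc k)"
    then have "tl (tl ys) = map (\<lambda>i. tl (tl ys) ! i) [0..<k]" by (auto intro: nth_equalityI)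
    then show "f (hd ys) (tl (tl ys)) =
        (\<lambda>zs. f (hd zs) (tl zs)) (map (\<lambda>g. g ys) (hd # map (\<lambda>i ys. tl (tl ys) ! i) [0..<k]))"
      by (simp add: comp_def)
  qed
qed

lemma rcn_sum:
  assumes b: "rcn k b" and f: "rcn (Suc k) (\<lambda>ys. f (hd ys) (tl ys))"
  shows "rcn k (\<lambda>xs. \<Sum>i<b xs. f i xs)"
proof -
  have "rcn (Suc (Suc k)) (\<lambda>ys. f (hd ys) (tl (tl ys)))" by (rule rcn_skip[OF f])
  then have "rcn k (\<lambda>xs. rec_nat 0 (\<lambda>n r. r + f n xs) (b xs))"
    by (intro rcn_rec rcn_add rcn_var1 rcn_const b)
  moreover have "rec_nat 0 (\<lambda>n r. r + f n xs) y = (\<Sum>i<y. f i xs)" for xs y by (induction y) auto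
  ultimately show ?thesis by simp
qed

lemma rcn_prod:
  assumes b: "rcn k b" and f: "rcn (Suc k) (\<lambda>ys. f (hd ys) (tl ys))"
  shows "rcn k (\<lambda>xs. \<Prod>i<b xs. f i xs)"
proof -
  have "rcn (Suc (Suc k)) (\<lambda>ys. f (hd ys) (tl (tl ys)))" by (rule rcn_skip[OF f])
  then have "rcn k (\<lambda>xs. rec_nat 1 (\<lambda>n r. r * f n xs) (b xs))"
    by (intro rcn_rec rcn_mult rcn_var1 rcn_const b)
  moreover have "rec_nat 1 (\<lambda>n r. r * f n xs) y = (\<Prod>i<y. f i xs)" for xs y by (induction y) auto
  ultimately show ?thesis by simp
qed

lemma rcn_if:
  assumes "rcp k P" "rcn k a" "rcn k b"
  shows "rcn k (\<lambda>xs. if P xs then a xs else b xs)"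
proof -
  have "rcn k (\<lambda>xs. (if P xs then 1 else 0) * a xs + (1 - (if P xs then 1 else 0)) * b xs)"
    using assms unfolding rcp_def by (intro rcn_add rcn_mult rcn_diff rcn_const)
  then show ?thesis by (rule rcn_cong) auto
qed

section \<open>Decidable relations, bounded quantifiers and division\<close>

lemma rcp_le: "rcn k a \<Longrightarrow> rcn k b \<Longrightarrow> rcp k (\<lambda>xs. a xs \<le> b xs)"
proof -
  assume "rcn k a" "rcn k b"
  then have "rcn k (\<lambda>xs. 1 - (a xs - b xs))" by (intro rcn_diff rcn_const)
  then show ?thesis unfolding rcp_def by (rule rcn_cong) auto
qed

lemma rcp_not:
  assumes "rcp k P"
  shows "rcp k (\<lambda>xs. \<not> P xs)"
proof -
  have "rcn k (\<lambda>xs. 1 - (if P xs then 1 else 0))"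
    using assms unfolding rcp_def by (intro rcn_diff rcn_const)
  then show ?thesis unfolding rcp_def by (rule rcn_cong) auto
qed

lemma rcp_conj:
  assumes "rcp k P" "rcp k Q"
  shows "rcp k (\<lambda>xs. P xs \<and> Q xs)"
proof -
  have "rcn k (\<lambda>xs. (if P xs then 1 else 0) * (if Q xs then 1 else 0))"
    using assms unfolding rcp_def by (intro rcn_mult)
  then show ?thesis unfolding rcp_def by (rule rcn_cong) auto
qed

lemma rcp_eq: "rcn k a \<Longrightarrow> rcn k b \<Longrightarrow> rcp k (\<lambda>xs. a xs = b xs)"
  using rcp_conj[OF rcp_le rcp_le, of k a b b a] by (simp add: order_eq_iff)

lemma rcp_less: "rcn k a \<Longrightarrow> rcn k b \<Longrightarrow> rcp k (\<lambda>xs. a xs < b xs)"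
  using rcp_not[OF rcp_le, of k b a] by (simp add: not_le)

lemma rcp_all:
  assumes b: "rcn k b" and P: "rcp (Suc k) (\<lambda>ys. P (hd ys) (tl ys))"
  shows "rcp k (\<lambda>xs. \<forall>i<b xs. P i xs)"
proof -
  have "rcn k (\<lambda>xs. \<Prod>i<b xs. if P i xs then 1 else 0)"
    by (rule rcn_prod[OF b]) (use P in \<open>simp add: rcp_def\<close>)
  then show ?thesis unfolding rcp_def
    by (rule rcn_cong) (auto simp: prod_zero_iff intro!: prod.neutral)
qed

lemma rcp_ex:
  assumes b: "rcn k b" and P: "rcp (Suc k) (\<lambda>ys. P (hd ys) (tl ys))"
  shows "rcp k (\<lambda>xs. \<exists>i<b xs. P i xs)"
  using rcp_not[OF rcp_all[OF b rcp_not[OF P]]] by simp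

text \<open>The quotient is the number of positive multiples of the divisor up to the dividend; the
  test \<open>0 < b xs\<close> gives \<open>0\<close> for division by zero.\<close>

lemma rcn_div: "rcn k a \<Longrightarrow> rcn k b \<Longrightarrow> rcn k (\<lambda>xs. a xs div b xs)"
proof -
  assume ab: "rcn k a" "rcn k b"
  then have "rcn k (\<lambda>xs. \<Sum>i<a xs. if Suc i * b xs \<le> a xs \<and> 0 < b xs then 1 else 0)"
    by (intro rcn_sum rcn_if rcp_conj rcp_le rcp_less rcn_mult rcn_Suc rcn_hd rcn_const rcn_tl)
  moreover have "(\<Sum>i<x. if Suc i * y \<le> x \<and> 0 < y then 1 else 0) = x div y" for x y :: nat
  proof (cases "y = 0")
    case False
    then have "Suc i * y \<le> x \<and> 0 < y \<longleftrightarrow> i < x div y" for i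
      using less_eq_div_iff_mult_less_eq[of y "Suc i" x] by (simp only: Suc_le_eq) auto
    moreover have "{..<x} \<inter> {i. i < x div y} = {..<x div y}"
      using div_le_dividend[of x y] by (auto simp: less_le_trans)
    ultimately have "{..<x} \<inter> {i. Suc i * y \<le> x \<and> 0 < y} = {..<x div y}" by simp
    then show ?thesis by (simp add: sum.If_cases)
  qed simp
  ultimately show ?thesis by simp
qed

lemma rcn_mod: "rcn k a \<Longrightarrow> rcn k b \<Longrightarrow> rcn k (\<lambda>xs. a xs mod b xs)"
proof -
  assume ab: "rcn k a" "rcn k b"
  then have "rcn k (\<lambda>xs. a xs - b xs * (a xs div b xs))" by (intro rcn_diff rcn_mult rcn_div)
  then show ?thesis by (simp add: minus_mult_div_eq_mod)
qed

lemmas rcn_intros = rcn_hd rcn_const rcn_Suc rcn_add rcn_mult rcn_power rcn_diff rcn_sum rcn_prod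
  rcn_div rcn_mod rcn_if rcp_le rcp_less rcp_eq rcp_conj rcp_not rcp_all rcp_ex

section \<open>Lists coded by numbers\<close>

text \<open>A nonempty list is coded by the successor of a pair, hence \<open>c - 1\<close>; the
  empty list has code \<open>0\<close>.\<close>

definition hd_code :: "nat \<Rightarrow> nat" where "hd_code c = fst (prod_decode (c - 1))"
definition tl_code :: "nat \<Rightarrow> nat" where "tl_code c = snd (prod_decode (c - 1))"
definition nth_code :: "nat \<Rightarrow> nat \<Rightarrow> nat" where "nth_code c i = hd_code ((tl_code ^^ i) c)"
definition cons_code :: "nat \<Rightarrow> nat \<Rightarrow> nat" where "cons_code a c = Suc (prod_encode (a, c))"
text \<open>A list is never longer than its code, so \<open>c\<close> bounds the search, and the
  tails stay \<open>0\<close> once the list is exhausted.\<close>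

definition length_code :: "nat \<Rightarrow> nat" where
  "length_code c = (\<Sum>i<c. if 0 < (tl_code ^^ i) c then 1 else 0)"

lemma rcn_prod_encode:
  assumes "rcn k a" "rcn k b"
  shows "rcn k (\<lambda>xs. prod_encode (a xs, b xs))"
proof -
  have "rcn k (\<lambda>xs. (a xs + b xs) * Suc (a xs + b xs) div 2 + a xs)"
    using assms by (intro rcn_intros)
  then show ?thesis by (simp add: prod_encode_def triangle_def)
qed

lemma rcn_cons_code: "rcn k a \<Longrightarrow> rcn k b \<Longrightarrow> rcn k (\<lambda>xs. cons_code (a xs) (b xs))"
  unfolding cons_code_def by (intro rcn_Suc rcn_prod_encode)

text \<open>Unpairing by bounded search: both components are at most \<open>z\<close>, and exactly
  one index satisfies the condition, so the sum returns that index.\<close>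

lemma prod_decode_sums:
  "fst (prod_decode z) = (\<Sum>a<Suc z. if \<exists>b<Suc z. prod_encode (a, b) = z then a else 0)"
  "snd (prod_decode z) = (\<Sum>b<Suc z. if \<exists>a<Suc z. prod_encode (a, b) = z then b else 0)"
proof -
  obtain x y where xy: "prod_decode z = (x, y)" by (cases "prod_decode z")
  then have z: "z = prod_encode (x, y)" by (metis prod_decode_inverse)
  then have le: "x < Suc z" "y < Suc z" using le_prod_encode_1 le_prod_encode_2 by (auto simp: less_Suc_eq_le)
  have "(\<Sum>a<Suc z. if \<exists>b<Suc z. prod_encode (a, b) = z then a else 0) = (\<Sum>a\<in>{x}. a)"
    by (rule sum.mono_neutral_cong_right) (use le z in \<open>auto simp: prod_encode_eq\<close>)
  then show "fst (prod_decode z) = (\<Sum>a<Suc z. if \<exists>b<Suc z. prod_encode (a, b) = z then a else 0)"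
    by (simp add: xy)
  have "(\<Sum>b<Suc z. if \<exists>a<Suc z. prod_encode (a, b) = z then b else 0) = (\<Sum>b\<in>{y}. b)"
    by (rule sum.mono_neutral_cong_right) (use le z in \<open>auto simp: prod_encode_eq\<close>)
  then show "snd (prod_decode z) = (\<Sum>b<Suc z. if \<exists>a<Suc z. prod_encode (a, b) = z then b else 0)"
    by (simp add: xy)
qed

lemma rcn_hd_code: "rcn k a \<Longrightarrow> rcn k (\<lambda>xs. hd_code (a xs))"
  unfolding hd_code_def prod_decode_sums by (intro rcn_intros rcn_prod_encode rcn_tl rcn_pred)

lemma rcn_tl_code: "rcn k a \<Longrightarrow> rcn k (\<lambda>xs. tl_code (a xs))"
  unfolding tl_code_def prod_decode_sums by (intro rcn_intros rcn_prod_encode rcn_tl rcn_pred)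

lemma rcn_tl_code_pow:
  assumes "rcn k a" "rcn k b"
  shows "rcn k (\<lambda>xs. (tl_code ^^ b xs) (a xs))"
proof -
  have "rcn k (\<lambda>xs. rec_nat (a xs) (\<lambda>n r. tl_code r) (b xs))"
    using assms by (intro rcn_rec rcn_tl_code rcn_var1)
  moreover have "rec_nat x (\<lambda>n r. tl_code r) y = (tl_code ^^ y) x" for x y by (induction y) auto
  ultimately show ?thesis by simp
qed

lemma rcn_nth_code: "rcn k a \<Longrightarrow> rcn k b \<Longrightarrow> rcn k (\<lambda>xs. nth_code (a xs) (b xs))"
  unfolding nth_code_def by (intro rcn_hd_code rcn_tl_code_pow)

lemma rcn_length_code: "rcn k a \<Longrightarrow> rcn k (\<lambda>xs. length_code (a xs))"
  unfolding length_code_def by (intro rcn_intros rcn_tl_code_pow rcn_tl)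

lemma cons_code_simps: "list_encode (x # xs) = cons_code x (list_encode xs)"
  "hd_code (cons_code a c) = a" "tl_code (cons_code a c) = c"
  by (simp_all add: cons_code_def hd_code_def tl_code_def)

lemma tl_code_0: "tl_code 0 = 0"
proof -
  have "prod_encode (0, 0) = 0" by (simp add: prod_encode_def)
  then have "prod_decode 0 = (0, 0)" by (metis prod_encode_inverse)
  then show ?thesis by (simp add: tl_code_def)
qed

lemma tl_code_pow: "(tl_code ^^ i) (list_encode xs) = list_encode (drop i xs)"
proof (induction i arbitrary: xs)
  case (Suc i)
  have "tl_code (list_encode xs) = list_encode (drop 1 xs)"
    by (cases xs) (simp_all add: tl_code_0 cons_code_simps del: list_encode.simps(2))
  then show ?case using Suc[of "drop 1 xs"] by (simp add: funpow_swap1)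
qed simp

lemma nth_code_list: "i < length xs \<Longrightarrow> nth_code (list_encode xs) i = xs ! i"
  unfolding nth_code_def tl_code_pow
  by (simp add: Cons_nth_drop_Suc[symmetric] cons_code_simps del: list_encode.simps(2))

lemma length_code_list: "length_code (list_encode xs) = length xs"
proof -
  have le: "length xs \<le> list_encode xs"
  proof (induction xs)
    case (Cons x xs)
    have "list_encode xs \<le> prod_encode (x, list_encode xs)" by (rule le_prod_encode_2)
    then show ?case using Cons by simp
  qed simp
  have pos: "0 < list_encode (drop i xs) \<longleftrightarrow> i < length xs" for i
    by (cases "drop i xs") (auto simp: drop_eq_Nil, metis drop_eq_Nil list.simps(3) not_le)
  have "length_code (list_encode xs) = card ({..<list_encode xs} \<inter> {i. i < length xs})"
    by (simp add: length_code_def tl_code_pow pos sum.If_cases)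
  also have "{..<list_encode xs} \<inter> {i. i < length xs} = {..<length xs}" using le by auto
  finally show ?thesis by simp
qed

text \<open>Course-of-values recursion: the history is coded with the most recent value first.\<close>

lemma rcn_course_of_values:
  assumes G: "\<And>j a b. rcn j a \<Longrightarrow> rcn j b \<Longrightarrow> rcn j (\<lambda>xs. G (a xs) (b xs))"
    and f: "\<And>n. f n = G n (list_encode (rev (map f [0..<n])))" and a: "rcn k a"
  shows "rcn k (\<lambda>xs. f (a xs))"
proof -
  have h: "rec_nat 0 (\<lambda>n r. cons_code (G n r) r) n = list_encode (rev (map f [0..<n]))" for n
    by (induction n) (simp_all add: cons_code_simps f[symmetric] del: list_encode.simps(2))
  have "rcn k (\<lambda>xs. G (a xs) (rec_nat 0 (\<lambda>n r. cons_code (G n r) r) (a xs)))"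
    by (intro G a rcn_rec rcn_const rcn_cons_code rcn_hd rcn_var1)
  then show ?thesis by (simp add: h f[symmetric])
qed

lemma recursiveI:
  assumes "\<And>k a. rcn k a \<Longrightarrow> rcn k (\<lambda>xs. f (a xs))"
  shows "recursive f"
proof -
  have "rcn 1 (\<lambda>xs. f (xs ! 0))" by (rule assms[OF rcn_nth]) simp
  then obtain F where F: "recursive_fn 1 F" "\<forall>xs. length xs = 1 \<longrightarrow> f (xs ! 0) = F xs"
    unfolding rcn_def by blast
  have "f x = F [x]" for x using F(2)[rule_format, of "[x]"] by simp
  then show ?thesis unfolding recursive_def using F(1) by blast
qed

section \<open>Computing the slope\<close>

text \<open>An integer \<open>x\<close> is stored as the pair of \<open>nat x\<close> and \<open>nat (- x)\<close>.\<close>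

definition crit_code :: "nat \<Rightarrow> nat" where
  "crit_code n = list_encode [nat (crit_u n), nat (- crit_u n), nat (crit_v n), nat (- crit_v n)]"

text \<open>The history has the latest value first, so value \<open>j\<close> stands at position
  \<open>n - 1 - j\<close>. The argument \<open>t\<close> selects a component: \<open>0\<close> and
  \<open>1\<close> are the positive and negative part of \<open>crit_u\<close>, \<open>2\<close> and
  \<open>3\<close> those of \<open>crit_v\<close>.\<close>

definition hist_entry :: "nat \<Rightarrow> nat \<Rightarrow> nat \<Rightarrow> nat \<Rightarrow> nat" where
  "hist_entry n r j t = nth_code (nth_code r (n - 1 - j)) t"

definition hist_conv :: "nat \<Rightarrow> nat \<Rightarrow> nat \<Rightarrow> nat \<Rightarrow> nat" where
  "hist_conv n r s t = (\<Sum>i<n - 1. hist_entry n r (Suc i) s * hist_entry n r (n - 1 - i) t)"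

text \<open>Truncated subtraction in both directions yields the positive and the negative part of a
  difference.\<close>

definition pos_neg_code :: "nat \<Rightarrow> nat \<Rightarrow> nat \<Rightarrow> nat \<Rightarrow> nat" where
  "pos_neg_code a b c d = cons_code (a - b) (cons_code (b - a) (cons_code (c - d) (cons_code (d - c) 0)))"

text \<open>The recursions for \<open>crit_u\<close> and \<open>crit_v\<close> with the terms of
  each sign collected; a subtracted term enters with its positive and negative parts
  exchanged.\<close>

definition crit_step :: "nat \<Rightarrow> nat \<Rightarrow> nat" where
  "crit_step n r = (if n = 0 then pos_neg_code 1 0 0 0 else if n = 1 then pos_neg_code 4 0 8 0 else
     pos_neg_code
       (36 * hist_entry n r (n - 1) 0 + 108 * hist_entry n r (n - 2) 1 + (hist_conv n r 0 1 + hist_conv n r 1 0))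
       (36 * hist_entry n r (n - 1) 1 + 108 * hist_entry n r (n - 2) 0 + (hist_conv n r 0 0 + hist_conv n r 1 1))
       (36 * hist_entry n r (n - 1) 2 + 108 * hist_entry n r (n - 2) 3 + 2 * (hist_conv n r 0 3 + hist_conv n r 1 2))
       (36 * hist_entry n r (n - 1) 3 + 108 * hist_entry n r (n - 2) 2 + 2 * (hist_conv n r 0 2 + hist_conv n r 1 3)))"

lemma rcn_hist_entry:
  "rcn k a \<Longrightarrow> rcn k b \<Longrightarrow> rcn k c \<Longrightarrow> rcn k d \<Longrightarrow> rcn k (\<lambda>xs. hist_entry (a xs) (b xs) (c xs) (d xs))"
  unfolding hist_entry_def by (intro rcn_nth_code rcn_diff rcn_const)

lemma rcn_hist_conv:
  "rcn k a \<Longrightarrow> rcn k b \<Longrightarrow> rcn k c \<Longrightarrow> rcn k d \<Longrightarrow> rcn k (\<lambda>xs. hist_conv (a xs) (b xs) (c xs) (d xs))"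
  unfolding hist_conv_def by (intro rcn_intros rcn_hist_entry rcn_tl)

lemma rcn_pos_neg_code:
  "rcn k a \<Longrightarrow> rcn k b \<Longrightarrow> rcn k c \<Longrightarrow> rcn k d \<Longrightarrow> rcn k (\<lambda>xs. pos_neg_code (a xs) (b xs) (c xs) (d xs))"
  unfolding pos_neg_code_def by (intro rcn_cons_code rcn_diff rcn_const)

lemma rcn_crit_step: "rcn k a \<Longrightarrow> rcn k b \<Longrightarrow> rcn k (\<lambda>xs. crit_step (a xs) (b xs))"
  unfolding crit_step_def
  by (intro rcn_if rcp_eq rcn_pos_neg_code rcn_add rcn_mult rcn_hist_entry rcn_hist_conv rcn_diff rcn_const)

lemma pos_neg_code_eq:
  assumes "u = int a - int b" "v = int c - int d"
  shows "pos_neg_code a b c d = list_encode [nat u, nat (- u), nat v, nat (- v)]"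
proof -
  have "nat u = a - b" "nat (- u) = b - a" "nat v = c - d" "nat (- v) = d - c" using assms by auto
  then show ?thesis by (simp add: pos_neg_code_def cons_code_simps del: list_encode.simps(2))
qed

lemma crit_code_step: "crit_code n = crit_step n (list_encode (rev (map crit_code [0..<n])))"
proof -
  define r where "r = list_encode (rev (map crit_code [0..<n]))"
  consider "n = 0" | "n = 1" | k where "n = Suc (Suc k)"
    by (metis One_nat_def old.nat.exhaust)
  then show ?thesis
  proof cases
    case 1
    have "pos_neg_code 1 0 0 0 = list_encode [nat 1, nat (- 1), nat 0, nat (- 0)]"
      by (rule pos_neg_code_eq) simp_all
    then show ?thesis using 1 by (simp add: crit_step_def crit_code_def)
  next
    case 2
    have "pos_neg_code 4 0 8 0 = list_encode [nat 4, nat (- 4), nat 8, nat (- 8)]"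
      by (rule pos_neg_code_eq) simp_all
    then show ?thesis using 2 by (simp add: crit_step_def crit_code_def)
  next
    case 3
    have nth: "nth_code r (n - 1 - j) = crit_code j" if "j < n" for j
      using that unfolding r_def by (subst nth_code_list) (auto simp: rev_nth)
    have e: "hist_entry n r j 0 = nat (crit_u j)" "hist_entry n r j 1 = nat (- crit_u j)"
      "hist_entry n r j 2 = nat (crit_v j)" "hist_entry n r j 3 = nat (- crit_v j)" if "j < n" for j
      unfolding hist_entry_def nth[OF that] crit_code_def by (simp_all add: nth_code_list del: list_encode.simps)
    have conv: "int (hist_conv n r s t) =
        (\<Sum>j\<in>{1..Suc k}. int (hist_entry n r j s) * int (hist_entry n r (n - j) t))" for s t
    proof -
      have "hist_conv n r s t = (\<Sum>j\<in>{1..Suc k}. hist_entry n r j s * hist_entry n r (n - j) t)"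
        unfolding hist_conv_def
        by (rule sum.reindex_bij_witness[of _ "\<lambda>j. j - 1" Suc]) (use 3 in auto)
      then show ?thesis by simp
    qed
    have less: "n - 1 < n" "n - 2 < n" using 3 by auto
    have pn: "int (nat x) = x + int (nat (- x))" for x by simp
    have u: "crit_u n = int (36 * hist_entry n r (n - 1) 0 + 108 * hist_entry n r (n - 2) 1 + (hist_conv n r 0 1 + hist_conv n r 1 0))
       - int (36 * hist_entry n r (n - 1) 1 + 108 * hist_entry n r (n - 2) 0 + (hist_conv n r 0 0 + hist_conv n r 1 1))"
    proof -
      have "(\<Sum>j\<in>{1..Suc k}. crit_u j * crit_u (n - j)) =
          int (hist_conv n r 0 0) + int (hist_conv n r 1 1) - int (hist_conv n r 0 1) - int (hist_conv n r 1 0)"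
        unfolding conv sum.distrib[symmetric] sum_subtractf[symmetric]
      proof (rule sum.cong[OF refl])
        fix j assume "j \<in> {1..Suc k}"
        then have j: "j < n" "n - j < n" using 3 by auto
        show "crit_u j * crit_u (n - j) = int (hist_entry n r j 0) * int (hist_entry n r (n - j) 0) +
            int (hist_entry n r j 1) * int (hist_entry n r (n - j) 1) -
            int (hist_entry n r j 0) * int (hist_entry n r (n - j) 1) -
            int (hist_entry n r j 1) * int (hist_entry n r (n - j) 0)"
          unfolding e[OF j(1)] e[OF j(2)] pn[of "crit_u j"] pn[of "crit_u (n - j)"] by (simp add: algebra_simps)
      qed
      moreover have "crit_u n = 36 * crit_u (n - 1) - 108 * crit_u (n - 2) - (\<Sum>j\<in>{1..Suc k}. crit_u j * crit_u (n - j))"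
        using 3 by simp
      ultimately show ?thesis
        unfolding e[OF less(1)] e[OF less(2)] of_nat_add of_nat_mult of_nat_numeral
          pn[of "crit_u (n - 1)"] pn[of "crit_u (n - 2)"] by (simp only: algebra_simps)
    qed
    have v: "crit_v n = int (36 * hist_entry n r (n - 1) 2 + 108 * hist_entry n r (n - 2) 3 + 2 * (hist_conv n r 0 3 + hist_conv n r 1 2))
       - int (36 * hist_entry n r (n - 1) 3 + 108 * hist_entry n r (n - 2) 2 + 2 * (hist_conv n r 0 2 + hist_conv n r 1 3))"
    proof -
      have "(\<Sum>j\<in>{1..Suc k}. crit_u j * crit_v (n - j)) =
          int (hist_conv n r 0 2) + int (hist_conv n r 1 3) - int (hist_conv n r 0 3) - int (hist_conv n r 1 2)"
        unfolding conv sum.distrib[symmetric] sum_subtractf[symmetric]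
      proof (rule sum.cong[OF refl])
        fix j assume "j \<in> {1..Suc k}"
        then have j: "j < n" "n - j < n" using 3 by auto
        show "crit_u j * crit_v (n - j) = int (hist_entry n r j 0) * int (hist_entry n r (n - j) 2) +
            int (hist_entry n r j 1) * int (hist_entry n r (n - j) 3) -
            int (hist_entry n r j 0) * int (hist_entry n r (n - j) 3) -
            int (hist_entry n r j 1) * int (hist_entry n r (n - j) 2)"
          unfolding e[OF j(1)] e[OF j(2)] pn[of "crit_u j"] pn[of "crit_v (n - j)"] by (simp add: algebra_simps)
      qed
      moreover have "crit_v n = 36 * crit_v (n - 1) - 108 * crit_v (n - 2) - 2 * (\<Sum>j\<in>{1..Suc k}. crit_u j * crit_v (n - j))"
        using 3 by simp
      ultimately show ?thesis
        unfolding e[OF less(1)] e[OF less(2)] of_nat_add of_nat_mult of_nat_numeral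
          pn[of "crit_v (n - 1)"] pn[of "crit_v (n - 2)"] by (simp only: algebra_simps)
    qed
    have "n \<noteq> 0" "n \<noteq> 1" using 3 by auto
    then show ?thesis
      unfolding crit_step_def crit_code_def[of n] r_def[symmetric] pos_neg_code_eq[OF u v] by simp
  qed
qed

lemma rcn_crit_code: "rcn k a \<Longrightarrow> rcn k (\<lambda>xs. crit_code (a xs))"
  by (rule rcn_course_of_values[where G = crit_step and f = crit_code, OF rcn_crit_step crit_code_step])

text \<open>Entry \<open>0\<close> of the code is the root, itself shifted by one, and arc
  \<open>a\<close> stands at position \<open>Suc a\<close>; this explains the offsets in the
  definitions that follow.\<close>

definition dart_count :: "nat \<Rightarrow> nat" where "dart_count c = length_code c - 1"
definition rev_code :: "nat \<Rightarrow> nat \<Rightarrow> nat" where "rev_code c a = nth_code (nth_code c (Suc a)) 1"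
definition succ_code :: "nat \<Rightarrow> nat \<Rightarrow> nat" where "succ_code c a = nth_code (nth_code c (Suc a)) 2"
definition root_code :: "nat \<Rightarrow> nat" where "root_code c = nth_code c 0 - 1"
definition face_pow :: "nat \<Rightarrow> nat \<Rightarrow> nat \<Rightarrow> nat" where
  "face_pow c k a = rec_nat a (\<lambda>n x. succ_code c (rev_code c x)) k"
text \<open>A cycle is no longer than the number of arcs, which bounds the search.\<close>

definition same_face :: "nat \<Rightarrow> nat \<Rightarrow> nat \<Rightarrow> bool" where
  "same_face c a b \<longleftrightarrow> (\<exists>k<dart_count c. face_pow c k a = b)"
definition face_size :: "nat \<Rightarrow> nat \<Rightarrow> nat" where
  "face_size c a = (\<Sum>b<dart_count c. if same_face c a b then 1 else 0)"
text \<open>Each inner face is represented once, by its least arc, so that a product over faces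
  becomes a product over arcs.\<close>

definition inner_leader :: "nat \<Rightarrow> nat \<Rightarrow> bool" where
  "inner_leader c a \<longleftrightarrow> (\<forall>k<dart_count c. a \<le> face_pow c k a) \<and> \<not> same_face c (root_code c) a"
definition digit :: "nat \<Rightarrow> nat \<Rightarrow> nat \<Rightarrow> nat" where
  "digit N h i = h div N ^ i mod N"
text \<open>Self-maps of the \<open>N\<close> arcs are enumerated as the numbers with \<open>N\<close> digits in base \<open>N\<close>.\<close>

definition auto_code :: "nat \<Rightarrow> nat \<Rightarrow> bool" where
  "auto_code c h \<longleftrightarrow> (\<forall>i<dart_count c.
     digit (dart_count c) h (rev_code c i) = rev_code c (digit (dart_count c) h i) \<and>
     digit (dart_count c) h (succ_code c i) = succ_code c (digit (dart_count c) h i)) \<and>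
     same_face c (root_code c) (digit (dart_count c) h (root_code c))"
definition auto_count :: "nat \<Rightarrow> nat" where
  "auto_count c = (\<Sum>h<dart_count c ^ dart_count c. if auto_code c h then 1 else 0)"
definition face_crit :: "nat \<Rightarrow> nat \<Rightarrow> nat \<Rightarrow> nat" where
  "face_crit c a t = nth_code (crit_code (face_size c a)) t"
text \<open>The numerator is a product of integers. Its absolute value and the number of its
  negative factors are computed separately; one of the two parts of each integer is
  \<open>0\<close>, so their sum is the absolute value.\<close>

definition abs_num :: "nat \<Rightarrow> nat" where
  "abs_num c = 3 * (\<Prod>a<dart_count c. if inner_leader c a then face_crit c a 0 + face_crit c a 1 else 1) *
     (face_crit c (root_code c) 2 + face_crit c (root_code c) 3)"
definition neg_count :: "nat \<Rightarrow> nat" where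
  "neg_count c = (\<Sum>a<dart_count c. if inner_leader c a \<and> 0 < face_crit c a 1 then 1 else 0) +
     (if 0 < face_crit c (root_code c) 3 then 1 else 0)"
text \<open>Without arcs the three values give \<open>(1 - 0) / (1 + 1)\<close>, the slope
  \<open>1 / 2\<close> of the single vertex; \<open>denom\<close> is one less than the actual
  denominator.\<close>

definition pos_num :: "nat \<Rightarrow> nat" where
  "pos_num c = (if dart_count c = 0 then 1 else if neg_count c mod 2 = 0 then abs_num c else 0)"
definition neg_num :: "nat \<Rightarrow> nat" where
  "neg_num c = (if dart_count c = 0 then 0 else if neg_count c mod 2 = 0 then 0 else abs_num c)"
definition denom :: "nat \<Rightarrow> nat" where
  "denom c = (if dart_count c = 0 then 1 else
     4 * 12 ^ (dart_count c div 2) * 3 ^ dart_count c * auto_count c - 1)"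

section \<open>Recursiveness of numerator and denominator\<close>

lemma rcn_dart_count: "rcn k c \<Longrightarrow> rcn k (\<lambda>xs. dart_count (c xs))"
  unfolding dart_count_def by (intro rcn_diff rcn_length_code rcn_const)

lemma rcn_rev_code: "rcn k c \<Longrightarrow> rcn k a \<Longrightarrow> rcn k (\<lambda>xs. rev_code (c xs) (a xs))"
  unfolding rev_code_def by (intro rcn_nth_code rcn_Suc rcn_const)

lemma rcn_succ_code: "rcn k c \<Longrightarrow> rcn k a \<Longrightarrow> rcn k (\<lambda>xs. succ_code (c xs) (a xs))"
  unfolding succ_code_def by (intro rcn_nth_code rcn_Suc rcn_const)

lemma rcn_root_code: "rcn k c \<Longrightarrow> rcn k (\<lambda>xs. root_code (c xs))"
  unfolding root_code_def by (intro rcn_nth_code rcn_diff rcn_const)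

lemma rcn_face_pow: "rcn k c \<Longrightarrow> rcn k i \<Longrightarrow> rcn k a \<Longrightarrow> rcn k (\<lambda>xs. face_pow (c xs) (i xs) (a xs))"
  unfolding face_pow_def by (intro rcn_rec rcn_succ_code rcn_rev_code rcn_var1 rcn_tl)

lemma rcp_same_face: "rcn k c \<Longrightarrow> rcn k a \<Longrightarrow> rcn k b \<Longrightarrow> rcp k (\<lambda>xs. same_face (c xs) (a xs) (b xs))"
  unfolding same_face_def by (intro rcp_ex rcp_eq rcn_face_pow rcn_dart_count rcn_hd rcn_tl)

lemma rcn_face_size: "rcn k c \<Longrightarrow> rcn k a \<Longrightarrow> rcn k (\<lambda>xs. face_size (c xs) (a xs))"
  unfolding face_size_def by (intro rcn_sum rcn_if rcp_same_face rcn_dart_count rcn_const rcn_hd rcn_tl)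

lemma rcp_inner_leader: "rcn k c \<Longrightarrow> rcn k a \<Longrightarrow> rcp k (\<lambda>xs. inner_leader (c xs) (a xs))"
  unfolding inner_leader_def
  by (intro rcp_conj rcp_not rcp_all rcp_le rcp_same_face rcn_face_pow rcn_dart_count rcn_root_code rcn_hd rcn_tl)

lemma rcn_digit: "rcn k n \<Longrightarrow> rcn k h \<Longrightarrow> rcn k i \<Longrightarrow> rcn k (\<lambda>xs. digit (n xs) (h xs) (i xs))"
  unfolding digit_def by (intro rcn_mod rcn_div rcn_power)

lemma rcp_auto_code: "rcn k c \<Longrightarrow> rcn k h \<Longrightarrow> rcp k (\<lambda>xs. auto_code (c xs) (h xs))"
  unfolding auto_code_def
  by (intro rcp_conj rcp_all rcp_eq rcp_same_face rcn_digit rcn_rev_code rcn_succ_code rcn_dart_count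
      rcn_root_code rcn_hd rcn_tl)

lemma rcn_auto_count: "rcn k c \<Longrightarrow> rcn k (\<lambda>xs. auto_count (c xs))"
  unfolding auto_count_def
  by (intro rcn_sum rcn_if rcn_power rcn_const rcp_auto_code rcn_dart_count rcn_hd rcn_tl)

lemma rcn_face_crit: "rcn k c \<Longrightarrow> rcn k a \<Longrightarrow> rcn k t \<Longrightarrow> rcn k (\<lambda>xs. face_crit (c xs) (a xs) (t xs))"
  unfolding face_crit_def by (intro rcn_nth_code rcn_crit_code rcn_face_size)

lemma rcn_abs_num: "rcn k c \<Longrightarrow> rcn k (\<lambda>xs. abs_num (c xs))"
  unfolding abs_num_def
  by (intro rcn_mult rcn_add rcn_prod rcn_if rcp_inner_leader rcn_face_crit rcn_root_code rcn_dart_count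
      rcn_const rcn_hd rcn_tl)

lemma rcn_neg_count: "rcn k c \<Longrightarrow> rcn k (\<lambda>xs. neg_count (c xs))"
  unfolding neg_count_def
  by (intro rcn_add rcn_sum rcn_if rcp_conj rcp_less rcp_inner_leader rcn_face_crit rcn_root_code rcn_dart_count
      rcn_const rcn_hd rcn_tl)

lemma recursive_pos_num: "recursive pos_num"
  by (rule recursiveI, unfold pos_num_def)
    (intro rcn_if rcp_eq rcn_mod rcn_neg_count rcn_abs_num rcn_dart_count rcn_const)

lemma recursive_neg_num: "recursive neg_num"
  by (rule recursiveI, unfold neg_num_def)
    (intro rcn_if rcp_eq rcn_mod rcn_neg_count rcn_abs_num rcn_dart_count rcn_const)

lemma recursive_denom: "recursive denom"
  by (rule recursiveI, unfold denom_def)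
    (intro rcn_if rcp_eq rcn_mult rcn_power rcn_div rcn_diff rcn_auto_count rcn_dart_count rcn_const)

section \<open>Correctness of the computed slope\<close>

lemma digit_inj:
  assumes "h < N ^ m" "h' < N ^ m" "\<And>i. i < m \<Longrightarrow> digit N h i = digit N h' i"
  shows "h = h'"
  using assms
proof (induction m arbitrary: h h')
  case (Suc m)
  have "N > 0" using Suc.prems(1) by (cases N) auto
  have "h div N = h' div N"
  proof (rule Suc.IH)
    show "h div N < N ^ m" "h' div N < N ^ m"
      using Suc.prems(1,2) by (auto intro!: less_mult_imp_div_less simp: mult.commute)
    show "digit N (h div N) i = digit N (h' div N) i" if "i < m" for i
      using Suc.prems(3)[of "Suc i"] that by (simp add: digit_def div_mult2_eq)
  qed
  moreover have "h mod N = h' mod N" using Suc.prems(3)[of 0] by (simp add: digit_def)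
  ultimately show ?case by (metis div_mult_mod_eq)
qed simp

text \<open>Injective by comparison of digits, surjective because both sides have
  \<open>N ^ N\<close> elements.\<close>

lemma digits_bij: "bij_betw (\<lambda>h. restrict (digit N h) {..<N}) {..<N ^ N} ({..<N} \<rightarrow>\<^sub>E {..<N})"
proof -
  let ?f = "\<lambda>h. restrict (digit N h) {..<N}"
  have inj: "inj_on ?f {..<N ^ N}"
  proof (rule inj_onI)
    fix h h' assume h: "h \<in> {..<N ^ N}" "h' \<in> {..<N ^ N}" and eq: "?f h = ?f h'"
    have "digit N h i = digit N h' i" if "i < N" for i using fun_cong[OF eq, of i] that by simp
    then show "h = h'" using h digit_inj[of h N N h'] by simp
  qed
  have "?f ` {..<N ^ N} \<subseteq> {..<N} \<rightarrow>\<^sub>E {..<N}"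
    by (auto simp: digit_def split: if_splits)
  moreover have "card (?f ` {..<N ^ N}) = card ({..<N} \<rightarrow>\<^sub>E {..<N})"
    by (simp add: card_image[OF inj] card_PiE)
  ultimately have "?f ` {..<N ^ N} = {..<N} \<rightarrow>\<^sub>E {..<N}"
    by (intro card_subset_eq finite_PiE) auto
  then show ?thesis using inj by (simp add: bij_betw_def)
qed

lemma orbit_bounded:
  assumes "finite A" "bij_betw f A A" "a \<in> A"
  shows "b \<in> orbit f a \<longleftrightarrow> (\<exists>k<card A. (f ^^ k) a = b)"
proof -
  obtain n where n: "0 < n" "(f ^^ n) a = a" "inj_on (\<lambda>i. (f ^^ i) a) {1..n}"
    "orbit f a = (\<lambda>i. (f ^^ i) a) ` {1..n}"
    by (rule orbit_enum[OF assms])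
  have "card {1..n} \<le> card A"
    by (rule card_inj_on_le[OF n(3) _ assms(1)]) (use n(4) orbit_subset_on[OF assms(2,3)] in auto)
  then have le: "n \<le> card A" by simp
  have b1: "orbit f a = {(f ^^ m) a | m. m < n}" by (rule orbit_altdef_bounded[OF n(2,1)])
  have b2: "orbit f a = {(f ^^ m) a | m. True}"
    by (rule orbit_altdef_self_in[OF orbit_self[OF assms]])
  show ?thesis
  proof
    assume "b \<in> orbit f a"
    then obtain m where "m < n" "b = (f ^^ m) a" unfolding b1 by blast
    then show "\<exists>k<card A. (f ^^ k) a = b" using le by (metis less_le_trans)
  next
    assume "\<exists>k<card A. (f ^^ k) a = b"
    then show "b \<in> orbit f a" unfolding b2 by blast
  qed
qed

context
  fixes M :: "(nat, nat) pre_map" and N c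
  assumes M: "rooted_planar_map M" and arcs: "map_arcs M = {..<N}" and N: "N > 0"
  defines "c \<equiv> map_code M"
begin

lemma M_ne: "map_arcs M \<noteq> {}" using N by (auto simp: arcs)

lemma card_arcs_N: "card (map_arcs M) = N" by (simp add: arcs)

lemma code_list: "c = list_encode (Suc (the (root_arc M)) #
    map (\<lambda>a. list_encode [tail (map_graph M) a, edge_rev M a, edge_succ M a]) [0..<N])"
  using root_arc_the(1)[OF M M_ne] unfolding c_def map_code_def card_arcs_N
  by (cases "root_arc M") (simp_all del: list_encode.simps(2))

lemma code_facts: "dart_count c = N" "root_code c = the (root_arc M)"
  "a < N \<Longrightarrow> rev_code c a = edge_rev M a" "a < N \<Longrightarrow> succ_code c a = edge_succ M a"
  unfolding dart_count_def root_code_def rev_code_def succ_code_def code_list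
  by (simp_all add: length_code_list nth_code_list del: list_encode.simps(2) upt_Suc)

abbreviation "ph \<equiv> edge_succ M \<circ> edge_rev M"

lemma ph_bij: "bij_betw ph {..<N} {..<N}"
  using face_bij[OF planar_map_arc_inv[OF M M_ne] planar_map_succ[OF M M_ne]] by (simp add: arcs)

lemma rs_less: "a < N \<Longrightarrow> edge_rev M a < N" "a < N \<Longrightarrow> edge_succ M a < N"
  using rooted_planar_mapD(5,6)[OF M, of a] by (auto simp: arcs)

lemma root_less: "the (root_arc M) < N"
  using root_arc_the(2)[OF M M_ne] by (simp add: arcs)

lemma face_pow_eq:
  assumes "a < N"
  shows "face_pow c k a = (ph ^^ k) a \<and> (ph ^^ k) a < N"
  using assms by (induction k) (auto simp: face_pow_def code_facts rs_less)

lemma same_face_eq: "a < N \<Longrightarrow> same_face c a b \<longleftrightarrow> b \<in> orbit ph a"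
  using orbit_bounded[OF _ ph_bij, of a b] face_pow_eq[of a] by (simp add: same_face_def code_facts)

lemma face_size_eq:
  assumes a: "a < N"
  shows "face_size c a = card (orbit ph a)"
proof -
  have "{..<N} \<inter> {b. b \<in> orbit ph a} = orbit ph a" using orbit_subset_on[OF ph_bij, of a] a by auto
  then show ?thesis by (simp add: face_size_def code_facts same_face_eq[OF a] sum.If_cases)
qed

lemma root_face_code: "root_left_face M = orbit ph (the (root_arc M))"
  by (simp add: root_left_face_def left_face_orbit)

lemma inner_leader_eq:
  assumes a: "a < N"
  shows "inner_leader c a \<longleftrightarrow> a = Min (orbit ph a) \<and> orbit ph a \<noteq> root_left_face M"
proof -
  have fin: "finite (orbit ph a)" using orbit_subset_on[OF ph_bij, of a] a finite_subset by blast
  have self: "a \<in> orbit ph a" by (rule orbit_self[OF _ ph_bij]) (use a in auto)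
  have "(\<forall>k<N. a \<le> face_pow c k a) \<longleftrightarrow> (\<forall>b\<in>orbit ph a. a \<le> b)"
    using orbit_bounded[OF _ ph_bij, of a] a face_pow_eq[OF a] by fastforce
  also have "\<dots> \<longleftrightarrow> a = Min (orbit ph a)"
    using fin self by (metis Min_eqI Min_le)
  finally have 1: "(\<forall>k<N. a \<le> face_pow c k a) \<longleftrightarrow> a = Min (orbit ph a)" .
  have "same_face c (root_code c) a \<longleftrightarrow> orbit ph a = root_left_face M"
    using same_face_eq[OF root_less, of a] orbit_mem_iff[OF _ ph_bij, of "the (root_arc M)" a] root_less a
    by (simp add: code_facts root_face_code)
  then show ?thesis using 1 by (simp add: inner_leader_def code_facts)
qed

lemma inner_cycles_leaders:
  "bij_betw (orbit ph) {a \<in> {..<N}. inner_leader c a} (inner_cycles M)"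
proof (rule bij_betw_imageI)
  show "inj_on (orbit ph) {a \<in> {..<N}. inner_leader c a}"
    by (rule inj_onI) (use inner_leader_eq in \<open>metis (no_types, lifting) lessThan_iff mem_Collect_eq\<close>)
  show "orbit ph ` {a \<in> {..<N}. inner_leader c a} = inner_cycles M"
  proof
    show "orbit ph ` {a \<in> {..<N}. inner_leader c a} \<subseteq> inner_cycles M"
      using inner_leader_eq by (auto simp: inner_cycles_def orbits_on_def arcs)
    show "inner_cycles M \<subseteq> orbit ph ` {a \<in> {..<N}. inner_leader c a}"
    proof
      fix P assume "P \<in> inner_cycles M"
      then have P: "P \<in> orbits_on ph {..<N}" "P \<noteq> root_left_face M" by (auto simp: inner_cycles_def arcs)
      have sub: "P \<subseteq> {..<N}" using orbits_on_eqD(2)[OF _ ph_bij P(1)] by auto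
      then have fin: "finite P" by (rule finite_subset) simp
      have m: "Min P \<in> P" using fin orbits_on_nonempty[OF P(1)] by (rule Min_in)
      have o: "P = orbit ph (Min P)" by (rule orbits_on_eqD(1)[OF _ ph_bij P(1) m]) simp
      have "inner_leader c (Min P)" using inner_leader_eq[of "Min P"] m sub P(2) o by auto
      then show "P \<in> orbit ph ` {a \<in> {..<N}. inner_leader c a}" using o m sub by blast
    qed
  qed
qed

lemma auto_count_eq: "auto_count c = card (outer_autos M)"
proof -
  let ?f = "\<lambda>h. restrict (digit N h) {..<N}"
  have code: "auto_code c h \<longleftrightarrow> ?f h \<in> outer_autos M" for h
  proof -
    have d: "digit N h i < N" for i using N by (simp add: digit_def)
    have "?f h \<in> {..<N} \<rightarrow>\<^sub>E {..<N}" using d by auto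
    then show ?thesis
      using rs_less root_less d same_face_eq[OF root_less]
      by (auto simp: auto_code_def outer_autos_def code_facts arcs root_face_code)
  qed
  have "auto_count c = card {h \<in> {..<N ^ N}. auto_code c h}"
    by (simp add: auto_count_def code_facts sum.If_cases Int_def)
  also have "bij_betw ?f {h \<in> {..<N ^ N}. auto_code c h} (outer_autos M)"
  proof (rule bij_betw_imageI)
    show "inj_on ?f {h \<in> {..<N ^ N}. auto_code c h}"
      by (rule inj_on_subset[OF bij_betw_imp_inj_on[OF digits_bij]]) auto
    show "?f ` {h \<in> {..<N ^ N}. auto_code c h} = outer_autos M"
    proof
      show "?f ` {h \<in> {..<N ^ N}. auto_code c h} \<subseteq> outer_autos M" using code by auto
      show "outer_autos M \<subseteq> ?f ` {h \<in> {..<N ^ N}. auto_code c h}"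
      proof
        fix g assume g: "g \<in> outer_autos M"
        then have "g \<in> {..<N} \<rightarrow>\<^sub>E {..<N}" by (auto simp: outer_autos_def arcs)
        then have "g \<in> ?f ` {..<N ^ N}" using bij_betw_imp_surj_on[OF digits_bij, of N] by simp
        then show "g \<in> ?f ` {h \<in> {..<N ^ N}. auto_code c h}" using g code by auto
      qed
    qed
  qed
  then have "card {h \<in> {..<N ^ N}. auto_code c h} = card (outer_autos M)" by (rule bij_betw_same_card)
  finally show ?thesis .
qed

lemma face_crit_eq:
  assumes "a < N"
  shows "face_crit c a 0 = nat (crit_u (card (orbit ph a)))" "face_crit c a (Suc 0) = nat (- crit_u (card (orbit ph a)))"
    "face_crit c a 2 = nat (crit_v (card (orbit ph a)))" "face_crit c a 3 = nat (- crit_v (card (orbit ph a)))"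
  by (simp_all add: face_crit_def face_size_eq[OF assms] crit_code_def nth_code_list del: list_encode.simps)

lemma num_eq: "int (pos_num c) - int (neg_num c) =
    3 * (\<Prod>P\<in>inner_cycles M. crit_u (card P)) * crit_v (card (root_left_face M))"
proof -
  let ?L = "{a \<in> {..<N}. inner_leader c a}"
  let ?u = "\<lambda>a. crit_u (card (orbit ph a))" and ?v = "crit_v (card (root_left_face M))"
  \<comment> \<open>Every integer is a sign times the sum of its two parts, and in a product the
    signs multiply to a parity.\<close>
  have sgn: "x = (- 1) ^ (if 0 < nat (- x) then 1 else 0) * int (nat x + nat (- x))" for x :: int
    by auto
  have "(\<Prod>a\<in>?L. ?u a) = (\<Prod>a\<in>?L. (- 1) ^ (if 0 < nat (- ?u a) then 1 else 0) * int (nat (?u a) + nat (- ?u a)))"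
    by (rule prod.cong[OF refl]) (rule sgn)
  also have "\<dots> = (- 1) ^ (\<Sum>a\<in>?L. if 0 < nat (- ?u a) then 1 else 0) * int (\<Prod>a\<in>?L. nat (?u a) + nat (- ?u a))"
    by (simp add: prod.distrib power_sum)
  finally have pr: "(\<Prod>a\<in>?L. ?u a) =
      (- 1) ^ (\<Sum>a\<in>?L. if 0 < nat (- ?u a) then 1 else 0) * int (\<Prod>a\<in>?L. nat (?u a) + nat (- ?u a))" .
  have ab: "abs_num c = 3 * (\<Prod>a\<in>?L. nat (?u a) + nat (- ?u a)) * (nat ?v + nat (- ?v))"
  proof -
    have "(\<Prod>a<N. if inner_leader c a then face_crit c a 0 + face_crit c a 1 else 1) =
        (\<Prod>a\<in>?L. face_crit c a 0 + face_crit c a 1)"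
      by (rule prod.mono_neutral_cong_right) auto
    also have "\<dots> = (\<Prod>a\<in>?L. nat (?u a) + nat (- ?u a))"
      by (rule prod.cong[OF refl]) (simp add: face_crit_eq)
    finally show ?thesis
      using face_crit_eq[OF root_less] by (simp add: abs_num_def code_facts root_face_code)
  qed
  have ng: "neg_count c = (\<Sum>a\<in>?L. if 0 < nat (- ?u a) then 1 else 0) + (if 0 < nat (- ?v) then 1 else 0)"
  proof -
    have "(\<Sum>a<N. if inner_leader c a \<and> 0 < face_crit c a 1 then 1 else 0) =
        (\<Sum>a\<in>?L. if 0 < face_crit c a 1 then 1 else 0)"
      by (rule sum.mono_neutral_cong_right) auto
    also have "\<dots> = (\<Sum>a\<in>?L. if 0 < nat (- ?u a) then 1 else 0)"
      by (rule sum.cong[OF refl]) (simp add: face_crit_eq)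
    finally show ?thesis
      using face_crit_eq[OF root_less] by (simp add: neg_count_def code_facts root_face_code)
  qed
  have "3 * (\<Prod>a\<in>?L. ?u a) * ?v = (- 1) ^ neg_count c * int (abs_num c)"
    unfolding pr ab ng by (subst (2) sgn[of ?v]) (simp add: power_add)
  moreover have "int (pos_num c) - int (neg_num c) = (- 1) ^ neg_count c * int (abs_num c)"
    using N by (cases "even (neg_count c)") (auto simp: pos_num_def neg_num_def code_facts even_iff_mod_2_eq_zero)
  ultimately show ?thesis using prod.reindex_bij_betw[OF inner_cycles_leaders, of "\<lambda>P. crit_u (card P)"] by simp
qed

lemma slope_code_pos:
  "slope M = (of_nat (pos_num c) - of_nat (neg_num c)) / of_nat (Suc (denom c))"
proof -
  have "edge_count M = N div 2" by (simp add: edge_count_def arcs)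
  moreover have "Suc (denom c) = 4 * 12 ^ (N div 2) * 3 ^ N * card (outer_autos M)"
    using N card_outer_autos_pos[OF M M_ne] by (simp add: denom_def code_facts auto_count_eq)
  moreover have "(of_nat (pos_num c) - of_nat (neg_num c) :: rat) =
      of_int (3 * (\<Prod>P\<in>inner_cycles M. crit_u (card P)) * crit_v (card (root_left_face M)))"
    unfolding num_eq[symmetric] by simp
  ultimately show ?thesis using M_ne by (simp only: slope_def if_False card_arcs_N)
qed

end

lemma slope_code:
  fixes M :: "(nat, nat) pre_map"
  assumes M: "rooted_planar_map M" and arcs: "map_arcs M = {..<card (map_arcs M)}"
  shows "slope M = (of_nat (pos_num (map_code M)) - of_nat (neg_num (map_code M))) /
    of_nat (Suc (denom (map_code M)))"
proof (cases "card (map_arcs M) = 0")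
  case True
  then have e: "map_arcs M = {}" using arcs by simp
  then have "root_arc M = None" using M by (auto simp: rooted_planar_map_def split: option.splits)
  then have "map_code M = list_encode [0]" by (simp add: map_code_def e)
  then have "dart_count (map_code M) = 0"
    unfolding dart_count_def by (simp only: length_code_list list.size)
  then show ?thesis using e by (simp add: slope_def pos_num_def neg_num_def denom_def)
next
  case False
  then show ?thesis using slope_code_pos[OF M arcs] by simp
qed

theorem theorem2:
  shows "\<exists>(c1 :: planar_map \<Rightarrow> rat) (c2 :: planar_map \<Rightarrow> real).
    computable_on_maps c1 \<and>
    (\<forall>m. c1 m > 0 \<and>
      (\<lambda>n. measure_pmf.expectation (random_planar_map n) (\<lambda>M. real (occurrences m M))
             - (of_rat (c1 m) * real n + c2 m)) \<in> O(\<lambda>n. 1 / real n))"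
proof -
  define E where "E m n = measure_pmf.expectation (random_planar_map n) (\<lambda>M. real (occurrences m M))" for m n
  have ex: "\<exists>c. c > 0 \<and> lin_asymp (E m) (of_rat c)" for m
  proof -
    obtain M :: "(nat, nat) pre_map" where "rooted_planar_map M" "m = abs_planar_map M" by (rule planar_map_cases)
    then show ?thesis using expectation_asymp unfolding E_def by blast
  qed
  \<comment> \<open>Choosing the slope by its asymptotic property makes \<open>c1\<close> a function
    on isomorphism classes at once; by \<open>lin_asymp_unique\<close> it equals
    \<open>slope\<close> of any representative.\<close>
  define c1 where "c1 m = (SOME c. c > 0 \<and> lin_asymp (E m) (of_rat c))" for m
  have c1: "c1 m > 0" "lin_asymp (E m) (of_rat (c1 m))" for m
    using someI_ex[OF ex, of m] by (auto simp: c1_def)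
  have "\<forall>m. \<exists>b. (\<lambda>n. E m n - (of_rat (c1 m) * real n + b)) \<in> O(\<lambda>n. 1 / real n)"
    using c1(2) unfolding lin_asymp_def by blast
  then obtain c2 where c2: "\<And>m. (\<lambda>n. E m n - (of_rat (c1 m) * real n + c2 m)) \<in> O(\<lambda>n. 1 / real n)"
    by metis
  have "computable_on_maps c1"
    unfolding computable_on_maps_def
  proof (intro exI conjI allI impI, rule recursive_pos_num, rule recursive_neg_num, rule recursive_denom)
    fix M :: "(nat, nat) pre_map"
    assume M: "rooted_planar_map M \<and> map_arcs M = {..<card (map_arcs M)}"
    have "(of_rat (c1 (abs_planar_map M)) :: real) = of_rat (slope M)"
      using c1(2)[of "abs_planar_map M"] expectation_asymp(1)[of M] M
      unfolding E_def by (blast intro: lin_asymp_unique)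
    then show "c1 (abs_planar_map M) = (of_nat (pos_num (map_code M)) - of_nat (neg_num (map_code M))) /
        of_nat (Suc (denom (map_code M)))"
      using slope_code M by simp
  qed
  then show ?thesis using c1(1) c2 unfolding E_def by blast
qed

end
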